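(* Let $(\mathfrak g,\mathfrak k)$ be a Hermitian symmetric pair, and let $\mathfrak q=\mathfrak l\oplus\mathfrak u$ be a $\theta$-stable parabolic subalgebra of $\mathfrak g$ with $\mathfrak l\subset\mathfrak k$ and $\mathfrak u\supset\mathfrak p^+$. Let $V$ be an admissible unitary $(\mathfrak g,K)$-module. Then the Dirac cohomology $H_D(\mathfrak g,\mathfrak l;V)$ is isomorphic to the $\bar{\mathfrak u}$-cohomology of $V$ and to the $\mathfrak u$-homology of $V$ up to modular twists: $$H_D(\mathfrak g,\mathfrak l;V)\cong H^\cdot(\bar{\mathfrak u},V)\otimes Z_{\rho(\bar{\mathfrak u})}\cong H_\cdot(\mathfrak u,V)\otimes Z_{\rho(\bar{\mathfrak u})}$$ as $\mathfrak l$-modules. Moreover, all three have the same set of harmonic representatives, namely $\operatorname{Ker}\Delta\subset V\otimes S$, where $\Delta=CC^{adj}+C^{adj}C$; that is, every class in each of $\operatorname{Ker}D/(\operatorname{Im}D\cap\operatorname{Ker}D)$, $\operatorname{Ker}C/\operatorname{Im}C$ and $\operatorname{Ker}C^-/\operatorname{Im}C^-$ (operators on $V\otimes S$) has a unique representative in $\operatorname{Ker}\Delta$.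
   Context: $G$ is a connected semisimple Lie group with finite center, Lie algebra $\mathfrak g_0$, complexification $\mathfrak g$; $\theta$ a Cartan involution, $K=G^\theta$, $\mathfrak g=\mathfrak k\oplus\mathfrak p$ the complexified Cartan decomposition, $B$ the Killing form, bar denotes conjugation with respect to $\mathfrak g_0$. Hermitian symmetric: $\mathfrak p=\mathfrak p^+\oplus\mathfrak p^-$ with $\mathfrak p^\pm$ $K$-stable abelian subalgebras, conjugate to each other, and $\mathfrak k\oplus\mathfrak p^{+}$ parabolic with Levi factor $\mathfrak k$ and nilradical $\mathfrak p^+$. The $\theta$-stable parabolic $\mathfrak q=\mathfrak l\oplus\mathfrak u$ has Levi factor $\mathfrak l=\bar{\mathfrak l}$, nilradical $\mathfrak u$, and opposite parabolic $\mathfrak l\oplus\bar{\mathfrak u}$; $\mathfrak s=\mathfrak u\oplus\bar{\mathfrak u}$ is the $B$-orthogonal of $\mathfrak l$. $V$ is unitary if it carries a positive definite $K$-invariant Hermitian form for which $\mathfrak g_0$ acts by skew-Hermitian operators. $C(\mathfrak s)$ is the Clifford algebra with relations $vw+wv=2B(v,w)$, acting on $S=\bigwedge^\cdot\mathfrak u$ by $u\cdot Y=u\wedge Y$ ($u\in\mathfrak u$) and $u^*\cdot(Y_1\wedge\dots\wedge Y_p)=2\sum_i(-1)^{i+1}B(u^*,Y_i)Y_1\wedge\dots\widehat{Y_i}\dots\wedge Y_p$ ($u^*\in\bar{\mathfrak u}$). With $u_1,\dots,u_n$ a basis of $\mathfrak u$ and $u_i^*$ the $B$-dual basis of $\bar{\mathfrak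 u}$, put in $U(\mathfrak g)\otimes C(\mathfrak s)$ $$C=\sum_iu_i^*\otimes u_i-\tfrac14\sum_{i,j}1\otimes[u_i^*,u_j^*]u_iu_j,\qquad C^-=\sum_iu_i\otimes u_i^*-\tfrac14\sum_{i,j}1\otimes[u_i,u_j]u_i^*u_j^*,$$ and $D=D(\mathfrak g,\mathfrak l)=C+C^-$ (Kostant's cubic Dirac operator). These act on $V\otimes S$; $H_D(\mathfrak g,\mathfrak l;V)=\operatorname{Ker}D/(\operatorname{Im}D\cap\operatorname{Ker}D)$. Under $V\otimes\bigwedge^\cdot\mathfrak u\cong\operatorname{Hom}(\bigwedge^\cdot\bar{\mathfrak u},V)$, $C$ is the $\bar{\mathfrak u}$-cohomology differential, and $C^-$ is $-2$ times the $\mathfrak u$-homology differential. $\mathfrak l$ acts on $V\otimes S$ by $X\mapsto X\otimes1+1\otimes\alpha(X)$ with $\alpha:\mathfrak l\to\mathfrak{so}(\mathfrak s)\hookrightarrow C(\mathfrak s)$ the standard map ($[\alpha(X),v]=[X,v]$ for $v\in\mathfrak s$). On $\bar{\mathfrak u}$-cohomology and $\mathfrak u$-homology $\mathfrak l$ acts in the usual way (via $V$ and the adjoint action). $Z_{\rho(\bar{\mathfrak u})}$ is the one-dimensional $\mathfrak l$-module on which $X$ acts by $\frac12\operatorname{tr}(\operatorname{ad}X|_{\bar{\mathfrak u}})$. $\langle X,Y\rangle=-2B(X,\theta\bar Y)$ is a positive definite Hermitian form on $\mathfrak u$, extended to $S=\bigwedge^\cdot\mathfrak u$ by determinants; $V\otimes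 S$ carries the tensor product of this form with the unitary form on $V$. $C^{adj}$ is the adjoint of $C$ with respect to this form. *)

theory Defs
  imports "HOL-Analysis.Analysis" "HOL-Algebra.Group" "HOL-Library.Function_Algebras"
begin

section \<open>Lie algebras over an arbitrary field of scalars\<close>

text \<open>
  The scalar multiplication is an explicit argument, so that the same notions apply to a real Lie
  algebra and to its complexification.
\<close>

locale lie_algebra = vector_space scale
  for scale :: "'k::field \<Rightarrow> 'a::ab_group_add \<Rightarrow> 'a" +
  fixes br :: "'a \<Rightarrow> 'a \<Rightarrow> 'a"
  assumes br_linear_left: "Vector_Spaces.linear scale scale (\<lambda>x. br x y)"
    and br_linear_right: "Vector_Spaces.linear scale scale (br x)"
    and br_self: "br x x = 0"
    and jacobi: "br x (br y z) + br y (br z x) + br z (br x y) = 0"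

definition lie_subalgebra ::
  "('k::field \<Rightarrow> 'a::ab_group_add \<Rightarrow> 'a) \<Rightarrow> ('a \<Rightarrow> 'a \<Rightarrow> 'a) \<Rightarrow> 'a set \<Rightarrow> bool" where
  "lie_subalgebra s br W \<longleftrightarrow> module.subspace s W \<and> (\<forall>x\<in>W. \<forall>y\<in>W. br x y \<in> W)"

definition lie_ideal ::
  "('k::field \<Rightarrow> 'a::ab_group_add \<Rightarrow> 'a) \<Rightarrow> ('a \<Rightarrow> 'a \<Rightarrow> 'a) \<Rightarrow> 'a set \<Rightarrow> 'a set \<Rightarrow> bool" where
  "lie_ideal s br Q I \<longleftrightarrow> module.subspace s I \<and> I \<subseteq> Q \<and> (\<forall>x\<in>Q. \<forall>y\<in>I. br x y \<in> I)"

definition lie_commutator ::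
  "('k::field \<Rightarrow> 'a::ab_group_add \<Rightarrow> 'a) \<Rightarrow> ('a \<Rightarrow> 'a \<Rightarrow> 'a) \<Rightarrow> 'a set \<Rightarrow> 'a set \<Rightarrow> 'a set" where
  "lie_commutator s br A B = module.span s {br x y | x y. x \<in> A \<and> y \<in> B}"

definition lie_solvable ::
  "('k::field \<Rightarrow> 'a::ab_group_add \<Rightarrow> 'a) \<Rightarrow> ('a \<Rightarrow> 'a \<Rightarrow> 'a) \<Rightarrow> 'a set \<Rightarrow> bool" where
  "lie_solvable s br W \<longleftrightarrow> (\<exists>k. ((\<lambda>A. lie_commutator s br A A) ^^ k) W = {0})"

definition lie_nilpotent ::
  "('k::field \<Rightarrow> 'a::ab_group_add \<Rightarrow> 'a) \<Rightarrow> ('a \<Rightarrow> 'a \<Rightarrow> 'a) \<Rightarrow> 'a set \<Rightarrow> bool" where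
  "lie_nilpotent s br W \<longleftrightarrow> (\<exists>k. (lie_commutator s br W ^^ k) W = {0})"

definition lie_semisimple ::
  "('k::field \<Rightarrow> 'a::ab_group_add \<Rightarrow> 'a) \<Rightarrow> ('a \<Rightarrow> 'a \<Rightarrow> 'a) \<Rightarrow> bool" where
  "lie_semisimple s br \<longleftrightarrow> (\<forall>I. lie_ideal s br UNIV I \<and> lie_solvable s br I \<longrightarrow> I = {0})"

definition borel_subalgebra ::
  "('k::field \<Rightarrow> 'a::ab_group_add \<Rightarrow> 'a) \<Rightarrow> ('a \<Rightarrow> 'a \<Rightarrow> 'a) \<Rightarrow> 'a set \<Rightarrow> bool" where
  "borel_subalgebra s br W \<longleftrightarrow> lie_subalgebra s br W \<and> lie_solvable s br W \<and>
     (\<forall>W'. lie_subalgebra s br W' \<and> lie_solvable s br W' \<and> W \<subseteq> W' \<longrightarrow> W' = W)"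

definition parabolic_subalgebra ::
  "('k::field \<Rightarrow> 'a::ab_group_add \<Rightarrow> 'a) \<Rightarrow> ('a \<Rightarrow> 'a \<Rightarrow> 'a) \<Rightarrow> 'a set \<Rightarrow> bool" where
  "parabolic_subalgebra s br Q \<longleftrightarrow> lie_subalgebra s br Q \<and> (\<exists>W. borel_subalgebra s br W \<and> W \<subseteq> Q)"

definition is_nilradical ::
  "('k::field \<Rightarrow> 'a::ab_group_add \<Rightarrow> 'a) \<Rightarrow> ('a \<Rightarrow> 'a \<Rightarrow> 'a) \<Rightarrow> 'a set \<Rightarrow> 'a set \<Rightarrow> bool" where
  "is_nilradical s br Q N \<longleftrightarrow> lie_ideal s br Q N \<and> lie_nilpotent s br N \<and>
     (\<forall>I. lie_ideal s br Q I \<and> lie_nilpotent s br I \<longrightarrow> I \<subseteq> N)"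

text \<open>
  A Levi factor of a parabolic subalgebra is a subalgebra complementary to the nilradical; it is
  isomorphic to the quotient by the nilradical, hence automatically reductive.
\<close>

definition parabolic_with_levi ::
  "('k::field \<Rightarrow> 'a::ab_group_add \<Rightarrow> 'a) \<Rightarrow> ('a \<Rightarrow> 'a \<Rightarrow> 'a) \<Rightarrow> 'a set \<Rightarrow> 'a set \<Rightarrow> 'a set \<Rightarrow> bool" where
  "parabolic_with_levi s br Q L N \<longleftrightarrow> parabolic_subalgebra s br Q \<and> is_nilradical s br Q N \<and>
     lie_subalgebra s br L \<and> L \<inter> N = {0} \<and> Q = L + N"

definition trace_on ::
  "('k::field \<Rightarrow> 'a::ab_group_add \<Rightarrow> 'a) \<Rightarrow> 'a set \<Rightarrow> ('a \<Rightarrow> 'a) \<Rightarrow> 'k" where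
  "trace_on s W f =
     (let b = (SOME b. \<not> module.dependent s b \<and> module.span s b = W)
      in \<Sum>x\<in>b. module.representation s b (f x) x)"

definition killing ::
  "('k::field \<Rightarrow> 'a::ab_group_add \<Rightarrow> 'a) \<Rightarrow> ('a \<Rightarrow> 'a \<Rightarrow> 'a) \<Rightarrow> 'a \<Rightarrow> 'a \<Rightarrow> 'k" where
  "killing s br x y = trace_on s UNIV (\<lambda>z. br x (br y z))"

definition cartan_involution ::
  "('e::euclidean_space \<Rightarrow> 'e \<Rightarrow> 'e) \<Rightarrow> ('e \<Rightarrow> 'e) \<Rightarrow> bool" where
  "cartan_involution br \<theta> \<longleftrightarrow> linear \<theta> \<and> (\<forall>x. \<theta> (\<theta> x) = x) \<and>
     (\<forall>x y. \<theta> (br x y) = br (\<theta> x) (\<theta> y)) \<and>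
     (\<forall>x. x \<noteq> 0 \<longrightarrow> - killing scaleR br x (\<theta> x) > 0)"


section \<open>Complexification\<close>

text \<open>The pair \<open>(x, y)\<close> stands for \<open>x + i y\<close>.\<close>

definition cscale :: "complex \<Rightarrow> 'e::real_vector \<times> 'e \<Rightarrow> 'e \<times> 'e" where
  "cscale z p = (Re z *\<^sub>R fst p - Im z *\<^sub>R snd p, Re z *\<^sub>R snd p + Im z *\<^sub>R fst p)"

definition cbr :: "('e::real_vector \<Rightarrow> 'e \<Rightarrow> 'e) \<Rightarrow> 'e \<times> 'e \<Rightarrow> 'e \<times> 'e \<Rightarrow> 'e \<times> 'e" where
  "cbr br p q = (br (fst p) (fst q) - br (snd p) (snd q), br (fst p) (snd q) + br (snd p) (fst q))"

definition cmap :: "('e \<Rightarrow> 'e) \<Rightarrow> 'e \<times> 'e \<Rightarrow> 'e \<times> 'e" where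
  "cmap f = map_prod f f"

definition cconj :: "'e::real_vector \<times> 'e \<Rightarrow> 'e \<times> 'e" where
  "cconj p = (fst p, - snd p)"

abbreviation ckilling ::
  "('e::euclidean_space \<Rightarrow> 'e \<Rightarrow> 'e) \<Rightarrow> 'e \<times> 'e \<Rightarrow> 'e \<times> 'e \<Rightarrow> complex" where
  "ckilling br \<equiv> killing cscale (cbr br)"

definition k_part :: "('e::real_vector \<Rightarrow> 'e) \<Rightarrow> ('e \<times> 'e) set" where
  "k_part \<theta> = {x. cmap \<theta> x = x}"

definition p_part :: "('e::real_vector \<Rightarrow> 'e) \<Rightarrow> ('e \<times> 'e) set" where
  "p_part \<theta> = {x. cmap \<theta> x = - x}"


section \<open>Lie groups\<close>

primrec Ck_on :: "nat \<Rightarrow> 'a::euclidean_space set \<Rightarrow> ('a \<Rightarrow> 'b::euclidean_space) \<Rightarrow> bool" where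
  "Ck_on 0 S f \<longleftrightarrow> continuous_on S f"
| "Ck_on (Suc k) S f \<longleftrightarrow> (\<forall>x\<in>S. f differentiable (at x)) \<and>
     (\<forall>v. Ck_on k S (\<lambda>x. frechet_derivative f (at x) v))"

definition smooth_on :: "'a::euclidean_space set \<Rightarrow> ('a \<Rightarrow> 'b::euclidean_space) \<Rightarrow> bool" where
  "smooth_on S f \<longleftrightarrow> (\<forall>k. Ck_on k S f)"

text \<open>A chart is a pair of its domain and its coordinate map.\<close>

type_synonym ('g, 'e) chart = "'g set \<times> ('g \<Rightarrow> 'e)"

definition chart_inv :: "('g, 'e) chart \<Rightarrow> 'e \<Rightarrow> 'g" where
  "chart_inv c = inv_into (fst c) (snd c)"

definition smooth_atlas :: "'g topology \<Rightarrow> ('g, 'e::euclidean_space) chart set \<Rightarrow> bool" where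
  "smooth_atlas T A \<longleftrightarrow>
     (\<forall>c\<in>A. openin T (fst c) \<and> open (snd c ` fst c) \<and>
        homeomorphic_map (subtopology T (fst c)) (top_of_set (snd c ` fst c)) (snd c)) \<and>
     (\<Union>c\<in>A. fst c) = topspace T \<and>
     (\<forall>c\<in>A. \<forall>d\<in>A. smooth_on (snd c ` (fst c \<inter> fst d)) (snd d \<circ> chart_inv c))"

definition smooth_map ::
  "'g topology \<Rightarrow> ('g, 'e::euclidean_space) chart set \<Rightarrow>
   'h topology \<Rightarrow> ('h, 'f::euclidean_space) chart set \<Rightarrow> ('g \<Rightarrow> 'h) \<Rightarrow> bool" where
  "smooth_map T A T' A' f \<longleftrightarrow> continuous_map T T' f \<and>
     (\<forall>c\<in>A. \<forall>d\<in>A'. smooth_on (snd c ` {x \<in> fst c. f x \<in> fst d}) (snd d \<circ> f \<circ> chart_inv c))"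

definition prod_atlas ::
  "('g, 'e) chart set \<Rightarrow> ('h, 'f) chart set \<Rightarrow> ('g \<times> 'h, 'e \<times> 'f) chart set" where
  "prod_atlas A A' = {(fst c \<times> fst d, map_prod (snd c) (snd d)) | c d. c \<in> A \<and> d \<in> A'}"

text \<open>
  A Lie group together with its Lie algebra: the type \<open>'e\<close> is the tangent space at the identity,
  identified with the model space by the differential of the chart \<open>lg_chart\<close>.
\<close>

record ('g, 'e) lie_group_data = "'g monoid" +
  lg_top :: "'g topology"
  lg_atlas :: "('g, 'e) chart set"
  lg_chart :: "('g, 'e) chart"
  lg_exp :: "'e \<Rightarrow> 'g"
  lg_br :: "'e \<Rightarrow> 'e \<Rightarrow> 'e"

definition lie_group :: "('g, 'e::euclidean_space) lie_group_data \<Rightarrow> bool" where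
  "lie_group G \<longleftrightarrow> group G \<and> topspace (lg_top G) = carrier G \<and>
     Hausdorff_space (lg_top G) \<and> second_countable (lg_top G) \<and> smooth_atlas (lg_top G) (lg_atlas G) \<and>
     smooth_map (prod_topology (lg_top G) (lg_top G)) (prod_atlas (lg_atlas G) (lg_atlas G))
       (lg_top G) (lg_atlas G) (\<lambda>(x, y). x \<otimes>\<^bsub>G\<^esub> y) \<and>
     smooth_map (lg_top G) (lg_atlas G) (lg_top G) (lg_atlas G) (\<lambda>x. inv\<^bsub>G\<^esub> x)"

definition in_chart :: "('g, 'e) lie_group_data \<Rightarrow> ('g \<Rightarrow> 'g) \<Rightarrow> 'e \<Rightarrow> 'e" where
  "in_chart G f = snd (lg_chart G) \<circ> f \<circ> chart_inv (lg_chart G)"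

definition Ad :: "('g, 'e::euclidean_space) lie_group_data \<Rightarrow> 'g \<Rightarrow> 'e \<Rightarrow> 'e" where
  "Ad G g = frechet_derivative (in_chart G (\<lambda>x. g \<otimes>\<^bsub>G\<^esub> x \<otimes>\<^bsub>G\<^esub> inv\<^bsub>G\<^esub> g)) (at (snd (lg_chart G) \<one>\<^bsub>G\<^esub>))"

definition one_parameter_subgroup ::
  "('g, 'e::euclidean_space) lie_group_data \<Rightarrow> 'e \<Rightarrow> (real \<Rightarrow> 'g) \<Rightarrow> bool" where
  "one_parameter_subgroup G X \<gamma> \<longleftrightarrow> continuous_map euclideanreal (lg_top G) \<gamma> \<and>
     (\<forall>s t. \<gamma> (s + t) = \<gamma> s \<otimes>\<^bsub>G\<^esub> \<gamma> t) \<and>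
     ((\<lambda>t. snd (lg_chart G) (\<gamma> t)) has_vector_derivative X) (at 0)"

text \<open>
  The exponential map is determined by its defining property: \<open>t \<mapsto> exp (t X)\<close> is the unique
  one-parameter subgroup with initial velocity \<open>X\<close>. The bracket is the differential of \<open>Ad\<close>.
\<close>

definition lie_group_with_algebra :: "('g, 'e::euclidean_space) lie_group_data \<Rightarrow> bool" where
  "lie_group_with_algebra G \<longleftrightarrow> lie_group G \<and>
     lg_chart G \<in> lg_atlas G \<and> \<one>\<^bsub>G\<^esub> \<in> fst (lg_chart G) \<and>
     (\<forall>X \<gamma>. one_parameter_subgroup G X \<gamma> \<longleftrightarrow> \<gamma> = (\<lambda>t. lg_exp G (t *\<^sub>R X))) \<and>
     lie_algebra scaleR (lg_br G) \<and>
     (\<forall>X Y. ((\<lambda>t. Ad G (lg_exp G (t *\<^sub>R X)) Y) has_vector_derivative lg_br G X Y) (at 0))"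

definition group_center :: "('g, 'm) monoid_scheme \<Rightarrow> 'g set" where
  "group_center G = {z \<in> carrier G. \<forall>g\<in>carrier G. z \<otimes>\<^bsub>G\<^esub> g = g \<otimes>\<^bsub>G\<^esub> z}"

definition connected_semisimple_finite_center :: "('g, 'e::euclidean_space) lie_group_data \<Rightarrow> bool" where
  "connected_semisimple_finite_center G \<longleftrightarrow> lie_group_with_algebra G \<and> connected_space (lg_top G) \<and>
     lie_semisimple scaleR (lg_br G) \<and> finite (group_center G)"

text \<open>\<open>\<Theta>\<close> is an automorphism of the Lie group \<open>G\<close> whose differential \<open>\<theta>\<close> is a Cartan involution.\<close>

definition global_cartan_involution ::
  "('g, 'e::euclidean_space) lie_group_data \<Rightarrow> ('g \<Rightarrow> 'g) \<Rightarrow> ('e \<Rightarrow> 'e) \<Rightarrow> bool" where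
  "global_cartan_involution G \<Theta> \<theta> \<longleftrightarrow> \<Theta> \<in> iso G G \<and> (\<forall>g\<in>carrier G. \<Theta> (\<Theta> g) = g) \<and>
     smooth_map (lg_top G) (lg_atlas G) (lg_top G) (lg_atlas G) \<Theta> \<and>
     (in_chart G \<Theta> has_derivative \<theta>) (at (snd (lg_chart G) \<one>\<^bsub>G\<^esub>)) \<and>
     cartan_involution (lg_br G) \<theta>"

definition fixed_subgroup :: "('g, 'm) monoid_scheme \<Rightarrow> ('g \<Rightarrow> 'g) \<Rightarrow> 'g set" where
  "fixed_subgroup G \<Theta> = {g \<in> carrier G. \<Theta> g = g}"


section \<open>Hermitian symmetric pairs and \<open>\<theta>\<close>-stable parabolic subalgebras\<close>

definition hermitian_symmetric ::
  "('g, 'e::euclidean_space) lie_group_data \<Rightarrow> 'g set \<Rightarrow> ('e \<Rightarrow> 'e) \<Rightarrow>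
   ('e \<times> 'e) set \<Rightarrow> ('e \<times> 'e) set \<Rightarrow> bool" where
  "hermitian_symmetric G K \<theta> pp pm \<longleftrightarrow>
     lie_subalgebra cscale (cbr (lg_br G)) pp \<and> lie_subalgebra cscale (cbr (lg_br G)) pm \<and>
     pp \<inter> pm = {0} \<and> pp + pm = p_part \<theta> \<and>
     (\<forall>k\<in>K. cmap (Ad G k) ` pp \<subseteq> pp \<and> cmap (Ad G k) ` pm \<subseteq> pm) \<and>
     (\<forall>x\<in>pp. \<forall>y\<in>pp. cbr (lg_br G) x y = 0) \<and>
     (\<forall>x\<in>pm. \<forall>y\<in>pm. cbr (lg_br G) x y = 0) \<and>
     pm = cconj ` pp \<and>
     parabolic_with_levi cscale (cbr (lg_br G)) (k_part \<theta> + pp) (k_part \<theta>) pp"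

definition theta_stable_parabolic ::
  "('e::euclidean_space \<Rightarrow> 'e \<Rightarrow> 'e) \<Rightarrow> ('e \<Rightarrow> 'e) \<Rightarrow> ('e \<times> 'e) set \<Rightarrow> ('e \<times> 'e) set \<Rightarrow> bool" where
  "theta_stable_parabolic br \<theta> l u \<longleftrightarrow>
     parabolic_with_levi cscale (cbr br) (l + u) l u \<and>
     cmap \<theta> ` (l + u) = l + u \<and>
     cconj ` l = l \<and>
     parabolic_with_levi cscale (cbr br) (l + cconj ` u) l (cconj ` u) \<and>
     (l + u) \<inter> (l + cconj ` u) = l \<and>
     u \<inter> cconj ` u = {0} \<and>
     u + cconj ` u = {x. \<forall>y\<in>l. ckilling br x y = 0}"


section \<open>\<open>(g, K)\<close>-modules\<close>

definition fin_dim :: "(complex \<Rightarrow> 'v::ab_group_add \<Rightarrow> 'v) \<Rightarrow> 'v set \<Rightarrow> bool" where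
  "fin_dim sV W \<longleftrightarrow> (\<exists>B. finite B \<and> W \<subseteq> module.span sV B)"

definition stable_subspace ::
  "(complex \<Rightarrow> 'v::ab_group_add \<Rightarrow> 'v) \<Rightarrow> 'g set \<Rightarrow> ('g \<Rightarrow> 'v \<Rightarrow> 'v) \<Rightarrow> 'v set \<Rightarrow> bool" where
  "stable_subspace sV K \<sigma> W \<longleftrightarrow> module.subspace sV W \<and> (\<forall>k\<in>K. \<forall>w\<in>W. \<sigma> k w \<in> W)"

definition irreducible_subspace ::
  "(complex \<Rightarrow> 'v::ab_group_add \<Rightarrow> 'v) \<Rightarrow> 'g set \<Rightarrow> ('g \<Rightarrow> 'v \<Rightarrow> 'v) \<Rightarrow> 'v set \<Rightarrow> bool" where
  "irreducible_subspace sV K \<sigma> E \<longleftrightarrow> stable_subspace sV K \<sigma> E \<and> E \<noteq> {0} \<and>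
     (\<forall>W. stable_subspace sV K \<sigma> W \<and> W \<subseteq> E \<longrightarrow> W = {0} \<or> W = E)"

definition K_isomorphic ::
  "(complex \<Rightarrow> 'v::ab_group_add \<Rightarrow> 'v) \<Rightarrow> 'g set \<Rightarrow> ('g \<Rightarrow> 'v \<Rightarrow> 'v) \<Rightarrow> 'v set \<Rightarrow> 'v set \<Rightarrow> bool" where
  "K_isomorphic sV K \<sigma> E W \<longleftrightarrow> (\<exists>f. bij_betw f E W \<and>
     (\<forall>x\<in>E. \<forall>y\<in>E. f (x + y) = f x + f y) \<and> (\<forall>c. \<forall>x\<in>E. f (sV c x) = sV c (f x)) \<and>
     (\<forall>k\<in>K. \<forall>x\<in>E. f (\<sigma> k x) = \<sigma> k (f x)))"

definition isotypic_component ::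
  "(complex \<Rightarrow> 'v::ab_group_add \<Rightarrow> 'v) \<Rightarrow> 'g set \<Rightarrow> ('g \<Rightarrow> 'v \<Rightarrow> 'v) \<Rightarrow> 'v set \<Rightarrow> 'v set" where
  "isotypic_component sV K \<sigma> E =
     module.span sV (\<Union>{W. stable_subspace sV K \<sigma> W \<and> K_isomorphic sV K \<sigma> E W})"

text \<open>
  Every \<open>K\<close>-type that occurs in the module is realized by some subspace \<open>E\<close>, so it is enough to
  quantify over these.
\<close>

definition admissible ::
  "(complex \<Rightarrow> 'v::ab_group_add \<Rightarrow> 'v) \<Rightarrow> 'g set \<Rightarrow> ('g \<Rightarrow> 'v \<Rightarrow> 'v) \<Rightarrow> bool" where
  "admissible sV K \<sigma> \<longleftrightarrow>
     (\<forall>E. irreducible_subspace sV K \<sigma> E \<and> fin_dim sV E \<longrightarrow> fin_dim sV (isotypic_component sV K \<sigma> E))"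

text \<open>
  \<open>\<pi>\<close> is the action of the complexified Lie algebra and \<open>\<sigma>\<close> that of \<open>K\<close>. As \<open>K\<close> acts locally
  finitely, continuity and differentiability of this action are those of its matrix coefficients.
\<close>

definition gK_module ::
  "('g, 'e::euclidean_space) lie_group_data \<Rightarrow> 'g set \<Rightarrow> ('e \<Rightarrow> 'e) \<Rightarrow>
   (complex \<Rightarrow> 'v::ab_group_add \<Rightarrow> 'v) \<Rightarrow> ('e \<times> 'e \<Rightarrow> 'v \<Rightarrow> 'v) \<Rightarrow> ('g \<Rightarrow> 'v \<Rightarrow> 'v) \<Rightarrow> bool" where
  "gK_module G K \<theta> sV \<pi> \<sigma> \<longleftrightarrow> vector_space sV \<and>
     (\<forall>X. Vector_Spaces.linear sV sV (\<pi> X)) \<and>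
     (\<forall>v. Vector_Spaces.linear cscale sV (\<lambda>X. \<pi> X v)) \<and>
     (\<forall>X Y v. \<pi> (cbr (lg_br G) X Y) v = \<pi> X (\<pi> Y v) - \<pi> Y (\<pi> X v)) \<and>
     (\<forall>k\<in>K. Vector_Spaces.linear sV sV (\<sigma> k)) \<and>
     (\<forall>v. \<sigma> \<one>\<^bsub>G\<^esub> v = v) \<and>
     (\<forall>k\<in>K. \<forall>h\<in>K. \<forall>v. \<sigma> (k \<otimes>\<^bsub>G\<^esub> h) v = \<sigma> k (\<sigma> h v)) \<and>
     (\<forall>v. \<exists>W. v \<in> W \<and> stable_subspace sV K \<sigma> W \<and> fin_dim sV W) \<and>
     (\<forall>v \<phi>. Vector_Spaces.linear sV (*) \<phi> \<longrightarrow>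
        continuous_map (subtopology (lg_top G) K) euclidean (\<lambda>k. \<phi> (\<sigma> k v))) \<and>
     (\<forall>X v \<phi>. \<theta> X = X \<longrightarrow> Vector_Spaces.linear sV (*) \<phi> \<longrightarrow>
        ((\<lambda>t. \<phi> (\<sigma> (lg_exp G (t *\<^sub>R X)) v)) has_vector_derivative \<phi> (\<pi> (X, 0) v)) (at 0)) \<and>
     (\<forall>k\<in>K. \<forall>X v. \<sigma> k (\<pi> X v) = \<pi> (cmap (Ad G k) X) (\<sigma> k v))"

definition unitary_form ::
  "'g set \<Rightarrow> (complex \<Rightarrow> 'v::ab_group_add \<Rightarrow> 'v) \<Rightarrow> ('e::real_vector \<times> 'e \<Rightarrow> 'v \<Rightarrow> 'v) \<Rightarrow>
   ('g \<Rightarrow> 'v \<Rightarrow> 'v) \<Rightarrow> ('v \<Rightarrow> 'v \<Rightarrow> complex) \<Rightarrow> bool" where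
  "unitary_form K sV \<pi> \<sigma> ip \<longleftrightarrow>
     (\<forall>w. Vector_Spaces.linear sV (*) (\<lambda>v. ip v w)) \<and>
     (\<forall>v w. ip w v = cnj (ip v w)) \<and>
     (\<forall>v. v \<noteq> 0 \<longrightarrow> Re (ip v v) > 0) \<and>
     (\<forall>k\<in>K. \<forall>v w. ip (\<sigma> k v) (\<sigma> k w) = ip v w) \<and>
     (\<forall>X v w. ip (\<pi> (X, 0) v) w = - ip v (\<pi> (X, 0) w))"


section \<open>The space \<open>V \<otimes> S\<close> and the Dirac operator\<close>

text \<open>
  Let \<open>e 0, \<dots>, e (n - 1)\<close> be a basis of \<open>u\<close>. The element \<open>\<Sum>I. v_I \<otimes> e_I\<close> of \<open>V \<otimes> \<Lambda>u\<close>, where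
  \<open>e_I\<close> is the wedge product of the \<open>e i\<close> with \<open>i \<in> I\<close> in increasing order, is represented by the
  function \<open>I \<mapsto> v_I\<close>, extended by 0 to the sets \<open>I\<close> that are not contained in \<open>{..<n}\<close>.
\<close>

definition basis_of ::
  "(complex \<Rightarrow> 'a::ab_group_add \<Rightarrow> 'a) \<Rightarrow> 'a set \<Rightarrow> nat \<Rightarrow> (nat \<Rightarrow> 'a) \<Rightarrow> bool" where
  "basis_of s W n e \<longleftrightarrow> inj_on e {..<n} \<and> \<not> module.dependent s (e ` {..<n}) \<and> module.span s (e ` {..<n}) = W"

definition dual_basis_of ::
  "('a \<Rightarrow> 'a \<Rightarrow> complex) \<Rightarrow> 'a set \<Rightarrow> nat \<Rightarrow> (nat \<Rightarrow> 'a) \<Rightarrow> (nat \<Rightarrow> 'a) \<Rightarrow> bool" where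
  "dual_basis_of B W n e e' \<longleftrightarrow> (\<forall>i<n. e' i \<in> W) \<and> (\<forall>i<n. \<forall>j<n. B (e i) (e' j) = (if i = j then 1 else 0))"

definition VS :: "nat \<Rightarrow> (nat set \<Rightarrow> 'v::zero) set" where
  "VS n = {f. \<forall>I. \<not> I \<subseteq> {..<n} \<longrightarrow> f I = 0}"

definition on_coeffs :: "('v \<Rightarrow> 'v) \<Rightarrow> ('i \<Rightarrow> 'v) \<Rightarrow> 'i \<Rightarrow> 'v" where
  "on_coeffs A f = (\<lambda>I. A (f I))"

text \<open>The operator \<open>1 \<otimes> (x \<and> _)\<close> for \<open>x \<in> u\<close>.\<close>

definition wedge ::
  "(complex \<Rightarrow> 'v::ab_group_add \<Rightarrow> 'v) \<Rightarrow> nat \<Rightarrow> (nat \<Rightarrow> 'e::real_vector \<times> 'e) \<Rightarrow> 'e \<times> 'e \<Rightarrow>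
   (nat set \<Rightarrow> 'v) \<Rightarrow> nat set \<Rightarrow> 'v" where
  "wedge sV n e x f = (\<lambda>I. if I \<subseteq> {..<n} then
     (\<Sum>i\<in>I. sV ((-1) ^ card {j \<in> I. j < i} * module.representation cscale (e ` {..<n}) x (e i)) (f (I - {i})))
     else 0)"

text \<open>
  The contraction by \<open>y\<close> in the conjugate of \<open>u\<close>: the sign of \<open>e_i\<close> in \<open>e_(I \<union> {i})\<close> is determined by
  the number of smaller elements of \<open>I\<close>.
\<close>

definition contract ::
  "(complex \<Rightarrow> 'v::ab_group_add \<Rightarrow> 'v) \<Rightarrow> ('e::euclidean_space \<Rightarrow> 'e \<Rightarrow> 'e) \<Rightarrow> nat \<Rightarrow> (nat \<Rightarrow> 'e \<times> 'e) \<Rightarrow> 'e \<times> 'e \<Rightarrow>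
   (nat set \<Rightarrow> 'v) \<Rightarrow> nat set \<Rightarrow> 'v" where
  "contract sV br n e y f = (\<lambda>I. if I \<subseteq> {..<n} then
     (\<Sum>i\<in>{..<n} - I. sV (2 * (-1) ^ card {j \<in> I. j < i} * ckilling br y (e i)) (f (insert i I)))
     else 0)"

text \<open>The Clifford action on \<open>V \<otimes> S\<close> of \<open>z = x + y\<close> with \<open>x\<close> in \<open>u\<close> and \<open>y\<close> in its conjugate.\<close>

definition clifford ::
  "(complex \<Rightarrow> 'v::ab_group_add \<Rightarrow> 'v) \<Rightarrow> ('e::euclidean_space \<Rightarrow> 'e \<Rightarrow> 'e) \<Rightarrow> ('e \<times> 'e) set \<Rightarrow> nat \<Rightarrow>
   (nat \<Rightarrow> 'e \<times> 'e) \<Rightarrow> 'e \<times> 'e \<Rightarrow> (nat set \<Rightarrow> 'v) \<Rightarrow> nat set \<Rightarrow> 'v" where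
  "clifford sV br u n e z f =
     (let x = (THE x. x \<in> u \<and> z - x \<in> cconj ` u)
      in wedge sV n e x f + contract sV br n e (z - x) f)"

text \<open>
  The action on \<open>V \<otimes> S\<close> of
  \<open>\<Sum>i. b i \<otimes> a i - 1/4 \<Sum>i j. 1 \<otimes> [b i, b j] (a i) (a j)\<close>;
  \<open>C\<close> and \<open>C\<^sup>-\<close> are the cases where \<open>a\<close> is the basis of \<open>u\<close>, respectively its dual basis,
  and \<open>b\<close> is the other one.
\<close>

definition half_dirac ::
  "(complex \<Rightarrow> 'v::ab_group_add \<Rightarrow> 'v) \<Rightarrow> ('e::euclidean_space \<Rightarrow> 'e \<Rightarrow> 'e) \<Rightarrow> ('e \<times> 'e \<Rightarrow> 'v \<Rightarrow> 'v) \<Rightarrow>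
   ('e \<times> 'e) set \<Rightarrow> nat \<Rightarrow> (nat \<Rightarrow> 'e \<times> 'e) \<Rightarrow> (nat \<Rightarrow> 'e \<times> 'e) \<Rightarrow> (nat \<Rightarrow> 'e \<times> 'e) \<Rightarrow>
   (nat set \<Rightarrow> 'v) \<Rightarrow> nat set \<Rightarrow> 'v" where
  "half_dirac sV br \<pi> u n e a b f =
     (let \<gamma> = clifford sV br u n e in
      (\<Sum>i<n. on_coeffs (\<pi> (b i)) (\<gamma> (a i) f)) -
      on_coeffs (sV (1/4)) (\<Sum>i<n. \<Sum>j<n. \<gamma> (cbr br (b i) (b j)) (\<gamma> (a i) (\<gamma> (a j) f))))"

definition dirac_C ::
  "(complex \<Rightarrow> 'v::ab_group_add \<Rightarrow> 'v) \<Rightarrow> ('e::euclidean_space \<Rightarrow> 'e \<Rightarrow> 'e) \<Rightarrow> ('e \<times> 'e \<Rightarrow> 'v \<Rightarrow> 'v) \<Rightarrow>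
   ('e \<times> 'e) set \<Rightarrow> nat \<Rightarrow> (nat \<Rightarrow> 'e \<times> 'e) \<Rightarrow> (nat \<Rightarrow> 'e \<times> 'e) \<Rightarrow>
   (nat set \<Rightarrow> 'v) \<Rightarrow> nat set \<Rightarrow> 'v" where
  "dirac_C sV br \<pi> u n e e' = half_dirac sV br \<pi> u n e e e'"

definition dirac_Cminus ::
  "(complex \<Rightarrow> 'v::ab_group_add \<Rightarrow> 'v) \<Rightarrow> ('e::euclidean_space \<Rightarrow> 'e \<Rightarrow> 'e) \<Rightarrow> ('e \<times> 'e \<Rightarrow> 'v \<Rightarrow> 'v) \<Rightarrow>
   ('e \<times> 'e) set \<Rightarrow> nat \<Rightarrow> (nat \<Rightarrow> 'e \<times> 'e) \<Rightarrow> (nat \<Rightarrow> 'e \<times> 'e) \<Rightarrow>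
   (nat set \<Rightarrow> 'v) \<Rightarrow> nat set \<Rightarrow> 'v" where
  "dirac_Cminus sV br \<pi> u n e e' = half_dirac sV br \<pi> u n e e' e"

definition dirac_D ::
  "(complex \<Rightarrow> 'v::ab_group_add \<Rightarrow> 'v) \<Rightarrow> ('e::euclidean_space \<Rightarrow> 'e \<Rightarrow> 'e) \<Rightarrow> ('e \<times> 'e \<Rightarrow> 'v \<Rightarrow> 'v) \<Rightarrow>
   ('e \<times> 'e) set \<Rightarrow> nat \<Rightarrow> (nat \<Rightarrow> 'e \<times> 'e) \<Rightarrow> (nat \<Rightarrow> 'e \<times> 'e) \<Rightarrow>
   (nat set \<Rightarrow> 'v) \<Rightarrow> nat set \<Rightarrow> 'v" where
  "dirac_D sV br \<pi> u n e e' f = dirac_C sV br \<pi> u n e e' f + dirac_Cminus sV br \<pi> u n e e' f"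

text \<open>
  The action \<open>X \<otimes> 1 + 1 \<otimes> \<alpha>(X)\<close> of \<open>l\<close> on \<open>V \<otimes> S\<close>. With the Clifford relations
  \<open>v w + w v = 2 B(v, w)\<close> one has \<open>\<alpha>(X) = 1/4 \<Sum>k. [X, d k] d' k\<close> for any basis \<open>d\<close> of \<open>s\<close> with
  \<open>B\<close>-dual basis \<open>d'\<close>; here \<open>d\<close> consists of the \<open>e i\<close> and the \<open>e' i\<close>.
\<close>

definition spin_action ::
  "(complex \<Rightarrow> 'v::ab_group_add \<Rightarrow> 'v) \<Rightarrow> ('e::euclidean_space \<Rightarrow> 'e \<Rightarrow> 'e) \<Rightarrow> ('e \<times> 'e \<Rightarrow> 'v \<Rightarrow> 'v) \<Rightarrow>
   ('e \<times> 'e) set \<Rightarrow> nat \<Rightarrow> (nat \<Rightarrow> 'e \<times> 'e) \<Rightarrow> (nat \<Rightarrow> 'e \<times> 'e) \<Rightarrow> 'e \<times> 'e \<Rightarrow>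
   (nat set \<Rightarrow> 'v) \<Rightarrow> nat set \<Rightarrow> 'v" where
  "spin_action sV br \<pi> u n e e' X f =
     (let \<gamma> = clifford sV br u n e in
      on_coeffs (\<pi> X) f +
      on_coeffs (sV (1/4)) (\<Sum>i<n. \<gamma> (cbr br X (e i)) (\<gamma> (e' i) f) + \<gamma> (cbr br X (e' i)) (\<gamma> (e i) f)))"

definition u_form ::
  "('e::euclidean_space \<Rightarrow> 'e \<Rightarrow> 'e) \<Rightarrow> ('e \<Rightarrow> 'e) \<Rightarrow> 'e \<times> 'e \<Rightarrow> 'e \<times> 'e \<Rightarrow> complex" where
  "u_form br \<theta> x y = - 2 * ckilling br x (cmap \<theta> (cconj y))"

text \<open>The inner product of \<open>e_I\<close> and \<open>e_J\<close>, a determinant written out by the Leibniz formula.\<close>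

definition gram :: "('a \<Rightarrow> 'a \<Rightarrow> complex) \<Rightarrow> (nat \<Rightarrow> 'a) \<Rightarrow> nat set \<Rightarrow> nat set \<Rightarrow> complex" where
  "gram h e I J = (if card I = card J then
     (\<Sum>p | p permutes {..<card I}. of_int (sign p) *
        (\<Prod>a<card I. h (e (sorted_list_of_set I ! a)) (e (sorted_list_of_set J ! p a))))
     else 0)"

definition VS_form ::
  "('v \<Rightarrow> 'v \<Rightarrow> complex) \<Rightarrow> ('a \<Rightarrow> 'a \<Rightarrow> complex) \<Rightarrow> nat \<Rightarrow> (nat \<Rightarrow> 'a) \<Rightarrow>
   (nat set \<Rightarrow> 'v) \<Rightarrow> (nat set \<Rightarrow> 'v) \<Rightarrow> complex" where
  "VS_form ip h n e f g = (\<Sum>I\<in>Pow {..<n}. \<Sum>J\<in>Pow {..<n}. ip (f I) (g J) * gram h e I J)"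

definition adjoint_on :: "'m set \<Rightarrow> ('m \<Rightarrow> 'm \<Rightarrow> complex) \<Rightarrow> ('m \<Rightarrow> 'm) \<Rightarrow> 'm \<Rightarrow> 'm" where
  "adjoint_on M form A y = (THE z. z \<in> M \<and> (\<forall>x\<in>M. form (A x) y = form x z))"


section \<open>Modules over \<open>l\<close> and their subquotients\<close>

record ('l, 'm) lmod =
  lm_carrier :: "'m set"
  lm_add :: "'m \<Rightarrow> 'm \<Rightarrow> 'm"
  lm_scale :: "complex \<Rightarrow> 'm \<Rightarrow> 'm"
  lm_act :: "'l \<Rightarrow> 'm \<Rightarrow> 'm"

definition lmod_isomorphic :: "'l set \<Rightarrow> ('l, 'm) lmod \<Rightarrow> ('l, 'n) lmod \<Rightarrow> bool" where
  "lmod_isomorphic l M N \<longleftrightarrow> (\<exists>f. bij_betw f (lm_carrier M) (lm_carrier N) \<and>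
     (\<forall>x\<in>lm_carrier M. \<forall>y\<in>lm_carrier M. f (lm_add M x y) = lm_add N (f x) (f y)) \<and>
     (\<forall>c. \<forall>x\<in>lm_carrier M. f (lm_scale M c x) = lm_scale N c (f x)) \<and>
     (\<forall>X\<in>l. \<forall>x\<in>lm_carrier M. f (lm_act M X x) = lm_act N X (f x)))"

definition cosets :: "'m::ab_group_add set \<Rightarrow> 'm set \<Rightarrow> 'm set set" where
  "cosets U W = {x +o W | x. x \<in> U}"

definition subquotient ::
  "(complex \<Rightarrow> 'm::ab_group_add \<Rightarrow> 'm) \<Rightarrow> ('l \<Rightarrow> 'm \<Rightarrow> 'm) \<Rightarrow> 'm set \<Rightarrow> 'm set \<Rightarrow> ('l, 'm set) lmod" where
  "subquotient s act U W = \<lparr>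
     lm_carrier = cosets U W,
     lm_add = (\<lambda>A B. A + B),
     lm_scale = (\<lambda>c A. s c ` A + W),
     lm_act = (\<lambda>X A. act X ` A + W)\<rparr>"

text \<open>The tensor product with the one-dimensional module on which \<open>X\<close> acts by \<open>\<kappa> X\<close>.\<close>

definition twist :: "('l \<Rightarrow> complex) \<Rightarrow> ('l, 'm) lmod \<Rightarrow> ('l, 'm) lmod" where
  "twist \<kappa> M = M \<lparr>lm_act := (\<lambda>X x. lm_add M (lm_act M X x) (lm_scale M (\<kappa> X) x))\<rparr>"

definition kernel_on :: "'m set \<Rightarrow> ('m \<Rightarrow> 'm::zero) \<Rightarrow> 'm set" where
  "kernel_on M A = {x \<in> M. A x = 0}"

definition rho_char :: "('e::euclidean_space \<Rightarrow> 'e \<Rightarrow> 'e) \<Rightarrow> ('e \<times> 'e) set \<Rightarrow> 'e \<times> 'e \<Rightarrow> complex" where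
  "rho_char br W X = trace_on cscale W (cbr br X) / 2"


section \<open>Lie algebra cohomology and homology\<close>

text \<open>
  A cochain in the total complex \<open>Hom(\<Lambda>W, V)\<close> is a function on lists of elements of \<open>W\<close> whose
  restriction to the lists of each length is multilinear and alternating; it is extended by 0 to
  all other lists.
\<close>

definition cochains ::
  "(complex \<Rightarrow> 'a::ab_group_add \<Rightarrow> 'a) \<Rightarrow> (complex \<Rightarrow> 'v::ab_group_add \<Rightarrow> 'v) \<Rightarrow> 'a set \<Rightarrow> ('a list \<Rightarrow> 'v) set" where
  "cochains s sV W = {f.
     (\<forall>xs. \<not> set xs \<subseteq> W \<longrightarrow> f xs = 0) \<and>
     (\<forall>xs. \<not> distinct xs \<longrightarrow> f xs = 0) \<and>
     (\<forall>xs ys x y. set xs \<subseteq> W \<and> set ys \<subseteq> W \<and> x \<in> W \<and> y \<in> W \<longrightarrow>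
        f (xs @ (x + y) # ys) = f (xs @ x # ys) + f (xs @ y # ys)) \<and>
     (\<forall>xs ys x c. set xs \<subseteq> W \<and> set ys \<subseteq> W \<and> x \<in> W \<longrightarrow>
        f (xs @ s c x # ys) = sV c (f (xs @ x # ys)))}"

definition cohom_d ::
  "(complex \<Rightarrow> 'v::ab_group_add \<Rightarrow> 'v) \<Rightarrow> ('a \<Rightarrow> 'a \<Rightarrow> 'a) \<Rightarrow> ('a \<Rightarrow> 'v \<Rightarrow> 'v) \<Rightarrow> 'a set \<Rightarrow>
   ('a list \<Rightarrow> 'v) \<Rightarrow> 'a list \<Rightarrow> 'v" where
  "cohom_d sV br \<pi> W f xs = (if set xs \<subseteq> W then
     (\<Sum>i<length xs. sV ((-1) ^ i) (\<pi> (xs ! i) (f (nths xs (- {i}))))) +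
     (\<Sum>j<length xs. \<Sum>i<j. sV ((-1) ^ (i + j)) (f (br (xs ! i) (xs ! j) # nths xs (- {i, j}))))
     else 0)"

definition cohom_action ::
  "('a \<Rightarrow> 'a \<Rightarrow> 'a) \<Rightarrow> ('a \<Rightarrow> 'v::ab_group_add \<Rightarrow> 'v) \<Rightarrow> 'a set \<Rightarrow> 'a \<Rightarrow> ('a list \<Rightarrow> 'v) \<Rightarrow> 'a list \<Rightarrow> 'v" where
  "cohom_action br \<pi> W X f xs = (if set xs \<subseteq> W then
     \<pi> X (f xs) - (\<Sum>i<length xs. f (xs[i := br X (xs ! i)])) else 0)"

definition cohomology ::
  "(complex \<Rightarrow> 'a::ab_group_add \<Rightarrow> 'a) \<Rightarrow> (complex \<Rightarrow> 'v::ab_group_add \<Rightarrow> 'v) \<Rightarrow> ('a \<Rightarrow> 'a \<Rightarrow> 'a) \<Rightarrow>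
   ('a \<Rightarrow> 'v \<Rightarrow> 'v) \<Rightarrow> 'a set \<Rightarrow> ('a, ('a list \<Rightarrow> 'v) set) lmod" where
  "cohomology s sV br \<pi> W =
     (let M = cochains s sV W; d = cohom_d sV br \<pi> W
      in subquotient (\<lambda>c. on_coeffs (sV c)) (cohom_action br \<pi> W) (kernel_on M d) (d ` M))"

text \<open>
  The chains of \<open>u\<close> are the elements of \<open>V \<otimes> \<Lambda>u\<close>, represented as above with respect to a basis of
  \<open>u\<close>; \<open>tensor_wedge v ys\<close> is \<open>v \<otimes> ys ! 0 \<and> ys ! 1 \<and> \<dots>\<close>.
\<close>

definition tensor_wedge ::
  "(complex \<Rightarrow> 'v::ab_group_add \<Rightarrow> 'v) \<Rightarrow> nat \<Rightarrow> (nat \<Rightarrow> 'e::real_vector \<times> 'e) \<Rightarrow> 'v \<Rightarrow> ('e \<times> 'e) list \<Rightarrow>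
   nat set \<Rightarrow> 'v" where
  "tensor_wedge sV n e v ys = foldr (wedge sV n e) ys (\<lambda>I. if I = {} then v else 0)"

definition on_basis ::
  "nat \<Rightarrow> (nat \<Rightarrow> 'a) \<Rightarrow> ('v \<Rightarrow> 'a list \<Rightarrow> nat set \<Rightarrow> 'v::ab_group_add) \<Rightarrow> (nat set \<Rightarrow> 'v) \<Rightarrow> nat set \<Rightarrow> 'v" where
  "on_basis n e A f = (\<Sum>I\<in>Pow {..<n}. A (f I) (map e (sorted_list_of_set I)))"

definition hom_boundary ::
  "(complex \<Rightarrow> 'v::ab_group_add \<Rightarrow> 'v) \<Rightarrow> ('e::real_vector \<Rightarrow> 'e \<Rightarrow> 'e) \<Rightarrow> ('e \<times> 'e \<Rightarrow> 'v \<Rightarrow> 'v) \<Rightarrow>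
   nat \<Rightarrow> (nat \<Rightarrow> 'e \<times> 'e) \<Rightarrow> (nat set \<Rightarrow> 'v) \<Rightarrow> nat set \<Rightarrow> 'v" where
  "hom_boundary sV br \<pi> n e = on_basis n e (\<lambda>v ys.
     (\<Sum>i<length ys. tensor_wedge sV n e (sV ((-1) ^ Suc i) (\<pi> (ys ! i) v)) (nths ys (- {i}))) +
     (\<Sum>j<length ys. \<Sum>i<j. tensor_wedge sV n e (sV ((-1) ^ (i + j)) v)
        (cbr br (ys ! i) (ys ! j) # nths ys (- {i, j}))))"

definition hom_action ::
  "(complex \<Rightarrow> 'v::ab_group_add \<Rightarrow> 'v) \<Rightarrow> ('e::real_vector \<Rightarrow> 'e \<Rightarrow> 'e) \<Rightarrow> ('e \<times> 'e \<Rightarrow> 'v \<Rightarrow> 'v) \<Rightarrow>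
   nat \<Rightarrow> (nat \<Rightarrow> 'e \<times> 'e) \<Rightarrow> 'e \<times> 'e \<Rightarrow> (nat set \<Rightarrow> 'v) \<Rightarrow> nat set \<Rightarrow> 'v" where
  "hom_action sV br \<pi> n e X = on_basis n e (\<lambda>v ys.
     tensor_wedge sV n e (\<pi> X v) ys +
     (\<Sum>i<length ys. tensor_wedge sV n e v (ys[i := cbr br X (ys ! i)])))"

definition homology ::
  "(complex \<Rightarrow> 'v::ab_group_add \<Rightarrow> 'v) \<Rightarrow> ('e::real_vector \<Rightarrow> 'e \<Rightarrow> 'e) \<Rightarrow> ('e \<times> 'e \<Rightarrow> 'v \<Rightarrow> 'v) \<Rightarrow>
   nat \<Rightarrow> (nat \<Rightarrow> 'e \<times> 'e) \<Rightarrow> ('e \<times> 'e, (nat set \<Rightarrow> 'v) set) lmod" where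
  "homology sV br \<pi> n e =
     (let d = hom_boundary sV br \<pi> n e
      in subquotient (\<lambda>c. on_coeffs (sV c)) (hom_action sV br \<pi> n e) (kernel_on (VS n) d) (d ` VS n))"

definition dirac_cohomology ::
  "(complex \<Rightarrow> 'v::ab_group_add \<Rightarrow> 'v) \<Rightarrow> ('e::euclidean_space \<Rightarrow> 'e \<Rightarrow> 'e) \<Rightarrow> ('e \<times> 'e \<Rightarrow> 'v \<Rightarrow> 'v) \<Rightarrow>
   ('e \<times> 'e) set \<Rightarrow> nat \<Rightarrow> (nat \<Rightarrow> 'e \<times> 'e) \<Rightarrow> (nat \<Rightarrow> 'e \<times> 'e) \<Rightarrow> ('e \<times> 'e, (nat set \<Rightarrow> 'v) set) lmod" where
  "dirac_cohomology sV br \<pi> u n e e' =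
     (let D = dirac_D sV br \<pi> u n e e'; Z = kernel_on (VS n) D
      in subquotient (\<lambda>c. on_coeffs (sV c)) (spin_action sV br \<pi> u n e e') Z (D ` VS n \<inter> Z))"

text \<open>
  \<open>H\<close> is a set of representatives for \<open>U / W\<close>: it consists of elements of \<open>U\<close>, and every class
  has exactly one representative in it.
\<close>

definition represents :: "'m::ab_group_add set \<Rightarrow> 'm set \<Rightarrow> 'm set \<Rightarrow> bool" where
  "represents H U W \<longleftrightarrow> H \<subseteq> U \<and> (\<forall>A\<in>cosets U W. \<exists>!h. h \<in> A \<and> h \<in> H)"

end

theory Submission
  imports Defs "Jordan_Normal_Form.Determinant"
begin

text \<open>
  Let \<open>C\<^sub>p\<close> and \<open>C\<^sub>p\<^sup>-\<close> be the parts of \<open>C\<close> and \<open>C\<^sup>-\<close> in which \<open>V\<close> is acted on by \<open>p\<close>, and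
  \<open>C\<^sub>k\<close>, \<open>C\<^sub>k\<^sup>-\<close> the rest. Unitarity gives \<open>C\<^sub>k\<^sup>a\<^sup>d\<^sup>j = C\<^sub>k\<^sup>-\<close> and \<open>C\<^sub>p\<^sup>a\<^sup>d\<^sup>j = - C\<^sub>p\<^sup>-\<close>. As
  \<open>u\<close> contains the abelian \<open>p\<^sup>+\<close>, the two parts of \<open>C\<close> square to 0 and anticommute, and so do
  \<open>C\<^sub>p\<close> and \<open>C\<^sub>k\<^sup>-\<close>. Hence \<open>C\<close> and \<open>C\<^sup>-\<close> have the same Laplacian \<open>\<Delta> = D\<^sub>k\<^sup>2 - D\<^sub>p\<^sup>2\<close>, where
  \<open>D\<^sub>k = C\<^sub>k + C\<^sub>k\<^sup>-\<close> is symmetric, \<open>D\<^sub>p = C\<^sub>p + C\<^sub>p\<^sup>-\<close> is skew and anticommutes with it, and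
  \<open>D = D\<^sub>k + D\<^sub>p\<close>. Apart from the action of \<open>k\<close> on \<open>V\<close>, \<open>\<Delta>\<close> involves only an operator commuting
  with \<open>K\<close>, so by admissibility it is locally finite and \<open>V \<otimes> S\<close> is the sum of its kernel and its
  image. The kernel then represents the cohomology of \<open>C\<close>, of \<open>C\<^sup>-\<close> and of \<open>D\<close>, and the actions of
  \<open>l\<close> on it differ by the character \<open>\<rho>\<close> of the spin action.
\<close>

section \<open>Clifford calculus for C and its opposite\<close>

text \<open>V has infinite dimension and no completeness, so a symmetric operator on V \<otimes> S
  need not split the space. What admissibility supplies is a finite-dimensional invariant subspace
  around each vector; there a linear relation between powers of the Laplacian gives the splitting.
  The second obstacle is that D is neither symmetric nor skew: D^2 = D_k^2 + D_p^2 is the sum of a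
  positive and a negative operator and says little about Ker D. The remedy is that D_k and D_p both
  commute with \<Delta>. Up to its harmonic part, an element of Ker D is \<Delta> z with z in the
  image of \<Delta>; then D z is harmonic and in that image, hence 0, and D z = 0 implies \<Delta> z
  = D(D_k z). The adjoint relations come from one observation: the adjoint of C is C^- for the
  representation twisted by \<theta>, and the twist only changes the sign of p. The character \<rho>
  is an ordering constant: the spin action weighs both orders of wedge product and contraction
  equally, and moving all contractions to the right leaves half the trace of ad X on the conjugate
  of u.\<close>

locale dual_bases =
  fixes sc :: "complex \<Rightarrow> 'a::ab_group_add \<Rightarrow> 'a" and br :: "'a \<Rightarrow> 'a \<Rightarrow> 'a" and B :: "'a \<Rightarrow> 'a \<Rightarrow> complex"
    and u ub :: "'a set" and n :: nat and e e' :: "nat \<Rightarrow> 'a"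
  assumes br_add_left: "br (x + y) z = br x z + br y z"
    and br_add_right: "br x (y + z) = br x y + br x z"
    and br_sc_left: "br (sc c x) y = sc c (br x y)"
    and br_sc_right: "br x (sc c y) = sc c (br x y)"
    and br_anti: "br x y = - br y x"
    and br_jacobi: "br x (br y z) = br (br x y) z + br y (br x z)"
    and B_add_left: "B (x + y) z = B x z + B y z"
    and B_sc_left: "B (sc c x) y = c * B x y"
    and B_sym: "B x y = B y x"
    and B_inv: "B (br x y) z = B x (br y z)"
    and br_u: "x \<in> u \<Longrightarrow> y \<in> u \<Longrightarrow> br x y \<in> u"
    and br_ub: "x \<in> ub \<Longrightarrow> y \<in> ub \<Longrightarrow> br x y \<in> ub"
    and ub_minus: "y \<in> ub \<Longrightarrow> - y \<in> ub"
    and e_in: "i < n \<Longrightarrow> e i \<in> u" and e'_in: "i < n \<Longrightarrow> e' i \<in> ub"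
    and B_dual: "i < n \<Longrightarrow> j < n \<Longrightarrow> B (e i) (e' j) = (if i = j then 1 else 0)"
    and u_expand: "x \<in> u \<Longrightarrow> (\<Sum>i<n. sc (B x (e' i)) (e i)) = x"
    and ub_expand: "y \<in> ub \<Longrightarrow> (\<Sum>i<n. sc (B y (e i)) (e' i)) = y"
    and tr_ub: "z \<in> ub \<Longrightarrow> (\<Sum>j<n. B (br z (e' j)) (e j)) = 0"
begin

lemma B_add_right: "B x (y + z) = B x y + B x z" and B_sc_right: "B x (sc c y) = c * B x y"
  by (metis B_add_left B_sym, metis B_sc_left B_sym)

lemma br_minus_right: "br x (- y) = - br x y"
proof -
  have "br x (- y + y + y) = br x (- y) + br x y + br x y" by (simp only: br_add_right)
  then show ?thesis by (simp add: eq_neg_iff_add_eq_0 add.commute)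
qed

lemma B_minus_left: "B (- x) y = - B x y"
proof -
  have "B (- x + x + x) y = B (- x) y + B x y + B x y" by (simp only: B_add_left)
  then show ?thesis by (simp add: eq_neg_iff_add_eq_0 add.commute)
qed

lemma B_minus_right: "B x (- y) = - B x y"
  by (metis B_minus_left B_sym)

lemma B_inv': "B (br X x) y = - B x (br X y)"
  by (metis B_inv B_minus_left br_anti)

lemma B_expand: "x \<in> u \<or> y \<in> ub \<Longrightarrow> (\<Sum>i<n. B x (e' i) * B (e i) y) = B x y"
proof -
  have sumL: "B (\<Sum>i\<in>A. f i) y = (\<Sum>i\<in>A. B (f i) y)" if "finite A" for A :: "nat set" and f y
    using that by (induction A rule: finite_induct) (use B_add_left[of 0 0 y] in \<open>auto simp: B_add_left\<close>)
  assume "x \<in> u \<or> y \<in> ub"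
  then show ?thesis
  proof
    assume "x \<in> u"
    from u_expand[OF this, symmetric] have "B x y = B (\<Sum>i<n. sc (B x (e' i)) (e i)) y" by simp
    also have "\<dots> = (\<Sum>i<n. B x (e' i) * B (e i) y)" by (simp add: sumL B_sc_left)
    finally show ?thesis by simp
  next
    assume "y \<in> ub"
    from ub_expand[OF this, symmetric] have "B y x = B (\<Sum>i<n. sc (B y (e i)) (e' i)) x" by simp
    also have "\<dots> = (\<Sum>i<n. B y (e i) * B (e' i) x)" by (simp add: sumL B_sc_left)
    finally show ?thesis by (simp add: B_sym mult.commute)
  qed
qed

end

text \<open>The operator ring is an algebra through an explicit map \<open>S\<close>, because the
  scalar action on V is an argument and not part of a type class. Centrality of the scalars is
  assumed from \<open>car\<close> on; until then they are kept on the left.\<close>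

locale dual_bases_scalars = dual_bases +
  fixes S :: "complex \<Rightarrow> 'r::{ring,monoid_mult}"
  assumes S_add: "S (a + b) = S a + S b" and S_mult: "S (a * b) = S a * S b" and S_1: "S 1 = 1"
begin

lemma S_0 [simp]: "S 0 = 0"
  using S_add[of 0 0] by simp

lemma S_minus: "S (- a) = - S a"
  using S_add[of a "- a"] by (simp add: add_eq_0_iff)

lemma S_sum: "S (\<Sum>i\<in>A. f i) = (\<Sum>i\<in>A. S (f i))"
  by (induction A rule: infinite_finite_induct) (auto simp: S_add)

lemma S_2: "S 2 * x = x + x"
proof -
  have "S (1 + 1) * x = x + x" by (simp only: S_add S_1 distrib_right mult_1_left)
  then show ?thesis by simp
qed

lemma half_double: "S (1/2) * (x + x) = x"
  by (simp flip: S_2 mult.assoc S_mult add: S_1)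

lemma double_eq_0: "x + x = (0::'r) \<Longrightarrow> x = 0"
  by (metis half_double mult_zero_right)

lemma triple_eq_0: assumes "x + x + x = (0::'r)" shows "x = 0"
proof -
  have "x + x + x = S (1 + 1 + 1) * x" by (simp only: S_add S_1 distrib_right mult_1_left)
  then have "S (1/3) * S 3 * x = 0" using assms by (simp add: mult.assoc)
  then show ?thesis by (simp flip: S_mult add: S_1)
qed

definition bilin :: "('a \<Rightarrow> 'a \<Rightarrow> 'r) \<Rightarrow> bool" where
  "bilin \<Phi> \<longleftrightarrow> (\<forall>x y z. \<Phi> (x + y) z = \<Phi> x z + \<Phi> y z) \<and> (\<forall>x y z. \<Phi> x (y + z) = \<Phi> x y + \<Phi> x z) \<and>
     (\<forall>c x y. \<Phi> (sc c x) y = S c * \<Phi> x y) \<and> (\<forall>c x y. \<Phi> x (sc c y) = S c * \<Phi> x y)"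

definition lin :: "('a \<Rightarrow> 'r) \<Rightarrow> bool" where
  "lin f \<longleftrightarrow> (\<forall>x y. f (x + y) = f x + f y) \<and> (\<forall>c x. f (sc c x) = S c * f x)"

lemma lin_0: assumes "lin f" shows "f 0 = 0"
  using assms[unfolded lin_def] by (metis add.right_neutral add_left_cancel)

lemma lin_sum: assumes "lin f" shows "f (\<Sum>i\<in>A. g i) = (\<Sum>i\<in>A. f (g i))"
  by (induction A rule: infinite_finite_induct)
    (use lin_0[OF assms] assms[unfolded lin_def] in auto)

lemma lin_minus: assumes "lin f" shows "f (- x) = - f x"
  using lin_0[OF assms] assms[unfolded lin_def] by (metis add.right_inverse add_eq_0_iff)

lemma lin_diff: assumes "lin f" shows "f (x - y) = f x - f y"
  using lin_minus[OF assms] assms[unfolded lin_def] by (metis diff_conv_add_uminus)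

lemma lin_expand_u: assumes "lin f" "x \<in> u" shows "(\<Sum>i<n. S (B x (e' i)) * f (e i)) = f x"
proof -
  have "f x = f (\<Sum>i<n. sc (B x (e' i)) (e i))" using u_expand[OF assms(2)] by simp
  then show ?thesis using assms(1) by (simp add: lin_sum lin_def)
qed

lemma lin_expand_ub: assumes "lin f" "x \<in> ub" shows "(\<Sum>i<n. S (B x (e i)) * f (e' i)) = f x"
proof -
  have "f x = f (\<Sum>i<n. sc (B x (e i)) (e' i))" using ub_expand[OF assms(2)] by simp
  then show ?thesis using assms(1) by (simp add: lin_sum lin_def)
qed

lemma bilin_lin: "bilin \<Phi> \<Longrightarrow> lin (\<Phi> x)" "bilin \<Phi> \<Longrightarrow> lin (\<lambda>x. \<Phi> x y)"
  by (auto simp: bilin_def lin_def)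

text \<open>The sum over dual bases is the value of \<Phi> on the canonical tensor of the pairing
  between \<open>ub\<close> and \<open>u\<close>, so an operator on one factor may be replaced by
  its \<open>B\<close>-adjoint on the other. Most invariance statements below are instances.\<close>

lemma transfer:
  assumes \<Phi>: "bilin \<Phi>" and A: "\<And>i. i < n \<Longrightarrow> A (e i) \<in> u" and A': "\<And>i. i < n \<Longrightarrow> A' (e' i) \<in> ub"
    and adj: "\<And>i j. i < n \<Longrightarrow> j < n \<Longrightarrow> B (A (e i)) (e' j) = B (e i) (A' (e' j))"
  shows "(\<Sum>i<n. \<Phi> (e' i) (A (e i))) = (\<Sum>i<n. \<Phi> (A' (e' i)) (e i))"
proof -
  have "(\<Sum>i<n. \<Phi> (e' i) (A (e i))) = (\<Sum>i<n. \<Sum>j<n. S (B (A (e i)) (e' j)) * \<Phi> (e' i) (e j))"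
    by (intro sum.cong refl) (simp add: lin_expand_u[OF bilin_lin(1)[OF \<Phi>]] A)
  also have "\<dots> = (\<Sum>i<n. \<Sum>j<n. S (B (A' (e' j)) (e i)) * \<Phi> (e' i) (e j))"
    by (intro sum.cong refl) (simp add: adj B_sym[of _ "e _"])
  also have "\<dots> = (\<Sum>j<n. \<Sum>i<n. S (B (A' (e' j)) (e i)) * \<Phi> (e' i) (e j))"
    by (rule sum.swap)
  also have "\<dots> = (\<Sum>j<n. \<Phi> (A' (e' j)) (e j))"
    by (intro sum.cong refl) (simp add: lin_expand_ub[OF bilin_lin(2)[OF \<Phi>]] A')
  finally show ?thesis .
qed

text \<open>The canonical tensor does not depend on the basis; the condition on \<open>f'\<close>
  says that it expands each \<open>e' j\<close> as the dual basis of \<open>f\<close> would. It is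
  applied to the images of the dual bases under a conjugation that exchanges \<open>u\<close> and
  \<open>ub\<close>.\<close>

lemma change_basis:
  assumes \<Phi>: "bilin \<Phi>" and f: "\<And>i. i < n \<Longrightarrow> f i \<in> u"
    and f': "\<And>j. j < n \<Longrightarrow> (\<Sum>i<n. sc (B (f i) (e' j)) (f' i)) = e' j"
  shows "(\<Sum>i<n. \<Phi> (f' i) (f i)) = (\<Sum>i<n. \<Phi> (e' i) (e i))"
proof -
  have "(\<Sum>i<n. \<Phi> (f' i) (f i)) = (\<Sum>i<n. \<Sum>j<n. S (B (f i) (e' j)) * \<Phi> (f' i) (e j))"
    by (intro sum.cong refl) (simp add: lin_expand_u[OF bilin_lin(1)[OF \<Phi>]] f)
  also have "\<dots> = (\<Sum>j<n. \<Sum>i<n. S (B (f i) (e' j)) * \<Phi> (f' i) (e j))"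
    by (rule sum.swap)
  also have "\<dots> = (\<Sum>j<n. \<Phi> (\<Sum>i<n. sc (B (f i) (e' j)) (f' i)) (e j))"
    using \<Phi> by (simp add: lin_sum[OF bilin_lin(2)[OF \<Phi>]] bilin_def)
  finally show ?thesis by (simp add: f')
qed

text \<open>Invariance of the canonical tensor: since \<open>B\<close> is invariant, the adjoint of
  ad X is - ad X.\<close>

lemma transfer_br:
  assumes \<Phi>: "bilin \<Phi>" and X: "\<And>x. x \<in> u \<Longrightarrow> br X x \<in> u" "\<And>x. x \<in> ub \<Longrightarrow> br X x \<in> ub"
  shows "(\<Sum>i<n. \<Phi> (e' i) (br X (e i))) = - (\<Sum>i<n. \<Phi> (br X (e' i)) (e i))"
proof -
  have "(\<Sum>i<n. \<Phi> (e' i) (br X (e i))) = (\<Sum>i<n. \<Phi> (- br X (e' i)) (e i))"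
    by (rule transfer[OF \<Phi>]) (auto simp: X e_in e'_in ub_minus B_inv' B_minus_right)
  then show ?thesis by (simp add: lin_minus[OF bilin_lin(2)[OF \<Phi>]] sum_negf)
qed

end

text \<open>The canonical anticommutation relations, with contractions normalized to 1 rather than
  to the 2 of the Clifford relations. In an abstract ring the identities for C become noncommutative
  algebra, free of index sets and of the signs attached to them.\<close>

locale car = dual_bases_scalars sc br B u ub n e e' S
  for sc :: "complex \<Rightarrow> 'a::ab_group_add \<Rightarrow> 'a" and br B u ub n e e' and S :: "complex \<Rightarrow> 'r::{ring,monoid_mult}" +
  fixes E I :: "nat \<Rightarrow> 'r"
  assumes S_comm: "S c * x = x * S c"
    and E_anti: "E i * E j = - (E j * E i)" and I_anti: "I i * I j = - (I j * I i)"
    and IE: "I i * E j = (if i = j then 1 else 0) - E j * I i"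
begin

definition eps :: "'a \<Rightarrow> 'r" where "eps x = (\<Sum>i<n. S (B x (e' i)) * E i)"

definition iota :: "'a \<Rightarrow> 'r" where "iota y = (\<Sum>i<n. S (B y (e i)) * I i)"

lemma lin_eps: "lin eps" and lin_iota: "lin iota"
  by (simp_all add: lin_def eps_def iota_def B_add_left B_sc_left S_add S_mult algebra_simps sum.distrib
      sum_distrib_left)

lemma eps_e [simp]: assumes "i < n" shows "eps (e i) = E i"
proof -
  have "eps (e i) = (\<Sum>j<n. if i = j then E j else 0)"
    unfolding eps_def by (intro sum.cong refl) (use assms in \<open>auto simp: B_dual S_1\<close>)
  then show ?thesis using assms by simp
qed

lemma iota_e' [simp]: assumes "i < n" shows "iota (e' i) = I i"
proof -
  have "iota (e' i) = (\<Sum>j<n. if i = j then I j else 0)"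
    unfolding iota_def by (intro sum.cong refl) (use assms in \<open>auto simp: B_dual S_1 B_sym[of "e' i"]\<close>)
  then show ?thesis using assms by simp
qed

lemma mult_S_left: "x * (S c * y) = S c * (x * y)"
proof -
  have "x * (S c * y) = (x * S c) * y" by (simp only: mult.assoc)
  then show ?thesis by (simp only: S_comm[symmetric] mult.assoc)
qed

lemma scalar_prod: "(S a * x) * (S b * y) = S (a * b) * (x * y)"
proof -
  have "(S a * x) * (S b * y) = S a * (x * S b) * y" by (simp only: mult.assoc)
  also have "\<dots> = S a * (S b * x) * y" by (simp only: S_comm[of b x])
  finally show ?thesis by (simp only: S_mult mult.assoc)
qed

lemma commute_mult: assumes "x * p = p * x" "y * p = p * (y::'r)" shows "(x * y) * p = p * (x * y)"
proof -
  have "(x * y) * p = x * (p * y)" by (simp only: mult.assoc assms)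
  also have "\<dots> = (p * x) * y" by (simp only: mult.assoc flip: assms)
  finally show ?thesis by (simp only: mult.assoc)
qed

lemma eps_anti: "eps x * eps y = - (eps y * eps x)"
proof -
  have "eps x * eps y = (\<Sum>i<n. \<Sum>j<n. S (B x (e' i) * B y (e' j)) * (E i * E j))"
    unfolding eps_def by (simp add: sum_product scalar_prod)
  also have "\<dots> = (\<Sum>i<n. \<Sum>j<n. - (S (B y (e' j) * B x (e' i)) * (E j * E i)))"
    by (intro sum.cong refl) (subst E_anti, simp add: mult.commute)
  also have "\<dots> = - (eps y * eps x)"
    unfolding eps_def by (subst sum.swap) (simp add: sum_product scalar_prod sum_negf)
  finally show ?thesis .
qed

lemma iota_anti: "iota x * iota y = - (iota y * iota x)"
proof -
  have "iota x * iota y = (\<Sum>i<n. \<Sum>j<n. S (B x (e i) * B y (e j)) * (I i * I j))"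
    unfolding iota_def by (simp add: sum_product scalar_prod)
  also have "\<dots> = (\<Sum>i<n. \<Sum>j<n. - (S (B y (e j) * B x (e i)) * (I j * I i)))"
    by (intro sum.cong refl) (subst I_anti, simp add: mult.commute)
  also have "\<dots> = - (iota y * iota x)"
    unfolding iota_def by (subst sum.swap) (simp add: sum_product scalar_prod sum_negf)
  finally show ?thesis .
qed

text \<open>Both operators are defined on the whole Lie algebra through coordinates. Their
  anticommutator is the pairing truncated to these coordinates, which is B(x, y) as soon as one of
  the arguments lies in its subspace. \<open>opL_eps\<close> needs this for brackets that may leave
  \<open>ub\<close>.\<close>

lemma iota_eps: assumes "x \<in> u \<or> y \<in> ub" shows "iota y * eps x = S (B x y) - eps x * iota y"
proof -
  have "iota y * eps x = (\<Sum>i<n. \<Sum>j<n. S (B y (e i) * B x (e' j)) * (I i * E j))"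
    unfolding iota_def eps_def by (simp add: sum_product scalar_prod)
  also have "\<dots> = (\<Sum>i<n. \<Sum>j<n. (if i = j then S (B y (e i) * B x (e' i)) else 0)
       - S (B x (e' j) * B y (e i)) * (E j * I i))"
    by (intro sum.cong refl) (auto simp: IE algebra_simps)
  also have "\<dots> = (\<Sum>i<n. S (B y (e i) * B x (e' i))) - (\<Sum>i<n. \<Sum>j<n. S (B x (e' j) * B y (e i)) * (E j * I i))"
    by (simp add: sum_subtractf)
  also have "(\<Sum>i<n. \<Sum>j<n. S (B x (e' j) * B y (e i)) * (E j * I i)) = eps x * iota y"
    unfolding iota_def eps_def by (subst sum.swap) (simp add: sum_product scalar_prod)
  also have "(\<Sum>i<n. S (B y (e i) * B x (e' i))) = S (B x y)"
    using B_expand[OF assms] by (simp flip: S_sum add: mult.commute B_sym[of y])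
  finally show ?thesis .
qed

lemma iota_E: "j < n \<Longrightarrow> iota y * E j = S (B (e j) y) - E j * iota y"
  using iota_eps[of "e j" y] by (simp add: e_in)

lemma I_eps: "j < n \<Longrightarrow> I j * eps x = S (B x (e' j)) - eps x * I j"
  using iota_eps[of x "e' j"] by (simp add: e'_in)

text \<open>\<open>P\<close> stands for a representation on V tensored with the identity on S, hence
  it commutes with all wedge products and contractions.\<close>

definition rep :: "('a \<Rightarrow> 'r) \<Rightarrow> bool" where
  "rep P \<longleftrightarrow> lin P \<and> (\<forall>x y. P (br x y) = P x * P y - P y * P x) \<and>
     (\<forall>x i. P x * E i = E i * P x) \<and> (\<forall>x i. P x * I i = I i * P x)"

lemma rep_eps: "rep P \<Longrightarrow> P x * eps y = eps y * P x" and rep_iota: "rep P \<Longrightarrow> P x * iota y = iota y * P x"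
  unfolding eps_def iota_def sum_distrib_left sum_distrib_right
  by (intro sum.cong refl commute_mult[symmetric]; simp add: S_comm rep_def)+

abbreviation "cc i j \<equiv> br (e' i) (e' j)"

text \<open>
  With \<open>E i\<close> and \<open>I i\<close> acting as the wedge product by \<open>e i\<close> and the contraction dual to it, the
  Clifford action of \<open>y\<close> in the conjugate of \<open>u\<close> is \<open>2 iota y\<close>; \<open>opC\<close> and \<open>opCm\<close> are then
  \<open>C\<close> and \<open>C\<^sup>-\<close> with all contractions moved to the right, and \<open>opL\<close> is the action on
  cochains, which makes Cartan's formula \<open>opC_iota\<close> hold.
\<close>

definition lin_part :: "('a \<Rightarrow> 'r) \<Rightarrow> 'r" where "lin_part P = (\<Sum>i<n. P (e' i) * E i)"

definition cubic :: 'r where "cubic = (\<Sum>i<n. \<Sum>j<n. E i * E j * iota (cc i j))"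

definition opC :: "('a \<Rightarrow> 'r) \<Rightarrow> 'r" where "opC P = lin_part P - S (1/2) * cubic"

definition lin_part_m :: "('a \<Rightarrow> 'r) \<Rightarrow> 'r" where "lin_part_m P = (\<Sum>i<n. P (e i) * I i)"

definition cubic_m :: 'r where "cubic_m = (\<Sum>i<n. \<Sum>j<n. eps (br (e i) (e j)) * I i * I j)"

definition opCm :: "('a \<Rightarrow> 'r) \<Rightarrow> 'r" where "opCm P = S 2 * lin_part_m P - cubic_m"

definition opL :: "('a \<Rightarrow> 'r) \<Rightarrow> 'a \<Rightarrow> 'r" where
  "opL P X = P X - (\<Sum>j<n. E j * iota (br X (e' j)))"

text \<open>Doubled, so that antisymmetrizing in \<open>i\<close> and \<open>j\<close> needs no
  factor 1/2: the products \<open>E i * E j\<close> are antisymmetric, so only commutators of values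
  of \<open>P\<close> survive, and these are values of \<open>P\<close> on brackets.\<close>

lemma lin_part_sq:
  assumes P: "rep P"
  shows "lin_part P * lin_part P + lin_part P * lin_part P = (\<Sum>i<n. \<Sum>j<n. P (cc i j) * (E i * E j))"
proof -
  have c: "P x * E i = E i * P x" "P (br x y) = P x * P y - P y * P x" for x y i
    using P by (auto simp: rep_def)
  have PEPE: "P x * E i * (P y * E j) = P x * P y * (E i * E j)" for x y i j
  proof -
    have "P x * E i * (P y * E j) = P x * (E i * P y) * E j" by (simp only: mult.assoc)
    then show ?thesis by (simp only: mult.assoc flip: c(1))
  qed
  have 1: "lin_part P * lin_part P = (\<Sum>i<n. \<Sum>j<n. P (e' i) * P (e' j) * (E i * E j))"
    unfolding lin_part_def sum_product PEPE ..
  also have "\<dots> = (\<Sum>i<n. \<Sum>j<n. P (e' j) * P (e' i) * (E j * E i))" by (rule sum.swap)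
  also have "\<dots> = (\<Sum>i<n. \<Sum>j<n. - (P (e' j) * P (e' i) * (E i * E j)))"
    by (intro sum.cong refl, subst E_anti) simp
  finally have 2: "lin_part P * lin_part P = (\<Sum>i<n. \<Sum>j<n. - (P (e' j) * P (e' i) * (E i * E j)))" .
  show ?thesis
    by (subst 1, subst 2) (simp add: c(2) left_diff_distrib sum_subtractf sum_negf)
qed

lemma E_EE: "E k * (E i * E j) = E i * E j * E k"
proof -
  have "E k * (E i * E j) = (E k * E i) * E j" by (simp only: mult.assoc)
  also have "\<dots> = - (E i * (E k * E j))" by (simp add: E_anti[of k i] mult.assoc)
  also have "\<dots> = E i * E j * E k" by (simp add: E_anti[of k j] mult.assoc)
  finally show ?thesis .
qed

lemma EEEE: "E i * E j * (E k * E l) = E k * E l * (E i * E j)"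
proof -
  have "E i * E j * (E k * E l) = E i * (E j * (E k * E l))" by (simp only: mult.assoc)
  also have "\<dots> = (E i * (E k * E l)) * E j" unfolding E_EE[of j] by (simp only: mult.assoc)
  finally show ?thesis unfolding E_EE[of i] by (simp only: mult.assoc)
qed

lemma E_cubic: "k < n \<Longrightarrow> E k * cubic + cubic * E k = (\<Sum>i<n. \<Sum>j<n. E i * E j * S (B (e k) (cc i j)))"
proof -
  assume k: "k < n"
  have "E k * cubic + cubic * E k = (\<Sum>i<n. \<Sum>j<n. E k * (E i * E j) * iota (cc i j) + E i * E j * (iota (cc i j) * E k))"
    unfolding cubic_def by (simp add: sum_distrib_left sum_distrib_right sum.distrib mult.assoc)
  also have "\<dots> = (\<Sum>i<n. \<Sum>j<n. E i * E j * S (B (e k) (cc i j)))"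
    unfolding E_EE iota_E[OF k] by (simp add: algebra_simps)
  finally show ?thesis .
qed

text \<open>The contraction in \<open>cubic\<close> meets the single \<open>E k\<close> of
  \<open>lin_part\<close>; summing the resulting coefficients over \<open>k\<close> reassembles the
  bracket inside \<open>P\<close>. The result is the same double sum as in
  \<open>lin_part_sq\<close>.\<close>

lemma lin_cubic:
  assumes P: "rep P"
  shows "lin_part P * cubic + cubic * lin_part P = (\<Sum>i<n. \<Sum>j<n. P (cc i j) * (E i * E j))"
proof -
  have cE: "E i * P x = P x * E i" and cI: "iota y * P x = P x * iota y" for x i y
    using P rep_iota[OF P] by (auto simp: rep_def)
  have W: "cubic * P x = P x * cubic" for x
    unfolding cubic_def sum_distrib_left sum_distrib_right
    by (intro sum.cong refl commute_mult) (auto simp: cE cI)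
  have "lin_part P * cubic + cubic * lin_part P = (\<Sum>k<n. P (e' k) * (E k * cubic + cubic * E k))"
    unfolding lin_part_def
    by (simp add: sum_distrib_left sum_distrib_right sum.distrib distrib_left mult.assoc)
      (simp flip: mult.assoc add: W)
  also have "\<dots> = (\<Sum>k<n. \<Sum>i<n. \<Sum>j<n. S (B (cc i j) (e k)) * P (e' k) * (E i * E j))"
    by (intro sum.cong refl) (simp add: E_cubic sum_distrib_left S_comm mult.assoc B_sym)
  also have "\<dots> = (\<Sum>i<n. \<Sum>k<n. \<Sum>j<n. S (B (cc i j) (e k)) * P (e' k) * (E i * E j))"
    by (rule sum.swap)
  also have "\<dots> = (\<Sum>i<n. \<Sum>j<n. \<Sum>k<n. S (B (cc i j) (e k)) * P (e' k) * (E i * E j))"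
    by (rule sum.cong[OF refl]) (rule sum.swap)
  also have "\<dots> = (\<Sum>i<n. \<Sum>j<n. P (cc i j) * (E i * E j))"
    by (intro sum.cong refl)
      (use P in \<open>simp flip: sum_distrib_right add: lin_expand_ub rep_def br_ub e'_in\<close>)
  finally show ?thesis .
qed

text \<open>Moving the contraction of the first factor past the wedge products of the second leaves
  two kinds of terms. Those with two contractions cancel in pairs, since pairs of wedge products
  commute while contractions anticommute. Those with one contraction carry a double bracket and
  vanish by the Jacobi identity.\<close>

lemma cubic_sq: "cubic * cubic = 0"
proof -
  have iEE: "iota y * (E k * E l) = E k * E l * iota y + S (B (e k) y) * E l - S (B (e l) y) * E k"
    if "k < n" "l < n" for y k l
  proof -
    have "iota y * (E k * E l) = (S (B (e k) y) - E k * iota y) * E l"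
      by (simp add: iota_E[OF that(1)] flip: mult.assoc)
    also have "\<dots> = S (B (e k) y) * E l - E k * (S (B (e l) y) - E l * iota y)"
      by (simp add: left_diff_distrib mult.assoc iota_E[OF that(2)])
    finally show ?thesis by (simp add: algebra_simps S_comm)
  qed
  let ?Z = "\<Sum>i<n. \<Sum>j<n. \<Sum>l<n. E i * E j * E l * iota (br (cc i j) (e' l))"
  define Q where "Q = (\<Sum>i<n. \<Sum>j<n. \<Sum>k<n. \<Sum>l<n. E i * E j * (E k * E l) * (iota (cc i j) * iota (cc k l)))"
  have lin2: "(\<Sum>k<n. S (B (e k) y) * iota (br (e' k) z)) = iota (br y z)" if "y \<in> ub" for y z
  proof -
    have "lin (\<lambda>w. iota (br w z))"
      using lin_iota by (simp add: lin_def br_add_left br_sc_left)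
    from lin_expand_ub[OF this that] show ?thesis by (simp add: B_sym)
  qed
  have lin3: "(\<Sum>k<n. S (B (e k) y) * iota (br z (e' k))) = iota (br z y)" if "y \<in> ub" for y z
  proof -
    have "lin (\<lambda>w. iota (br z w))"
      using lin_iota by (simp add: lin_def br_add_right br_sc_right)
    from lin_expand_ub[OF this that] show ?thesis by (simp add: B_sym)
  qed
  have contr: "(\<Sum>k<n. \<Sum>l<n. (S (B (e k) y) * E l - S (B (e l) y) * E k) * iota (cc k l))
      = (\<Sum>l<n. E l * iota (br y (e' l))) + (\<Sum>l<n. E l * iota (br y (e' l)))" if y: "y \<in> ub" for y
  proof -
    have "(\<Sum>k<n. \<Sum>l<n. S (B (e k) y) * E l * iota (cc k l)) = (\<Sum>l<n. \<Sum>k<n. S (B (e k) y) * E l * iota (cc k l))"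
      by (rule sum.swap)
    also have "\<dots> = (\<Sum>l<n. E l * iota (br y (e' l)))"
      by (intro sum.cong refl) (simp add: lin2[OF y, symmetric] sum_distrib_left S_comm mult.assoc)
    finally have 1: "(\<Sum>k<n. \<Sum>l<n. S (B (e k) y) * E l * iota (cc k l)) = (\<Sum>l<n. E l * iota (br y (e' l)))" .
    have "(\<Sum>k<n. \<Sum>l<n. S (B (e l) y) * E k * iota (cc k l)) = (\<Sum>k<n. E k * iota (br (e' k) y))"
      by (intro sum.cong refl) (simp add: lin3[OF y, symmetric] sum_distrib_left S_comm mult.assoc)
    also have "\<dots> = - (\<Sum>l<n. E l * iota (br y (e' l)))"
      by (subst br_anti) (simp add: lin_minus[OF lin_iota] sum_negf)
    finally show ?thesis by (simp add: left_diff_distrib sum_subtractf 1)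
  qed
  have "cubic * cubic = (\<Sum>i<n. \<Sum>j<n. E i * E j * (iota (cc i j) * cubic))"
    by (subst (1) cubic_def) (simp add: sum_distrib_right mult.assoc)
  also have "\<dots> = (\<Sum>i<n. \<Sum>j<n. \<Sum>k<n. \<Sum>l<n. E i * E j * (iota (cc i j) * (E k * E l)) * iota (cc k l))"
    unfolding cubic_def by (simp add: sum_distrib_left mult.assoc)
  also have "\<dots> = (\<Sum>i<n. \<Sum>j<n. \<Sum>k<n. \<Sum>l<n. E i * E j * (E k * E l) * (iota (cc i j) * iota (cc k l))
      + E i * E j * ((S (B (e k) (cc i j)) * E l - S (B (e l) (cc i j)) * E k) * iota (cc k l)))"
    by (intro sum.cong refl) (simp add: iEE algebra_simps)
  also have "\<dots> = Q + (\<Sum>i<n. \<Sum>j<n. E i * E j *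
       (\<Sum>k<n. \<Sum>l<n. (S (B (e k) (cc i j)) * E l - S (B (e l) (cc i j)) * E k) * iota (cc k l)))"
    unfolding Q_def by (simp add: sum.distrib sum_distrib_left)
  also have "\<dots> = Q + (?Z + ?Z)"
    by (intro arg_cong2[where f = "(+)"] refl, simp add: contr br_ub e'_in sum_distrib_left distrib_left sum.distrib mult.assoc)
  finally have 1: "cubic * cubic = Q + (?Z + ?Z)" .
  \<comment> \<open>The index pairs (i, j) and (k, l) are exchanged, one interchange of summations
    at a time; this shows Q = - Q.\<close>
  have "Q = (\<Sum>i<n. \<Sum>k<n. \<Sum>j<n. \<Sum>l<n. E i * E j * (E k * E l) * (iota (cc i j) * iota (cc k l)))"
    unfolding Q_def by (rule sum.cong[OF refl], rule sum.swap)
  also have "\<dots> = (\<Sum>k<n. \<Sum>i<n. \<Sum>l<n. \<Sum>j<n. E i * E j * (E k * E l) * (iota (cc i j) * iota (cc k l)))"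
    by (subst sum.swap, rule sum.cong[OF refl], rule sum.cong[OF refl], rule sum.swap)
  also have "\<dots> = (\<Sum>k<n. \<Sum>l<n. \<Sum>i<n. \<Sum>j<n. E i * E j * (E k * E l) * (iota (cc i j) * iota (cc k l)))"
    by (rule sum.cong[OF refl], rule sum.swap)
  also have "\<dots> = (\<Sum>k<n. \<Sum>l<n. \<Sum>i<n. \<Sum>j<n. - (E k * E l * (E i * E j) * (iota (cc k l) * iota (cc i j))))"
    by (intro sum.cong refl, subst iota_anti) (simp add: EEEE)
  also have "\<dots> = - Q" unfolding Q_def by (simp add: sum_negf)
  finally have Q: "Q = 0" using double_eq_0[of Q] by (metis add.right_inverse)
  \<comment> \<open>The product of three wedge operators is invariant under cyclic rotation of its
    indices, so three times the sum is a sum of Jacobi expressions.\<close>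
  define t where "t i j l = E i * E j * E l * iota (br (cc i j) (e' l))" for i j l
  have Z: "?Z = (\<Sum>i<n. \<Sum>j<n. \<Sum>l<n. t i j l)" by (simp add: t_def)
  have r1: "(\<Sum>i<n. \<Sum>j<n. \<Sum>l<n. t i j l) = (\<Sum>i<n. \<Sum>j<n. \<Sum>l<n. t j l i)"
  proof -
    have "(\<Sum>i<n. \<Sum>j<n. \<Sum>l<n. t j l i) = (\<Sum>j<n. \<Sum>i<n. \<Sum>l<n. t j l i)" by (rule sum.swap)
    also have "\<dots> = (\<Sum>j<n. \<Sum>l<n. \<Sum>i<n. t j l i)" by (rule sum.cong[OF refl], rule sum.swap)
    finally show ?thesis by simp
  qed
  have r2: "(\<Sum>i<n. \<Sum>j<n. \<Sum>l<n. t i j l) = (\<Sum>i<n. \<Sum>j<n. \<Sum>l<n. t l i j)"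
  proof -
    have "(\<Sum>i<n. \<Sum>j<n. \<Sum>l<n. t l i j) = (\<Sum>i<n. \<Sum>l<n. \<Sum>j<n. t l i j)" by (rule sum.cong[OF refl], rule sum.swap)
    also have "\<dots> = (\<Sum>l<n. \<Sum>i<n. \<Sum>j<n. t l i j)" by (rule sum.swap)
    finally show ?thesis by simp
  qed
  have "t i j l + t j l i + t l i j = 0" for i j l
  proof -
    have e1: "E j * E l * E i = E i * E j * E l" and e2: "E l * E i * E j = E i * E j * E l"
      using E_EE[of i j l] E_EE[of l i j] by (simp_all add: mult.assoc)
    have "br (cc i j) (e' l) + br (cc j l) (e' i) + br (cc l i) (e' j) = 0"
      using br_jacobi[of "e' i" "e' j" "e' l"] br_anti[of "cc j l" "e' i"] br_anti[of "cc l i" "e' j"]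
        br_minus_right[of "e' j" "cc i l"] br_anti[of "e' l" "e' i"]
      by (simp add: algebra_simps)
    then have "iota (br (cc i j) (e' l)) + iota (br (cc j l) (e' i)) + iota (br (cc l i) (e' j)) = 0"
      using lin_iota lin_0[OF lin_iota] by (metis lin_def)
    then show ?thesis unfolding t_def e1 e2 by (simp flip: distrib_left)
  qed
  then have "(\<Sum>i<n. \<Sum>j<n. \<Sum>l<n. t i j l + t j l i + t l i j) = 0" by simp
  then have "?Z + ?Z + ?Z = 0"
    by (simp only: sum.distrib Z r1[symmetric] r2[symmetric])
  then have "?Z = 0" by (rule triple_eq_0)
  then show ?thesis using 1 Q by simp
qed

text \<open>The factor 1/2 in \<open>opC\<close> is what makes the square of the linear part cancel
  its anticommutator with the cubic part: the former equals the common double sum only after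
  doubling.\<close>

lemma opC_sq: assumes P: "rep P" shows "opC P * opC P = 0"
proof -
  define l where "l = lin_part P"
  define m where "m = S (1/2) * cubic"
  have lc: "l * m + m * l = S (1/2) * (l * cubic + cubic * l)"
    unfolding m_def by (simp only: mult_S_left mult.assoc distrib_left)
  have mm: "m * m = 0" unfolding m_def by (simp add: mult_S_left mult.assoc cubic_sq)
  have "l * l = S (1/2) * (l * l + l * l)" by (rule half_double[symmetric])
  also have "\<dots> = S (1/2) * (l * cubic + cubic * l)"
    unfolding l_def lin_part_sq[OF P] lin_cubic[OF P] ..
  finally have "l * l = l * m + m * l" by (simp only: lc)
  then have "(l - m) * (l - m) = 0" by (simp add: left_diff_distrib right_diff_distrib mm)
  then show ?thesis by (simp add: opC_def l_def m_def)
qed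

end

section \<open>Cartan's formula, the action of the Levi factor, and reordering of the cubic
  terms\<close>

context car
begin

lemma rep_lin: "rep P \<Longrightarrow> lin P" by (simp add: rep_def)

lemma sum_E_iota_cc:
  assumes "y \<in> ub" shows "(\<Sum>k<n. S (B (e k) y) * iota (br (e' k) z)) = iota (br y z)"
    and "(\<Sum>k<n. S (B (e k) y) * iota (br z (e' k))) = iota (br z y)"
proof -
  have "lin (\<lambda>w. iota (br w z))" "lin (\<lambda>w. iota (br z w))"
    using lin_iota by (simp_all add: lin_def br_add_left br_sc_left br_add_right br_sc_right)
  from this[THEN lin_expand_ub, OF assms]
  show "(\<Sum>k<n. S (B (e k) y) * iota (br (e' k) z)) = iota (br y z)"
    and "(\<Sum>k<n. S (B (e k) y) * iota (br z (e' k))) = iota (br z y)"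
    by (simp_all add: B_sym)
qed

lemma iota_EE:
  assumes "k < n" "l < n"
  shows "iota y * (E k * E l) = E k * E l * iota y + S (B (e k) y) * E l - S (B (e l) y) * E k"
proof -
  have "iota y * (E k * E l) = (S (B (e k) y) - E k * iota y) * E l"
    by (simp add: iota_E[OF assms(1)] flip: mult.assoc)
  also have "\<dots> = S (B (e k) y) * E l - E k * (S (B (e l) y) - E l * iota y)"
    by (simp add: left_diff_distrib mult.assoc iota_E[OF assms(2)])
  finally show ?thesis by (simp add: algebra_simps S_comm)
qed

lemma cubic_iota:
  assumes y: "y \<in> ub"
  shows "cubic * iota y + iota y * cubic = (\<Sum>j<n. E j * iota (br y (e' j))) + (\<Sum>j<n. E j * iota (br y (e' j)))"
proof -
  have "cubic * iota y + iota y * cubic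
    = (\<Sum>k<n. \<Sum>l<n. E k * E l * (iota (cc k l) * iota y) + iota y * (E k * E l) * iota (cc k l))"
    unfolding cubic_def by (simp add: sum_distrib_left sum_distrib_right sum.distrib mult.assoc)
  also have "\<dots> = (\<Sum>k<n. \<Sum>l<n. (S (B (e k) y) * E l - S (B (e l) y) * E k) * iota (cc k l))"
    by (intro sum.cong refl, subst iota_anti) (simp add: iota_EE algebra_simps)
  also have "\<dots> = (\<Sum>k<n. \<Sum>l<n. S (B (e k) y) * E l * iota (cc k l)) - (\<Sum>k<n. \<Sum>l<n. S (B (e l) y) * E k * iota (cc k l))"
    by (simp add: left_diff_distrib sum_subtractf)
  also have "(\<Sum>k<n. \<Sum>l<n. S (B (e k) y) * E l * iota (cc k l)) = (\<Sum>l<n. E l * iota (br y (e' l)))"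
    by (subst sum.swap, intro sum.cong refl)
      (simp add: sum_E_iota_cc(1)[OF y, symmetric] sum_distrib_left mult_S_left mult.assoc)
  also have "(\<Sum>k<n. \<Sum>l<n. S (B (e l) y) * E k * iota (cc k l)) = (\<Sum>k<n. E k * iota (br (e' k) y))"
    by (intro sum.cong refl) (simp add: sum_E_iota_cc(2)[OF y, symmetric] sum_distrib_left mult_S_left mult.assoc)
  also have "\<dots> = - (\<Sum>l<n. E l * iota (br y (e' l)))"
    by (subst br_anti) (simp add: lin_minus[OF lin_iota] sum_negf)
  finally show ?thesis by simp
qed

lemma lin_part_iota:
  assumes P: "rep P" and y: "y \<in> ub"
  shows "lin_part P * iota y + iota y * lin_part P = P y"
proof -
  have PI: "iota y * (P x * E i) = P x * (iota y * E i)" for x i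
    by (simp only: mult.assoc[symmetric] rep_iota[OF P])
  have "lin_part P * iota y + iota y * lin_part P = (\<Sum>i<n. P (e' i) * (E i * iota y + iota y * E i))"
    unfolding lin_part_def sum_distrib_left sum_distrib_right distrib_left PI by (simp add: sum.distrib mult.assoc)
  also have "\<dots> = (\<Sum>i<n. S (B y (e i)) * P (e' i))"
    by (intro sum.cong refl) (simp add: iota_E B_sym S_comm)
  finally show ?thesis using lin_expand_ub[OF rep_lin[OF P] y] by simp
qed

text \<open>This determines \<open>opC\<close> recursively through contractions, which is how
  \<open>ev_opC\<close> identifies it with the cochain differential.\<close>

lemma opC_iota:
  assumes P: "rep P" and y: "y \<in> ub"
  shows "opC P * iota y + iota y * opC P = opL P y"
proof -
  have "opC P * iota y + iota y * opC P
      = (lin_part P * iota y + iota y * lin_part P) - S (1/2) * (cubic * iota y + iota y * cubic)"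
    by (simp add: opC_def left_diff_distrib right_diff_distrib distrib_left mult.assoc mult_S_left)
  then show ?thesis unfolding lin_part_iota[OF P y] cubic_iota[OF y] half_double opL_def .
qed

lemma opL_iota:
  assumes P: "rep P" and z: "z \<in> ub"
  shows "opL P X * iota z = iota z * opL P X + iota (br X z)"
proof -
  have s: "E j * iota (br X (e' j)) * iota z = iota z * (E j * iota (br X (e' j))) - S (B (e j) z) * iota (br X (e' j))"
    if "j < n" for j
  proof -
    have "iota z * (E j * iota (br X (e' j))) = (S (B (e j) z) - E j * iota z) * iota (br X (e' j))"
      by (simp add: iota_E[OF that] flip: mult.assoc)
    also have "\<dots> = S (B (e j) z) * iota (br X (e' j)) + E j * (iota (br X (e' j)) * iota z)"
      by (simp add: left_diff_distrib mult.assoc iota_anti[of "br X (e' j)" z])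
    finally show ?thesis by (simp add: mult.assoc)
  qed
  have "(\<Sum>j<n. E j * iota (br X (e' j))) * iota z
     = iota z * (\<Sum>j<n. E j * iota (br X (e' j))) - (\<Sum>j<n. S (B (e j) z) * iota (br X (e' j)))"
    unfolding sum_distrib_left sum_distrib_right by (simp add: s sum_subtractf)
  then show ?thesis
    unfolding opL_def by (simp add: left_diff_distrib right_diff_distrib rep_iota[OF P] sum_E_iota_cc(2)[OF z])
qed

text \<open>There is no condition on \<open>X\<close>: \<open>eps\<close> depends on its argument
  only through the pairings with the \<open>e'\<close>, and invariance of \<open>B\<close> moves ad
  X across these pairings.\<close>

lemma opL_eps:
  assumes P: "rep P" and x: "x \<in> u"
  shows "opL P X * eps x = eps x * opL P X + eps (br X x)"
proof -
  have s: "E j * iota (br X (e' j)) * eps x = eps x * (E j * iota (br X (e' j))) - S (B (br X x) (e' j)) * E j"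
    if "j < n" for j
  proof -
    have "E j * iota (br X (e' j)) * eps x = E j * (S (B x (br X (e' j))) - eps x * iota (br X (e' j)))"
      using iota_eps[of x "br X (e' j)"] x by (simp add: mult.assoc)
    also have "\<dots> = - (S (B (br X x) (e' j)) * E j) - E j * eps x * iota (br X (e' j))"
      by (simp add: right_diff_distrib mult.assoc S_minus flip: S_comm B_inv') (simp add: B_inv' S_minus)
    also have "E j * eps x = - (eps x * E j)"
      using eps_anti[of "e j" x] that by simp
    finally show ?thesis by (simp add: mult.assoc)
  qed
  have "(\<Sum>j<n. E j * iota (br X (e' j))) * eps x
     = eps x * (\<Sum>j<n. E j * iota (br X (e' j))) - eps (br X x)"
    unfolding sum_distrib_left sum_distrib_right eps_def[of "br X x"] by (simp add: s sum_subtractf)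
  then show ?thesis
    unfolding opL_def by (simp add: left_diff_distrib right_diff_distrib rep_eps[OF P])
qed

lemma opL_P:
  assumes P: "rep P"
  shows "opL P X * P Y = P Y * opL P X + P (br X Y)"
proof -
  have "E j * iota (br X (e' j)) * P Y = P Y * (E j * iota (br X (e' j)))" for j
    by (rule commute_mult) (use P in \<open>simp_all add: rep_def rep_iota\<close>)
  then have "(\<Sum>j<n. E j * iota (br X (e' j))) * P Y = P Y * (\<Sum>j<n. E j * iota (br X (e' j)))"
    unfolding sum_distrib_left sum_distrib_right by simp
  then show ?thesis
    using P by (simp add: opL_def left_diff_distrib right_diff_distrib rep_def)
qed

text \<open>Commutation with \<open>d\<close> up to a correction is treated as a derivation, so that
  the corrections of nested sums and products can be collected by rules. Invariance then means that
  the total correction is 0.\<close>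

lemma derivation_mult:
  assumes "(d::'r) * x = x * d + dx" "d * y = y * d + dy"
  shows "d * (x * y) = x * y * d + (dx * y + x * dy)"
proof -
  have "d * (x * y) = d * x * y" by (simp only: mult.assoc)
  also have "\<dots> = x * (d * y) + dx * y" unfolding assms(1) distrib_right by (simp only: mult.assoc)
  finally show ?thesis unfolding assms(2) distrib_left by (simp add: mult.assoc add.assoc add.commute)
qed

lemma derivation_sum:
  assumes "\<And>i. i \<in> A \<Longrightarrow> (d::'r) * f i = f i * d + df i"
  shows "d * (\<Sum>i\<in>A. f i) = (\<Sum>i\<in>A. f i) * d + (\<Sum>i\<in>A. df i)"
  using assms by (simp add: sum_distrib_left sum_distrib_right sum.distrib)

text \<open>\<open>X\<close> normalizes both \<open>u\<close> and \<open>ub\<close>, as the elements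
  of \<open>l\<close> do. The operators below are built from canonical tensors, so
  \<open>transfer_br\<close> cancels the corrections.\<close>

context
  fixes X P
  assumes P: "rep P" and X: "\<And>x. x \<in> u \<Longrightarrow> br X x \<in> u" "\<And>x. x \<in> ub \<Longrightarrow> br X x \<in> ub"
begin

private lemma L_e: "i < n \<Longrightarrow> opL P X * E i = E i * opL P X + eps (br X (e i))"
  using opL_eps[OF P e_in[of i]] by simp

private lemma L_e': "i < n \<Longrightarrow> opL P X * I i = I i * opL P X + iota (br X (e' i))"
  using opL_iota[OF P e'_in[of i]] by simp

lemma opL_lin_part: "opL P X * lin_part P = lin_part P * opL P X"
proof -
  have b: "bilin (\<lambda>y x. P y * eps x)"
    using rep_lin[OF P] lin_eps by (simp add: bilin_def lin_def algebra_simps mult_S_left)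
  have "opL P X * lin_part P = lin_part P * opL P X + (\<Sum>i<n. P (br X (e' i)) * E i + P (e' i) * eps (br X (e i)))"
    unfolding lin_part_def by (intro derivation_sum derivation_mult opL_P[OF P] L_e) simp
  also have "(\<Sum>i<n. P (br X (e' i)) * E i + P (e' i) * eps (br X (e i))) = 0"
    using transfer_br[OF b X] by (simp add: sum.distrib)
  finally show ?thesis by simp
qed

lemma opL_lin_part_m: "opL P X * lin_part_m P = lin_part_m P * opL P X"
proof -
  have b: "bilin (\<lambda>y x. P x * iota y)"
    using rep_lin[OF P] lin_iota by (simp add: bilin_def lin_def algebra_simps mult_S_left)
  have "opL P X * lin_part_m P = lin_part_m P * opL P X + (\<Sum>i<n. P (br X (e i)) * I i + P (e i) * iota (br X (e' i)))"
    unfolding lin_part_m_def by (intro derivation_sum derivation_mult opL_P[OF P] L_e') simp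
  also have "(\<Sum>i<n. P (br X (e i)) * I i + P (e i) * iota (br X (e' i))) = 0"
    using transfer_br[OF b X] by (simp add: sum.distrib)
  finally show ?thesis by simp
qed

text \<open>Invariance is applied once for each of the two wedge indices; the Jacobi identity splits
  the correction coming from the bracket into the two terms that match.\<close>

lemma opL_cubic: "opL P X * cubic = cubic * opL P X"
proof -
  let ?t = "\<lambda>i j. (eps (br X (e i)) * E j + E i * eps (br X (e j))) * iota (cc i j) + E i * E j * iota (br X (cc i j))"
  have "opL P X * cubic = cubic * opL P X + (\<Sum>i<n. \<Sum>j<n. ?t i j)"
    unfolding cubic_def
    by (intro derivation_sum derivation_mult opL_iota[OF P] L_e) (auto intro: br_ub e'_in)
  also have "(\<Sum>i<n. \<Sum>j<n. ?t i j)
     = (\<Sum>i<n. \<Sum>j<n. eps (br X (e i)) * (E j * iota (cc i j))) + (\<Sum>i<n. E i * (\<Sum>j<n. eps (br X (e j)) * iota (cc i j)))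
       + (\<Sum>i<n. \<Sum>j<n. E i * E j * iota (br X (cc i j)))"
    by (simp add: distrib_right sum.distrib sum_distrib_left mult.assoc)
  also have "(\<Sum>i<n. \<Sum>j<n. eps (br X (e i)) * (E j * iota (cc i j)))
     = - (\<Sum>i<n. \<Sum>j<n. E i * (E j * iota (br (br X (e' i)) (e' j))))"
  proof -
    have b: "bilin (\<lambda>y x. eps x * (\<Sum>j<n. E j * iota (br y (e' j))))"
      using lin_eps lin_iota by (simp add: bilin_def lin_def distrib_left distrib_right mult_S_left mult.assoc br_add_left br_sc_left sum.distrib sum_distrib_left)
    from transfer_br[OF b X] show ?thesis by (simp add: sum_distrib_left)
  qed
  also have "(\<Sum>i<n. E i * (\<Sum>j<n. eps (br X (e j)) * iota (cc i j)))
     = - (\<Sum>i<n. \<Sum>j<n. E i * (E j * iota (br (e' i) (br X (e' j)))))"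
  proof -
    have "(\<Sum>j<n. eps (br X (e j)) * iota (cc i j)) = - (\<Sum>j<n. E j * iota (br (e' i) (br X (e' j))))" for i
    proof -
      have b: "bilin (\<lambda>y x. eps x * iota (br (e' i) y))"
        using lin_eps lin_iota by (simp add: bilin_def lin_def distrib_left distrib_right mult_S_left mult.assoc br_add_right br_sc_right)
      from transfer_br[OF b X] show ?thesis by simp
    qed
    then show ?thesis by (simp add: sum_distrib_left sum_negf)
  qed
  also have "(\<Sum>i<n. \<Sum>j<n. E i * E j * iota (br X (cc i j)))
     = (\<Sum>i<n. \<Sum>j<n. E i * (E j * iota (br (br X (e' i)) (e' j)))) + (\<Sum>i<n. \<Sum>j<n. E i * (E j * iota (br (e' i) (br X (e' j)))))"
    using lin_iota by (simp add: br_jacobi[of X] lin_def distrib_left sum.distrib mult.assoc)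
  finally show ?thesis by simp
qed

lemma opL_cubic_m: "opL P X * cubic_m = cubic_m * opL P X"
proof -
  let ?b = "\<lambda>i j. br (e i) (e j)"
  let ?t = "\<lambda>i j. (eps (br X (?b i j)) * I i + eps (?b i j) * iota (br X (e' i))) * I j + eps (?b i j) * I i * iota (br X (e' j))"
  have "opL P X * cubic_m = cubic_m * opL P X + (\<Sum>i<n. \<Sum>j<n. ?t i j)"
    unfolding cubic_m_def
    by (intro derivation_sum derivation_mult opL_eps[OF P] L_e') (auto intro: br_u e_in)
  also have "(\<Sum>i<n. \<Sum>j<n. ?t i j)
     = (\<Sum>i<n. \<Sum>j<n. eps (br X (?b i j)) * (I i * I j)) + (\<Sum>i<n. \<Sum>j<n. eps (?b i j) * (iota (br X (e' i)) * I j))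
       + (\<Sum>i<n. \<Sum>j<n. eps (?b i j) * (I i * iota (br X (e' j))))"
    by (simp add: distrib_right sum.distrib sum_distrib_left mult.assoc)
  also have "(\<Sum>i<n. \<Sum>j<n. eps (?b i j) * (iota (br X (e' i)) * I j))
     = - (\<Sum>i<n. \<Sum>j<n. eps (br (br X (e i)) (e j)) * (I i * I j))"
  proof -
    have b: "bilin (\<lambda>y x. \<Sum>j<n. eps (br x (e j)) * (iota y * I j))"
      using lin_eps lin_iota by (simp add: bilin_def lin_def distrib_left distrib_right mult_S_left mult.assoc br_add_left br_sc_left sum.distrib sum_distrib_left)
    from transfer_br[OF b X] show ?thesis by simp
  qed
  also have "(\<Sum>i<n. \<Sum>j<n. eps (?b i j) * (I i * iota (br X (e' j))))
     = - (\<Sum>i<n. \<Sum>j<n. eps (br (e i) (br X (e j))) * (I i * I j))"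
  proof -
    have "(\<Sum>j<n. eps (?b i j) * (I i * iota (br X (e' j)))) = - (\<Sum>j<n. eps (br (e i) (br X (e j))) * (I i * I j))" for i
    proof -
      have b: "bilin (\<lambda>y x. eps (br (e i) x) * (I i * iota y))"
        using lin_eps lin_iota by (simp add: bilin_def lin_def distrib_left distrib_right mult_S_left mult.assoc br_add_right br_sc_right)
      from transfer_br[OF b X] show ?thesis by simp
    qed
    then show ?thesis by (simp add: sum_negf)
  qed
  also have "(\<Sum>i<n. \<Sum>j<n. eps (br X (?b i j)) * (I i * I j))
     = (\<Sum>i<n. \<Sum>j<n. eps (br (br X (e i)) (e j)) * (I i * I j)) + (\<Sum>i<n. \<Sum>j<n. eps (br (e i) (br X (e j))) * (I i * I j))"
    using lin_eps by (simp add: br_jacobi[of X] lin_def distrib_right sum.distrib)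
  finally show ?thesis by simp
qed

lemma opL_opC: "opL P X * opC P = opC P * opL P X"
  by (simp add: opC_def left_diff_distrib right_diff_distrib opL_lin_part mult_S_left opL_cubic mult.assoc)

lemma opL_opCm: "opL P X * opCm P = opCm P * opL P X"
  by (simp add: opCm_def left_diff_distrib right_diff_distrib opL_lin_part_m mult_S_left opL_cubic_m mult.assoc)

text \<open>The action written through ad X on \<open>ub\<close>, as on cochains, equals the one
  written through ad X on the wedge factors in \<open>u\<close>, as on chains. One operator
  therefore serves cohomology and homology.\<close>

lemma opL_eq: "opL P X = P X + (\<Sum>j<n. eps (br X (e j)) * I j)"
proof -
  have b: "bilin (\<lambda>y x. eps x * iota y)"
    using lin_eps lin_iota by (simp add: bilin_def lin_def distrib_left distrib_right mult_S_left mult.assoc)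
  from transfer_br[OF b X] show ?thesis by (simp add: opL_def)
qed

text \<open>Both halves of the spin sum contribute the same operator, apart from the constant left
  by moving \<open>E i\<close> to the left of a contraction. That constant, half the trace of ad X
  on \<open>ub\<close>, is the modular twist.\<close>

lemma spin_opL:
  "P X + S (1/4) * (\<Sum>i<n. eps (br X (e i)) * (S 2 * I i) + S 2 * iota (br X (e' i)) * E i)
   = opL P X + S ((\<Sum>i<n. B (br X (e' i)) (e i)) / 2)"
proof -
  let ?Q = "\<Sum>j<n. E j * iota (br X (e' j))"
  have "(\<Sum>i<n. eps (br X (e i)) * (S 2 * I i) + S 2 * iota (br X (e' i)) * E i)
     = S 2 * ((\<Sum>j<n. eps (br X (e j)) * I j) + (\<Sum>i<n. S (B (br X (e' i)) (e i))) - ?Q)"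
    by (simp add: mult_S_left mult.assoc iota_E sum.distrib sum_distrib_left sum_subtractf right_diff_distrib distrib_left B_sym)
  also have "(\<Sum>j<n. eps (br X (e j)) * I j) = - ?Q"
    using opL_eq by (simp add: opL_def)
  finally have "S (1/4) * (\<Sum>i<n. eps (br X (e i)) * (S 2 * I i) + S 2 * iota (br X (e' i)) * E i)
     = S (1/2) * (S (\<Sum>i<n. B (br X (e' i)) (e i)) - (?Q + ?Q))"
    by (simp flip: mult.assoc S_mult add: S_sum diff_diff_eq)
  also have "\<dots> = S ((\<Sum>i<n. B (br X (e' i)) (e i)) / 2) - ?Q"
    unfolding right_diff_distrib half_double by (simp flip: S_mult)
  finally show ?thesis by (simp add: opL_def)
qed

end

text \<open>In the definition of C the contraction stands to the left of both wedge products. Moving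
  it to the right produces traces of ad z on \<open>ub\<close> with z in \<open>ub\<close>, which
  vanish by \<open>tr_ub\<close>.\<close>

lemma cubic_reorder: "(\<Sum>i<n. \<Sum>j<n. iota (cc i j) * (E i * E j)) = cubic"
proof -
  have "(\<Sum>i<n. \<Sum>j<n. iota (cc i j) * (E i * E j))
    = cubic + ((\<Sum>i<n. \<Sum>j<n. S (B (e i) (cc i j)) * E j) - (\<Sum>i<n. \<Sum>j<n. S (B (e j) (cc i j)) * E i))"
    unfolding cubic_def by (simp add: iota_EE sum.distrib sum_subtractf)
  also have "(\<Sum>i<n. \<Sum>j<n. S (B (e j) (cc i j)) * E i) = 0"
    using tr_ub[OF e'_in] by (simp flip: sum_distrib_right S_sum add: B_sym[of "e _"])
  also have "(\<Sum>i<n. \<Sum>j<n. S (B (e i) (cc i j)) * E j) = 0"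
  proof -
    have "(\<Sum>i<n. B (e i) (cc i j)) = 0" if "j < n" for j
      using tr_ub[OF e'_in[OF that]] by (subst br_anti) (simp add: B_minus_right sum_negf B_sym[of "e _"])
    then show ?thesis by (subst sum.swap) (simp flip: sum_distrib_right S_sum)
  qed
  finally show ?thesis by simp
qed

lemma II_eps: "i < n \<Longrightarrow> j < n \<Longrightarrow>
  I i * I j * eps y = S (B y (e' j)) * I i - S (B y (e' i)) * I j + eps y * (I i * I j)"
proof -
  assume ij: "i < n" "j < n"
  have "I i * I j * eps y = I i * (S (B y (e' j)) - eps y * I j)"
    by (simp add: mult.assoc I_eps[OF ij(2)])
  also have "\<dots> = S (B y (e' j)) * I i - (S (B y (e' i)) - eps y * I i) * I j"
    by (simp add: right_diff_distrib flip: mult.assoc I_eps[OF ij(1)] S_comm)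
  finally show ?thesis by (simp add: algebra_simps)
qed

text \<open>The counterpart of \<open>cubic_iota\<close> with wedge products and contractions
  exchanged. It feeds both the cross relation \<open>Cp_Ckm\<close> and the recursion for the
  homology boundary.\<close>

lemma cubic_m_eps:
  assumes y: "y \<in> u"
  shows "cubic_m * eps y + eps y * cubic_m
    = - ((\<Sum>j<n. eps (br y (e j)) * I j) + (\<Sum>j<n. eps (br y (e j)) * I j))"
proof -
  have e1: "(\<Sum>i<n. S (B y (e' i)) * eps (br (e i) z)) = eps (br y z)" for z
    by (rule lin_expand_u[OF _ y]) (use lin_eps in \<open>simp add: lin_def br_add_left br_sc_left\<close>)
  have e2: "(\<Sum>i<n. S (B y (e' i)) * eps (br z (e i))) = eps (br z y)" for z
    by (rule lin_expand_u[OF _ y]) (use lin_eps in \<open>simp add: lin_def br_add_right br_sc_right\<close>)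
  let ?b = "\<lambda>i j. br (e i) (e j)"
  have "cubic_m * eps y + eps y * cubic_m
    = (\<Sum>i<n. \<Sum>j<n. eps (?b i j) * (I i * I j * eps y) + eps y * eps (?b i j) * (I i * I j))"
    unfolding cubic_m_def by (simp add: sum_distrib_left sum_distrib_right sum.distrib mult.assoc)
  also have "\<dots> = (\<Sum>i<n. \<Sum>j<n. eps (?b i j) * (S (B y (e' j)) * I i) - eps (?b i j) * (S (B y (e' i)) * I j))"
  proof (intro sum.cong refl)
    fix i j assume "i \<in> {..<n}" "j \<in> {..<n}"
    then have "eps (?b i j) * (I i * I j * eps y) + eps y * eps (?b i j) * (I i * I j)
      = eps (?b i j) * (S (B y (e' j)) * I i) - eps (?b i j) * (S (B y (e' i)) * I j)
        + (eps (?b i j) * eps y + eps y * eps (?b i j)) * (I i * I j)"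
      by (simp add: II_eps[unfolded mult.assoc] distrib_left right_diff_distrib distrib_right mult.assoc)
    also have "eps (?b i j) * eps y + eps y * eps (?b i j) = 0"
      by (subst eps_anti) simp
    finally show "eps (?b i j) * (I i * I j * eps y) + eps y * eps (?b i j) * (I i * I j)
      = eps (?b i j) * (S (B y (e' j)) * I i) - eps (?b i j) * (S (B y (e' i)) * I j)" by simp
  qed
  also have "\<dots> = (\<Sum>i<n. (\<Sum>j<n. S (B y (e' j)) * eps (?b i j)) * I i) - (\<Sum>j<n. (\<Sum>i<n. S (B y (e' i)) * eps (?b i j)) * I j)"
    unfolding sum_subtractf by (subst (2) sum.swap) (simp add: mult_S_left sum_distrib_right mult.assoc)
  also have "\<dots> = (\<Sum>i<n. eps (br (e i) y) * I i) - (\<Sum>j<n. eps (br y (e j)) * I j)"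
    by (simp add: e1 e2)
  also have "(\<Sum>i<n. eps (br (e i) y) * I i) = - (\<Sum>j<n. eps (br y (e j)) * I j)"
    by (subst br_anti) (simp add: lin_minus[OF lin_eps] sum_negf)
  finally show ?thesis by simp
qed

lemma lin_part_m_eps:
  assumes P: "rep P" and y: "y \<in> u"
  shows "lin_part_m P * eps y + eps y * lin_part_m P = P y"
proof -
  have PI: "eps y * (P x * I i) = P x * (eps y * I i)" for x i
    by (simp only: mult.assoc[symmetric] rep_eps[OF P])
  have "lin_part_m P * eps y + eps y * lin_part_m P = (\<Sum>i<n. P (e i) * (I i * eps y + eps y * I i))"
    unfolding lin_part_m_def sum_distrib_left sum_distrib_right distrib_left PI by (simp add: sum.distrib mult.assoc)
  also have "\<dots> = (\<Sum>i<n. S (B y (e' i)) * P (e i))"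
    by (intro sum.cong refl) (simp add: I_eps S_comm)
  finally show ?thesis using lin_expand_u[OF rep_lin[OF P] y] by simp
qed

end

text \<open>\<open>pp\<close> is the projection to p along k, so that x - pp x lies in k. The
  assumptions on brackets are what is used of the Hermitian structure: the projections of
  \<open>u\<close> commute with each other, likewise those of \<open>ub\<close>, and both sets of
  projections are stable enough under k-components of \<open>u\<close> to stay in \<open>u\<close>
  and \<open>ub\<close>.\<close>

locale car_theta = car sc br B u ub n e e' S E I
  for sc :: "complex \<Rightarrow> 'a::ab_group_add \<Rightarrow> 'a" and br B u ub n e e' and S :: "complex \<Rightarrow> 'r::{ring,monoid_mult}" and E I +
  fixes pp :: "'a \<Rightarrow> 'a"
  assumes pp_add: "pp (x + y) = pp x + pp y" and pp_sc: "pp (sc c x) = sc c (pp x)"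
    and pp_pp [simp]: "pp (pp x) = pp x"
    and B_pp: "B (pp x) y = B x (pp y)"
    and pp_u: "x \<in> u \<Longrightarrow> pp x \<in> u" and pp_ub: "y \<in> ub \<Longrightarrow> pp y \<in> ub"
    and br_pp_u: "x \<in> u \<Longrightarrow> y \<in> u \<Longrightarrow> br (pp x) (pp y) = 0"
    and br_pp_ub: "x \<in> ub \<Longrightarrow> y \<in> ub \<Longrightarrow> br (pp x) (pp y) = 0"
    and br_kp: "pp (br (x - pp x) y) = br (x - pp x) (pp y)"
    and br_kp_u: "x \<in> u \<Longrightarrow> y \<in> u \<Longrightarrow> br (x - pp x) (pp y) \<in> u"
    and br_kp_ub: "x \<in> u \<Longrightarrow> y \<in> ub \<Longrightarrow> br (x - pp x) (pp y) \<in> ub"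
begin

definition kp :: "'a \<Rightarrow> 'a" where "kp x = x - pp x"

lemma br_diff_right: "br z (x - y) = br z x - br z y"
  using br_add_right[of z x "- y"] by (simp add: br_minus_right)

definition Cp :: "('a \<Rightarrow> 'r) \<Rightarrow> 'r" where "Cp P = lin_part (\<lambda>x. P (pp x))"

definition Cpm :: "('a \<Rightarrow> 'r) \<Rightarrow> 'r" where "Cpm P = S 2 * lin_part_m (\<lambda>x. P (pp x))"

definition Ck :: "('a \<Rightarrow> 'r) \<Rightarrow> 'r" where "Ck P = opC P - Cp P"

definition Ckm :: "('a \<Rightarrow> 'r) \<Rightarrow> 'r" where "Ckm P = opCm P - Cpm P"

text \<open>The values of \<open>P\<close> on the projections of \<open>ub\<close> commute while the
  wedge products anticommute.\<close>

lemma Cp_sq: assumes P: "rep P" shows "Cp P * Cp P = 0"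
proof -
  let ?p = "\<lambda>i. P (pp (e' i))"
  have PEPE: "?p i * E i * (?p j * E j) = ?p i * ?p j * (E i * E j)" for i j
  proof -
    have "?p i * E i * (?p j * E j) = ?p i * (E i * ?p j) * E j" by (simp only: mult.assoc)
    also have "E i * ?p j = ?p j * E i" using P by (simp add: rep_def)
    finally show ?thesis by (simp only: mult.assoc)
  qed
  have comm: "?p i * ?p j = ?p j * ?p i" if "i < n" "j < n" for i j
    using P that br_pp_ub[OF e'_in e'_in, of i j] lin_0[OF rep_lin[OF P]] by (simp add: rep_def) (metis eq_iff_diff_eq_0)
  have 1: "Cp P * Cp P = (\<Sum>i<n. \<Sum>j<n. ?p i * ?p j * (E i * E j))"
    unfolding Cp_def lin_part_def sum_product PEPE ..
  also have "\<dots> = (\<Sum>i<n. \<Sum>j<n. ?p j * ?p i * (E j * E i))" by (rule sum.swap)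
  also have "\<dots> = (\<Sum>i<n. \<Sum>j<n. - (?p i * ?p j * (E i * E j)))"
    by (intro sum.cong refl, subst E_anti) (simp add: comm)
  also have "\<dots> = - (Cp P * Cp P)" by (simp add: sum_negf 1)
  finally show ?thesis using double_eq_0[of "Cp P * Cp P"] by (metis add.right_inverse)
qed

text \<open>Kept general in \<open>f\<close> and \<open>g\<close> because it is applied to p against
  p and to p against k. The last sum is the contribution of the delta in \<open>IE\<close>.\<close>

lemma lin_parts:
  assumes P: "rep P"
  shows "lin_part (\<lambda>x. P (f x)) * lin_part_m (\<lambda>x. P (g x)) + lin_part_m (\<lambda>x. P (g x)) * lin_part (\<lambda>x. P (f x))
    = (\<Sum>i<n. \<Sum>j<n. P (br (f (e' i)) (g (e j))) * (E i * I j)) + (\<Sum>i<n. P (g (e i)) * P (f (e' i)))"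
proof -
  let ?f = "\<lambda>i. P (f (e' i))" and ?g = "\<lambda>j. P (g (e j))"
  have "lin_part (\<lambda>x. P (f x)) * lin_part_m (\<lambda>x. P (g x)) = (\<Sum>i<n. \<Sum>j<n. ?f i * ?g j * (E i * I j))"
  proof -
    have "?f i * E i * (?g j * I j) = ?f i * ?g j * (E i * I j)" for i j
    proof -
      have "?f i * E i * (?g j * I j) = ?f i * (E i * ?g j) * I j" by (simp only: mult.assoc)
      also have "E i * ?g j = ?g j * E i" using P by (simp add: rep_def)
      finally show ?thesis by (simp only: mult.assoc)
    qed
    then show ?thesis unfolding lin_part_def lin_part_m_def sum_product by simp
  qed
  moreover have "lin_part_m (\<lambda>x. P (g x)) * lin_part (\<lambda>x. P (f x)) = (\<Sum>i<n. \<Sum>j<n. ?g j * ?f i * (I j * E i))"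
  proof -
    have "?g j * I j * (?f i * E i) = ?g j * ?f i * (I j * E i)" for i j
    proof -
      have "?g j * I j * (?f i * E i) = ?g j * (I j * ?f i) * E i" by (simp only: mult.assoc)
      also have "I j * ?f i = ?f i * I j" using P by (simp add: rep_def)
      finally show ?thesis by (simp only: mult.assoc)
    qed
    then show ?thesis unfolding lin_part_def lin_part_m_def sum_product by (subst sum.swap) simp
  qed
  ultimately have "lin_part (\<lambda>x. P (f x)) * lin_part_m (\<lambda>x. P (g x)) + lin_part_m (\<lambda>x. P (g x)) * lin_part (\<lambda>x. P (f x))
    = (\<Sum>i<n. \<Sum>j<n. (?f i * ?g j - ?g j * ?f i) * (E i * I j) + (if j = i then ?g j * ?f i else 0))"
    unfolding IE by (simp flip: sum.distrib) (intro sum.cong refl, auto simp: algebra_simps)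
  also have "\<dots> = (\<Sum>i<n. \<Sum>j<n. P (br (f (e' i)) (g (e j))) * (E i * I j)) + (\<Sum>i<n. ?g i * ?f i)"
    using P by (simp add: sum.distrib rep_def)
  finally show ?thesis .
qed

lemma bilin_P_P: "rep P \<Longrightarrow> bilin (\<lambda>y x. P x * P (pp y))"
  using rep_lin[of P] by (simp add: bilin_def lin_def algebra_simps mult_S_left pp_add pp_sc)

text \<open>\<open>pp\<close> is a \<open>B\<close>-symmetric idempotent, so one copy of it can be
  absorbed into the other across the canonical tensor; the mixed part between k and p is therefore
  0.\<close>

lemma sum_P_kp_pp: assumes P: "rep P" shows "(\<Sum>i<n. P (kp (e i)) * P (pp (e' i))) = 0"
proof -
  have 1: "(\<Sum>i<n. P (pp (e i)) * P (pp (e' i))) = (\<Sum>i<n. P (e i) * P (pp (pp (e' i))))"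
    by (rule transfer[OF bilin_P_P[OF P]]) (auto simp: pp_u pp_ub e_in e'_in B_pp)
  show ?thesis
    by (simp add: kp_def lin_diff[OF rep_lin[OF P]] left_diff_distrib sum_subtractf 1)
qed

text \<open>Brackets of p with p lie in k, so beyond k this anticommutator involves V only through
  the second sum. This form is what makes the Laplacian locally finite.\<close>

lemma Cp_Cpm:
  assumes P: "rep P"
  shows "Cp P * Cpm P + Cpm P * Cp P
    = S 2 * ((\<Sum>i<n. \<Sum>j<n. P (br (pp (e' i)) (pp (e j))) * (E i * I j)) + (\<Sum>i<n. P (pp (e i)) * P (pp (e' i))))"
  unfolding lin_parts[OF P, symmetric] Cp_def Cpm_def by (simp add: mult_S_left mult.assoc distrib_left)

text \<open>This matches the cubic term with the linear one. The projection moves from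
  \<open>e' k\<close> to \<open>e k\<close>; there the p-component of \<open>x\<close> drops out,
  because projections of \<open>u\<close> commute; then invariance moves ad of the k-component to
  the other factor.\<close>

lemma kp_move:
  assumes P: "rep P" and x: "x \<in> u"
  shows "(\<Sum>k<n. P (pp (e' k)) * eps (br (e k) x)) = - (\<Sum>k<n. P (br (pp (e' k)) (kp x)) * E k)"
proof -
  note l = rep_lin[OF P]
  have b1: "bilin (\<lambda>y z. P y * eps (br z x))" and b2: "bilin (\<lambda>y z. P y * eps z)"
    using l lin_eps by (simp_all add: bilin_def lin_def algebra_simps mult_S_left br_add_left br_sc_left)
  have "(\<Sum>k<n. P (pp (e' k)) * eps (br (e k) x)) = (\<Sum>k<n. P (e' k) * eps (br (pp (e k)) x))"
    by (rule transfer[OF b1, symmetric]) (auto simp: pp_u pp_ub e_in e'_in B_pp)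
  also have "\<dots> = (\<Sum>k<n. P (e' k) * eps (- br (kp x) (pp (e k))))"
  proof (intro sum.cong refl)
    fix k assume "k \<in> {..<n}"
    then have "br (pp (e k)) (pp x) = 0" by (simp add: br_pp_u e_in x)
    then have "br (pp (e k)) x = br (pp (e k)) (kp x)" by (simp add: kp_def br_diff_right)
    then show "P (e' k) * eps (br (pp (e k)) x) = P (e' k) * eps (- br (kp x) (pp (e k)))"
      using br_anti[of "pp (e k)" "kp x"] by simp
  qed
  also have "\<dots> = - (\<Sum>k<n. P (e' k) * eps (br (kp x) (pp (e k))))"
    by (simp add: lin_minus[OF lin_eps] sum_negf)
  also have "(\<Sum>k<n. P (e' k) * eps (br (kp x) (pp (e k)))) = (\<Sum>k<n. P (- br (kp x) (pp (e' k))) * eps (e k))"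
    by (rule transfer[OF b2])
      (auto simp: kp_def br_kp_u br_kp_ub x e_in e'_in ub_minus B_minus_right B_inv' B_pp br_kp)
  also have "\<dots> = (\<Sum>k<n. P (br (pp (e' k)) (kp x)) * E k)"
    by (intro sum.cong refl) (simp flip: br_anti)
  finally show ?thesis .
qed

lemma E_cubic_m: "k < n \<Longrightarrow> E k * cubic_m + cubic_m * E k = - ((\<Sum>j<n. eps (br (e k) (e j)) * I j) + (\<Sum>j<n. eps (br (e k) (e j)) * I j))"
  using cubic_m_eps[OF e_in[of k]] by (simp add: add.commute)

text \<open>The linear part of C^- contributes \<open>?T\<close> twice, through the Clifford factor
  2. The cubic part also contributes it twice, since \<open>E k\<close> can be contracted with
  either of two antisymmetric slots. The minus sign in \<open>opCm\<close> makes the two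
  cancel.\<close>

lemma Cp_Ckm: assumes P: "rep P" shows "Cp P * Ckm P + Ckm P * Cp P = 0"
proof -
  note l = rep_lin[OF P]
  have Ckm: "Ckm P = S 2 * lin_part_m (\<lambda>x. P (kp x)) - cubic_m"
    by (simp add: Ckm_def opCm_def Cpm_def lin_part_m_def kp_def lin_diff[OF l] left_diff_distrib sum_subtractf right_diff_distrib)
  let ?T = "\<Sum>j<n. (\<Sum>i<n. P (br (pp (e' i)) (kp (e j))) * E i) * I j"
  have lin: "Cp P * lin_part_m (\<lambda>x. P (kp x)) + lin_part_m (\<lambda>x. P (kp x)) * Cp P = ?T"
    unfolding Cp_def lin_parts[OF P] sum_P_kp_pp[OF P]
    by (subst sum.swap) (simp add: sum_distrib_right mult.assoc)
  have "Cp P * cubic_m + cubic_m * Cp P = (\<Sum>k<n. P (pp (e' k)) * (E k * cubic_m + cubic_m * E k))"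
  proof -
    have W: "cubic_m * P x = P x * cubic_m" for x
      unfolding cubic_m_def sum_distrib_left sum_distrib_right
      using P by (intro sum.cong refl commute_mult) (auto simp: rep_def rep_eps)
    show ?thesis
      unfolding Cp_def lin_part_def
      by (simp add: sum_distrib_left sum_distrib_right sum.distrib distrib_left mult.assoc)
        (simp flip: mult.assoc add: W)
  qed
  also have "\<dots> = - (\<Sum>k<n. P (pp (e' k)) * ((\<Sum>j<n. eps (br (e k) (e j)) * I j) + (\<Sum>j<n. eps (br (e k) (e j)) * I j)))"
    unfolding sum_negf[symmetric] by (intro sum.cong refl) (simp add: E_cubic_m algebra_simps)
  also have "(\<Sum>k<n. P (pp (e' k)) * ((\<Sum>j<n. eps (br (e k) (e j)) * I j) + (\<Sum>j<n. eps (br (e k) (e j)) * I j)))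
    = (\<Sum>k<n. \<Sum>j<n. P (pp (e' k)) * eps (br (e k) (e j)) * I j) + (\<Sum>k<n. \<Sum>j<n. P (pp (e' k)) * eps (br (e k) (e j)) * I j)"
    by (simp add: distrib_left sum_distrib_left sum.distrib mult.assoc)
  also have "(\<Sum>k<n. \<Sum>j<n. P (pp (e' k)) * eps (br (e k) (e j)) * I j) = - ?T"
    by (subst sum.swap) (simp flip: sum_distrib_right add: kp_move[OF P e_in] sum_negf)
  finally have cub: "Cp P * cubic_m + cubic_m * Cp P = ?T + ?T" by simp
  have "S 2 * ?T = ?T + ?T" by (rule S_2)
  have "Cp P * Ckm P + Ckm P * Cp P = S 2 * (Cp P * lin_part_m (\<lambda>x. P (kp x)) + lin_part_m (\<lambda>x. P (kp x)) * Cp P)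
     - (Cp P * cubic_m + cubic_m * Cp P)"
    unfolding Ckm by (simp add: left_diff_distrib right_diff_distrib distrib_left mult_S_left mult.assoc)
  then show ?thesis unfolding lin cub by (simp only: \<open>S 2 * ?T = ?T + ?T\<close> diff_self)
qed

text \<open>\<open>Q\<close> is \<open>P\<close> composed with the involution \<open>x \<mapsto> x - 2 pp x\<close>, that is, with \<open>\<theta>\<close>.\<close>

lemma opC_theta:
  assumes P: "rep P" and Q: "\<And>x. Q x = P (kp x) - P (pp x)"
  shows "opC Q = Ck P - Cp P" and "opCm Q = Ckm P - Cpm P"
proof -
  note l = rep_lin[OF P]
  have q: "Q x = P x - (P (pp x) + P (pp x))" for x
    by (simp add: Q kp_def lin_diff[OF l] algebra_simps)
  have 1: "lin_part Q = lin_part P - (Cp P + Cp P)" and 2: "lin_part_m Q = lin_part_m P - (lin_part_m (\<lambda>x. P (pp x)) + lin_part_m (\<lambda>x. P (pp x)))"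
    by (simp_all add: lin_part_def lin_part_m_def Cp_def q left_diff_distrib distrib_right sum_subtractf sum.distrib)
  show "opC Q = Ck P - Cp P" unfolding Ck_def opC_def 1 by simp
  show "opCm Q = Ckm P - Cpm P" unfolding Ckm_def Cpm_def opCm_def 2 by (simp add: right_diff_distrib distrib_left)
qed

end

section \<open>Operators on the exterior algebra\<close>

text \<open>
  Operators on the functions on sets of naturals with values in a complex vector space. The scalar
  multiplication \<open>s\<close> of that space is not determined by its type, so that an operator is a
  family indexed by all possible \<open>s\<close>; this makes linearity part of the type, and the scalars
  central.
\<close>

definition fock_linear :: "(complex \<Rightarrow> 'v::ab_group_add \<Rightarrow> 'v) \<Rightarrow> ((nat set \<Rightarrow> 'v) \<Rightarrow> nat set \<Rightarrow> 'v) \<Rightarrow> bool" where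
  "fock_linear s F \<longleftrightarrow> (\<forall>f g. F (f + g) = F f + F g) \<and> (\<forall>c f. F (on_coeffs (s c) f) = on_coeffs (s c) (F f))"

typedef (overloaded) 'v fock_op = "{F :: (complex \<Rightarrow> 'v::ab_group_add \<Rightarrow> 'v) \<Rightarrow> (nat set \<Rightarrow> 'v) \<Rightarrow> nat set \<Rightarrow> 'v.
    \<forall>s. if vector_space s then fock_linear s (F s) else F s = (\<lambda>_. 0)}"
proof (intro exI CollectI allI)
  fix s :: "complex \<Rightarrow> 'v \<Rightarrow> 'v"
  show "if vector_space s then fock_linear s ((\<lambda>_ _. 0) s) else ((\<lambda>_ _. 0) s) = (\<lambda>_. 0 :: nat set \<Rightarrow> 'v)"
  proof (cases "vector_space s")
    case True
    then interpret vector_space s .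
    show ?thesis using True by (simp add: fock_linear_def on_coeffs_def fun_eq_iff)
  qed simp
qed

setup_lifting type_definition_fock_op

definition op_family :: "(complex \<Rightarrow> 'v::ab_group_add \<Rightarrow> 'v) \<Rightarrow> 'v fock_op \<Rightarrow> (nat set \<Rightarrow> 'v) \<Rightarrow> nat set \<Rightarrow> 'v" where
  "op_family s a = Rep_fock_op a s"

lemma fock_linear_op_family: "vector_space s \<Longrightarrow> fock_linear s (op_family s a)"
  and op_family_trivial: "\<not> vector_space s \<Longrightarrow> op_family s a = (\<lambda>_. 0)"
  using Rep_fock_op[of a] by (auto simp: op_family_def split: if_splits)

text \<open>Families are required to be 0 wherever \<open>s\<close> is not a vector space, so
  equality only has to be tested on genuine vector spaces.\<close>

lemma fock_op_eqI: "(\<And>s f I. vector_space s \<Longrightarrow> op_family s a f I = op_family s b f I) \<Longrightarrow> a = b"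
  by (metis (no_types, opaque_lifting) Rep_fock_op_inject ext op_family_def op_family_trivial)

instantiation fock_op :: (ab_group_add) "{ring,monoid_mult}"
begin

lift_definition zero_fock_op :: "'a fock_op" is "\<lambda>s f. 0"
proof -
  fix s :: "complex \<Rightarrow> 'a \<Rightarrow> 'a"
  show "if vector_space s then fock_linear s (\<lambda>_. 0) else (\<lambda>_. 0) = (\<lambda>_. 0 :: nat set \<Rightarrow> 'a)"
  proof (cases "vector_space s")
    case True
    then interpret vector_space s .
    show ?thesis using True by (simp add: fock_linear_def on_coeffs_def fun_eq_iff)
  qed simp
qed

lift_definition one_fock_op :: "'a fock_op" is "\<lambda>s f. if vector_space s then f else 0"
  by (auto simp: fock_linear_def)

lift_definition plus_fock_op :: "'a fock_op \<Rightarrow> 'a fock_op \<Rightarrow> 'a fock_op" is "\<lambda>F G s f. F s f + G s f"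
proof -
  fix F G :: "(complex \<Rightarrow> 'a \<Rightarrow> 'a) \<Rightarrow> (nat set \<Rightarrow> 'a) \<Rightarrow> nat set \<Rightarrow> 'a" and s :: "complex \<Rightarrow> 'a \<Rightarrow> 'a"
  assume F: "\<And>s. if vector_space s then fock_linear s (F s) else F s = (\<lambda>_. 0)"
    and G: "\<And>s. if vector_space s then fock_linear s (G s) else G s = (\<lambda>_. 0)"
  show "if vector_space s then fock_linear s (\<lambda>f. F s f + G s f) else (\<lambda>f. F s f + G s f) = (\<lambda>_. 0)"
  proof (cases "vector_space s")
    case True
    then interpret vector_space s .
    show ?thesis using True F[of s] G[of s] by (simp add: fock_linear_def on_coeffs_def fun_eq_iff scale_right_distrib)
  qed (use F[of s] G[of s] in simp)
qed

lift_definition uminus_fock_op :: "'a fock_op \<Rightarrow> 'a fock_op" is "\<lambda>F s f. - F s f"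
proof -
  fix F :: "(complex \<Rightarrow> 'a \<Rightarrow> 'a) \<Rightarrow> (nat set \<Rightarrow> 'a) \<Rightarrow> nat set \<Rightarrow> 'a" and s :: "complex \<Rightarrow> 'a \<Rightarrow> 'a"
  assume F: "\<And>s. if vector_space s then fock_linear s (F s) else F s = (\<lambda>_. 0)"
  show "if vector_space s then fock_linear s (\<lambda>f. - F s f) else (\<lambda>f. - F s f) = (\<lambda>_. 0)"
  proof (cases "vector_space s")
    case True
    then interpret vector_space s .
    show ?thesis using True F[of s] by (simp add: fock_linear_def on_coeffs_def fun_eq_iff)
  qed (use F[of s] in simp)
qed

lift_definition minus_fock_op :: "'a fock_op \<Rightarrow> 'a fock_op \<Rightarrow> 'a fock_op" is "\<lambda>F G s f. F s f - G s f"
proof -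
  fix F G :: "(complex \<Rightarrow> 'a \<Rightarrow> 'a) \<Rightarrow> (nat set \<Rightarrow> 'a) \<Rightarrow> nat set \<Rightarrow> 'a" and s :: "complex \<Rightarrow> 'a \<Rightarrow> 'a"
  assume F: "\<And>s. if vector_space s then fock_linear s (F s) else F s = (\<lambda>_. 0)"
    and G: "\<And>s. if vector_space s then fock_linear s (G s) else G s = (\<lambda>_. 0)"
  show "if vector_space s then fock_linear s (\<lambda>f. F s f - G s f) else (\<lambda>f. F s f - G s f) = (\<lambda>_. 0)"
  proof (cases "vector_space s")
    case True
    then interpret vector_space s .
    show ?thesis using True F[of s] G[of s] by (simp add: fock_linear_def on_coeffs_def fun_eq_iff scale_right_diff_distrib)
  qed (use F[of s] G[of s] in simp)
qed

lift_definition times_fock_op :: "'a fock_op \<Rightarrow> 'a fock_op \<Rightarrow> 'a fock_op" is "\<lambda>F G s f. F s (G s f)"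
proof -
  fix F G :: "(complex \<Rightarrow> 'a \<Rightarrow> 'a) \<Rightarrow> (nat set \<Rightarrow> 'a) \<Rightarrow> nat set \<Rightarrow> 'a" and s :: "complex \<Rightarrow> 'a \<Rightarrow> 'a"
  assume "\<And>s. if vector_space s then fock_linear s (F s) else F s = (\<lambda>_. 0)"
    and "\<And>s. if vector_space s then fock_linear s (G s) else G s = (\<lambda>_. 0)"
  from this[of s] show "if vector_space s then fock_linear s (\<lambda>f. F s (G s f)) else (\<lambda>f. F s (G s f)) = (\<lambda>_. 0)"
    by (simp add: fock_linear_def split: if_splits)
qed

lemma op_family_simps:
  "op_family s 0 f = 0" "op_family s (a + b) f = op_family s a f + op_family s b f"
  "op_family s (- a) f = - op_family s a f" "op_family s (a - b) f = op_family s a f - op_family s b f"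
  "op_family s (a * b) f = op_family s a (op_family s b f)"
  "vector_space s \<Longrightarrow> op_family s 1 f = f"
  by (simp_all add: op_family_def zero_fock_op.rep_eq plus_fock_op.rep_eq uminus_fock_op.rep_eq
      minus_fock_op.rep_eq times_fock_op.rep_eq one_fock_op.rep_eq)

lemma op_family_add: "op_family s a (f + g) = op_family s a f + op_family s a g"
  using fock_linear_op_family[of s a] op_family_trivial[of s a] by (cases "vector_space s") (auto simp: fock_linear_def)

instance
  by standard (rule fock_op_eqI; simp add: op_family_simps op_family_add algebra_simps)+

end

lift_definition scal_op :: "complex \<Rightarrow> 'v::ab_group_add fock_op" is
  "\<lambda>c s f. if vector_space s then on_coeffs (s c) f else 0"
proof -
  fix c and s :: "complex \<Rightarrow> 'v \<Rightarrow> 'v"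
  show "if vector_space s then fock_linear s (\<lambda>f. if vector_space s then on_coeffs (s c) f else 0)
    else (\<lambda>f. if vector_space s then on_coeffs (s c) f else 0) = (\<lambda>_. 0)"
  proof (cases "vector_space s")
    case True
    then interpret vector_space s .
    show ?thesis using True by (simp add: fock_linear_def on_coeffs_def fun_eq_iff scale_right_distrib mult.commute)
  qed simp
qed

text \<open>The comparison is strict, so inserting \<open>i\<close> into \<open>I\<close> or
  removing it does not change the sign.\<close>

definition sgn_pos :: "nat set \<Rightarrow> nat \<Rightarrow> complex" where
  "sgn_pos I i = (- 1) ^ card {j \<in> I. j < i}"

lift_definition create_op :: "nat \<Rightarrow> 'v::ab_group_add fock_op" is
  "\<lambda>i s f I. if vector_space s \<and> i \<in> I then s (sgn_pos I i) (f (I - {i})) else 0"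
proof -
  fix i and s :: "complex \<Rightarrow> 'v \<Rightarrow> 'v"
  show "if vector_space s then fock_linear s (\<lambda>f I. if vector_space s \<and> i \<in> I then s (sgn_pos I i) (f (I - {i})) else 0)
    else (\<lambda>f I. if vector_space s \<and> i \<in> I then s (sgn_pos I i) (f (I - {i})) else 0) = (\<lambda>_. 0)"
  proof (cases "vector_space s")
    case True
    then interpret vector_space s .
    show ?thesis using True by (simp add: fock_linear_def on_coeffs_def fun_eq_iff scale_right_distrib mult.commute)
  qed (simp add: fun_eq_iff)
qed

lift_definition annih_op :: "nat \<Rightarrow> 'v::ab_group_add fock_op" is
  "\<lambda>i s f I. if vector_space s \<and> i \<notin> I then s (sgn_pos I i) (f (insert i I)) else 0"
proof -
  fix i and s :: "complex \<Rightarrow> 'v \<Rightarrow> 'v"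
  show "if vector_space s then fock_linear s (\<lambda>f I. if vector_space s \<and> i \<notin> I then s (sgn_pos I i) (f (insert i I)) else 0)
    else (\<lambda>f I. if vector_space s \<and> i \<notin> I then s (sgn_pos I i) (f (insert i I)) else 0) = (\<lambda>_. 0)"
  proof (cases "vector_space s")
    case True
    then interpret vector_space s .
    show ?thesis using True by (simp add: fock_linear_def on_coeffs_def fun_eq_iff scale_right_distrib mult.commute)
  qed (simp add: fun_eq_iff)
qed

text \<open>\<open>A\<close> is meant to be linear for the one scaling \<open>s0\<close>; at every
  other scaling, or if \<open>A\<close> is not linear, the family is 0. Identities involving such
  operators are therefore checked separately at \<open>s0\<close> and elsewhere, as in
  \<open>P_eqI\<close>.\<close>

lift_definition coeff_op :: "(complex \<Rightarrow> 'v::ab_group_add \<Rightarrow> 'v) \<Rightarrow> ('v \<Rightarrow> 'v) \<Rightarrow> 'v fock_op" is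
  "\<lambda>s0 A s f. if s = s0 \<and> Vector_Spaces.linear s s A then on_coeffs A f else 0"
proof -
  fix s0 s :: "complex \<Rightarrow> 'v \<Rightarrow> 'v" and A
  show "if vector_space s then fock_linear s (\<lambda>f. if s = s0 \<and> Vector_Spaces.linear s s A then on_coeffs A f else 0)
    else (\<lambda>f. if s = s0 \<and> Vector_Spaces.linear s s A then on_coeffs A f else 0) = (\<lambda>_. 0)"
  proof (cases "vector_space s")
    case True
    then interpret vector_space s .
    show ?thesis using True
      by (auto simp: fock_linear_def on_coeffs_def fun_eq_iff Vector_Spaces.linear_iff)
  qed (auto simp: fun_eq_iff Vector_Spaces.linear_iff)
qed

lemma op_family_create: "vector_space s \<Longrightarrow> op_family s (create_op i) f I = (if i \<in> I then s (sgn_pos I i) (f (I - {i})) else 0)"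
  and op_family_annih: "vector_space s \<Longrightarrow> op_family s (annih_op i) f I = (if i \<in> I then 0 else s (sgn_pos I i) (f (insert i I)))"
  and op_family_scal: "vector_space s \<Longrightarrow> op_family s (scal_op c) f I = s c (f I)"
  and op_family_coeff: "op_family s (coeff_op s0 A) f I = (if s = s0 \<and> Vector_Spaces.linear s s A then A (f I) else 0)"
  by (simp_all add: op_family_def create_op.rep_eq annih_op.rep_eq scal_op.rep_eq on_coeffs_def)
    (cases "s = s0"; simp add: op_family_def coeff_op.rep_eq on_coeffs_def)

lemma sgn_pos_insert: "i \<notin> I \<Longrightarrow> sgn_pos (insert i I) j = (if i < j then - sgn_pos I j else sgn_pos I j)"
proof -
  assume "i \<notin> I"
  have "{k \<in> insert i I. k < j} = (if i < j then insert i {k \<in> I. k < j} else {k \<in> I. k < j})" by auto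
  moreover have "finite {k \<in> I. k < j}" by (rule finite_subset[of _ "{..<j}"]) auto
  ultimately show ?thesis using \<open>i \<notin> I\<close> by (simp add: sgn_pos_def)
qed

lemma sgn_pos_remove: "i \<in> I \<Longrightarrow> sgn_pos (I - {i}) j = (if i < j then - sgn_pos I j else sgn_pos I j)"
  using sgn_pos_insert[of i "I - {i}" j] by (auto simp: insert_absorb)

lemma sgn_pos_sq [simp]: "sgn_pos I j * sgn_pos I j = 1"
  by (simp add: sgn_pos_def flip: power_add)

lemma create_anti: "create_op i * create_op j = - (create_op j * create_op i :: 'v::ab_group_add fock_op)"
proof (rule fock_op_eqI)
  fix s :: "complex \<Rightarrow> 'v \<Rightarrow> 'v" and f I assume s: "vector_space s"
  then interpret vector_space s .
  have "I - {i} - {j} = I - {j} - {i}" by auto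
  then show "op_family s (create_op i * create_op j) f I = op_family s (- (create_op j * create_op i)) f I"
    by (auto simp: op_family_simps op_family_create[OF s] sgn_pos_remove mult.commute)
qed

lemma annih_anti: "annih_op i * annih_op j = - (annih_op j * annih_op i :: 'v::ab_group_add fock_op)"
proof (rule fock_op_eqI)
  fix s :: "complex \<Rightarrow> 'v \<Rightarrow> 'v" and f I assume s: "vector_space s"
  then interpret vector_space s .
  show "op_family s (annih_op i * annih_op j) f I = op_family s (- (annih_op j * annih_op i)) f I"
    by (auto simp: op_family_simps op_family_annih[OF s] sgn_pos_insert mult.commute insert_commute)
qed

lemma annih_create: "annih_op i * create_op j = (if i = j then 1 else 0) - create_op j * (annih_op i :: 'v::ab_group_add fock_op)"
proof (rule fock_op_eqI)
  fix s :: "complex \<Rightarrow> 'v \<Rightarrow> 'v" and f I assume s: "vector_space s"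
  then interpret vector_space s .
  show "op_family s (annih_op i * create_op j) f I = op_family s ((if i = j then 1 else 0) - create_op j * annih_op i) f I"
  proof (cases "i = j")
    case True
    then show ?thesis
      by (auto simp: op_family_simps op_family_annih[OF s] op_family_create[OF s] sgn_pos_insert sgn_pos_remove insert_absorb s)
  next
    case False
    then have "insert i I - {j} = insert i (I - {j})" by auto
    then show ?thesis using False
      by (auto simp: op_family_simps op_family_annih[OF s] op_family_create[OF s] sgn_pos_insert sgn_pos_remove mult.commute)
  qed
qed

lemma scal_central: "scal_op c * a = a * (scal_op c :: 'v::ab_group_add fock_op)"
proof (rule fock_op_eqI)
  fix s :: "complex \<Rightarrow> 'v \<Rightarrow> 'v" and f I assume s: "vector_space s"
  have "op_family s (scal_op c) g = on_coeffs (s c) g" for g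
    by (simp add: fun_eq_iff op_family_scal[OF s] on_coeffs_def)
  then show "op_family s (scal_op c * a) f I = op_family s (a * scal_op c) f I"
    using fock_linear_op_family[OF s, of a] by (simp add: op_family_simps fock_linear_def)
qed

lemma scal_add: "scal_op (a + b) = scal_op a + (scal_op b :: 'v::ab_group_add fock_op)"
  and scal_mult: "scal_op (a * b) = scal_op a * (scal_op b :: 'v fock_op)"
  and scal_1: "scal_op 1 = (1 :: 'v fock_op)"
  by (rule fock_op_eqI, simp add: op_family_simps op_family_scal vector_space_def)+

lemma coeff_commute:
  "coeff_op s0 A * create_op i = create_op i * (coeff_op s0 A :: 'v::ab_group_add fock_op)"
  "coeff_op s0 A * annih_op i = annih_op i * (coeff_op s0 A :: 'v fock_op)"
proof -
  have l: "A (s c x) = s c (A x)" "A 0 = 0" if "Vector_Spaces.linear s s A" for s c x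
  proof -
    interpret Vector_Spaces.linear s s A by (rule that)
    show "A (s c x) = s c (A x)" "A 0 = 0" by (auto simp: scale zero)
  qed
  show "coeff_op s0 A * create_op i = create_op i * (coeff_op s0 A :: 'v fock_op)"
  proof (rule fock_op_eqI)
    fix s :: "complex \<Rightarrow> 'v \<Rightarrow> 'v" and f I assume s: "vector_space s"
    then interpret vector_space s .
    have "s c 0 = 0" for c by simp
    then show "op_family s (coeff_op s0 A * create_op i) f I = op_family s (create_op i * coeff_op s0 A) f I"
      using s l[of s0]
      by (cases "s = s0"; cases "Vector_Spaces.linear s0 s0 A"; simp add: op_family_simps op_family_create op_family_coeff)
  qed
  show "coeff_op s0 A * annih_op i = annih_op i * (coeff_op s0 A :: 'v fock_op)"
  proof (rule fock_op_eqI)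
    fix s :: "complex \<Rightarrow> 'v \<Rightarrow> 'v" and f I assume s: "vector_space s"
    then interpret vector_space s .
    have "s c 0 = 0" for c by simp
    then show "op_family s (coeff_op s0 A * annih_op i) f I = op_family s (annih_op i * coeff_op s0 A) f I"
      using s l[of s0]
      by (cases "s = s0"; cases "Vector_Spaces.linear s0 s0 A"; simp add: op_family_simps op_family_annih op_family_coeff)
  qed
qed

section \<open>Traces and the Killing form\<close>

context vector_space
begin

text \<open>\<open>trace_on\<close> takes an arbitrarily chosen basis, so nothing can be computed
  with it before independence of that choice is known.\<close>

lemma trace_basis_indep:
  assumes fin: "finite b" "finite b'" and ind: "independent b" "independent b'"
    and sp: "span b = W" "span b' = W"
    and f: "Vector_Spaces.linear scale scale f" and fW: "\<And>x. x \<in> W \<Longrightarrow> f x \<in> W"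
  shows "(\<Sum>x\<in>b. representation b (f x) x) = (\<Sum>y\<in>b'. representation b' (f y) y)"
proof -
  interpret f: Vector_Spaces.linear scale scale f by (rule f)
  have bW: "x \<in> b \<Longrightarrow> x \<in> W" "y \<in> b' \<Longrightarrow> y \<in> W" for x y
    using sp span_base by auto
  have expand: "representation c (\<Sum>y\<in>d. scale (r y) (v y)) x = (\<Sum>y\<in>d. r y * representation c (v y) x)"
    if "independent c" "span c = W" "\<And>y. y \<in> d \<Longrightarrow> v y \<in> W" for c d r v x
    using that by (subst representation_sum) (auto simp: representation_scale span_scale intro!: sum.cong)
  have "(\<Sum>x\<in>b. representation b (f x) x)
      = (\<Sum>x\<in>b. \<Sum>y\<in>b'. representation b' (f x) y * representation b y x)"
  proof (intro sum.cong refl)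
    fix x assume x: "x \<in> b"
    have "f x = (\<Sum>y\<in>b'. scale (representation b' (f x) y) y)"
      using ind(2) fW[OF bW(1)[OF x]] sp fin by (simp add: sum_representation_eq)
    then have "representation b (f x) x = representation b (\<Sum>y\<in>b'. scale (representation b' (f x) y) y) x"
      by simp
    also have "\<dots> = (\<Sum>y\<in>b'. representation b' (f x) y * representation b y x)"
      by (rule expand[OF ind(1) sp(1)]) (rule bW(2))
    finally show "representation b (f x) x = (\<Sum>y\<in>b'. representation b' (f x) y * representation b y x)" .
  qed
  also have "\<dots> = (\<Sum>y\<in>b'. \<Sum>x\<in>b. representation b y x * representation b' (f x) y)"
    by (subst sum.swap) (simp add: mult.commute)
  also have "\<dots> = (\<Sum>y\<in>b'. representation b' (f y) y)"
  proof (intro sum.cong refl)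
    fix y assume y: "y \<in> b'"
    have "f y = f (\<Sum>x\<in>b. scale (representation b y x) x)"
      using ind(1) bW(2)[OF y] sp fin by (simp add: sum_representation_eq)
    also have "\<dots> = (\<Sum>x\<in>b. scale (representation b y x) (f x))"
      by (simp add: f.sum f.scale)
    finally have "representation b' (f y) y = representation b' (\<Sum>x\<in>b. scale (representation b y x) (f x)) y"
      by simp
    also have "\<dots> = (\<Sum>x\<in>b. representation b y x * representation b' (f x) y)"
      by (rule expand[OF ind(2) sp(2)]) (simp add: fW bW)
    finally show "(\<Sum>x\<in>b. representation b y x * representation b' (f x) y) = representation b' (f y) y" ..
  qed
  finally show ?thesis .
qed

lemma trace_on_eq:
  assumes fin: "finite b" and ind: "independent b" and sp: "span b = W"
    and f: "Vector_Spaces.linear scale scale f" and fW: "\<And>x. x \<in> W \<Longrightarrow> f x \<in> W"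
  shows "trace_on scale W f = (\<Sum>x\<in>b. representation b (f x) x)"
proof -
  define b0 where "b0 = (SOME b. independent b \<and> span b = W)"
  have b0: "independent b0" "span b0 = W"
    using someI_ex[of "\<lambda>b. independent b \<and> span b = W"] ind sp unfolding b0_def by blast+
  have "b0 \<subseteq> span b" using b0(2) sp span_superset by auto
  then have "finite b0" using independent_span_bound[OF fin b0(1)] by auto
  from trace_basis_indep[OF this fin b0(1) ind b0(2) sp f fW]
  show ?thesis by (simp add: trace_on_def b0_def)
qed

lemma trace_on_coord:
  assumes inj: "inj_on e {..<n::nat}" and ind: "independent (e ` {..<n})" and sp: "span (e ` {..<n}) = W"
    and f: "Vector_Spaces.linear scale scale f" and fW: "\<And>x. x \<in> W \<Longrightarrow> f x \<in> W"
    and \<phi>: "\<And>x. x \<in> W \<Longrightarrow> x = (\<Sum>i<n. scale (\<phi> i x) (e i))"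
  shows "trace_on scale W f = (\<Sum>i<n. \<phi> i (f (e i)))"
proof -
  have rep: "representation (e ` {..<n}) x (e i) = \<phi> i x" if "x \<in> W" "i < n" for x i
  proof -
    have "representation (e ` {..<n}) x (e i) = (\<Sum>j<n. \<phi> j x * representation (e ` {..<n}) (e j) (e i))"
      by (subst \<phi>[OF that(1)], subst representation_sum)
        (auto simp: ind representation_scale span_scale span_base)
    also have "\<dots> = (\<Sum>j<n. if j = i then \<phi> j x else 0)"
      using inj that(2) by (intro sum.cong refl) (auto simp: representation_basis[OF ind] inj_on_def)
    finally show ?thesis using that(2) by simp
  qed
  have eW: "i < n \<Longrightarrow> e i \<in> W" for i
    unfolding sp[symmetric] by (rule span_base) simp
  have "trace_on scale W f = (\<Sum>x\<in>e ` {..<n}. representation (e ` {..<n}) (f x) x)"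
    by (rule trace_on_eq[OF _ ind sp f fW]) auto
  also have "\<dots> = (\<Sum>i<n. \<phi> i (f (e i)))"
    by (subst sum.reindex[OF inj]) (simp add: rep fW eW)
  finally show ?thesis .
qed

lemma trace_on_comp_commute:
  assumes fin: "finite b" and ind: "independent b" and sp: "span b = UNIV"
    and f: "Vector_Spaces.linear scale scale f" and g: "Vector_Spaces.linear scale scale g"
  shows "trace_on scale UNIV (\<lambda>x. f (g x)) = trace_on scale UNIV (\<lambda>x. g (f x))"
proof -
  interpret f: Vector_Spaces.linear scale scale f by (rule f)
  interpret g: Vector_Spaces.linear scale scale g by (rule g)
  have comp: "Vector_Spaces.linear scale scale (\<lambda>x. f (g x))" "Vector_Spaces.linear scale scale (\<lambda>x. g (f x))"
    using Vector_Spaces.linear_compose[OF g f] Vector_Spaces.linear_compose[OF f g] by (simp_all add: comp_def)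
  have 1: "representation b (h (k x)) x = (\<Sum>y\<in>b. representation b (k x) y * representation b (h y) x)"
    if "Vector_Spaces.linear scale scale h" for h k x
  proof -
    interpret h: Vector_Spaces.linear scale scale h by (rule that)
    have "h (k x) = h (\<Sum>y\<in>b. scale (representation b (k x) y) y)"
      using ind sp fin by (simp add: sum_representation_eq)
    also have "\<dots> = (\<Sum>y\<in>b. scale (representation b (k x) y) (h y))" by (simp add: h.sum h.scale)
    finally have "representation b (h (k x)) x = representation b (\<Sum>y\<in>b. scale (representation b (k x) y) (h y)) x"
      by simp
    also have "\<dots> = (\<Sum>y\<in>b. representation b (k x) y * representation b (h y) x)"
      using ind sp by (subst representation_sum) (auto simp: representation_scale)
    finally show ?thesis .
  qed
  have "trace_on scale UNIV (\<lambda>x. f (g x)) = (\<Sum>x\<in>b. \<Sum>y\<in>b. representation b (g x) y * representation b (f y) x)"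
    by (simp add: trace_on_eq[OF fin ind sp comp(1)] 1[OF f])
  also have "\<dots> = (\<Sum>y\<in>b. \<Sum>x\<in>b. representation b (f y) x * representation b (g x) y)"
    by (subst sum.swap) (simp add: mult.commute)
  also have "\<dots> = trace_on scale UNIV (\<lambda>x. g (f x))"
    by (simp add: trace_on_eq[OF fin ind sp comp(2)] 1[OF g])
  finally show ?thesis .
qed

text \<open>Extend a basis of \<open>W'\<close> to one of \<open>W\<close>: the values of
  \<open>f\<close> have no coordinates along the added vectors, which thus contribute 0 to the
  trace.\<close>

lemma trace_on_image:
  assumes fin: "finite F" "W \<subseteq> span F" and W: "subspace W" "subspace W'" "W' \<subseteq> W"
    and f: "Vector_Spaces.linear scale scale f" and fW: "\<And>x. x \<in> W \<Longrightarrow> f x \<in> W'"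
  shows "trace_on scale W f = trace_on scale W' f"
proof -
  obtain b' where b': "b' \<subseteq> W'" "independent b'" "W' \<subseteq> span b'"
    using maximal_independent_subset[of W'] by blast
  obtain b where b: "b' \<subseteq> b" "b \<subseteq> W" "independent b" "W \<subseteq> span b"
    using maximal_independent_subset_extend[of b' W] b' W(3) by blast
  have sp: "span b = W" "span b' = W'"
    using b b' W by (auto dest: span_minimal[of b W] span_minimal[of b' W'])
  have finb: "finite b" using independent_span_bound[OF fin(1) b(3)] b(2) fin(2) by auto
  then have finb': "finite b'" using b(1) finite_subset by auto
  have "trace_on scale W f = (\<Sum>x\<in>b. representation b (f x) x)"
    using W(3) fW by (intro trace_on_eq[OF finb b(3) sp(1) f]) auto
  also have "\<dots> = (\<Sum>x\<in>b. representation b' (f x) x)"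
  proof (rule sum.cong[OF refl])
    fix x assume "x \<in> b"
    then have "f x \<in> span b'" using b(2) sp(2) fW by auto
    from representation_extend[OF b(3) this b(1)]
    show "representation b (f x) x = representation b' (f x) x" by simp
  qed
  also have "\<dots> = (\<Sum>x\<in>b'. representation b' (f x) x)"
    by (rule sum.mono_neutral_right[OF finb b(1)]) (auto dest: representation_ne_zero)
  also have "\<dots> = trace_on scale W' f"
    using W(3) fW by (intro trace_on_eq[OF finb' b'(2) sp(2) f, symmetric]) auto
  finally show ?thesis .
qed

end

section \<open>Traces of nilpotent adjoint actions and invariance of the Killing form\<close>

context lie_algebra
begin

sublocale brl: Vector_Spaces.linear scale scale "\<lambda>x. br x y" for y by (rule br_linear_left)
sublocale brr: Vector_Spaces.linear scale scale "br x" for x by (rule br_linear_right)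

lemma br_anti: "br x y = - br y x"
proof -
  have "br (x + y) (x + y) = br x x + br x y + (br y x + br y y)"
    unfolding brl.add brr.add by (simp only: ac_simps)
  then show ?thesis by (simp add: br_self eq_neg_iff_add_eq_0 add.commute)
qed

lemma br_derivation: "br x (br y z) = br (br x y) z + br y (br x z)"
proof -
  have "br y (br z x) = - br y (br x z)" by (subst br_anti[of z x]) (rule brr.neg)
  moreover have "br z (br x y) = - br (br x y) z" by (rule br_anti)
  ultimately show ?thesis using jacobi[of x y z] by (simp add: algebra_simps)
qed

text \<open>ad z maps each term of the lower central series into the next, and by
  \<open>trace_on_image\<close> the trace may be taken on the smaller space. Descending to 0 leaves
  trace 0.\<close>

lemma nilpotent_trace:
  assumes fin: "finite F" "span F = UNIV" and W: "lie_subalgebra scale br W" and nil: "lie_nilpotent scale br W"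
    and z: "z \<in> W"
  shows "trace_on scale W (br z) = 0"
proof -
  define U where "U k = (lie_commutator scale br W ^^ k) W" for k
  have U_Suc: "U (Suc k) = span {br x y | x y. x \<in> W \<and> y \<in> U k}" for k
    by (simp add: U_def lie_commutator_def)
  have sub: "subspace (U k)" for k
    using W by (cases k) (simp_all add: U_Suc, simp add: U_def lie_subalgebra_def)
  have mono: "U (Suc k) \<subseteq> U k" for k
  proof (induction k)
    case 0
    have "{br x y | x y. x \<in> W \<and> y \<in> U 0} \<subseteq> W" using W by (auto simp: lie_subalgebra_def U_def)
    then show ?case unfolding U_Suc using span_minimal[of _ W] sub[of 0] by (simp add: U_def)
  next
    case (Suc k)
    then show ?case unfolding U_Suc[of "Suc k"] unfolding U_Suc[of k] by (intro span_mono) (use Suc in \<open>auto simp: U_Suc\<close>)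
  qed
  have z_in: "br z y \<in> U (Suc k)" if "y \<in> U k" for k y
    unfolding U_Suc by (rule span_base) (use z that in auto)
  have "trace_on scale (U 0) (br z) = trace_on scale (U k) (br z)" for k
  proof (induction k)
    case (Suc k)
    have "trace_on scale (U k) (br z) = trace_on scale (U (Suc k)) (br z)"
      by (rule trace_on_image[OF fin(1) _ sub sub mono br_linear_right z_in]) (simp add: fin)
    then show ?case using Suc by simp
  qed simp
  moreover obtain k where "U k = {0}" using nil by (auto simp: lie_nilpotent_def U_def)
  moreover have "trace_on scale {0} (br z) = 0"
    using trace_on_eq[of "{}" "{0}" "br z"] by (simp add: br_linear_right dependent_def brr.zero)
  ultimately show ?thesis by (metis U_def funpow_0)
qed

context
  fixes b assumes fin: "finite b" and ind: "independent b" and sp: "span b = UNIV"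
begin

private lemma ad2: "Vector_Spaces.linear scale scale (\<lambda>z. br x (br y z))"
  using Vector_Spaces.linear_compose[OF br_linear_right br_linear_right] by (simp add: comp_def)

private lemma killing_eq: "killing scale br x y = (\<Sum>z\<in>b. representation b (br x (br y z)) z)"
  unfolding killing_def by (rule trace_on_eq[OF fin ind sp ad2]) simp

lemma killing_add: "killing scale br (x + y) z = killing scale br x z + killing scale br y z"
  by (simp add: killing_eq brl.add representation_add ind sp sum.distrib)

lemma killing_scale: "killing scale br (scale c x) y = c * killing scale br x y"
  by (simp add: killing_eq brl.scale representation_scale ind sp sum_distrib_left)

lemma killing_sym: "killing scale br x y = killing scale br y x"
  unfolding killing_def by (rule trace_on_comp_commute[OF fin ind sp br_linear_right br_linear_right])

private lemma linear_sub:
  assumes "Vector_Spaces.linear scale scale f" "Vector_Spaces.linear scale scale g"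
  shows "Vector_Spaces.linear scale scale (\<lambda>x. f x - g x)"
  using assms by (simp add: Vector_Spaces.linear_iff algebra_simps scale_right_diff_distrib)

private lemma trace_diff:
  assumes "Vector_Spaces.linear scale scale f" "Vector_Spaces.linear scale scale g"
  shows "trace_on scale UNIV (\<lambda>x. f x - g x) = trace_on scale UNIV f - trace_on scale UNIV g"
  using trace_on_eq[OF fin ind sp assms(1)] trace_on_eq[OF fin ind sp assms(2)]
    trace_on_eq[OF fin ind sp linear_sub[OF assms]]
  by (simp add: representation_diff ind sp sum_subtractf)

lemma killing_inv: "killing scale br (br x y) z = killing scale br x (br y z)"
proof -
  have l3: "Vector_Spaces.linear scale scale (\<lambda>w. br x (br y (br z w)))" for x y z
    using Vector_Spaces.linear_compose[OF ad2[of y z] br_linear_right[of x]] by (simp add: comp_def)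
  have ad: "br (br x y) w = br x (br y w) - br y (br x w)" for x y w
    using br_derivation[of x y w] by simp
  have "killing scale br (br x y) z
      = trace_on scale UNIV (\<lambda>w. br x (br y (br z w))) - trace_on scale UNIV (\<lambda>w. br y (br x (br z w)))"
    unfolding killing_def ad by (rule trace_diff[OF l3 l3])
  also have "trace_on scale UNIV (\<lambda>w. br y (br x (br z w))) = trace_on scale UNIV (\<lambda>w. br x (br z (br y w)))"
    by (rule trace_on_comp_commute[OF fin ind sp br_linear_right ad2])
  also have "trace_on scale UNIV (\<lambda>w. br x (br y (br z w))) - trace_on scale UNIV (\<lambda>w. br x (br z (br y w)))
      = killing scale br x (br y z)"
    unfolding killing_def ad brr.diff by (rule trace_diff[OF l3 l3, symmetric])
  finally show ?thesis .
qed

text \<open>ad (f x) is the conjugate of ad x by \<open>f\<close>, and the trace is invariant under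
  conjugation. Applied to the Cartan involution and to Ad k.\<close>

lemma killing_automorphism:
  assumes f: "Vector_Spaces.linear scale scale f" and g: "Vector_Spaces.linear scale scale g"
    and gf: "\<And>x. g (f x) = x" and fg: "\<And>x. f (g x) = x" and br: "\<And>x y. f (br x y) = br (f x) (f y)"
  shows "killing scale br (f x) (f y) = killing scale br x y"
proof -
  have l: "Vector_Spaces.linear scale scale (\<lambda>z. br x (br y (g z)))"
    using Vector_Spaces.linear_compose[OF g ad2[of x y]] by (simp add: comp_def)
  have "killing scale br (f x) (f y) = trace_on scale UNIV (\<lambda>z. f (br x (br y (g z))))"
    unfolding killing_def by (rule arg_cong[where f = "trace_on scale UNIV"]) (simp add: br fg)
  also have "\<dots> = trace_on scale UNIV (\<lambda>z. br x (br y (g (f z))))"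
    by (rule trace_on_comp_commute[OF fin ind sp f l])
  finally show ?thesis by (simp add: gf killing_def)
qed

end

end

section \<open>The adjoint representation\<close>

text \<open>Two facts about the group are wanted: Ad acts by automorphisms of the Lie algebra, so
  that it preserves the Killing form, and homomorphisms intertwine exponentials, so that
  exponentials of \<theta>-fixed vectors lie in K. Both must be extracted from smoothness in
  charts.\<close>

locale lie_group_algebra =
  fixes G :: "('g, 'e::euclidean_space) lie_group_data" (structure)
  assumes G: "lie_group_with_algebra G"
begin

abbreviation "c0 \<equiv> lg_chart G"
abbreviation "T \<equiv> lg_top G"
abbreviation "At \<equiv> lg_atlas G"

lemma grp: "group G" using G by (simp add: lie_group_with_algebra_def lie_group_def)

sublocale group G by (rule grp)

lemma top_carrier: "topspace T = carrier G" and atlas: "smooth_atlas T At"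
  and mult_smooth: "smooth_map (prod_topology T T) (prod_atlas At At) T At (\<lambda>(x, y). x \<otimes> y)"
  and c0: "c0 \<in> At" "\<one> \<in> fst c0"
  using G by (auto simp: lie_group_with_algebra_def lie_group_def)

lemma chart_open: "c \<in> At \<Longrightarrow> openin T (fst c)" and chart_img_open: "c \<in> At \<Longrightarrow> open (snd c ` fst c)"
  and chart_homeo: "c \<in> At \<Longrightarrow> homeomorphic_map (subtopology T (fst c)) (top_of_set (snd c ` fst c)) (snd c)"
  and chart_cover: "(\<Union>c\<in>At. fst c) = carrier G"
  using atlas top_carrier by (auto simp: smooth_atlas_def)

lemma chart_carrier: "c \<in> At \<Longrightarrow> x \<in> fst c \<Longrightarrow> x \<in> carrier G"
  using chart_cover by auto

lemma chart_inj: "c \<in> At \<Longrightarrow> inj_on (snd c) (fst c)"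
  using homeomorphic_imp_injective_map[OF chart_homeo, of c] openin_subset[OF chart_open, of c]
  by (simp add: Int_absorb1)

lemma chart_inv_chart: "c \<in> At \<Longrightarrow> x \<in> fst c \<Longrightarrow> chart_inv c (snd c x) = x"
  by (simp add: chart_inv_def chart_inj)

lemma chart_inv_in: "z \<in> snd c ` fst c \<Longrightarrow> chart_inv c z \<in> fst c"
  by (simp add: chart_inv_def inv_into_into)

lemma chart_image_open:
  assumes c: "c \<in> At" and N: "openin T N" "N \<subseteq> fst c"
  shows "open (snd c ` N)"
proof -
  have "open_map (subtopology T (fst c)) (top_of_set (snd c ` fst c)) (snd c)"
    using chart_homeo[OF c] by (rule homeomorphic_imp_open_map)
  moreover have "openin (subtopology T (fst c)) N"
    using N by (simp add: openin_subtopology_alt) (metis inf.absorb_iff2 image_eqI mem_Collect_eq)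
  ultimately have "openin (top_of_set (snd c ` fst c)) (snd c ` N)" by (auto simp: open_map_def)
  then show ?thesis using chart_img_open[OF c] by (rule openin_open_trans)
qed

lemma smooth_map_differentiable:
  assumes "smooth_map T1 A1 T2 A2 f" "c \<in> A1" "d \<in> A2" "x \<in> fst c" "f x \<in> fst d"
  shows "(snd d \<circ> f \<circ> chart_inv c) differentiable (at (snd c x))"
proof -
  have "Ck_on (Suc 0) (snd c ` {x \<in> fst c. f x \<in> fst d}) (snd d \<circ> f \<circ> chart_inv c)"
    using assms unfolding smooth_map_def smooth_on_def by blast
  then show ?thesis using assms(4,5) by auto
qed

abbreviation conj_by :: "'g \<Rightarrow> 'g \<Rightarrow> 'g" where "conj_by g x \<equiv> g \<otimes> x \<otimes> inv g"

lemma mult_continuous: "continuous_map (prod_topology T T) T (\<lambda>(x, y). x \<otimes> y)"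
  using mult_smooth by (simp add: smooth_map_def)

lemma left_mult_continuous: "g \<in> carrier G \<Longrightarrow> continuous_map T T (\<lambda>x. g \<otimes> x)"
  using continuous_map_compose[OF _ mult_continuous, of T "\<lambda>x. (g, x)"]
  by (simp add: continuous_map_pairwise comp_def top_carrier)

lemma right_mult_continuous: "g \<in> carrier G \<Longrightarrow> continuous_map T T (\<lambda>x. x \<otimes> g)"
  using continuous_map_compose[OF _ mult_continuous, of T "\<lambda>x. (x, g)"]
  by (simp add: continuous_map_pairwise comp_def top_carrier)

lemma conj_continuous: "g \<in> carrier G \<Longrightarrow> continuous_map T T (conj_by g)"
  using continuous_map_compose[OF left_mult_continuous right_mult_continuous[of "inv g"], of g]
  by (simp add: comp_def)

lemma preimage_open:
  assumes f: "continuous_map T T f" and c: "c \<in> At" and d: "d \<in> At"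
  shows "openin T {y \<in> fst c. f y \<in> fst d}"
proof -
  have "{y \<in> fst c. f y \<in> fst d} = fst c \<inter> {y \<in> topspace T. f y \<in> fst d}"
    using chart_carrier[OF c] top_carrier by auto
  then show ?thesis
    using openin_Int[OF chart_open[OF c] openin_continuous_map_preimage[OF f chart_open[OF d]]] by simp
qed

lemma chart_inv_pair:
  assumes "c \<in> At" "d \<in> At" "x \<in> fst c" "y \<in> fst d"
  shows "chart_inv (fst c \<times> fst d, map_prod (snd c) (snd d)) (snd c x, snd d y) = (x, y)"
proof -
  have "inj_on (map_prod (snd c) (snd d)) (fst c \<times> fst d)"
    using chart_inj[OF assms(1)] chart_inj[OF assms(2)] by (rule map_prod_inj_on)
  from inv_into_f_f[OF this, of "(x, y)"] show ?thesis
    using assms by (simp add: chart_inv_def)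
qed

lemma mult_differentiable:
  assumes c: "c \<in> At" "d \<in> At" "b \<in> At" and x: "x \<in> fst c" "y \<in> fst d" "x \<otimes> y \<in> fst b"
  shows "(snd b \<circ> (\<lambda>(x, y). x \<otimes> y) \<circ> chart_inv (fst c \<times> fst d, map_prod (snd c) (snd d)))
    differentiable (at (snd c x, snd d y))"
proof -
  have "(fst c \<times> fst d, map_prod (snd c) (snd d)) \<in> prod_atlas At At"
    using c unfolding prod_atlas_def by blast
  from smooth_map_differentiable[OF mult_smooth this c(3), of "(x, y)"] x show ?thesis by simp
qed

text \<open>Multiplication is known to be smooth only chart by chart, so conjugation is factored
  through a chart at g and one at its inverse. Near 1 the product g x lies in the chart at g again,
  which therefore serves twice.\<close>

lemma conj_differentiable:
  assumes g: "g \<in> carrier G"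
  shows "in_chart G (conj_by g) differentiable (at (snd c0 \<one>))"
proof -
  obtain d where d: "d \<in> At" "g \<in> fst d" using g chart_cover by blast
  obtain d' where d': "d' \<in> At" "inv g \<in> fst d'" using g chart_cover inv_closed by blast
  define f1 where "f1 = snd d \<circ> (\<lambda>(x, y). x \<otimes> y) \<circ> chart_inv (fst d \<times> fst c0, map_prod (snd d) (snd c0))"
  define f2 where "f2 = snd c0 \<circ> (\<lambda>(x, y). x \<otimes> y) \<circ> chart_inv (fst d \<times> fst d', map_prod (snd d) (snd d'))"
  have f1: "f1 differentiable (at (snd d g, snd c0 \<one>))"
    using mult_differentiable[OF d(1) c0(1) d(1) d(2) c0(2)] d g by (simp add: f1_def)
  have f2: "f2 differentiable (at (snd d g, snd d' (inv g)))"
    using mult_differentiable[OF d(1) d'(1) c0(1) d(2) d'(2)] c0 g by (simp add: f2_def)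
  have p1: "(\<lambda>z. (snd d g, z)) differentiable (at (snd c0 \<one>))"
    and p2: "(\<lambda>w. (w, snd d' (inv g))) differentiable (at (snd d g))"
    by (auto simp: differentiable_def intro!: exI has_derivative_Pair derivative_eq_intros)
  have q1: "(\<lambda>z. f1 (snd d g, z)) differentiable (at (snd c0 \<one>))"
    using differentiable_chain_at[OF p1 f1] by (simp add: comp_def)
  have q2: "(\<lambda>w. f2 (w, snd d' (inv g))) differentiable (at (snd d g))"
    using differentiable_chain_at[OF p2 f2] by (simp add: comp_def)
  have v: "f1 (snd d g, snd c0 x) = snd d (g \<otimes> x)" if "x \<in> fst c0" for x
    using that chart_inv_pair[OF d(1) c0(1) d(2) that] by (simp add: f1_def)
  have q: "(\<lambda>z. f2 (f1 (snd d g, z), snd d' (inv g))) differentiable (at (snd c0 \<one>))"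
    using differentiable_chain_at[OF q1, of "\<lambda>w. f2 (w, snd d' (inv g))"] q2 v[OF c0(2)] g by (simp add: comp_def)
  \<comment> \<open>The factorization is valid only where g y stays in the chart \<open>d\<close>;
    by continuity this is an open neighborhood of 1.\<close>
  define N where "N = {y \<in> fst c0. g \<otimes> y \<in> fst d}"
  have N: "openin T N" unfolding N_def by (rule preimage_open[OF left_mult_continuous[OF g] c0(1) d(1)])
  have oN: "open (snd c0 ` N)" by (rule chart_image_open[OF c0(1) N]) (auto simp: N_def)
  have 1: "snd c0 \<one> \<in> snd c0 ` N" using c0 d g by (auto simp: N_def)
  have eq: "f2 (f1 (snd d g, z), snd d' (inv g)) = in_chart G (conj_by g) z" if z: "z \<in> snd c0 ` N" for z
  proof -
    obtain y where y: "y \<in> fst c0" "g \<otimes> y \<in> fst d" "z = snd c0 y" using z by (auto simp: N_def)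
    have "f2 (f1 (snd d g, z), snd d' (inv g)) = snd c0 (g \<otimes> y \<otimes> inv g)"
      using chart_inv_pair[OF d(1) d'(1) y(2) d'(2)] by (simp add: y(3) v[OF y(1)] f2_def)
    then show ?thesis by (simp add: in_chart_def y chart_inv_chart[OF c0(1)])
  qed
  obtain D where "((\<lambda>z. f2 (f1 (snd d g, z), snd d' (inv g))) has_derivative D) (at (snd c0 \<one>))"
    using q by (auto simp: differentiable_def)
  from has_derivative_transform_within_open[OF this oN 1 eq]
  show ?thesis by (auto simp: differentiable_def)
qed

text \<open>From here on Ad is handled through this derivative, which unlike
  \<open>frechet_derivative\<close> composes by the chain rule and is unique.\<close>

lemma Ad_derivative: "g \<in> carrier G \<Longrightarrow> (in_chart G (conj_by g) has_derivative Ad G g) (at (snd c0 \<one>))"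
  using conj_differentiable frechet_derivative_works unfolding Ad_def by blast

lemma in_chart_comp:
  assumes f: "continuous_map T T f" "f \<one> = \<one>" "(in_chart G f has_derivative A) (at (snd c0 \<one>))"
    and g: "(in_chart G g has_derivative B) (at (snd c0 \<one>))"
  shows "(in_chart G (\<lambda>x. g (f x)) has_derivative (\<lambda>x. B (A x))) (at (snd c0 \<one>))"
proof -
  define N where "N = {y \<in> fst c0. f y \<in> fst c0}"
  have N: "openin T N" unfolding N_def by (rule preimage_open[OF f(1) c0(1) c0(1)])
  have oN: "open (snd c0 ` N)" by (rule chart_image_open[OF c0(1) N]) (auto simp: N_def)
  have 1: "snd c0 \<one> \<in> snd c0 ` N" using c0 f(2) by (auto simp: N_def)
  have f1: "in_chart G f (snd c0 \<one>) = snd c0 \<one>" by (simp add: in_chart_def chart_inv_chart[OF c0] f(2))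
  have eq: "(in_chart G g \<circ> in_chart G f) z = in_chart G (\<lambda>x. g (f x)) z" if "z \<in> snd c0 ` N" for z
    using that by (auto simp: N_def in_chart_def chart_inv_chart[OF c0(1)])
  have "(in_chart G g \<circ> in_chart G f has_derivative (B \<circ> A)) (at (snd c0 \<one>))"
    by (rule diff_chain_at[OF f(3)]) (simp add: f1 g)
  from has_derivative_transform_within_open[OF this oN 1 eq] show ?thesis by (simp add: comp_def)
qed

lemma Ad_mult: assumes g: "g \<in> carrier G" and k: "k \<in> carrier G" shows "Ad G (g \<otimes> k) = (\<lambda>x. Ad G g (Ad G k x))"
proof -
  have "(in_chart G (\<lambda>x. conj_by g (conj_by k x)) has_derivative (\<lambda>x. Ad G g (Ad G k x))) (at (snd c0 \<one>))"
    using in_chart_comp[OF conj_continuous[OF k] _ Ad_derivative[OF k] Ad_derivative[OF g]] k by simp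
  moreover have "(in_chart G (conj_by (g \<otimes> k)) has_derivative Ad G (g \<otimes> k)) (at (snd c0 \<one>))"
    by (rule Ad_derivative) (use g k in simp)
  moreover have "in_chart G (\<lambda>x. conj_by g (conj_by k x)) z = in_chart G (conj_by (g \<otimes> k)) z" if "z \<in> snd c0 ` fst c0" for z
    using chart_carrier[OF c0(1) chart_inv_in[OF that]] g k by (simp add: in_chart_def inv_mult_group m_assoc)
  ultimately show ?thesis
    using has_derivative_transform_within_open[of _ _ "snd c0 \<one>" UNIV "snd c0 ` fst c0" "in_chart G (conj_by (g \<otimes> k))"]
      chart_img_open[OF c0(1)] c0(2) has_derivative_unique by (metis (no_types, lifting) image_eqI)
qed

lemma Ad_one: "Ad G \<one> = (\<lambda>x. x)"
proof -
  have "((\<lambda>x. x) has_derivative (\<lambda>x. x)) (at (snd c0 \<one>))" by simp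
  moreover have "z = in_chart G (conj_by \<one>) z" if "z \<in> snd c0 ` fst c0" for z
    using that chart_carrier[OF c0(1)] by (auto simp: in_chart_def chart_inv_chart[OF c0(1)])
  ultimately have "(in_chart G (conj_by \<one>) has_derivative (\<lambda>x. x)) (at (snd c0 \<one>))"
    using has_derivative_transform_within_open[of _ _ "snd c0 \<one>" UNIV "snd c0 ` fst c0" "in_chart G (conj_by \<one>)"]
      chart_img_open[OF c0(1)] c0(2) by blast
  then show ?thesis using Ad_derivative[OF one_closed] has_derivative_unique by blast
qed

lemma Ad_linear: "g \<in> carrier G \<Longrightarrow> linear (Ad G g)"
  using Ad_derivative has_derivative_linear by blast

lemma Ad_inv: assumes "g \<in> carrier G" shows "Ad G g (Ad G (inv g) x) = x" "Ad G (inv g) (Ad G g x) = x"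
  using Ad_mult[of g "inv g"] Ad_mult[of "inv g" g] assms by (auto simp: Ad_one fun_eq_iff)

lemma exp_subgroup: "one_parameter_subgroup G X (\<lambda>t. lg_exp G (t *\<^sub>R X))"
  and exp_unique: "one_parameter_subgroup G X \<gamma> \<Longrightarrow> \<gamma> = (\<lambda>t. lg_exp G (t *\<^sub>R X))"
  using G by (auto simp: lie_group_with_algebra_def)

lemma exp_carrier: "lg_exp G (t *\<^sub>R X) \<in> carrier G"
  using exp_subgroup[of X] continuous_map_image_subset_topspace[of euclideanreal T "\<lambda>t. lg_exp G (t *\<^sub>R X)"] top_carrier
  by (auto simp: one_parameter_subgroup_def)

lemma exp_zero: "lg_exp G (0 *\<^sub>R X) = \<one>"
proof -
  have "lg_exp G ((0 + 0) *\<^sub>R X) = lg_exp G (0 *\<^sub>R X) \<otimes> lg_exp G (0 *\<^sub>R X)"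
    using exp_subgroup[of X] by (metis one_parameter_subgroup_def)
  then show ?thesis using exp_carrier[of 0 X] l_cancel_one' by (metis add_0)
qed

text \<open>The image of a one-parameter subgroup is again one, with velocity \<open>A X\<close>,
  and the uniqueness built into the exponential map identifies it. Used for conjugations and for the
  global Cartan involution.\<close>

lemma hom_exp:
  assumes f: "continuous_map T T f" "(in_chart G f has_derivative A) (at (snd c0 \<one>))"
    and hom: "\<And>x y. x \<in> carrier G \<Longrightarrow> y \<in> carrier G \<Longrightarrow> f (x \<otimes> y) = f x \<otimes> f y"
  shows "f (lg_exp G (t *\<^sub>R X)) = lg_exp G (t *\<^sub>R A X)"
proof -
  let ?\<gamma> = "\<lambda>t. lg_exp G (t *\<^sub>R X)"
  note s = exp_subgroup[of X, unfolded one_parameter_subgroup_def]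
  have cont: "continuous_map euclideanreal T ?\<gamma>" using s by blast
  have "one_parameter_subgroup G (A X) (\<lambda>t. f (?\<gamma> t))"
    unfolding one_parameter_subgroup_def
  proof (intro conjI allI)
    show "continuous_map euclideanreal T (\<lambda>t. f (?\<gamma> t))"
      using continuous_map_compose[OF cont f(1)] by (simp add: comp_def)
    show "f (?\<gamma> (s' + t)) = f (?\<gamma> s') \<otimes> f (?\<gamma> t)" for s' t
      using s hom exp_carrier by metis
    have "openin euclideanreal {t \<in> topspace euclideanreal. ?\<gamma> t \<in> fst c0}"
      by (rule openin_continuous_map_preimage[OF cont chart_open[OF c0(1)]])
    then have o: "open {t. ?\<gamma> t \<in> fst c0}" by simp
    have d: "((\<lambda>t. snd c0 (?\<gamma> t)) has_derivative (\<lambda>t. t *\<^sub>R X)) (at 0)"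
      using s by (simp add: has_vector_derivative_def)
    have "(in_chart G f \<circ> (\<lambda>t. snd c0 (?\<gamma> t)) has_derivative A \<circ> (\<lambda>t. t *\<^sub>R X)) (at 0)"
      by (rule diff_chain_at[OF d]) (use f(2) exp_zero[of X] in simp)
    moreover have "A \<circ> (\<lambda>t. t *\<^sub>R X) = (\<lambda>t. t *\<^sub>R A X)"
      using linear_scale[OF has_derivative_linear[OF f(2)]] by (simp add: fun_eq_iff)
    moreover have "(in_chart G f \<circ> (\<lambda>t. snd c0 (?\<gamma> t))) t = snd c0 (f (?\<gamma> t))" if "t \<in> {t. ?\<gamma> t \<in> fst c0}" for t
      using that by (simp add: in_chart_def chart_inv_chart[OF c0(1)])
    ultimately have D: "(in_chart G f \<circ> (\<lambda>t. snd c0 (?\<gamma> t)) has_derivative (\<lambda>t. t *\<^sub>R A X)) (at 0)"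
      and eq: "\<And>t. t \<in> {t. ?\<gamma> t \<in> fst c0} \<Longrightarrow> (in_chart G f \<circ> (\<lambda>t. snd c0 (?\<gamma> t))) t = snd c0 (f (?\<gamma> t))"
      by auto
    have "0 \<in> {t. ?\<gamma> t \<in> fst c0}" using exp_zero[of X] c0(2) by simp
    from has_derivative_transform_within_open[OF D o this eq]
    show "((\<lambda>t. snd c0 (f (?\<gamma> t))) has_vector_derivative A X) (at 0)"
      by (simp add: has_vector_derivative_def)
  qed
  then show ?thesis using exp_unique by metis
qed

lemma conj_exp: "k \<in> carrier G \<Longrightarrow> conj_by k (lg_exp G (t *\<^sub>R X)) = lg_exp G (t *\<^sub>R Ad G k X)"
  by (rule hom_exp[OF conj_continuous Ad_derivative]) (simp_all add: m_assoc inv_solve_left)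

text \<open>Differentiate at t = 0 the identity Ad k Ad (exp tX) Y = Ad (exp (t Ad k X)) Ad k
  Y.\<close>

lemma Ad_br: assumes k: "k \<in> carrier G" shows "Ad G k (lg_br G X Y) = lg_br G (Ad G k X) (Ad G k Y)"
proof -
  have br: "((\<lambda>t. Ad G (lg_exp G (t *\<^sub>R X)) Y) has_vector_derivative lg_br G X Y) (at 0)" for X Y
    using G by (simp add: lie_group_with_algebra_def)
  have "bounded_linear (Ad G k)" using Ad_linear[OF k] linear_conv_bounded_linear by blast
  from bounded_linear.has_vector_derivative[OF this br]
  have "((\<lambda>t. Ad G k (Ad G (lg_exp G (t *\<^sub>R X)) Y)) has_vector_derivative Ad G k (lg_br G X Y)) (at 0)" .
  moreover have "Ad G k (Ad G (lg_exp G (t *\<^sub>R X)) Y) = Ad G (lg_exp G (t *\<^sub>R Ad G k X)) (Ad G k Y)" for t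
  proof -
    have "k \<otimes> lg_exp G (t *\<^sub>R X) = lg_exp G (t *\<^sub>R Ad G k X) \<otimes> k"
      unfolding conj_exp[OF k, symmetric] using k exp_carrier[of t X] by (simp add: m_assoc)
    then show ?thesis using Ad_mult[OF k exp_carrier] Ad_mult[OF exp_carrier k] by (metis)
  qed
  ultimately show ?thesis
    using br[of "Ad G k X" "Ad G k Y"] vector_derivative_unique_at by (metis (no_types, lifting) ext)
qed

end

section \<open>The inner product on the exterior algebra\<close>

lemma sorted_nth_in: "finite K \<Longrightarrow> b < card K \<Longrightarrow> sorted_list_of_set K ! b \<in> K"
  using nth_mem[of b "sorted_list_of_set K"] by simp

lemma sorted_list_remove_nth:
  assumes K: "finite K" and a: "a < card K" and c: "c < card K - 1"
  shows "sorted_list_of_set (K - {sorted_list_of_set K ! a}) ! c = sorted_list_of_set K ! (if c < a then c else Suc c)"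
proof -
  let ?xs = "sorted_list_of_set K"
  have len: "length ?xs = card K" using K by simp
  have d: "distinct ?xs" by simp
  have split: "?xs = take a ?xs @ ?xs ! a # drop (Suc a) ?xs"
    using a len by (simp add: id_take_nth_drop)
  have "?xs ! a \<notin> set (take a ?xs)"
    using d split by (metis distinct_append distinct.simps(2) disjoint_iff list.set_intros(1))
  then have "remove1 (?xs ! a) ?xs = take a ?xs @ drop (Suc a) ?xs"
    by (subst (2) split) (simp add: remove1_append)
  then have "sorted_list_of_set (K - {?xs ! a}) = take a ?xs @ drop (Suc a) ?xs"
    using K by (simp add: sorted_list_of_set_remove)
  then show ?thesis using a c len by (simp add: nth_append min_def)
qed

lemma sgn_pos_nth:
  assumes K: "finite K" and b: "b < card K"
  shows "sgn_pos K (sorted_list_of_set K ! b) = (- 1) ^ b"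
proof -
  let ?xs = "sorted_list_of_set K"
  have len: "length ?xs = card K" using K by simp
  have mono: "c < d \<Longrightarrow> d < card K \<Longrightarrow> ?xs ! c < ?xs ! d" for c d
    using sorted_wrt_nth_less[OF strict_sorted_list_of_set[of K]] len by simp
  have "{k \<in> K. k < ?xs ! b} = (\<lambda>c. ?xs ! c) ` {..<b}"
  proof (rule equalityI; rule subsetI)
    fix k assume k: "k \<in> {k \<in> K. k < ?xs ! b}"
    then obtain c where c: "c < card K" "k = ?xs ! c"
      using K len by (metis (no_types, lifting) in_set_conv_nth mem_Collect_eq set_sorted_list_of_set)
    then have "c < b" using k mono[of b c] by (cases c b rule: linorder_cases) auto
    then show "k \<in> (\<lambda>c. ?xs ! c) ` {..<b}" using c by auto
  next
    fix k assume "k \<in> (\<lambda>c. ?xs ! c) ` {..<b}"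
    then show "k \<in> {k \<in> K. k < ?xs ! b}"
      using b mono len sorted_nth_in[OF K] by auto
  qed
  moreover have "inj_on (\<lambda>c. ?xs ! c) {..<b}"
    using b len by (intro inj_onI) (simp add: nth_eq_iff_index_eq)
  ultimately show ?thesis by (simp add: sgn_pos_def card_image)
qed

lemma sum_sorted_nth:
  assumes "finite K" shows "(\<Sum>b<card K. g (sorted_list_of_set K ! b)) = (\<Sum>j\<in>K. g j)"
  by (rule sum.reindex_bij_betw[OF bij_betw_nth]) (use assms in auto)

definition gram_mat :: "('a \<Rightarrow> 'a \<Rightarrow> complex) \<Rightarrow> (nat \<Rightarrow> 'a) \<Rightarrow> nat set \<Rightarrow> nat set \<Rightarrow> complex mat" where
  "gram_mat h e I J = mat (card I) (card J) (\<lambda>(a, b). h (e (sorted_list_of_set I ! a)) (e (sorted_list_of_set J ! b)))"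

lemma gram_det: "card I = card J \<Longrightarrow> gram h e I J = Determinant.det (gram_mat h e I J)"
proof -
  assume c: "card I = card J"
  have "(\<Prod>a = 0..<card J. gram_mat h e I J $$ (a, p a))
      = (\<Prod>a<card J. h (e (sorted_list_of_set I ! a)) (e (sorted_list_of_set J ! p a)))"
    if "p permutes {0..<card J}" for p
    using permutes_in_image[OF that] c by (auto simp: gram_mat_def lessThan_atLeast0 intro!: prod.cong)
  then show ?thesis
    using c by (simp add: gram_def Determinant.det_def gram_mat_def lessThan_atLeast0)
qed

text \<open>Expansion along row \<open>r\<close> of a matrix whose other rows are the Gram rows of
  \<open>I\<close>. Leaving \<open>M\<close> otherwise free covers both the Gram matrix of
  \<open>insert i I\<close> and a degenerate matrix with a repeated row.\<close>

lemma gram_laplace_general: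
  assumes fin: "finite I" "finite J" and c: "card J = Suc (card I)"
    and M: "M \<in> carrier_mat (card J) (card J)" and r: "r < card J"
    and row: "\<And>b. b < card J \<Longrightarrow> M $$ (r, b) = h (e i) (e (sorted_list_of_set J ! b))"
    and del: "\<And>a b. a < card I \<Longrightarrow> b < card J \<Longrightarrow> M $$ (if a < r then a else Suc a, b) = h (e (sorted_list_of_set I ! a)) (e (sorted_list_of_set J ! b))"
  shows "Determinant.det M = (- 1) ^ r * (\<Sum>j\<in>J. sgn_pos J j * h (e i) (e j) * gram h e I (J - {j}))"
proof -
  have cof: "cofactor M r b = (- 1) ^ r * ((- 1) ^ b * gram h e I (J - {sorted_list_of_set J ! b}))" if b: "b < card J" for b
  proof -
    let ?j = "sorted_list_of_set J ! b"
    have j: "?j \<in> J" by (rule sorted_nth_in[OF fin(2) b])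
    then have cJ: "card (J - {?j}) = card I" by (simp only: card_Diff_singleton c diff_Suc_1)
    have "mat_delete M r b = gram_mat h e I (J - {?j})"
    proof (rule eq_matI)
      fix a b' assume "a < dim_row (gram_mat h e I (J - {?j}))" "b' < dim_col (gram_mat h e I (J - {?j}))"
      then have ab: "a < card I" "b' < card I" using cJ by (auto simp: gram_mat_def)
      then have "mat_delete M r b $$ (a, b') = M $$ (if a < r then a else Suc a, if b' < b then b' else Suc b')"
        using M c by (simp add: mat_delete_def)
      also have "\<dots> = h (e (sorted_list_of_set I ! a)) (e (sorted_list_of_set J ! (if b' < b then b' else Suc b')))"
        using ab c by (intro del) auto
      also have "sorted_list_of_set J ! (if b' < b then b' else Suc b') = sorted_list_of_set (J - {?j}) ! b'"
        using ab c b by (intro sorted_list_remove_nth[symmetric] fin) auto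
      finally show "mat_delete M r b $$ (a, b') = gram_mat h e I (J - {?j}) $$ (a, b')"
        using ab cJ by (simp add: gram_mat_def)
    qed (use M c cJ in \<open>auto simp: gram_mat_def mat_delete_def\<close>)
    then show ?thesis unfolding cofactor_def by (simp add: gram_det cJ power_add)
  qed
  have "Determinant.det M = (\<Sum>b<card J. M $$ (r, b) * cofactor M r b)"
    by (rule laplace_expansion_row[OF M r])
  also have "\<dots> = (\<Sum>b<card J. (- 1) ^ r * (sgn_pos J (sorted_list_of_set J ! b) * h (e i) (e (sorted_list_of_set J ! b)) * gram h e I (J - {sorted_list_of_set J ! b})))"
    by (intro sum.cong refl) (simp add: row cof sgn_pos_nth fin)
  also have "\<dots> = (\<Sum>j\<in>J. (- 1) ^ r * (sgn_pos J j * h (e i) (e j) * gram h e I (J - {j})))"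
    by (rule sum_sorted_nth[OF fin(2)])
  finally show ?thesis by (simp add: sum_distrib_left)
qed

text \<open>\<open>r\<close> is the position of \<open>i\<close> in the sorted list of
  \<open>insert i I\<close>, so the sign on the left and the sign of the row expansion are both
  (-1)^r and cancel.\<close>

lemma gram_insert:
  assumes fin: "finite I" "finite J" and i: "i \<notin> I"
  shows "sgn_pos I i * gram h e (insert i I) J = (\<Sum>j\<in>J. sgn_pos J j * h (e i) (e j) * gram h e I (J - {j}))"
proof (cases "card J = Suc (card I)")
  case c: True
  let ?xs = "sorted_list_of_set (insert i I)"
  have "i \<in> set ?xs" by (subst set_sorted_list_of_set) (use fin in auto)
  then obtain r where r: "r < card (insert i I)" "?xs ! r = i"
    using fin by (metis finite_insert in_set_conv_nth length_sorted_list_of_set)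
  have r': "r < card J" using r c fin i by simp
  have I: "insert i I - {?xs ! r} = I" using r i by auto
  have cI: "card (insert i I) = card J" using c fin i by simp
  have sgn: "sgn_pos I i = (- 1) ^ r"
    using sgn_pos_nth[of "insert i I" r] r fin i sgn_pos_insert[OF i, of i] by simp
  have "Determinant.det (gram_mat h e (insert i I) J) = (- 1) ^ r * (\<Sum>j\<in>J. sgn_pos J j * h (e i) (e j) * gram h e I (J - {j}))"
  proof (rule gram_laplace_general[OF fin c _ r'])
    fix a b assume ab: "a < card I" "b < card J"
    then have "sorted_list_of_set I ! a = ?xs ! (if a < r then a else Suc a)"
      using sorted_list_remove_nth[of "insert i I" r a] r fin i by (simp add: I)
    then show "gram_mat h e (insert i I) J $$ (if a < r then a else Suc a, b) = h (e (sorted_list_of_set I ! a)) (e (sorted_list_of_set J ! b))"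
      using ab cI c by (simp add: gram_mat_def)
  qed (use r r' cI in \<open>auto simp: gram_mat_def\<close>)
  then show ?thesis by (simp add: gram_det cI sgn power_mult_distrib[symmetric] flip: mult.assoc)
next
  case False
  have "gram h e I (J - {j}) = 0" if "j \<in> J" for j
    using False card_Suc_Diff1[OF fin(2) that] by (auto simp: gram_def)
  moreover have "gram h e (insert i I) J = 0" using False fin i by (auto simp: gram_def)
  ultimately show ?thesis by simp
qed

text \<open>The sum is a determinant in which the row of \<open>i\<close> occurs twice. It fills in
  the sets containing \<open>i\<close> in \<open>adj_create\<close>, on which wedging with
  \<open>e i\<close> is 0.\<close>

lemma gram_repeat:
  assumes fin: "finite I" "finite J" and i: "i \<in> I"
  shows "(\<Sum>j\<in>J. sgn_pos J j * h (e i) (e j) * gram h e I (J - {j})) = 0"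
proof (cases "card J = Suc (card I)")
  case c: True
  let ?xs = "sorted_list_of_set I"
  let ?M = "mat (card J) (card J) (\<lambda>(a, b). h (e (if a = 0 then i else ?xs ! (a - 1))) (e (sorted_list_of_set J ! b)))"
  obtain r where r: "r < card I" "?xs ! r = i"
    using fin i by (metis in_set_conv_nth length_sorted_list_of_set set_sorted_list_of_set)
  have "Determinant.det ?M = (- 1) ^ 0 * (\<Sum>j\<in>J. sgn_pos J j * h (e i) (e j) * gram h e I (J - {j}))"
    by (rule gram_laplace_general[OF fin c]) (use c in auto)
  moreover have "Determinant.det ?M = 0"
    by (rule Determinant.det_identical_rows[of _ "card J" 0 "Suc r"]) (use c r in \<open>auto simp: row_def\<close>)
  ultimately show ?thesis by simp
next
  case False
  have "gram h e I (J - {j}) = 0" if "j \<in> J" for j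
    using False card_Suc_Diff1[OF fin(2) that] by (auto simp: gram_def)
  then show ?thesis by simp
qed

lemma gram_hermitian:
  assumes h: "\<And>x y. h y x = cnj (h x y)" shows "gram h e J I = cnj (gram h e I J)"
proof (cases "card I = card J")
  case True
  interpret cnj: comm_ring_hom cnj by standard auto
  have "gram_mat h e J I = map_mat cnj (transpose_mat (gram_mat h e I J))"
    by (rule eq_matI) (auto simp: gram_mat_def h[symmetric])
  then have "Determinant.det (gram_mat h e J I) = cnj (Determinant.det (transpose_mat (gram_mat h e I J)))"
    by simp
  also have "Determinant.det (transpose_mat (gram_mat h e I J)) = Determinant.det (gram_mat h e I J)"
    by (rule det_transpose[of _ "card J"]) (auto simp: gram_mat_def True)
  finally show ?thesis using True by (simp add: gram_det)
qed (simp add: gram_def)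

locale fock_form = vector_space sV
  for sV :: "complex \<Rightarrow> 'v::ab_group_add \<Rightarrow> 'v" +
  fixes ip :: "'v \<Rightarrow> 'v \<Rightarrow> complex" and h :: "'a \<Rightarrow> 'a \<Rightarrow> complex" and n :: nat and e :: "nat \<Rightarrow> 'a"
  assumes ip_linear: "Vector_Spaces.linear sV (*) (\<lambda>v. ip v w)"
    and ip_herm: "ip w v = cnj (ip v w)"
    and ip_pos: "v \<noteq> 0 \<Longrightarrow> Re (ip v v) > 0"
    and h_herm: "h y x = cnj (h x y)"
begin

abbreviation app :: "'v fock_op \<Rightarrow> (nat set \<Rightarrow> 'v) \<Rightarrow> nat set \<Rightarrow> 'v" where "app \<equiv> op_family sV"

lemma vs: "vector_space sV" by unfold_locales

lemmas app_simps = op_family_simps(1-5) op_family_simps(6)[OF vs] op_family_add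
lemmas app_create = op_family_create[OF vs]
lemmas app_annih = op_family_annih[OF vs]
lemmas app_scal = op_family_scal[OF vs]

lemma app_zero [simp]: "app a 0 = 0"
  using op_family_add[of sV a 0 0] by simp

lemma app_sum: "app (\<Sum>i\<in>A. a i) f = (\<Sum>i\<in>A. app (a i) f)"
  by (induction A rule: infinite_finite_induct) (auto simp: app_simps)

lemma app_minus: "app a (- f) = - app a f"
  using op_family_add[of sV a f "- f"] by (simp add: add_eq_0_iff)

lemma app_diff: "app a (f - g) = app a f - app a g"
  using op_family_add[of sV a f "- g"] by (simp add: app_minus)

lemma app_sum_right: "app a (\<Sum>i\<in>A. f i) = (\<Sum>i\<in>A. app a (f i))"
  by (induction A rule: infinite_finite_induct)
    (simp_all only: simp_thms sum.infinite sum.empty sum.insert op_family_add app_zero)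

lemma VS_sum: "(\<And>i. i \<in> A \<Longrightarrow> f i \<in> VS n) \<Longrightarrow> (\<Sum>i\<in>A. f i) \<in> (VS n :: (nat set \<Rightarrow> 'v) set)"
proof (induction A rule: infinite_finite_induct)
  case (insert x F)
  then show ?case by (simp only: simp_thms sum.insert) (auto simp: VS_def)
qed (simp_all add: VS_def)

lemma sum_fun_eval: "(\<Sum>i\<in>A. f i) I = (\<Sum>i\<in>A. f i I :: 'v)"
  by (induction A rule: infinite_finite_induct) auto

lemma ip_add: "ip (v + v') w = ip v w + ip v' w" and ip_scale: "ip (sV c v) w = c * ip v w"
  and ip_0 [simp]: "ip 0 w = 0"
proof -
  interpret l: Vector_Spaces.linear sV "(*)" "\<lambda>v. ip v w" by (rule ip_linear)
  show "ip (v + v') w = ip v w + ip v' w" "ip (sV c v) w = c * ip v w" "ip 0 w = 0"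
    by (auto simp: l.add l.scale)
qed

lemma ip_sum: "ip (\<Sum>i\<in>A. v i) w = (\<Sum>i\<in>A. ip (v i) w)"
  by (induction A rule: infinite_finite_induct) (auto simp: ip_add)

lemma ip_add_right: "ip w (v + v') = ip w v + ip w v'" and ip_scale_right: "ip w (sV c v) = cnj c * ip w v"
  and ip_0_right [simp]: "ip w 0 = 0"
  by (simp_all add: ip_herm[of w _] ip_add ip_scale)

abbreviation form :: "(nat set \<Rightarrow> 'v) \<Rightarrow> (nat set \<Rightarrow> 'v) \<Rightarrow> complex" where
  "form \<equiv> VS_form ip h n e"

lemma form_add: "form (f + f') g = form f g + form f' g"
  by (simp add: VS_form_def ip_add distrib_right sum.distrib)

lemma form_herm: "form g f = cnj (form f g)"
  unfolding VS_form_def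
  by (subst sum.swap) (simp add: cnj_sum ip_herm[of _ "f _"] gram_hermitian[of h e, OF h_herm, symmetric])

lemma form_add_right: "form g (f + f') = form g f + form g f'"
  by (simp add: form_herm[of g] form_add)

lemma form_0 [simp]: "form 0 g = 0" "form g 0 = 0"
  by (simp_all add: VS_form_def)

lemma form_sum: "form (\<Sum>i\<in>A. f i) g = (\<Sum>i\<in>A. form (f i) g)"
  by (induction A rule: infinite_finite_induct)
    (simp_all only: simp_thms sum.infinite sum.empty sum.insert form_add form_0)

lemma form_minus: "form (- f) g = - form f g"
  using form_add[of f "- f" g] by (simp add: eq_neg_iff_add_eq_0 add.commute)

lemma form_minus_right: "form g (- f) = - form g f"
  by (simp add: form_herm[of g] form_minus)

text \<open>A relation rather than a function, since without completeness an adjoint need not exist.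
  It may range over all functions, because the form only sees the coefficients at subsets of
  \<open>{..<n}\<close>.\<close>

definition adj :: "'v fock_op \<Rightarrow> 'v fock_op \<Rightarrow> bool" where
  "adj a b \<longleftrightarrow> (\<forall>f g. form (app a f) g = form f (app b g))"

lemma adjD: "adj a b \<Longrightarrow> form (app a f) g = form f (app b g)" by (simp add: adj_def)

lemma adj_sym: "adj a b \<Longrightarrow> adj b a"
  unfolding adj_def by (metis form_herm)

lemma adj_add: "adj a b \<Longrightarrow> adj c d \<Longrightarrow> adj (a + c) (b + d)"
  by (simp add: adj_def app_simps form_add form_add_right)

lemma adj_minus: "adj a b \<Longrightarrow> adj (- a) (- b)"
  by (simp add: adj_def app_simps form_minus form_minus_right)

lemma adj_diff: "adj a b \<Longrightarrow> adj c d \<Longrightarrow> adj (a - c) (b - d)"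
  using adj_add[OF _ adj_minus] by fastforce

lemma adj_mult: "adj a b \<Longrightarrow> adj c d \<Longrightarrow> adj (a * c) (d * b)"
  by (simp add: adj_def app_simps)

lemma adj_0: "adj 0 0"
  by (simp add: adj_def app_simps)

lemma adj_sum: "(\<And>i. i \<in> A \<Longrightarrow> adj (a i) (b i)) \<Longrightarrow> adj (\<Sum>i\<in>A. a i) (\<Sum>i\<in>A. b i)"
  by (induction A rule: infinite_finite_induct) (auto simp: adj_add adj_0)

lemma adj_scal: "adj (scal_op c) (scal_op (cnj c))"
  by (simp add: adj_def VS_form_def app_scal ip_scale ip_scale_right mult.assoc)

lemma adj_coeff:
  assumes A: "Vector_Spaces.linear sV sV A" and B: "Vector_Spaces.linear sV sV B"
    and AB: "\<And>v w. ip (A v) w = ip v (B w)"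
  shows "adj (coeff_op sV A) (coeff_op sV B)"
  by (simp add: adj_def VS_form_def op_family_coeff A B AB)

text \<open>The basis \<open>e\<close> need not be orthonormal, so the adjoint of the wedge product
  with \<open>e i\<close> is a combination of contractions with Gram coefficients.\<close>

definition annih_dual :: "nat \<Rightarrow> 'v fock_op" where
  "annih_dual i = (\<Sum>j<n. scal_op (h (e j) (e i)) * annih_op j)"

lemma adj_create: assumes i: "i < n" shows "adj (create_op i) (annih_dual i)"
  unfolding adj_def
proof (intro allI)
  fix f g :: "nat set \<Rightarrow> 'v"
  have finP: "finite I" if "I \<in> Pow {..<n}" for I
    using that finite_subset by auto
  have cs: "cnj (sgn_pos I j) = sgn_pos I j" for I j by (simp add: sgn_pos_def)
  have L: "(\<Sum>I\<in>Pow {..<n}. ip (app (create_op i) f I) w * gram h e I J)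
     = (\<Sum>I\<in>{I \<in> Pow {..<n}. i \<notin> I}. ip (f I) w * (sgn_pos I i * gram h e (insert i I) J))" for w J
  proof -
    have "(\<Sum>I\<in>Pow {..<n}. ip (app (create_op i) f I) w * gram h e I J)
        = (\<Sum>I\<in>{I \<in> Pow {..<n}. i \<in> I}. ip (sV (sgn_pos I i) (f (I - {i}))) w * gram h e I J)"
      by (rule sum.mono_neutral_cong_right) (auto simp: app_create)
    also have "\<dots> = (\<Sum>I\<in>{I \<in> Pow {..<n}. i \<notin> I}. ip (f I) w * (sgn_pos I i * gram h e (insert i I) J))"
      by (rule sum.reindex_bij_witness[of _ "insert i" "\<lambda>I. I - {i}"])
        (use i in \<open>auto simp: ip_scale sgn_pos_insert sgn_pos_remove insert_absorb\<close>)
    finally show ?thesis .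
  qed
  have "form (app (create_op i) f) g
     = (\<Sum>J\<in>Pow {..<n}. \<Sum>I\<in>Pow {..<n}. ip (app (create_op i) f I) (g J) * gram h e I J)"
    unfolding VS_form_def by (rule sum.swap)
  also have "\<dots> = (\<Sum>J\<in>Pow {..<n}. \<Sum>I\<in>{I \<in> Pow {..<n}. i \<notin> I}. ip (f I) (g J) * (\<Sum>j\<in>J. sgn_pos J j * h (e i) (e j) * gram h e I (J - {j})))"
    unfolding L by (intro sum.cong refl) (auto simp: gram_insert finP)
  \<comment> \<open>The sets \<open>I\<close> containing \<open>i\<close> may be added, as their
    inner sum is 0 by \<open>gram_repeat\<close>.\<close>
  also have "\<dots> = (\<Sum>J\<in>Pow {..<n}. \<Sum>I\<in>Pow {..<n}. ip (f I) (g J) * (\<Sum>j\<in>J. sgn_pos J j * h (e i) (e j) * gram h e I (J - {j})))"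
    by (intro sum.cong refl sum.mono_neutral_left) (auto simp: gram_repeat finP)
  also have "\<dots> = (\<Sum>I\<in>Pow {..<n}. \<Sum>J\<in>Pow {..<n}. \<Sum>j\<in>J. ip (f I) (g J) * (sgn_pos J j * h (e i) (e j) * gram h e I (J - {j})))"
    by (subst sum.swap) (simp add: sum_distrib_left)
  also have "\<dots> = (\<Sum>I\<in>Pow {..<n}. \<Sum>(J, j)\<in>Sigma (Pow {..<n}) (\<lambda>J. J). ip (f I) (g J) * (sgn_pos J j * h (e i) (e j) * gram h e I (J - {j})))"
    by (intro sum.cong refl sum.Sigma) (auto intro: finP)
  \<comment> \<open>Replacing \<open>J\<close> by \<open>J - {j}\<close> turns an element of the set
    into an index missing from it, the indexing of a contraction.\<close>
  also have "\<dots> = (\<Sum>I\<in>Pow {..<n}. \<Sum>(J, j)\<in>Sigma (Pow {..<n}) (\<lambda>J. {..<n} - J).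
       ip (f I) (g (insert j J)) * (sgn_pos J j * h (e i) (e j) * gram h e I J))"
    by (intro sum.cong refl sum.reindex_bij_witness[of _ "\<lambda>(J, j). (insert j J, j)" "\<lambda>(J, j). (J - {j}, j)"])
      (auto simp: insert_absorb sgn_pos_remove)
  also have "\<dots> = (\<Sum>I\<in>Pow {..<n}. \<Sum>J\<in>Pow {..<n}. \<Sum>j\<in>{..<n} - J.
       ip (f I) (g (insert j J)) * (sgn_pos J j * h (e i) (e j) * gram h e I J))"
    by (intro sum.cong refl sum.Sigma[symmetric]) auto
  also have "\<dots> = form f (app (annih_dual i) g)"
    unfolding VS_form_def
  proof (intro sum.cong refl)
    fix I J
    have "app (annih_dual i) g J = (\<Sum>j<n. sV (h (e j) (e i)) (if j \<in> J then 0 else sV (sgn_pos J j) (g (insert j J))))"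
      by (simp add: annih_dual_def app_sum app_simps app_scal app_annih sum_fun_eval)
    also have "\<dots> = (\<Sum>j\<in>{..<n} - J. sV (h (e j) (e i) * sgn_pos J j) (g (insert j J)))"
      by (rule sum.mono_neutral_cong_right) auto
    finally have "ip (f I) (app (annih_dual i) g J) = cnj (\<Sum>j\<in>{..<n} - J. h (e j) (e i) * sgn_pos J j * cnj (ip (f I) (g (insert j J))))"
      by (subst ip_herm) (simp add: ip_sum ip_scale ip_herm[of "g _" "f I"])
    also have "\<dots> = (\<Sum>j\<in>{..<n} - J. h (e i) (e j) * sgn_pos J j * ip (f I) (g (insert j J)))"
      by (simp add: cnj_sum cs h_herm[of "e i" "e _", symmetric])
    finally show "(\<Sum>j\<in>{..<n} - J. ip (f I) (g (insert j J)) * (sgn_pos J j * h (e i) (e j) * gram h e I J))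
        = ip (f I) (app (annih_dual i) g J) * gram h e I J"
      by (simp add: sum_distrib_right sum_distrib_left mult_ac)
  qed
  finally show "form (app (create_op i) f) g = form f (app (annih_dual i) g)" .
qed

definition homog :: "nat \<Rightarrow> (nat set \<Rightarrow> 'v) \<Rightarrow> bool" where
  "homog p f \<longleftrightarrow> f \<in> VS n \<and> (\<forall>I. f I \<noteq> 0 \<longrightarrow> card I = p)"

lemma number_op: "f \<in> VS n \<Longrightarrow> app (\<Sum>j<n. create_op j * annih_op j) f I = sV (of_nat (card I)) (f I)"
proof -
  assume f: "f \<in> VS n"
  have "app (\<Sum>j<n. create_op j * annih_op j) f I = (\<Sum>j<n. if j \<in> I then f I else 0)"
    by (simp add: app_sum sum_fun_eval app_simps)
      (intro sum.cong refl, auto simp: app_create app_annih sgn_pos_remove insert_absorb)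
  also have "\<dots> = (\<Sum>j\<in>{..<n} \<inter> I. f I)"
    by (simp add: sum.If_cases)
  also have "\<dots> = sV (of_nat (card I)) (f I)"
  proof (cases "I \<subseteq> {..<n}")
    case True
    then have "{..<n} \<inter> I = I" by auto
    then show ?thesis by (simp add: sum_constant_scale)
  next
    case False
    then show ?thesis using f by (simp add: VS_def)
  qed
  finally show ?thesis .
qed

lemma homog_split:
  fixes f :: "nat set \<Rightarrow> 'v"
  assumes f: "f \<in> VS n"
  shows "f = (\<Sum>p\<le>n. (\<lambda>I. if card I = p then f I else 0))"
proof
  fix I
  have "(\<Sum>p\<le>n. (\<lambda>I. if card I = p then f I else 0)) I = (\<Sum>p\<le>n. if card I = p then f I else 0)"
    by (rule sum_fun_eval)
  also have "\<dots> = (if card I \<le> n then f I else 0)" by simp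
  also have "\<dots> = f I"
  proof (cases "I \<subseteq> {..<n}")
    case True
    then show ?thesis using card_mono[of "{..<n}" I] by simp
  next
    case False
    then show ?thesis using f by (simp add: VS_def)
  qed
  finally show "f I = (\<Sum>p\<le>n. (\<lambda>I. if card I = p then f I else 0)) I" by simp
qed

lemma form_homog_orth: "homog p f \<Longrightarrow> homog q g \<Longrightarrow> p \<noteq> q \<Longrightarrow> form f g = 0"
  unfolding VS_form_def by (intro sum.neutral ballI) (auto simp: homog_def gram_def, metis ip_0 ip_0_right)

end

text \<open>The rows of \<open>c\<close> are the coordinates of an orthonormal basis.\<close>

locale fock_form_pos = fock_form sV ip h n e
  for sV :: "complex \<Rightarrow> 'v::ab_group_add \<Rightarrow> 'v" and ip and h :: "'a \<Rightarrow> 'a \<Rightarrow> complex" and n e +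
  fixes c :: "nat \<Rightarrow> nat \<Rightarrow> complex"
  assumes c: "i < n \<Longrightarrow> j < n \<Longrightarrow> (\<Sum>k<n. c k i * (\<Sum>i'<n. cnj (c k i') * h (e j) (e i'))) = (if i = j then 1 else 0)"
begin

definition cre :: "nat \<Rightarrow> 'v fock_op" where "cre k = (\<Sum>i<n. scal_op (c k i) * create_op i)"
definition ann :: "nat \<Rightarrow> 'v fock_op" where "ann k = (\<Sum>i<n. scal_op (cnj (c k i)) * annih_dual i)"

lemma adj_cre: "adj (cre k) (ann k)"
  unfolding cre_def ann_def
  by (intro adj_sum, subst scal_central[of "cnj _"], intro adj_mult adj_scal adj_create) simp

lemma scal_sum: "scal_op (\<Sum>i\<in>A. g i) = (\<Sum>i\<in>A. scal_op (g i) :: 'v fock_op)"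
proof (induction A rule: infinite_finite_induct)
  case (insert x F)
  then show ?case by (simp add: scal_add)
qed (use scal_add[of 0 0] in simp_all)

lemma ann_eq: "ann k = (\<Sum>j<n. scal_op (\<Sum>i<n. cnj (c k i) * h (e j) (e i)) * annih_op j)"
  unfolding ann_def annih_dual_def scal_sum sum_distrib_left sum_distrib_right
  by (subst sum.swap) (simp add: scal_mult mult.assoc)

text \<open>The degree operator does not depend on the basis; orthonormality enters through the
  identity \<open>c\<close>. On the left each summand is an operator times its own adjoint, which
  makes positivity visible.\<close>

lemma number_eq: "(\<Sum>k<n. cre k * ann k) = (\<Sum>j<n. create_op j * annih_op j)"
proof -
  let ?d = "\<lambda>k j. \<Sum>i'<n. cnj (c k i') * h (e j) (e i')"
  have m: "scal_op a * x * (scal_op b * y) = scal_op (a * b) * (x * y)" for a b and x y :: "'v fock_op"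
    using scal_central[of b x] by (simp add: scal_mult mult.assoc) (metis mult.assoc)
  have "(\<Sum>k<n. cre k * ann k) = (\<Sum>k<n. \<Sum>i<n. \<Sum>j<n. scal_op (c k i * ?d k j) * (create_op i * annih_op j))"
    unfolding cre_def ann_eq sum_product m ..
  also have "\<dots> = (\<Sum>i<n. \<Sum>k<n. \<Sum>j<n. scal_op (c k i * ?d k j) * (create_op i * annih_op j))"
    by (rule sum.swap)
  also have "\<dots> = (\<Sum>i<n. \<Sum>j<n. \<Sum>k<n. scal_op (c k i * ?d k j) * (create_op i * annih_op j))"
    by (rule sum.cong[OF refl], rule sum.swap)
  also have "\<dots> = (\<Sum>i<n. \<Sum>j<n. scal_op (\<Sum>k<n. c k i * ?d k j) * (create_op i * annih_op j))"
    unfolding scal_sum[of "\<lambda>k. c k _ * _ k"] sum_distrib_right ..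
  also have "\<dots> = (\<Sum>i<n. \<Sum>j<n. if i = j then create_op i * annih_op i else 0)"
  proof (intro sum.cong refl)
    fix i j assume "i \<in> {..<n}" "j \<in> {..<n}"
    then show "scal_op (\<Sum>k<n. c k i * ?d k j) * (create_op i * annih_op j) = (if i = j then create_op i * annih_op i else (0 :: 'v fock_op))"
      using c[of i j] scal_sum[of "\<lambda>_. 0" "{}"] by (simp add: scal_1)
  qed
  also have "\<dots> = (\<Sum>j<n. create_op j * annih_op j)" by simp
  finally show ?thesis .
qed

lemma app_annih_homog:
  assumes f: "homog (Suc p) f" and j: "j < n" shows "homog p (app (annih_op j) f)"
proof -
  have sub: "K \<subseteq> {..<n}" if "f K \<noteq> 0" for K
  proof (rule ccontr)
    assume "\<not> K \<subseteq> {..<n}"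
    then show False using f that by (simp add: homog_def VS_def)
  qed
  have card: "card K = Suc p" if "f K \<noteq> 0" for K
    using f that by (simp add: homog_def)
  have nz: "j \<notin> I \<and> f (insert j I) \<noteq> 0" if "app (annih_op j) f I \<noteq> 0" for I
    using that by (auto simp: app_annih split: if_splits)
  have "app (annih_op j) f I = 0" if "\<not> I \<subseteq> {..<n}" for I
    using nz[of I] sub[of "insert j I"] that by blast
  moreover have "card I = p" if "app (annih_op j) f I \<noteq> 0" for I
  proof -
    have "insert j I \<subseteq> {..<n}" using nz[OF that] sub by blast
    then have "finite I" using finite_subset by auto
    then show ?thesis using nz[OF that] card[of "insert j I"] by simp
  qed
  ultimately show ?thesis by (auto simp: homog_def VS_def)
qed

lemma homog_lin: "homog p f \<Longrightarrow> homog p g \<Longrightarrow> homog p (f + g)" "homog p f \<Longrightarrow> homog p (app (scal_op a) f)" "homog p 0"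
  by (auto simp: homog_def VS_def app_scal) (metis add.right_neutral)

lemma homog_sum: "(\<And>i. i \<in> A \<Longrightarrow> homog p (f i)) \<Longrightarrow> homog p (\<Sum>i\<in>A. f i)"
  by (induction A rule: infinite_finite_induct) (simp_all only: simp_thms sum.infinite sum.empty sum.insert homog_lin, auto simp: homog_lin)

lemma app_ann_homog: "homog (Suc p) f \<Longrightarrow> homog p (app (ann k) f)"
  unfolding ann_eq app_sum app_simps by (intro homog_sum homog_lin app_annih_homog) auto

text \<open>
  In degree \<open>p\<close> the number operator, written in an orthonormal basis, gives
  \<open>p * form f f = (\<Sum>k<n. form (app (ann k) f) (app (ann k) f))\<close>.
\<close>

lemma form_homog_pos: "homog p f \<Longrightarrow> Re (form f f) \<ge> 0 \<and> (Re (form f f) = 0 \<longrightarrow> f = 0)"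
proof (induction p arbitrary: f)
  case 0
  have f: "f I = 0" if "I \<noteq> {}" for I
  proof (cases "I \<subseteq> {..<n}")
    case True
    then have "finite I" using finite_subset by blast
    then show ?thesis using 0 that by (auto simp: homog_def)
  next
    case False
    then show ?thesis using 0 by (auto simp: homog_def VS_def)
  qed
  have "form f f = (\<Sum>I\<in>Pow {..<n}. if I = {} then ip (f {}) (f {}) else 0)"
    unfolding VS_form_def
  proof (intro sum.cong refl)
    fix I assume "I \<in> Pow {..<n}"
    have "(\<Sum>J\<in>Pow {..<n}. ip (f I) (f J) * gram h e I J) = (\<Sum>J\<in>Pow {..<n}. if J = {} then ip (f I) (f {}) * gram h e I {} else 0)"
      by (intro sum.cong refl) (auto simp: f)
    then show "(\<Sum>J\<in>Pow {..<n}. ip (f I) (f J) * gram h e I J) = (if I = {} then ip (f {}) (f {}) else 0)"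
      by (auto simp: f gram_def)
  qed
  then have "form f f = ip (f {}) (f {})" by simp
  moreover have "f = 0" if "f {} = 0"
    using f that by (intro ext) (metis zero_fun_apply)
  ultimately show ?case using ip_pos[of "f {}"] by (cases "f {} = 0") (simp_all only: form_0, auto)
next
  case (Suc p)
  have "app (\<Sum>j<n. create_op j * annih_op j) f = app (scal_op (of_nat (Suc p))) f"
  proof
    fix I
    show "app (\<Sum>j<n. create_op j * annih_op j) f I = app (scal_op (of_nat (Suc p))) f I"
      using Suc.prems by (subst number_op) (auto simp: homog_def app_scal)
  qed
  then have N: "app (scal_op (of_nat (Suc p))) f = (\<Sum>k<n. app (cre k) (app (ann k) f))"
    by (simp only: number_eq[symmetric] app_sum app_simps)
  have "of_nat (Suc p) * form f f = form (app (scal_op (of_nat (Suc p))) f) f"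
    by (simp add: VS_form_def app_scal ip_scale sum_distrib_left mult.assoc)
  also have "\<dots> = (\<Sum>k<n. form (app (ann k) f) (app (ann k) f))"
    unfolding N form_sum by (simp add: adjD[OF adj_cre])
  finally have eq: "of_nat (Suc p) * form f f = (\<Sum>k<n. form (app (ann k) f) (app (ann k) f))" .
  have "real (Suc p) * Re (form f f) = Re (of_nat (Suc p) * form f f)" by simp
  also have "\<dots> = (\<Sum>k<n. Re (form (app (ann k) f) (app (ann k) f)))" unfolding eq by (rule Re_sum)
  finally have Re: "real (Suc p) * Re (form f f) = (\<Sum>k<n. Re (form (app (ann k) f) (app (ann k) f)))" .
  note IH = Suc.IH[OF app_ann_homog[OF Suc.prems]]
  have "0 \<le> real (Suc p) * Re (form f f)" unfolding Re by (intro sum_nonneg) (use IH in auto)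
  then have 1: "0 \<le> Re (form f f)" by (simp add: zero_le_mult_iff)
  have 2: "f = 0" if "Re (form f f) = 0"
  proof -
    have "(\<Sum>k<n. Re (form (app (ann k) f) (app (ann k) f))) = 0" using Re that by simp
    then have "\<forall>k<n. Re (form (app (ann k) f) (app (ann k) f)) = 0"
      using IH by (subst (asm) sum_nonneg_eq_0_iff) auto
    then have "app (scal_op (of_nat (Suc p))) f = 0" unfolding N using IH by (intro sum.neutral) (metis app_zero lessThan_iff)
    then have "sV (of_nat (Suc p)) (f I) = 0" for I by (metis app_scal zero_fun_apply)
    then have "f I = 0" for I by (metis of_nat_eq_0_iff scale_eq_0_iff nat.distinct(2))
    then show ?thesis by (intro ext) simp
  qed
  show ?case using 1 2 by blast
qed

text \<open>Different degrees are orthogonal because the Gram coefficient of sets of different size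
  is 0, so positivity reduces to homogeneous elements.\<close>

lemma form_pos:
  assumes f: "f \<in> VS n" shows "Re (form f f) \<ge> 0" and "form f f = 0 \<Longrightarrow> f = 0"
proof -
  define F where "F p = (\<lambda>I. if card I = p then f I else 0)" for p :: nat
  have F: "homog p (F p)" for p using f by (auto simp: homog_def F_def VS_def)
  have f_eq: "f = (\<Sum>p\<le>n. F p)" unfolding F_def by (rule homog_split[OF f])
  have "form f f = (\<Sum>p\<le>n. form (F p) f)" by (subst (1) f_eq) (rule form_sum)
  also have "\<dots> = (\<Sum>p\<le>n. form (F p) (F p))"
  proof (intro sum.cong refl)
    fix p assume p: "p \<in> {..n}"
    have "form f (F p) = (\<Sum>q\<le>n. form (F q) (F p))" by (subst (1) f_eq) (rule form_sum)
    also have "\<dots> = (\<Sum>q\<le>n. if q = p then form (F p) (F p) else 0)"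
      by (intro sum.cong refl) (auto simp: form_homog_orth[OF F F])
    also have "\<dots> = form (F p) (F p)" using p by simp
    finally show "form (F p) f = form (F p) (F p)" by (metis form_herm)
  qed
  finally have eq: "Re (form f f) = (\<Sum>p\<le>n. Re (form (F p) (F p)))" by (metis Re_sum)
  show "Re (form f f) \<ge> 0" unfolding eq by (intro sum_nonneg) (use form_homog_pos[OF F] in auto)
  assume "form f f = 0"
  then have "\<forall>p\<in>{..n}. Re (form (F p) (F p)) = 0"
    using form_homog_pos[OF F] eq sum_nonneg_eq_0_iff[of "{..n}" "\<lambda>p. Re (form (F p) (F p))"] by simp
  then have "F p = 0" if "p \<le> n" for p using form_homog_pos[OF F] that by auto
  then show "f = 0" by (subst f_eq) (intro sum.neutral, auto)
qed

end

section \<open>Harmonic representatives\<close>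

lemma mem_coset: "x \<in> a +o W \<longleftrightarrow> x - a \<in> (W :: 'm::ab_group_add set)"
  by (auto simp: elt_set_plus_def) (metis add_diff_cancel_left' diff_add_cancel add.commute)

lemma representsI:
  fixes H U W :: "'m::ab_group_add set"
  assumes "H \<subseteq> U" and "\<And>x y. x \<in> H \<Longrightarrow> y \<in> H \<Longrightarrow> x - y \<in> H" and "\<And>x y. x \<in> W \<Longrightarrow> y \<in> W \<Longrightarrow> x - y \<in> W"
    and ex: "\<And>x. x \<in> U \<Longrightarrow> \<exists>h\<in>H. h - x \<in> W" and triv: "\<And>x. x \<in> H \<Longrightarrow> x \<in> W \<Longrightarrow> x = 0"
  shows "represents H U W"
  unfolding represents_def cosets_def
proof (intro conjI ballI)
  fix A assume "A \<in> {x +o W | x. x \<in> U}"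
  then obtain x where x: "x \<in> U" "A = x +o W" by auto
  obtain h where h: "h \<in> H" "h - x \<in> W" using ex[OF x(1)] by auto
  show "\<exists>!h. h \<in> A \<and> h \<in> H"
  proof (rule ex1I[of _ h])
    show "h \<in> A \<and> h \<in> H" using h by (simp add: x mem_coset)
    fix h' assume h': "h' \<in> A \<and> h' \<in> H"
    then have "h' - x \<in> W" by (simp add: x mem_coset)
    from assms(3)[OF this h(2)]
    have "h' - h \<in> W" by simp
    then show "h' = h" using triv[of "h' - h"] assms(2) h h' by auto
  qed
qed (use assms(1) in auto)

lemma neg_add_0: "- a + - b = 0 \<Longrightarrow> b = - (a :: 'm::ab_group_add)"
  by (metis add_eq_0_iff minus_minus)

text \<open>The condition on Ck - Cp is the vanishing of the square for the representation twisted
  by \<theta>. The remaining commutation relations follow by combining the two squares and by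
  passing to adjoints.\<close>

locale hodge = fock_form_pos sV ip h n e c
  for sV :: "complex \<Rightarrow> 'v::ab_group_add \<Rightarrow> 'v" and ip and h :: "'a \<Rightarrow> 'a \<Rightarrow> complex" and n e c +
  fixes Ck Cp Ckm Cpm :: "'v fock_op"
  assumes pres: "f \<in> VS n \<Longrightarrow> app Ck f \<in> VS n" "f \<in> VS n \<Longrightarrow> app Cp f \<in> VS n"
      "f \<in> VS n \<Longrightarrow> app Ckm f \<in> VS n" "f \<in> VS n \<Longrightarrow> app Cpm f \<in> VS n"
    and adjk: "adj Ck Ckm" and adjp: "adj Cp (- Cpm)"
    and Cp_sq: "Cp * Cp = 0" and C_sq: "(Ck + Cp) * (Ck + Cp) = 0" and C_sq': "(Ck - Cp) * (Ck - Cp) = 0"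
    and cross: "Cp * Ckm + Ckm * Cp = 0"
begin

lemma VS_closed: "f \<in> VS n \<Longrightarrow> g \<in> VS n \<Longrightarrow> f + g \<in> VS n" "f \<in> VS n \<Longrightarrow> g \<in> VS n \<Longrightarrow> f - g \<in> VS n"
  "f \<in> VS n \<Longrightarrow> - f \<in> (VS n :: (nat set \<Rightarrow> 'v) set)" "0 \<in> (VS n :: (nat set \<Rightarrow> 'v) set)"
  by (auto simp: VS_def)

lemma form_nondeg: "g \<in> VS n \<Longrightarrow> (\<And>f. f \<in> VS n \<Longrightarrow> form f g = 0) \<Longrightarrow> g = 0"
  using form_pos(2)[of g] by blast

lemma app_image_diff:
  assumes "x \<in> app a ` VS n" "y \<in> app a ` VS n" shows "x - y \<in> app a ` VS n"
proof -
  obtain f g where fg: "f \<in> VS n" "g \<in> VS n" and xy: "x = app a f" "y = app a g" using assms by blast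
  show ?thesis unfolding xy app_diff[symmetric] by (rule imageI[OF VS_closed(2)[OF fg]])
qed

text \<open>A relation passes to adjoints only on \<open>VS n\<close>, where the form is
  nondegenerate; hence the restriction in \<open>r5\<close> to \<open>r8\<close>.\<close>

lemma adj_zero:
  assumes "adj a b" "\<And>f. f \<in> VS n \<Longrightarrow> app a f = 0" "g \<in> VS n" "app b g \<in> VS n" shows "app b g = 0"
  by (rule form_nondeg[OF assms(4)]) (use assms(1,2) in \<open>simp only: adjD[OF assms(1), symmetric] form_0\<close>)

lemma double_zero: assumes "x + x = (0 :: nat set \<Rightarrow> 'v)" shows "x = 0"
proof
  fix I
  have "x I + x I = 0" using assms by (metis plus_fun_apply zero_fun_apply)
  then have "sV 2 (x I) = 0" using scale_left_distrib[of 1 1 "x I"] by simp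
  then show "x I = 0 I" by (simp add: scale_eq_0_iff)
qed

abbreviation "kk \<equiv> app Ck"
abbreviation "qq \<equiv> app Cp"
abbreviation "km \<equiv> app Ckm"
abbreviation "qm \<equiv> app Cpm"

lemma r1: "kk (kk f) = 0" and r2: "qq (qq f) = 0" and r3: "kk (qq f) = - qq (kk f)" and r4: "qq (km f) = - km (qq f)"
proof -
  have a: "app ((Ck + Cp) * (Ck + Cp)) f = 0" "app ((Ck - Cp) * (Ck - Cp)) f = 0" "app (Cp * Cp) f = 0" "app (Cp * Ckm + Ckm * Cp) f = 0"
    by (simp_all only: C_sq C_sq' Cp_sq cross app_simps)
  show 2: "qq (qq f) = 0" using a(3) by (simp only: app_simps)
  have b1: "(kk (kk f) + qq (kk f)) + (kk (qq f) + qq (qq f)) = 0" using a(1) by (simp only: app_simps)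
  have b2: "(kk (kk f) - kk (qq f)) - (qq (kk f) - qq (qq f)) = 0" using a(2) by (simp only: app_simps app_diff)
  \<comment> \<open>Adding the squares of Ck + Cp and Ck - Cp removes the mixed terms.\<close>
  have "((kk (kk f) + qq (kk f)) + (kk (qq f) + qq (qq f))) + ((kk (kk f) - kk (qq f)) - (qq (kk f) - qq (qq f))) = 0"
    by (simp only: b1 b2 add_0_left)
  then have "kk (kk f) + kk (kk f) = 0" by (simp add: 2 algebra_simps)
  then show 1: "kk (kk f) = 0" by (rule double_zero)
  show "kk (qq f) = - qq (kk f)" using b1 unfolding 1 2 by (simp add: eq_neg_iff_add_eq_0 add.commute)
  show "qq (km f) = - km (qq f)" using a(4) by (simp only: app_simps eq_neg_iff_add_eq_0)
qed

lemma r5: "f \<in> VS n \<Longrightarrow> kk (qm f) = - qm (kk f)" and r6: "f \<in> VS n \<Longrightarrow> km (km f) = 0"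
  and r7: "f \<in> VS n \<Longrightarrow> qm (qm f) = 0" and r8: "f \<in> VS n \<Longrightarrow> km (qm f) = - qm (km f)"
proof -
  assume f: "f \<in> VS n"
  note kq = adj_sym[OF adjk]
  show "km (km f) = 0"
    using adj_zero[OF adj_mult[OF adjk adjk] _ f] f pres by (simp only: app_simps r1)
  have "app ((- Cpm) * (- Cpm)) f = 0"
    by (rule adj_zero[OF adj_mult[OF adjp adjp] _ f]) (simp_all only: app_simps app_minus r2 minus_minus pres f)
  then show "qm (qm f) = 0" by (simp only: app_simps app_minus minus_minus)
  have "app ((- Cpm) * Ckm + Ckm * (- Cpm)) f = 0"
    by (rule adj_zero[OF adj_add[OF adj_mult[OF adjk adjp] adj_mult[OF adjp adjk]] _ f])
      (simp_all only: app_simps app_minus r3 pres f VS_closed add.left_inverse)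
  then show "km (qm f) = - qm (km f)" by (simp only: app_simps app_minus) (rule neg_add_0)
  have "app (Ck * (- Cpm) + (- Cpm) * Ck) f = 0"
    by (rule adj_zero[OF adj_add[OF adj_mult[OF adjp kq] adj_mult[OF kq adjp]] _ f])
      (simp_all only: app_simps app_minus r4 pres f VS_closed add.left_inverse)
  then show "kk (qm f) = - qm (kk f)" by (simp only: app_simps app_minus) (metis neg_add_0 minus_minus)
qed

abbreviation "C \<equiv> Ck + Cp"
abbreviation "Cm \<equiv> Ckm + Cpm"
abbreviation "Ca \<equiv> Ckm - Cpm"
abbreviation "Cma \<equiv> Ck - Cp"
abbreviation "Lap \<equiv> C * Ca + Ca * C"

lemma adj_C: "adj C Ca" and adj_Cm: "adj Cm Cma"
proof -
  show "adj C Ca" using adj_add[OF adjk adjp] by simp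
  have "adj (- Cpm) Cp" by (rule adj_sym[OF adjp])
  from adj_minus[OF this] have "adj Cpm (- Cp)" by simp
  from adj_add[OF adj_sym[OF adjk] this] show "adj Cm Cma" by simp
qed

lemma presC: "f \<in> VS n \<Longrightarrow> app C f \<in> VS n" "f \<in> VS n \<Longrightarrow> app Cm f \<in> VS n"
  "f \<in> VS n \<Longrightarrow> app Ca f \<in> VS n" "f \<in> VS n \<Longrightarrow> app Cma f \<in> VS n" "f \<in> VS n \<Longrightarrow> app Lap f \<in> VS n"
  by (simp_all only: app_simps app_diff pres VS_closed)

text \<open>The mixed terms between k and p cancel by \<open>r4\<close> and \<open>r5\<close>; the
  minus signs reflect that the p-part is skew.\<close>

lemma Lap_eq: "f \<in> VS n \<Longrightarrow> app Lap f = kk (km f) + km (kk f) - qq (qm f) - qm (qq f)"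
  by (simp only: app_simps app_diff r4 r5) (simp add: algebra_simps)

lemma Lap_eq_m: "f \<in> VS n \<Longrightarrow> app (Cm * Cma + Cma * Cm) f = app Lap f"
  by (simp only: Lap_eq) (simp only: app_simps app_diff r4 r5, simp add: algebra_simps)

definition Harm :: "(nat set \<Rightarrow> 'v) set" where "Harm = kernel_on (VS n) (app Lap)"

lemma Harm_VS: "f \<in> Harm \<Longrightarrow> f \<in> VS n" by (simp add: Harm_def kernel_on_def)

text \<open>The form of (ab + ba) f with f is the sum of the squared norms of a f and b f.\<close>

lemma Lap_kernel:
  assumes ab: "adj a b" and f: "f \<in> VS n" "app a f \<in> VS n" "app b f \<in> VS n" and z: "app (a * b + b * a) f = 0"
  shows "app a f = 0" and "app b f = 0"
proof -
  have "form (app b f) (app b f) + form (app a f) (app a f) = form (app (a * b + b * a) f) f"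
    by (simp only: app_simps form_add adjD[OF ab] adjD[OF adj_sym[OF ab]])
  then have "form (app b f) (app b f) + form (app a f) (app a f) = 0" by (simp only: z form_0)
  moreover have r: "form g g = of_real (Re (form g g))" for g
    using form_herm[of g g] by (metis Reals_cnj_iff complex_is_Real_iff of_real_Re)
  ultimately have "Re (form (app b f) (app b f)) + Re (form (app a f) (app a f)) = 0"
    by (metis plus_complex.simps(1) zero_complex.simps(1))
  then have "Re (form (app b f) (app b f)) = 0" "Re (form (app a f) (app a f)) = 0"
    using form_pos(1)[OF f(2)] form_pos(1)[OF f(3)] by linarith+
  then show "app a f = 0" "app b f = 0" using r form_pos(2)[OF f(2)] form_pos(2)[OF f(3)] by (metis of_real_0)+
qed

lemma Harm_zero: assumes "f \<in> Harm" shows "app C f = 0" "app Ca f = 0" "app Cm f = 0" "app Cma f = 0"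
proof -
  have f: "f \<in> VS n" "app Lap f = 0" using assms by (auto simp: Harm_def kernel_on_def)
  show "app C f = 0" "app Ca f = 0" using Lap_kernel[OF adj_C f(1)] f presC by blast+
  show "app Cm f = 0" "app Cma f = 0"
    using Lap_kernel[OF adj_Cm f(1)] f presC Lap_eq_m[OF f(1)] by metis+
qed

lemma Harm_diff: "x \<in> Harm \<Longrightarrow> y \<in> Harm \<Longrightarrow> x - y \<in> Harm"
  unfolding Harm_def kernel_on_def mem_Collect_eq by (metis VS_closed(2) app_diff diff_self)

text \<open>This takes the place of completeness: kernel and image of a symmetric operator are
  orthogonal, but that together they span the space has to be proved separately.\<close>

definition complements :: bool where
  "complements \<longleftrightarrow> (\<forall>x\<in>VS n. \<exists>h\<in>Harm. \<exists>y\<in>VS n. x = h + app Lap y)"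

text \<open>The usual Hodge argument: if x = h + a b y + b a y is closed, then a b a y = 0, so b a y
  has norm 0 and x is h plus an exact term.\<close>

lemma represents_complex:
  assumes comp: complements
    and ab: "adj a b" and pa: "\<And>f. f \<in> VS n \<Longrightarrow> app a f \<in> VS n" and pb: "\<And>f. f \<in> VS n \<Longrightarrow> app b f \<in> VS n"
    and sq: "\<And>f. f \<in> VS n \<Longrightarrow> app a (app a f) = 0"
    and L: "\<And>f. f \<in> VS n \<Longrightarrow> app (a * b + b * a) f = app Lap f"
  shows "represents Harm (kernel_on (VS n) (app a)) (app a ` VS n)"
proof (rule representsI)
  have Ha: "app a f = 0" "app b f = 0" if "f \<in> Harm" for f
  proof -
    have "f \<in> VS n" "app (a * b + b * a) f = 0" using that L by (auto simp: Harm_def kernel_on_def)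
    then show "app a f = 0" "app b f = 0" using Lap_kernel[OF ab] pa pb by blast+
  qed
  show "Harm \<subseteq> kernel_on (VS n) (app a)" using Ha Harm_VS by (auto simp: kernel_on_def)
  show "x - y \<in> app a ` VS n" if "x \<in> app a ` VS n" "y \<in> app a ` VS n" for x y
    using that by (rule app_image_diff)
  show "\<exists>h\<in>Harm. h - x \<in> app a ` VS n" if x: "x \<in> kernel_on (VS n) (app a)" for x
  proof -
    obtain h y where h: "h \<in> Harm" "y \<in> VS n" "x = h + app Lap y"
      using comp x by (auto simp: complements_def kernel_on_def)
    let ?z = "app b (app a y)"
    have L': "app Lap y = app a (app b y) + ?z" using L[OF h(2)] by (simp only: app_simps)
    have "app a x = app a ?z"
      unfolding h(3) L' by (simp only: app_simps Ha(1)[OF h(1)] sq[OF pb[OF h(2)]] add_0_left)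
    then have "app a ?z = 0" using x by (simp add: kernel_on_def)
    then have "form ?z ?z = 0"
      by (simp only: adjD[OF adj_sym[OF ab]] form_0)
    then have "?z = 0" using form_pos(2) pa pb h(2) by blast
    then have "h - x = app a (- app b y)" unfolding h(3) L' by (simp add: app_minus)
    then show ?thesis using h VS_closed(3) pb by blast
  qed
  show "x = 0" if x: "x \<in> Harm" "x \<in> app a ` VS n" for x
  proof -
    obtain y where y: "y \<in> VS n" "x = app a y" using x by auto
    have "form x x = form y (app b x)" unfolding y(2) by (rule adjD[OF ab])
    then have "form x x = 0" by (simp only: Ha(2)[OF x(1)] form_0)
    then show ?thesis using form_pos(2) Harm_VS[OF x(1)] by blast
  qed
qed (rule Harm_diff)

lemma represents_C: "complements \<Longrightarrow> represents Harm (kernel_on (VS n) (app C)) (app C ` VS n)"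
  by (rule represents_complex[OF _ adj_C presC(1,3)]) (simp_all only: app_simps[symmetric] C_sq, simp only: app_simps)

lemma Cm_sq: "f \<in> VS n \<Longrightarrow> app Cm (app Cm f) = 0"
  by (simp only: app_simps r6 r7 r8) simp

lemma represents_Cm: "complements \<Longrightarrow> represents Harm (kernel_on (VS n) (app Cm)) (app Cm ` VS n)"
  by (rule represents_complex[OF _ adj_Cm presC(2,4) Cm_sq Lap_eq_m])

abbreviation "D \<equiv> C + Cm"

text \<open>The argument of \<open>represents_complex\<close> rests on a square 0, which
  \<open>D\<close> does not have. The adjoint of \<open>D\<close> still kills harmonic vectors,
  which gives uniqueness; existence rests on an explicit preimage under \<open>D\<close> of the
  Laplacian part of a kernel element.\<close>

lemma represents_D:
  assumes comp: complements
  shows "represents Harm (kernel_on (VS n) (app D)) (app D ` VS n \<inter> kernel_on (VS n) (app D))"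
proof (rule representsI)
  let ?Z = "kernel_on (VS n) (app D)"
  have Z_diff: "x - y \<in> ?Z" if "x \<in> ?Z" "y \<in> ?Z" for x y
    using that unfolding kernel_on_def mem_Collect_eq by (metis VS_closed(2) app_diff diff_self)
  have HD: "app D f = 0" if "f \<in> Harm" for f
    using Harm_zero[OF that] by (simp only: app_simps add_0_left)
  show HZ: "Harm \<subseteq> ?Z" using HD Harm_VS by (auto simp: kernel_on_def)
  have W_diff: "x - y \<in> app D ` VS n" if "x \<in> app D ` VS n" "y \<in> app D ` VS n" for x y
    using that by (rule app_image_diff)
  show "x - y \<in> app D ` VS n \<inter> ?Z" if "x \<in> app D ` VS n \<inter> ?Z" "y \<in> app D ` VS n \<inter> ?Z" for x y
    using that Z_diff W_diff by blast
  have triv: "x = 0" if x: "x \<in> Harm" "x \<in> app D ` VS n" for x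
  proof -
    obtain y where y: "y \<in> VS n" "x = app D y" using x by auto
    have "form x x = form y (app (Ca + Cma) x)" unfolding y(2) by (rule adjD[OF adj_add[OF adj_C adj_Cm]])
    moreover have "app (Ca + Cma) x = 0"
      using Harm_zero[OF x(1)] unfolding op_family_simps(2)[of _ Ca Cma] by (simp only: add_0_left)
    ultimately have "form x x = 0" by (simp only: form_0)
    then show ?thesis using form_pos(2) Harm_VS[OF x(1)] by blast
  qed
  then show "x = 0" if "x \<in> Harm" "x \<in> app D ` VS n \<inter> ?Z" for x using that by blast
  show "\<exists>h\<in>Harm. h - x \<in> app D ` VS n \<inter> ?Z" if x: "x \<in> ?Z" for x
  proof -
    have xV: "x \<in> VS n" and xD: "app D x = 0" using x by (auto simp: kernel_on_def)
    obtain h y0 where h: "h \<in> Harm" "y0 \<in> VS n" "x = h + app Lap y0"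
      using comp xV by (auto simp: complements_def)
    \<comment> \<open>A second decomposition replaces \<open>y0\<close> by a vector \<open>z\<close>
      in the image of \<open>Lap\<close>. The harmonic vector D z found below is then in that image
      too.\<close>
    obtain h' y1 where h': "h' \<in> Harm" "y1 \<in> VS n" "y0 = h' + app Lap y1"
      using comp h(2) by (auto simp: complements_def)
    define z where "z = app Lap y1"
    have z: "z \<in> VS n" unfolding z_def by (rule presC(5)[OF h'(2)])
    have Lh': "app Lap h' = 0" using h'(1) by (simp add: Harm_def kernel_on_def)
    have x': "x = h + app Lap z" unfolding h(3) h'(3) z_def by (simp only: op_family_add Lh' add_0_left)
    define Dk where "Dk f = kk f + km f" for f
    define Dp where "Dp f = qq f + qm f" for f
    have D: "app D f = Dk f + Dp f" for f by (simp only: app_simps Dk_def Dp_def) (simp add: algebra_simps)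
    have lap: "app Lap f = Dk (Dk f) - Dp (Dp f)" if "f \<in> VS n" for f
      using that by (simp only: Dk_def Dp_def Lap_eq op_family_add r1 r2 r6 r7) (simp add: algebra_simps)
    have anti: "Dk (Dp f) = - Dp (Dk f)" if "f \<in> VS n" for f
      using that by (simp only: Dk_def Dp_def op_family_add r3 r4 r5 r8) (simp add: algebra_simps)
    have V: "Dk f \<in> VS n" "Dp f \<in> VS n" if "f \<in> VS n" for f using that by (simp_all only: Dk_def Dp_def pres VS_closed)
    have Dkadd: "Dk (f + g) = Dk f + Dk g" "Dp (f + g) = Dp f + Dp g" "Dk (- f) = - Dk f" "Dp (- f) = - Dp f" for f g
      by (simp_all only: Dk_def Dp_def op_family_add app_minus) (simp_all add: algebra_simps)
    have comm: "app Lap (Dk f) = Dk (app Lap f)" "app Lap (Dp f) = Dp (app Lap f)" if f: "f \<in> VS n" for f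
    proof -
      have pk: "Dp (Dk f) = - Dk (Dp f)" if "f \<in> VS n" for f using anti[OF that] by simp
      have "Dk (Dp (Dp f)) = Dp (Dp (Dk f))"
        by (simp only: anti V f Dkadd minus_minus)
      then show "app Lap (Dk f) = Dk (app Lap f)"
        unfolding lap[OF V(1)[OF f]] lap[OF f] using Dkadd(1)[of "Dk (Dk f)" "- Dp (Dp f)"] Dkadd(3)[of "Dp (Dp f)"] by simp
      have "Dp (Dk (Dk f)) = Dk (Dk (Dp f))"
        by (simp only: pk V f Dkadd minus_minus)
      then show "app Lap (Dp f) = Dp (app Lap f)"
        unfolding lap[OF V(2)[OF f]] lap[OF f] using Dkadd(2)[of "Dk (Dk f)" "- Dp (Dp f)"] Dkadd(4)[of "Dp (Dp f)"] by simp
    qed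
    have commD: "app Lap (app D f) = app D (app Lap f)" if "f \<in> VS n" for f
      unfolding D by (simp only: op_family_add[of _ Lap] comm that V)
    have "app D (app Lap z) = 0" using xD unfolding x' by (simp only: op_family_add[of _ D] HD[OF h(1)] add_0_left)
    then have "app Lap (app D z) = 0" by (simp only: commD[OF z])
    moreover have DzV: "app D z \<in> VS n" unfolding D by (simp only: V z VS_closed)
    ultimately have "app D z \<in> Harm" by (simp add: Harm_def kernel_on_def)
    moreover have "app D z = app Lap (app D y1)" unfolding z_def by (simp only: commD[OF h'(2)])
    \<comment> \<open>A harmonic vector in the image of the symmetric operator \<open>Lap\<close> is
      orthogonal to itself.\<close>
    ultimately have Dz: "app D z = 0"
    proof -
      assume H: "app D z \<in> Harm" and eq: "app D z = app Lap (app D y1)"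
      have "form (app D z) (app D z) = form (app D y1) (app Lap (app D z))"
        by (subst (1) eq) (rule adjD[OF adj_add[OF adj_mult[OF adj_C adj_sym[OF adj_C]] adj_mult[OF adj_sym[OF adj_C] adj_C]]])
      also have "\<dots> = 0" using H unfolding Harm_def kernel_on_def mem_Collect_eq by (metis form_0(2))
      finally show ?thesis using form_pos(2)[OF DzV] by blast
    qed
    then have Dpz: "Dp z = - Dk z" unfolding D by (simp only: eq_neg_iff_add_eq_0 add.commute)
    \<comment> \<open>From D z = 0 one gets D_p^2 z = - D_p D_k z = D_k D_p z, so D (D_k z) = D_k^2
      z - D_p^2 z, which is the Laplacian of z.\<close>
    have "app D (Dk z) = Dk (Dk z) - Dk (Dp z)"
      unfolding D anti[OF z] by simp
    also have "\<dots> = Dk (Dk z) - Dp (Dp z)"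
    proof -
      have "Dp (Dp z) = - Dp (Dk z)" by (simp only: Dpz Dkadd)
      then show ?thesis by (simp only: anti[OF z])
    qed
    finally have "app D (Dk z) = app Lap z" by (simp only: lap[OF z])
    then have "h - x = app D (- Dk z)" unfolding x' by (simp only: app_minus) simp
    then have 1: "h - x \<in> app D ` VS n" using V(1)[OF z] VS_closed(3) by blast
    moreover have "h - x \<in> ?Z" by (rule Z_diff) (use HZ h(1) x in auto)
    ultimately show ?thesis using h(1) by blast
  qed
qed (rule Harm_diff)

end

section \<open>Subquotients as modules over l\<close>

definition harm_module :: "(complex \<Rightarrow> 'm \<Rightarrow> 'm::ab_group_add) \<Rightarrow> ('l \<Rightarrow> 'm \<Rightarrow> 'm) \<Rightarrow> 'm set \<Rightarrow> ('l, 'm) lmod" where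
  "harm_module s act H = \<lparr>lm_carrier = H, lm_add = (+), lm_scale = s, lm_act = act\<rparr>"

lemma coset_image_add:
  fixes W :: "'m::ab_group_add set"
  assumes W: "0 \<in> W" "\<And>x y. x \<in> W \<Longrightarrow> y \<in> W \<Longrightarrow> x + y \<in> W"
    and f: "f ` W \<subseteq> W" "\<And>w. w \<in> W \<Longrightarrow> f (a + w) = f a + f w"
  shows "f ` (a +o W) + W = f a +o W"
proof (rule equalityI; rule subsetI)
  fix x assume "x \<in> f ` (a +o W) + W"
  then obtain w w' where w: "w \<in> W" "w' \<in> W" "x = f (a + w) + w'"
    by (auto simp: set_plus_def elt_set_plus_def)
  then have "f w + w' \<in> W" using W(2) f(1) by blast
  then show "x \<in> f a +o W" using w f(2) by (auto simp: elt_set_plus_def add.assoc)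
next
  fix x assume "x \<in> f a +o W"
  then obtain w where w: "w \<in> W" "x = f a + w" by (auto simp: elt_set_plus_def)
  have "f 0 = 0" using f(2)[OF W(1)] by (metis add.right_neutral add_left_cancel)
  then have "x = f (a + 0) + w" using w(2) by simp
  moreover have "a + 0 \<in> a +o W" using W(1) by (rule set_plus_intro2)
  ultimately show "x \<in> f ` (a +o W) + W" using w(1) by (blast intro: set_plus_intro)
qed

lemma coset_add:
  fixes W :: "'m::ab_group_add set"
  assumes W: "0 \<in> W" "\<And>x y. x \<in> W \<Longrightarrow> y \<in> W \<Longrightarrow> x + y \<in> W"
  shows "(a +o W) + (b +o W) = (a + b) +o W"
proof -
  have "W + W = W" using W by (auto simp: set_plus_def) (metis add.right_neutral)
  then show ?thesis by (simp add: set_plus_rearrange)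
qed

text \<open>Unique representatives make \<open>H\<close> a model of the quotient; through
  \<open>g\<close> they may live in another space, as for cochains. The conditions on
  \<open>s'\<close> and \<open>a'\<close> ensure that the set operations in
  \<open>subquotient\<close> map cosets to cosets.\<close>

lemma represents_iso:
  fixes g :: "'m::ab_group_add \<Rightarrow> 'n::ab_group_add" and U W :: "'n set"
  assumes rep: "represents (g ` H) U W" and inj: "inj_on g H"
    and W: "0 \<in> W" "\<And>x y. x \<in> W \<Longrightarrow> y \<in> W \<Longrightarrow> x - y \<in> W"
    and add: "\<And>x y. x \<in> H \<Longrightarrow> y \<in> H \<Longrightarrow> g (x + y) = g x + g y"
    and scale: "\<And>c x. x \<in> H \<Longrightarrow> g (s c x) = s' c (g x)"
    and act: "\<And>X x. X \<in> l \<Longrightarrow> x \<in> H \<Longrightarrow> g (a X x) = a' X (g x)"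
    and s': "\<And>c x w. x \<in> U \<Longrightarrow> w \<in> W \<Longrightarrow> s' c (x + w) = s' c x + s' c w" "\<And>c w. w \<in> W \<Longrightarrow> s' c w \<in> W"
    and a': "\<And>X x w. X \<in> l \<Longrightarrow> x \<in> U \<Longrightarrow> w \<in> W \<Longrightarrow> a' X (x + w) = a' X x + a' X w" "\<And>X w. X \<in> l \<Longrightarrow> w \<in> W \<Longrightarrow> a' X w \<in> W"
  shows "lmod_isomorphic l (harm_module s a H) (subquotient s' a' U W)"
proof -
  have Wneg: "- x \<in> W" if "x \<in> W" for x using W(2)[OF W(1) that] by simp
  have Wadd: "x + y \<in> W" if "x \<in> W" "y \<in> W" for x y using W(2)[OF that(1) Wneg[OF that(2)]] by simp
  have HU: "g x \<in> U" if "x \<in> H" for x using rep that by (auto simp: represents_def)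
  have uniq: "\<exists>!h. h \<in> A \<and> h \<in> g ` H" if "A \<in> cosets U W" for A using rep that by (auto simp: represents_def)
  have mem: "x \<in> x +o W" for x using set_plus_intro2[OF W(1), of x] by simp
  have coset_eq: "x +o W = y +o W" if "x - y \<in> W" for x y
  proof (rule equalityI; rule subsetI)
    show "z \<in> y +o W" if "z \<in> x +o W" for z
      using that Wadd[OF _ \<open>x - y \<in> W\<close>, of "z - x"] by (simp add: mem_coset)
    show "z \<in> x +o W" if "z \<in> y +o W" for z
      using that W(2)[OF _ \<open>x - y \<in> W\<close>, of "z - y"] by (simp add: mem_coset)
  qed
  define F where "F x = g x +o W" for x
  have "bij_betw F H (cosets U W)"
  proof (rule bij_betwI')
    fix x y assume xy: "x \<in> H" "y \<in> H"
    show "(F x = F y) = (x = y)"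
    proof
      assume "F x = F y"
      moreover have "F x \<in> cosets U W" using HU[OF xy(1)] by (auto simp: F_def cosets_def)
      ultimately have "g x = g y" using uniq[of "F x"] mem xy unfolding F_def by (metis imageI)
      then show "x = y" using inj xy by (auto simp: inj_on_def)
    qed simp
  next
    fix x assume "x \<in> H"
    then show "F x \<in> cosets U W" using HU by (auto simp: F_def cosets_def)
  next
    fix A assume A: "A \<in> cosets U W"
    then obtain x where x: "x \<in> U" "A = x +o W" by (auto simp: cosets_def)
    obtain h where "h \<in> H" "g h \<in> A" using uniq[OF A] by auto
    then show "\<exists>h\<in>H. A = F h"
      using coset_eq[of "g h" x] x by (auto simp: F_def mem_coset)
  qed
  moreover have "F (x + y) = F x + F y" if "x \<in> H" "y \<in> H" for x y
    using that by (simp add: F_def add coset_add[OF W(1) Wadd])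
  moreover have "F (s c x) = s' c ` F x + W" if "x \<in> H" for c x
    unfolding F_def scale[OF that]
    by (rule coset_image_add[symmetric]) (use W Wadd s' HU[OF that] in auto)
  moreover have "F (a X x) = a' X ` F x + W" if "X \<in> l" "x \<in> H" for X x
    unfolding F_def act[OF that]
    by (rule coset_image_add[symmetric]) (use W Wadd a' that HU[OF that(2)] in auto)
  ultimately show ?thesis
    unfolding lmod_isomorphic_def by (intro exI[of _ F]) (simp add: harm_module_def subquotient_def)
qed

text \<open>\<open>lmod\<close> is a bare record without module axioms; closure of the carrier is
  what inverting or twisting an isomorphism requires.\<close>

definition lmod_closed :: "'l set \<Rightarrow> ('l, 'm) lmod \<Rightarrow> bool" where
  "lmod_closed l M \<longleftrightarrow> (\<forall>x\<in>lm_carrier M. \<forall>y\<in>lm_carrier M. lm_add M x y \<in> lm_carrier M) \<and>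
     (\<forall>c. \<forall>x\<in>lm_carrier M. lm_scale M c x \<in> lm_carrier M) \<and>
     (\<forall>X\<in>l. \<forall>x\<in>lm_carrier M. lm_act M X x \<in> lm_carrier M)"

lemma lmod_isomorphic_trans:
  assumes "lmod_isomorphic l M N" "lmod_isomorphic l N R" shows "lmod_isomorphic l M R"
proof -
  obtain f where f: "bij_betw f (lm_carrier M) (lm_carrier N)"
    "\<forall>x\<in>lm_carrier M. \<forall>y\<in>lm_carrier M. f (lm_add M x y) = lm_add N (f x) (f y)"
    "\<forall>c. \<forall>x\<in>lm_carrier M. f (lm_scale M c x) = lm_scale N c (f x)"
    "\<forall>X\<in>l. \<forall>x\<in>lm_carrier M. f (lm_act M X x) = lm_act N X (f x)"
    using assms(1) unfolding lmod_isomorphic_def by blast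
  obtain g where g: "bij_betw g (lm_carrier N) (lm_carrier R)"
    "\<forall>x\<in>lm_carrier N. \<forall>y\<in>lm_carrier N. g (lm_add N x y) = lm_add R (g x) (g y)"
    "\<forall>c. \<forall>x\<in>lm_carrier N. g (lm_scale N c x) = lm_scale R c (g x)"
    "\<forall>X\<in>l. \<forall>x\<in>lm_carrier N. g (lm_act N X x) = lm_act R X (g x)"
    using assms(2) unfolding lmod_isomorphic_def by blast
  have fx: "f x \<in> lm_carrier N" if "x \<in> lm_carrier M" for x using f(1) that by (auto simp: bij_betw_def)
  show ?thesis
    unfolding lmod_isomorphic_def
    by (rule exI[of _ "g \<circ> f"]) (use bij_betw_trans[OF f(1) g(1)] f g fx in auto)
qed

lemma lmod_isomorphic_sym:
  assumes "lmod_isomorphic l M N" and cl: "lmod_closed l M" shows "lmod_isomorphic l N M"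
proof -
  obtain f where f: "bij_betw f (lm_carrier M) (lm_carrier N)"
    "\<forall>x\<in>lm_carrier M. \<forall>y\<in>lm_carrier M. f (lm_add M x y) = lm_add N (f x) (f y)"
    "\<forall>c. \<forall>x\<in>lm_carrier M. f (lm_scale M c x) = lm_scale N c (f x)"
    "\<forall>X\<in>l. \<forall>x\<in>lm_carrier M. f (lm_act M X x) = lm_act N X (f x)"
    using assms(1) unfolding lmod_isomorphic_def by blast
  let ?g = "inv_into (lm_carrier M) f"
  have g: "?g y \<in> lm_carrier M" "f (?g y) = y" if "y \<in> lm_carrier N" for y
    using f(1) that by (auto simp: bij_betw_def inv_into_into f_inv_into_f)
  have gf: "?g (f x) = x" if "x \<in> lm_carrier M" for x
    using f(1) that by (simp add: bij_betw_def)
  have "?g (lm_add N x y) = lm_add M (?g x) (?g y)" if "x \<in> lm_carrier N" "y \<in> lm_carrier N" for x y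
    using f(2) g that gf[of "lm_add M (?g x) (?g y)"] cl by (simp add: lmod_closed_def)
  moreover have "?g (lm_scale N c x) = lm_scale M c (?g x)" if "x \<in> lm_carrier N" for c x
    using f(3) g that gf[of "lm_scale M c (?g x)"] cl by (simp add: lmod_closed_def)
  moreover have "?g (lm_act N X x) = lm_act M X (?g x)" if "X \<in> l" "x \<in> lm_carrier N" for X x
    using f(4) g that gf[of "lm_act M X (?g x)"] cl by (simp add: lmod_closed_def)
  ultimately show ?thesis
    unfolding lmod_isomorphic_def by (intro exI[of _ ?g]) (use bij_betw_inv_into[OF f(1)] in auto)
qed

lemma lmod_isomorphic_twist:
  assumes "lmod_isomorphic l M N" and cl: "lmod_closed l M"
  shows "lmod_isomorphic l (twist \<kappa> M) (twist \<kappa> N)"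
proof -
  obtain f where f: "bij_betw f (lm_carrier M) (lm_carrier N)"
    "\<forall>x\<in>lm_carrier M. \<forall>y\<in>lm_carrier M. f (lm_add M x y) = lm_add N (f x) (f y)"
    "\<forall>c. \<forall>x\<in>lm_carrier M. f (lm_scale M c x) = lm_scale N c (f x)"
    "\<forall>X\<in>l. \<forall>x\<in>lm_carrier M. f (lm_act M X x) = lm_act N X (f x)"
    using assms(1) unfolding lmod_isomorphic_def by blast
  then show ?thesis
    unfolding lmod_isomorphic_def by (intro exI[of _ f]) (use cl in \<open>simp add: twist_def lmod_closed_def\<close>)
qed

lemma represents_image:
  fixes g :: "'m::ab_group_add \<Rightarrow> 'n::ab_group_add"
  assumes rep: "represents H U W" and M: "U \<subseteq> M" "W \<subseteq> M" "\<And>x y. x \<in> M \<Longrightarrow> y \<in> M \<Longrightarrow> x - y \<in> M"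
    and inj: "inj_on g M" and diff: "\<And>x y. x \<in> M \<Longrightarrow> y \<in> M \<Longrightarrow> g (x - y) = g x - g y"
  shows "represents (g ` H) (g ` U) (g ` W)"
  unfolding represents_def
proof (intro conjI ballI)
  have HU: "H \<subseteq> U" using rep by (simp add: represents_def)
  then show "g ` H \<subseteq> g ` U" by auto
  have iff: "g h \<in> g x +o g ` W \<longleftrightarrow> h \<in> x +o W" if "h \<in> M" "x \<in> M" for h x
    using that M by (simp add: mem_coset diff[symmetric] inj_on_image_mem_iff[OF inj])
  fix A assume "A \<in> cosets (g ` U) (g ` W)"
  then obtain x where x: "x \<in> U" "A = g x +o g ` W" by (auto simp: cosets_def)
  have "x +o W \<in> cosets U W" using x(1) by (auto simp: cosets_def)
  then have "\<exists>!h. h \<in> x +o W \<and> h \<in> H" using rep unfolding represents_def by blast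
  then obtain h where h: "h \<in> x +o W" "h \<in> H" "\<And>h'. h' \<in> x +o W \<Longrightarrow> h' \<in> H \<Longrightarrow> h' = h"
    by (elim ex1E) metis
  show "\<exists>!h. h \<in> A \<and> h \<in> g ` H"
  proof (rule ex1I[of _ "g h"])
    have xM: "x \<in> M" and HM: "\<And>h. h \<in> H \<Longrightarrow> h \<in> M" using x(1) HU M(1) by auto
    show "g h \<in> A \<and> g h \<in> g ` H" unfolding x(2) using iff[OF HM[OF h(2)] xM] h by blast
    fix y assume y: "y \<in> A \<and> y \<in> g ` H"
    then obtain h' where h': "h' \<in> H" "y = g h'" by blast
    then have "h' \<in> x +o W" using y iff[OF HM[OF h'(1)] xM] unfolding x(2) by blast
    then show "y = g h" using h(3) h' by blast
  qed
qed

section \<open>Unitary representations of K\<close>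

locale herm_space = vector_space sV for sV :: "complex \<Rightarrow> 'v::ab_group_add \<Rightarrow> 'v" +
  fixes ip :: "'v \<Rightarrow> 'v \<Rightarrow> complex"
  assumes ip_linear: "Vector_Spaces.linear sV (*) (\<lambda>v. ip v w)"
    and ip_herm: "ip w v = cnj (ip v w)"
    and ip_pos: "v \<noteq> 0 \<Longrightarrow> Re (ip v v) > 0"
begin

sublocale ipl: Vector_Spaces.linear sV "(*)" "\<lambda>v. ip v w" for w by (rule ip_linear)

lemma ip_add_right: "ip w (v + v') = ip w v + ip w v'" and ip_scale_right: "ip w (sV c v) = cnj c * ip w v"
  and ip_diff_right: "ip w (v - v') = ip w v - ip w v'" and ip_0_right [simp]: "ip w 0 = 0"
  by (simp_all add: ip_herm[of w] ipl.add ipl.scale ipl.diff ipl.zero)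

lemma ip_sum_right: "ip w (\<Sum>i\<in>A. f i) = (\<Sum>i\<in>A. ip w (f i))"
  by (induction A rule: infinite_finite_induct) (auto simp: ip_add_right)

lemma ip_self: "ip v v = of_real (Re (ip v v))"
  using ip_herm[of v v] by (metis Reals_cnj_iff complex_is_Real_iff of_real_Re)

text \<open>Gram-Schmidt in a space of arbitrary dimension. It serves finite-dimensional subspaces
  of V as well as \<open>u\<close> with the form \<open>h\<close>.\<close>

lemma orthonormal_basis:
  fixes e :: "nat \<Rightarrow> 'v"
  assumes "inj_on e {..<n}" "independent (e ` {..<n})"
  shows "\<exists>b. (\<forall>k<n. b k \<in> span (e ` {..<n})) \<and> (\<forall>i<n. \<forall>j<n. ip (b i) (b j) = (if i = j then 1 else 0)) \<and>
    (\<forall>x\<in>span (e ` {..<n}). x = (\<Sum>k<n. sV (ip x (b k)) (b k)))"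
  using assms
proof (induction n)
  case 0
  then show ?case by simp
next
  case (Suc n)
  let ?U = "span (e ` {..<n})"
  have ins: "e ` {..<Suc n} = insert (e n) (e ` {..<n})" by (auto simp: lessThan_Suc)
  have notin: "e n \<notin> e ` {..<n}" using inj_onD[OF Suc.prems(1), of n] by force
  have ind: "independent (e ` {..<n})" "e n \<notin> ?U"
    using Suc.prems(2) notin unfolding ins by (auto simp: independent_insert)
  obtain b where b: "\<And>k. k < n \<Longrightarrow> b k \<in> ?U" "\<And>i j. i < n \<Longrightarrow> j < n \<Longrightarrow> ip (b i) (b j) = (if i = j then 1 else 0)"
    "\<And>x. x \<in> ?U \<Longrightarrow> x = (\<Sum>k<n. sV (ip x (b k)) (b k))"
  proof -
    have "inj_on e {..<n}" by (rule inj_on_subset[OF Suc.prems(1)]) auto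
    from Suc.IH[OF this ind(1)] show ?thesis using that by blast
  qed
  define w where "w = e n - (\<Sum>k<n. sV (ip (e n) (b k)) (b k))"
  have sumU: "(\<Sum>k<n. sV (ip (e n) (b k)) (b k)) \<in> ?U" by (intro span_sum span_scale b(1)) auto
  have "w \<noteq> 0" using ind(2) sumU by (auto simp: w_def)
  define r where "r = sqrt (Re (ip w w))"
  have r: "r > 0" "r * r = Re (ip w w)" using ip_pos[OF \<open>w \<noteq> 0\<close>] by (auto simp: r_def)
  have bw: "ip (b k) w = 0" if k: "k < n" for k
  proof -
    have "ip (b k) (\<Sum>j<n. sV (ip (e n) (b j)) (b j)) = (\<Sum>j<n. cnj (ip (e n) (b j)) * ip (b k) (b j))"
      by (simp add: ip_sum_right ip_scale_right)
    also have "\<dots> = (\<Sum>j<n. if j = k then cnj (ip (e n) (b j)) else 0)"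
      by (intro sum.cong refl) (use k b(2) in auto)
    finally have "ip (b k) (\<Sum>j<n. sV (ip (e n) (b j)) (b j)) = (\<Sum>j<n. if j = k then cnj (ip (e n) (b j)) else 0)" .
    then show ?thesis using k by (simp add: w_def ip_diff_right ip_herm[of "b k" "e n"])
  qed
  define b' where "b' k = (if k < n then b k else sV (of_real (1 / r)) w)" for k
  have ww: "ip w w = of_real (r * r)" using ip_self[of w] r by simp
  have orth: "ip (b' i) (b' j) = (if i = j then 1 else 0)" if "i < Suc n" "j < Suc n" for i j
  proof -
    have "ip w (b j) = 0" if "j < n" for j using bw[OF that] ip_herm[of w "b j"] by simp
    then show ?thesis using that r b(2) bw
      by (auto simp: b'_def ipl.scale ip_scale_right less_Suc_eq ww)
  qed
  have old: "x = (\<Sum>k<Suc n. sV (ip x (b' k)) (b' k))" if x: "x \<in> ?U" for x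
  proof -
    have "ip x w = (\<Sum>k<n. ip x (b k) * ip (b k) w)"
      by (subst b(3)[OF x]) (simp add: ipl.sum ipl.scale)
    then have "ip x (b' n) = 0" by (simp add: b'_def ip_scale_right bw)
    then show ?thesis using b(3)[OF x] by (simp add: b'_def)
  qed
  have new: "e n = (\<Sum>k<Suc n. sV (ip (e n) (b' k)) (b' k))"
  proof -
    have "ip (e n) w = ip (w + (\<Sum>k<n. sV (ip (e n) (b k)) (b k))) w" by (simp add: w_def)
    also have "\<dots> = ip w w" by (simp add: ipl.add ipl.sum ipl.scale bw)
    finally have "ip (e n) (b' n) = of_real (1 / r) * of_real (r * r)" by (simp add: b'_def ip_scale_right ww)
    also have "\<dots> = of_real r" using r(1) by (simp add: field_simps)
    finally have "sV (ip (e n) (b' n)) (b' n) = sV (of_real r * of_real (1 / r)) w" by (simp add: b'_def)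
    also have "of_real r * of_real (1 / r) = (1 :: complex)" using r(1) by simp
    finally have "sV (ip (e n) (b' n)) (b' n) = w" by simp
    then show ?thesis by (simp add: b'_def w_def)
  qed
  have sub: "subspace {x. x = (\<Sum>k<Suc n. sV (ip x (b' k)) (b' k))}"
  proof (rule subspaceI)
    fix x y c assume x: "x \<in> {x. x = (\<Sum>k<Suc n. sV (ip x (b' k)) (b' k))}"
    then have x': "(\<Sum>k<Suc n. sV (ip x (b' k)) (b' k)) = x" by auto
    have "(\<Sum>k<Suc n. sV (ip (sV c x) (b' k)) (b' k)) = sV c (\<Sum>k<Suc n. sV (ip x (b' k)) (b' k))"
      by (simp only: ipl.scale scale_scale[symmetric] scale_sum_right)
    then show "sV c x \<in> {x. x = (\<Sum>k<Suc n. sV (ip x (b' k)) (b' k))}" unfolding x' by simp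
    assume y: "y \<in> {x. x = (\<Sum>k<Suc n. sV (ip x (b' k)) (b' k))}"
    then have y': "(\<Sum>k<Suc n. sV (ip y (b' k)) (b' k)) = y" by auto
    have "(\<Sum>k<Suc n. sV (ip (x + y) (b' k)) (b' k)) = x + y"
      unfolding ipl.add scale_left_distrib sum.distrib x' y' ..
    then show "x + y \<in> {x. x = (\<Sum>k<Suc n. sV (ip x (b' k)) (b' k))}" by simp
  qed (simp add: ipl.zero)
  have exp: "x = (\<Sum>k<Suc n. sV (ip x (b' k)) (b' k))" if "x \<in> span (e ` {..<Suc n})" for x
  proof -
    have "e ` {..<Suc n} \<subseteq> {x. x = (\<Sum>k<Suc n. sV (ip x (b' k)) (b' k))}"
      unfolding ins using new old span_base[of _ "e ` {..<n}"] by blast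
    from span_minimal[OF this sub] that show ?thesis by blast
  qed
  have mem: "b' k \<in> span (e ` {..<Suc n})" if "k < Suc n" for k
  proof -
    have mono: "?U \<subseteq> span (e ` {..<Suc n})" by (rule span_mono) auto
    have "w \<in> span (e ` {..<Suc n})"
      unfolding w_def by (intro span_diff) (use sumU mono in \<open>auto intro: span_base\<close>)
    then show ?thesis using b(1) mono by (auto simp: b'_def span_scale)
  qed
  show ?case using mem orth exp by (intro exI[of _ b']) auto
qed

lemma fin_dim_basis:
  assumes W: "subspace W" "fin_dim sV W"
  obtains b where "finite b" "independent b" "b \<subseteq> W" "span b = W" "dim W = card b"
proof -
  obtain B where B: "finite B" "W \<subseteq> span B" using W(2) by (auto simp: fin_dim_def)
  obtain b where b: "b \<subseteq> W" "independent b" "W \<subseteq> span b"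
    using maximal_independent_subset[of W] by blast
  have "finite b" using independent_span_bound[OF B(1) b(2)] b(1) B(2) by auto
  moreover have sp: "span b = W" using b W by (auto dest: span_minimal[of b W])
  moreover have "dim W = card b" by (rule dim_eq_card) (simp_all add: sp b(2) span_eq_iff[THEN iffD2, OF W(1)])
  ultimately show ?thesis using b that by blast
qed

lemma orth_projection:
  assumes Z: "subspace Z" "fin_dim sV Z"
  shows "\<exists>z\<in>Z. \<forall>x\<in>Z. ip (v - z) x = 0"
proof -
  obtain B where B: "finite B" "independent B" "span B = Z" by (rule fin_dim_basis[OF Z])
  obtain e where e: "bij_betw e {..<card B} B"
    using ex_bij_betw_nat_finite[OF B(1)] by (auto simp: atLeast0LessThan)
  then have eB: "e ` {..<card B} = B" "inj_on e {..<card B}" by (auto simp: bij_betw_def)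
  obtain b where b: "\<And>k. k < card B \<Longrightarrow> b k \<in> Z"
    "\<And>i j. i < card B \<Longrightarrow> j < card B \<Longrightarrow> ip (b i) (b j) = (if i = j then 1 else 0)"
    "\<And>x. x \<in> Z \<Longrightarrow> x = (\<Sum>k<card B. sV (ip x (b k)) (b k))"
    using orthonormal_basis[of e "card B"] eB B by metis
  define z where "z = (\<Sum>k<card B. sV (ip v (b k)) (b k))"
  have zb: "ip (v - z) (b j) = 0" if "j < card B" for j
  proof -
    have "ip z (b j) = (\<Sum>k<card B. ip v (b k) * ip (b k) (b j))"
      unfolding z_def by (simp add: ipl.sum ipl.scale)
    also have "\<dots> = (\<Sum>k<card B. if k = j then ip v (b k) else 0)"
      by (intro sum.cong refl) (use that b(2) in auto)
    finally have "ip z (b j) = (\<Sum>k<card B. if k = j then ip v (b k) else 0)" .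
    then show ?thesis using that by (simp add: ipl.diff)
  qed
  have "ip (v - z) x = 0" if "x \<in> Z" for x
    by (subst b(3)[OF that]) (simp add: ip_sum_right ip_scale_right zb)
  moreover have "z \<in> Z" unfolding z_def using Z(1) b(1) by (intro subspace_sum subspace_scale) auto
  ultimately show ?thesis by blast
qed

lemma fin_dim_subset: "fin_dim sV W \<Longrightarrow> Z \<subseteq> W \<Longrightarrow> fin_dim sV Z"
  by (auto simp: fin_dim_def)

lemma dim_less:
  assumes "subspace W" "fin_dim sV W" "subspace Z" "Z \<subset> W" shows "dim Z < dim W"
proof -
  have "fin_dim sV Z" using assms fin_dim_subset by blast
  then obtain b where b: "finite b" "independent b" "b \<subseteq> Z" "span b = Z" "dim Z = card b"
    using fin_dim_basis[OF assms(3)] by metis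
  obtain b' where b': "b \<subseteq> b'" "b' \<subseteq> W" "independent b'" "W \<subseteq> span b'"
    using maximal_independent_subset_extend[of b W] b assms(4) by blast
  obtain B where B: "finite B" "W \<subseteq> span B" using assms(2) by (auto simp: fin_dim_def)
  have fin: "finite b'" using independent_span_bound[OF B(1) b'(3)] b'(2) B(2) by auto
  have sp: "span b' = W" using b' assms(1) by (auto dest: span_minimal[of b' W])
  have "dim W = card b'" by (rule dim_eq_card) (simp_all add: sp b'(3) span_eq_iff[THEN iffD2, OF assms(1)])
  moreover have "b \<noteq> b'" using sp b(4) assms(4) by auto
  ultimately show ?thesis using b(5) b'(1) fin by (simp add: psubset_card_mono psubset_eq)
qed

end

locale unitary_K = herm_space sV ip for sV :: "complex \<Rightarrow> 'v::ab_group_add \<Rightarrow> 'v" and ip +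
  fixes K :: "'g set" and \<sigma> :: "'g \<Rightarrow> 'v \<Rightarrow> 'v"
  assumes \<sigma>_linear: "k \<in> K \<Longrightarrow> Vector_Spaces.linear sV sV (\<sigma> k)"
    and \<sigma>_inv: "k \<in> K \<Longrightarrow> \<exists>k'\<in>K. \<forall>v. \<sigma> k (\<sigma> k' v) = v \<and> \<sigma> k' (\<sigma> k v) = v"
    and \<sigma>_unitary: "k \<in> K \<Longrightarrow> ip (\<sigma> k v) (\<sigma> k w) = ip v w"
begin

lemma \<sigma>_zero: "k \<in> K \<Longrightarrow> \<sigma> k 0 = 0"
proof -
  assume "k \<in> K"
  then interpret l: Vector_Spaces.linear sV sV "\<sigma> k" by (rule \<sigma>_linear)
  show ?thesis by (rule l.zero)
qed

abbreviation "kstable \<equiv> stable_subspace sV K \<sigma>"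
abbreviation "kirred \<equiv> irreducible_subspace sV K \<sigma>"

lemma stable_span:
  assumes "\<And>k x. k \<in> K \<Longrightarrow> x \<in> A \<Longrightarrow> \<sigma> k x \<in> span A" shows "kstable (span A)"
proof -
  have "\<sigma> k x \<in> span A" if k: "k \<in> K" and x: "x \<in> span A" for k x
  proof -
    interpret l: Vector_Spaces.linear sV sV "\<sigma> k" by (rule \<sigma>_linear[OF k])
    show ?thesis using l.span_image[of A] span_minimal[of "\<sigma> k ` A" "span A"] assms[OF k] x by blast
  qed
  then show ?thesis by (simp add: stable_subspace_def)
qed

lemma stable_orth:
  assumes W: "kstable W" and Z: "kstable Z" shows "kstable {w \<in> W. \<forall>x\<in>Z. ip w x = 0}"
  unfolding stable_subspace_def
proof (intro conjI ballI)
  show "subspace {w \<in> W. \<forall>x\<in>Z. ip w x = 0}"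
    using W by (auto simp: stable_subspace_def subspace_def ipl.zero ipl.add ipl.scale)
  fix k w assume k: "k \<in> K" and w: "w \<in> {w \<in> W. \<forall>x\<in>Z. ip w x = 0}"
  obtain k' where k': "k' \<in> K" "\<And>v. \<sigma> k (\<sigma> k' v) = v" using \<sigma>_inv[OF k] by blast
  have "ip (\<sigma> k w) x = 0" if x: "x \<in> Z" for x
  proof -
    have "ip (\<sigma> k w) x = ip w (\<sigma> k' x)" using \<sigma>_unitary[OF k, of w "\<sigma> k' x"] by (simp add: k')
    then show ?thesis using w Z k'(1) x by (auto simp: stable_subspace_def)
  qed
  then show "\<sigma> k w \<in> {w \<in> W. \<forall>x\<in>Z. ip w x = 0}" using w W k by (auto simp: stable_subspace_def)
qed

text \<open>By unitarity the orthogonal complement of a stable subspace is stable, and in finite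
  dimension it is a complement; induction on the dimension does the rest.\<close>

lemma complete_reducibility:
  assumes "kstable W" "fin_dim sV W"
  shows "W \<subseteq> span (\<Union>{E. kirred E \<and> E \<subseteq> W})"
  using assms
proof (induction "dim W" arbitrary: W rule: less_induct)
  case less
  note W = less.prems
  have sW: "subspace W" using W by (simp add: stable_subspace_def)
  show ?case
  proof (cases "W = {0} \<or> kirred W")
    case True
    then show ?thesis
    proof
      assume "W = {0}"
      then show ?thesis by (auto simp: span_zero)
    next
      assume "kirred W"
      then show ?thesis by (intro subsetI span_base) auto
    qed
  next
    case False
    then obtain Z where Z: "kstable Z" "Z \<subseteq> W" "Z \<noteq> {0}" "Z \<noteq> W"
      using W by (auto simp: irreducible_subspace_def)
    have sZ: "subspace Z" "fin_dim sV Z" using Z W fin_dim_subset by (auto simp: stable_subspace_def)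
    define Y where "Y = {w \<in> W. \<forall>x\<in>Z. ip w x = 0}"
    have Y: "kstable Y" "Y \<subseteq> W" unfolding Y_def using stable_orth[OF W(1) Z(1)] by auto
    have sY: "subspace Y" "fin_dim sV Y" using Y W fin_dim_subset by (auto simp: stable_subspace_def)
    obtain z where z: "z \<in> Z" "z \<noteq> 0" using Z(3) subspace_0[OF sZ(1)] by auto
    have "z \<notin> Y"
      using z ip_pos[OF z(2)] unfolding Y_def by force
    then have "Y \<subset> W" using Y(2) z(1) Z(2) by auto
    then have IHY: "Y \<subseteq> span (\<Union>{E. kirred E \<and> E \<subseteq> Y})"
      using less.hyps[OF dim_less[OF sW W(2) sY(1)] Y(1) sY(2)] by blast
    have IHZ: "Z \<subseteq> span (\<Union>{E. kirred E \<and> E \<subseteq> Z})"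
      using less.hyps[OF dim_less[OF sW W(2) sZ(1)] Z(1) sZ(2)] Z by blast
    have mono: "span (\<Union>{E. kirred E \<and> E \<subseteq> X}) \<subseteq> span (\<Union>{E. kirred E \<and> E \<subseteq> W})" if "X \<subseteq> W" for X
      by (rule span_mono) (use that in blast)
    show ?thesis
    proof
      fix w assume w: "w \<in> W"
      obtain z where z: "z \<in> Z" "\<forall>x\<in>Z. ip (w - z) x = 0" using orth_projection[OF sZ] by blast
      have "w - z \<in> Y" using z w Z(2) subspace_diff[OF sW] by (auto simp: Y_def)
      then have "(w - z) + z \<in> span (\<Union>{E. kirred E \<and> E \<subseteq> W})"
        using IHY IHZ mono[OF Y(2)] mono[OF Z(2)] z(1) by (intro span_add) blast+
      then show "w \<in> span (\<Union>{E. kirred E \<and> E \<subseteq> W})" by simp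
    qed
  qed
qed

lemma irreducible_transport:
  assumes E: "kirred E" and iso: "K_isomorphic sV K \<sigma> E W" and W: "kstable W"
    and Z: "kstable Z" "Z \<subseteq> W" shows "Z = {0} \<or> Z = W"
proof -
  obtain f where f: "bij_betw f E W" "\<And>x y. x \<in> E \<Longrightarrow> y \<in> E \<Longrightarrow> f (x + y) = f x + f y"
    "\<And>c x. x \<in> E \<Longrightarrow> f (sV c x) = sV c (f x)" "\<And>k x. k \<in> K \<Longrightarrow> x \<in> E \<Longrightarrow> f (\<sigma> k x) = \<sigma> k (f x)"
    using iso by (auto simp: K_isomorphic_def)
  have sE: "kstable E" "subspace E" and sZ: "subspace Z"
    using E Z by (auto simp: irreducible_subspace_def stable_subspace_def)
  have f0: "f 0 = 0" using f(3)[of 0 0] subspace_0[OF sE(2)] by simp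
  define Y where "Y = {x \<in> E. f x \<in> Z}"
  have "kstable Y"
    using sE Z f f0 unfolding Y_def stable_subspace_def subspace_def by auto
  then have "Y = {0} \<or> Y = E" using E by (auto simp: irreducible_subspace_def Y_def)
  moreover have "Z = f ` Y" using f(1) Z(2) by (auto simp: Y_def bij_betw_def)
  ultimately show ?thesis using f(1) f0 by (auto simp: bij_betw_def)
qed

context
  fixes T :: "'v \<Rightarrow> 'v"
  assumes T: "Vector_Spaces.linear sV sV T" and TK: "\<And>k v. k \<in> K \<Longrightarrow> T (\<sigma> k v) = \<sigma> k (T v)"
    and adm: "admissible sV K \<sigma>"
begin

interpretation T: Vector_Spaces.linear sV sV T by (rule T)

text \<open>On a copy \<open>W\<close> of \<open>E\<close> the kernel of \<open>T\<close> is stable,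
  so \<open>T\<close> is 0 or injective there, and in the second case the image is another copy of
  \<open>E\<close>. Thus an equivariant operator preserves isotypic components, and admissibility
  makes these finite-dimensional.\<close>

lemma isotypic_good:
  assumes E: "kirred E" "fin_dim sV E"
  defines "Q \<equiv> isotypic_component sV K \<sigma> E"
  shows "kstable Q" "fin_dim sV Q" "E \<subseteq> Q" "T ` Q \<subseteq> Q"
proof -
  define SS where "SS = {W. kstable W \<and> K_isomorphic sV K \<sigma> E W}"
  have Q: "Q = span (\<Union>SS)" by (simp add: Q_def isotypic_component_def SS_def)
  show "fin_dim sV Q" using adm E by (simp add: admissible_def Q_def)
  show "kstable Q" unfolding Q
    by (rule stable_span) (auto simp: SS_def stable_subspace_def intro!: span_base)
  have "K_isomorphic sV K \<sigma> E E" unfolding K_isomorphic_def by (rule exI[of _ "\<lambda>x. x"]) (auto simp: bij_betw_def)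
  then have "E \<in> SS" using E by (simp add: SS_def irreducible_subspace_def)
  then show "E \<subseteq> Q" unfolding Q by (intro subsetI span_base) auto
  have "T ` W \<subseteq> Q" if W: "W \<in> SS" for W
  proof -
    have sW: "kstable W" "K_isomorphic sV K \<sigma> E W" "subspace W" using W by (auto simp: SS_def stable_subspace_def)
    define N where "N = {w \<in> W. T w = 0}"
    have "kstable N"
      using sW TK unfolding N_def stable_subspace_def subspace_def
      by (auto simp: T.zero T.add T.scale \<sigma>_zero)
    then have "N = {0} \<or> N = W" using irreducible_transport[OF E(1) sW(2,1)] by (auto simp: N_def)
    then show ?thesis
    proof
      assume "N = W"
      then have "T w = 0" if "w \<in> W" for w using that by (auto simp: N_def)
      then show ?thesis by (auto simp: Q span_zero)
    next
      assume N: "N = {0}"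
      have inj: "inj_on T W"
      proof (rule inj_onI)
        fix x y assume xy: "x \<in> W" "y \<in> W" "T x = T y"
        then have "x - y \<in> N" using subspace_diff[OF sW(3)] by (auto simp: N_def T.diff)
        then show "x = y" using N by simp
      qed
      have "kstable (T ` W)"
        unfolding stable_subspace_def
      proof (intro conjI ballI)
        show "subspace (T ` W)" by (rule T.subspace_image[OF sW(3)])
        fix k w assume "k \<in> K" "w \<in> T ` W"
        then show "\<sigma> k w \<in> T ` W" using sW(1) by (auto simp: stable_subspace_def TK[symmetric])
      qed
      moreover obtain f where f: "bij_betw f E W" "\<And>x y. x \<in> E \<Longrightarrow> y \<in> E \<Longrightarrow> f (x + y) = f x + f y"
        "\<And>c x. x \<in> E \<Longrightarrow> f (sV c x) = sV c (f x)" "\<And>k x. k \<in> K \<Longrightarrow> x \<in> E \<Longrightarrow> f (\<sigma> k x) = \<sigma> k (f x)"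
        using sW(2) by (auto simp: K_isomorphic_def)
      have "K_isomorphic sV K \<sigma> E (T ` W)"
        unfolding K_isomorphic_def
        by (rule exI[of _ "T \<circ> f"])
          (use bij_betw_trans[OF f(1) inj_on_imp_bij_betw[OF inj]] f in \<open>auto simp: T.add T.scale TK\<close>)
      ultimately have "T ` W \<in> SS" by (simp add: SS_def)
      then show ?thesis unfolding Q by (intro subsetI span_base) auto
    qed
  qed
  then have "T ` (\<Union>SS) \<subseteq> Q" by auto
  then have "span (T ` (\<Union>SS)) \<subseteq> Q" unfolding Q by (intro span_minimal) auto
  then show "T ` Q \<subseteq> Q" unfolding Q T.span_image[symmetric] .
qed

definition good :: "'v set \<Rightarrow> bool" where
  "good Y \<longleftrightarrow> kstable Y \<and> fin_dim sV Y \<and> T ` Y \<subseteq> Y"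

lemma good_join:
  assumes Q: "good Q" and Y: "good Y" shows "good (span (Q \<union> Y))"
proof -
  let ?V = "span (Q \<union> Y)"
  have sup: "Q \<subseteq> ?V" "Y \<subseteq> ?V" by (auto intro: span_base)
  have "kstable ?V"
    by (rule stable_span) (use Q Y sup in \<open>auto simp: stable_subspace_def good_def\<close>)
  moreover have "fin_dim sV ?V"
  proof -
    obtain B B' where B: "finite B" "Q \<subseteq> span B" "finite B'" "Y \<subseteq> span B'"
      using Q Y by (auto simp: fin_dim_def good_def)
    have "?V \<subseteq> span (B \<union> B')"
      by (rule span_minimal) (use B span_mono[of B "B \<union> B'"] span_mono[of B' "B \<union> B'"] in auto)
    then show ?thesis using B by (auto simp: fin_dim_def intro!: exI[of _ "B \<union> B'"])
  qed
  moreover have "T ` ?V \<subseteq> ?V"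
  proof -
    have "T ` (Q \<union> Y) \<subseteq> ?V" using Q Y sup unfolding good_def by blast
    then have "span (T ` (Q \<union> Y)) \<subseteq> ?V" by (intro span_minimal) auto
    then show ?thesis by (simp add: T.span_image)
  qed
  ultimately show ?thesis by (simp add: good_def)
qed

lemma good_0: "good {0}"
  by (auto simp: stable_subspace_def \<sigma>_zero good_def T.zero fin_dim_def intro!: exI[of _ "{}"])

text \<open>A vector in a finite-dimensional stable subspace is a finite combination of vectors from
  irreducible pieces; the isotypic components of these pieces are joined.\<close>

lemma good_subspace:
  assumes W: "kstable W" "fin_dim sV W" and v: "v \<in> W"
  shows "\<exists>V'. v \<in> V' \<and> good V'"
proof -
  have "v \<in> span (\<Union>{E. kirred E \<and> E \<subseteq> W})" using complete_reducibility[OF W] v by auto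
  then show ?thesis
  proof (induction rule: span_induct_alt)
    case base
    then show ?case using good_0 by blast
  next
    case (step c x y)
    obtain E where E: "kirred E" "E \<subseteq> W" "x \<in> E" using step(1) by auto
    let ?Q = "isotypic_component sV K \<sigma> E"
    note Q = isotypic_good[OF E(1) fin_dim_subset[OF W(2) E(2)]]
    have gQ: "good ?Q" using Q by (simp add: good_def)
    obtain Y where Y: "y \<in> Y" "good Y" using step(2) by blast
    have "sV c x + y \<in> span (?Q \<union> Y)"
      using E(3) Q(3) Y(1) by (intro span_add span_scale span_base) auto
    then show ?case using good_join[OF gQ Y(2)] by blast
  qed
qed

lemma good_finite:
  assumes fin: "finite A" and loc: "\<And>v. \<exists>W. v \<in> W \<and> kstable W \<and> fin_dim sV W"
  shows "\<exists>V'. A \<subseteq> V' \<and> good V'"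
  using fin
proof (induction A)
  case empty
  then show ?case using good_0 by blast
next
  case (insert v A)
  obtain W where "v \<in> W" "kstable W" "fin_dim sV W" using loc by blast
  then obtain Q where Q: "v \<in> Q" "good Q" using good_subspace by blast
  obtain Y where Y: "A \<subseteq> Y" "good Y" using insert by blast
  have "insert v A \<subseteq> span (Q \<union> Y)" using Q(1) Y(1) by (auto intro: span_base)
  then show ?case using good_join[OF Q(2) Y(2)] by blast
qed

end

end

section \<open>The complexified Lie algebra\<close>

lemma vector_space_cscale: "vector_space (cscale :: complex \<Rightarrow> 'e::real_vector \<times> 'e \<Rightarrow> 'e \<times> 'e)"
  by unfold_locales (auto simp: cscale_def algebra_simps scaleR_add_left)

interpretation cvs: vector_space "cscale :: complex \<Rightarrow> 'e::real_vector \<times> 'e \<Rightarrow> 'e \<times> 'e"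
  by (rule vector_space_cscale)

lemma cconj_simps [simp]:
  "cconj (cconj x) = x" "cconj (x + y) = cconj x + cconj y" "cconj (cscale c x) = cscale (cnj c) (cconj x)"
  "cconj 0 = 0" "cconj (- x) = - cconj x" "cconj (x - y) = cconj x - cconj y"
  by (auto simp: cconj_def cscale_def prod_eq_iff)

lemma linear_cscaleI:
  "(\<And>x y. f (x + y) = f x + f y) \<Longrightarrow> (\<And>c x. f (cscale c x) = cscale c (f x)) \<Longrightarrow> Vector_Spaces.linear cscale cscale f"
  by (simp add: Vector_Spaces.linear_iff vector_space_cscale)

lemma cmap_simps:
  assumes "linear f"
  shows "cmap f (x + y) = cmap f x + cmap f y" "cmap f (cscale c x) = cscale c (cmap f x)"
    "cmap f (cconj x) = cconj (cmap f x)"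
proof -
  interpret linear f by (rule assms)
  show "cmap f (x + y) = cmap f x + cmap f y" "cmap f (cscale c x) = cscale c (cmap f x)"
    "cmap f (cconj x) = cconj (cmap f x)"
    by (auto simp: cmap_def cconj_def cscale_def prod_eq_iff add diff scale neg)
qed

text \<open>A real basis is a complex basis of the complexification. Computed in it, the complex
  Killing form is the bilinear extension of the real one.\<close>

definition creal_basis :: "('e::euclidean_space \<times> 'e) set" where "creal_basis = (\<lambda>b. (b, 0)) ` Basis"

lemma creal_basis_sum:
  "(\<Sum>x\<in>creal_basis. cscale (g x) x) = ((\<Sum>b\<in>Basis. Re (g (b, 0)) *\<^sub>R b), (\<Sum>b\<in>Basis. Im (g (b, 0)) *\<^sub>R b))"
  unfolding creal_basis_def by (subst sum.reindex) (auto simp: inj_on_def cscale_def sum_prod)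

lemma finite_creal_basis: "finite creal_basis"
  by (simp add: creal_basis_def)

lemma independent_creal_basis: "cvs.independent (creal_basis :: ('e::euclidean_space \<times> 'e) set)"
proof (rule cvs.independent_if_scalars_zero[OF finite_creal_basis])
  fix g :: "'e \<times> 'e \<Rightarrow> complex" and x :: "'e \<times> 'e"
  assume 0: "(\<Sum>x\<in>creal_basis. cscale (g x) x) = 0" and "x \<in> creal_basis"
  then obtain b where b: "b \<in> Basis" "x = (b, 0)" by (auto simp: creal_basis_def)
  have "(\<Sum>b\<in>Basis. Re (g (b, 0)) *\<^sub>R b) \<bullet> b = 0" "(\<Sum>b\<in>Basis. Im (g (b, 0)) *\<^sub>R b) \<bullet> b = 0"
    using 0 unfolding creal_basis_sum by (auto simp: prod_eq_iff)
  then show "g x = 0" using b by (simp add: complex_eq_iff inner_sum_left_Basis)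
qed

lemma creal_basis_expand: "x = (\<Sum>b\<in>creal_basis. cscale (Complex (fst x \<bullet> fst b) (snd x \<bullet> fst b)) b)"
  by (simp add: creal_basis_sum euclidean_representation)

lemma span_creal_basis: "cvs.span (creal_basis :: ('e::euclidean_space \<times> 'e) set) = UNIV"
proof -
  have "x \<in> cvs.span creal_basis" for x :: "'e \<times> 'e"
    by (subst creal_basis_expand) (intro cvs.span_sum cvs.span_scale cvs.span_base)
  then show ?thesis by auto
qed

lemma representation_creal_basis:
  assumes "b \<in> creal_basis"
  shows "cvs.representation creal_basis x b = Complex (fst x \<bullet> fst b) (snd x \<bullet> fst b)"
proof -
  have "cvs.representation creal_basis x b
      = cvs.representation creal_basis (\<Sum>b\<in>creal_basis. cscale (Complex (fst x \<bullet> fst b) (snd x \<bullet> fst b)) b) b"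
    by (subst creal_basis_expand) (rule refl)
  also have "\<dots> = (\<Sum>b'\<in>creal_basis. Complex (fst x \<bullet> fst b') (snd x \<bullet> fst b') * (if b = b' then 1 else 0))"
    by (subst cvs.representation_sum)
      (auto simp: independent_creal_basis span_creal_basis cvs.representation_scale cvs.representation_basis intro!: sum.cong)
  also have "\<dots> = Complex (fst x \<bullet> fst b) (snd x \<bullet> fst b)"
    using assms by (simp add: finite_creal_basis sum.delta' mult.commute[of _ "if _ then _ else _"] if_distrib cong: if_cong)
  finally show ?thesis .
qed

locale real_lie = lie_algebra scaleR br for br :: "'e::euclidean_space \<Rightarrow> 'e \<Rightarrow> 'e"
begin

lemma real_basis: "finite (Basis :: 'e set)" "\<not> module.dependent (*\<^sub>R) (Basis :: 'e set)"
  "module.span (*\<^sub>R) (Basis :: 'e set) = UNIV"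
  using independent_Basis span_Basis by (simp_all add: dependent_raw_def[symmetric] span_raw_def[symmetric])

lemma br_linear_simps: "br (x + y) z = br x z + br y z" "br z (x + y) = br z x + br z y"
  "br (c *\<^sub>R x) z = c *\<^sub>R br x z" "br z (c *\<^sub>R x) = c *\<^sub>R br z x" "br (x - y) z = br x z - br y z"
  "br z (x - y) = br z x - br z y" "br (- x) z = - br x z" "br z (- x) = - br z x" "br 0 z = 0" "br z 0 = 0"
  by (simp_all add: brl.add brr.add brl.scale brr.scale brl.diff brr.diff brl.neg brr.neg brl.zero brr.zero)

sublocale c: lie_algebra cscale "cbr br"
proof (intro lie_algebra.intro lie_algebra_axioms.intro vector_space_cscale)
  fix x y z :: "'e \<times> 'e" and k :: complex
  show "Vector_Spaces.linear cscale cscale (\<lambda>x. cbr br x y)" "Vector_Spaces.linear cscale cscale (cbr br x)"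
    by (rule linear_cscaleI; simp add: cbr_def cscale_def br_linear_simps algebra_simps)+
  show "cbr br x x = 0" using br_anti[of "fst x" "snd x"] by (simp add: cbr_def br_self zero_prod_def)
  show "cbr br x (cbr br y z) + cbr br y (cbr br z x) + cbr br z (cbr br x y) = 0"
  proof -
    have j: "br a (br b c) = - br b (br c a) - br c (br a b)" for a b c
      using jacobi[of a b c] by (simp add: algebra_simps eq_neg_iff_add_eq_0)
    show ?thesis
      by (simp add: cbr_def br_linear_simps prod_eq_iff j[of "fst x"] j[of "snd x"])
  qed
qed

abbreviation "kl \<equiv> killing scaleR br"
abbreviation "ckl \<equiv> killing cscale (cbr br)"

lemmas kl_scale = killing_scale[OF real_basis]
  and kl_sym = killing_sym[OF real_basis]
  and kl_automorphism = killing_automorphism[OF real_basis]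

lemmas ckl_add = c.killing_add[OF finite_creal_basis independent_creal_basis span_creal_basis]
  and ckl_scale = c.killing_scale[OF finite_creal_basis independent_creal_basis span_creal_basis]
  and ckl_sym = c.killing_sym[OF finite_creal_basis independent_creal_basis span_creal_basis]
  and ckl_inv = c.killing_inv[OF finite_creal_basis independent_creal_basis span_creal_basis]

lemma ckl_real: "ckl (a, 0) (b, 0) = of_real (kl a b)"
proof -
  have l: "Vector_Spaces.linear cscale cscale (\<lambda>z. cbr br (a, 0) (cbr br (b, 0) z))"
    using Vector_Spaces.linear_compose[OF c.br_linear_right c.br_linear_right] by (simp add: comp_def)
  have l': "Vector_Spaces.linear (*\<^sub>R) (*\<^sub>R) (\<lambda>z. br a (br b z))"
    using Vector_Spaces.linear_compose[OF br_linear_right br_linear_right] by (simp add: comp_def)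
  have "ckl (a, 0) (b, 0) = (\<Sum>x\<in>creal_basis. cvs.representation creal_basis (cbr br (a, 0) (cbr br (b, 0) x)) x)"
    unfolding killing_def
    by (rule cvs.trace_on_eq[OF finite_creal_basis independent_creal_basis span_creal_basis l]) simp
  also have "\<dots> = (\<Sum>x\<in>creal_basis. of_real (br a (br b (fst x)) \<bullet> fst x))"
    by (intro sum.cong refl)
      (auto simp: representation_creal_basis, auto simp: creal_basis_def cbr_def br_linear_simps complex_eq_iff)
  also have "\<dots> = (\<Sum>x\<in>Basis. of_real (br a (br b x) \<bullet> x))"
    unfolding creal_basis_def by (subst sum.reindex) (auto simp: inj_on_def)
  also have "(\<Sum>x\<in>Basis. br a (br b x) \<bullet> x) = kl a b"
  proof -
    have "kl a b = (\<Sum>x\<in>Basis. module.representation (*\<^sub>R) Basis (br a (br b x)) x)"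
      unfolding killing_def by (rule trace_on_eq[OF real_basis l']) simp
    then show ?thesis by (simp flip: representation_raw_def add: representation_euclidean_space)
  qed
  then have "(\<Sum>x\<in>Basis. of_real (br a (br b x) \<bullet> x)) = (of_real (kl a b) :: complex)"
    by (simp flip: of_real_sum)
  finally show ?thesis .
qed

lemma ckl_eq: "ckl (a, b) (c, d) = of_real (kl a c - kl b d) + \<i> * of_real (kl a d + kl b c)"
proof -
  have d: "(x, y) = (x, 0) + cscale \<i> (y, 0)" for x y :: 'e by (simp add: cscale_def)
  have r: "ckl z (x + y) = ckl z x + ckl z y" "ckl z (cscale k x) = k * ckl z x" for x y z k
    using ckl_add[of x y z] ckl_scale[of k x z] by (simp_all add: ckl_sym[of z])
  show ?thesis
    by (subst d[of a b], subst d[of c d])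
      (simp add: ckl_add ckl_scale r ckl_real algebra_simps flip: mult.assoc)
qed

lemma ckl_cmap:
  assumes "\<And>x y. kl (f x) (f y) = kl x y" shows "ckl (cmap f x) (cmap f y) = ckl x y"
  by (cases x; cases y) (simp add: cmap_def ckl_eq assms)

lemma kl_minus: "kl (- x) y = - kl x y" "kl x (- y) = - kl x y"
  using kl_scale[of "- 1" x y] kl_scale[of "- 1" y x] by (simp_all add: kl_sym[of x])

lemma ckl_cconj: "ckl (cconj x) (cconj y) = cnj (ckl x y)"
  by (cases x; cases y; rule complex_eqI) (simp_all add: cconj_def ckl_eq kl_minus)

lemma cbr_cconj: "cbr br (cconj x) (cconj y) = cconj (cbr br x y)"
  by (simp add: cbr_def cconj_def br_linear_simps)

lemma cbr_cmap:
  assumes "linear f" "\<And>x y. f (br x y) = br (f x) (f y)"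
  shows "cbr br (cmap f x) (cmap f y) = cmap f (cbr br x y)"
proof -
  interpret linear f by (rule assms)
  show ?thesis by (simp add: cbr_def cmap_def assms(2)[symmetric] add diff)
qed

end

section \<open>Hermitian symmetric pairs and theta-stable parabolics\<close>

locale dirac_setting =
  fixes G :: "('g, 'e::euclidean_space) lie_group_data"
    and \<Theta> :: "'g \<Rightarrow> 'g" and \<theta> :: "'e \<Rightarrow> 'e" and K :: "'g set"
    and p_plus p_minus l u :: "('e \<times> 'e) set"
    and br :: "'e \<Rightarrow> 'e \<Rightarrow> 'e"
    and sV :: "complex \<Rightarrow> 'v::ab_group_add \<Rightarrow> 'v"
    and \<pi> :: "'e \<times> 'e \<Rightarrow> 'v \<Rightarrow> 'v" and \<sigma> :: "'g \<Rightarrow> 'v \<Rightarrow> 'v" and ip :: "'v \<Rightarrow> 'v \<Rightarrow> complex"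
    and n :: nat and e e' :: "nat \<Rightarrow> 'e \<times> 'e"
  assumes ss: "connected_semisimple_finite_center G" and br_def: "br = lg_br G"
    and gci: "global_cartan_involution G \<Theta> \<theta>" and K_def: "K = fixed_subgroup G \<Theta>"
    and hs: "hermitian_symmetric G K \<theta> p_plus p_minus"
    and par: "theta_stable_parabolic br \<theta> l u" and lk: "l \<subseteq> k_part \<theta>" and pu: "p_plus \<subseteq> u"
    and gK: "gK_module G K \<theta> sV \<pi> \<sigma>" and adm: "admissible sV K \<sigma>" and uni: "unitary_form K sV \<pi> \<sigma> ip"
    and basis: "basis_of cscale u n e" and dual: "dual_basis_of (ckilling br) (cconj ` u) n e e'"
begin

lemma lga: "lie_group_with_algebra G" using ss by (simp add: connected_semisimple_finite_center_def)

sublocale lg: lie_group_algebra G by unfold_locales (rule lga)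

sublocale rl: real_lie br
  using lga by (simp add: real_lie_def lie_group_with_algebra_def br_def)

abbreviation "B \<equiv> ckilling br"
abbreviation "cb \<equiv> cbr br"
abbreviation "th \<equiv> cmap \<theta>"
abbreviation "ub \<equiv> cconj ` u"
text \<open>The conjugation with respect to the compact real form k_0 + i p_0. It exchanges
  \<open>u\<close> and \<open>ub\<close> and links the Hermitian form on \<open>u\<close> to the
  Killing form.\<close>

abbreviation "J x \<equiv> th (cconj x)"

lemma ci: "cartan_involution br \<theta>" using gci by (simp add: global_cartan_involution_def br_def)

lemma \<theta>: "linear \<theta>" "\<theta> (\<theta> x) = x" "\<theta> (br x y) = br (\<theta> x) (\<theta> y)" "x \<noteq> 0 \<Longrightarrow> rl.kl x (\<theta> x) < 0"
  using ci by (auto simp: cartan_involution_def)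

lemma linear_raw: "linear f \<longleftrightarrow> Vector_Spaces.linear (*\<^sub>R) (*\<^sub>R) f"
  by (simp add: linear_def)

lemma kl_\<theta>: "rl.kl (\<theta> x) (\<theta> y) = rl.kl x y"
  by (rule rl.kl_automorphism[of \<theta> \<theta>]) (simp_all add: \<theta>(2,3) \<theta>(1)[unfolded linear_raw])

lemma th_add: "th (x + y) = th x + th y" and th_sc: "th (cscale c x) = cscale c (th x)"
  and th_cconj: "th (cconj x) = cconj (th x)"
  by (rule cmap_simps[OF \<theta>(1)])+

lemma th_th [simp]: "th (th x) = x"
  by (simp add: cmap_def prod_eq_iff \<theta>(2))

lemma th_linear: "Vector_Spaces.linear cscale cscale th"
  by (rule linear_cscaleI) (rule th_add th_sc)+

lemma th_0 [simp]: "th 0 = 0" using th_add[of 0 0] by simp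

lemma th_minus: "th (- x) = - th x" using th_add[of x "- x"] by (simp add: add_eq_0_iff)

lemma th_diff: "th (x - y) = th x - th y" using th_add[of x "- y"] by (simp add: th_minus)

lemma B_th: "B (th x) (th y) = B x y" by (rule rl.ckl_cmap) (rule kl_\<theta>)

lemma cb_th: "cb (th x) (th y) = th (cb x y)" by (rule rl.cbr_cmap) (use \<theta> in auto)

lemma J_J [simp]: "J (J x) = x" by (simp add: th_cconj)

lemma J_sc: "J (cscale c x) = cscale (cnj c) (J x)"
  by (simp add: th_sc)

lemma B_J: "B (J x) (J y) = cnj (B x y)" by (simp add: B_th rl.ckl_cconj)

lemma cb_J: "cb (J x) (J y) = J (cb x y)" by (simp add: cb_th rl.cbr_cconj)

lemma J_sum: "J (\<Sum>i\<in>A. f i) = (\<Sum>i\<in>A. J (f i))"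
  by (induction A rule: infinite_finite_induct) (auto simp: th_add)

lemma parab: "parabolic_with_levi cscale cb (l + u) l u" "cmap \<theta> ` (l + u) = l + u" "cconj ` l = l"
  "parabolic_with_levi cscale cb (l + ub) l ub" "u \<inter> ub = {0}"
  using par by (auto simp: theta_stable_parabolic_def)

lemma nilrad: "is_nilradical cscale cb (l + u) u" "is_nilradical cscale cb (l + ub) ub" "cvs.subspace l"
  using parab by (auto simp: parabolic_with_levi_def lie_subalgebra_def)

lemma ideal: "lie_ideal cscale cb (l + u) u" "lie_ideal cscale cb (l + ub) ub"
  using nilrad by (auto simp: is_nilradical_def)

lemma sub_u: "cvs.subspace u" and sub_ub: "cvs.subspace ub"
  using ideal by (auto simp: lie_ideal_def)

lemma in_sum: "x \<in> l \<Longrightarrow> x \<in> l + u" "x \<in> u \<Longrightarrow> x \<in> l + u" "x \<in> l \<Longrightarrow> x \<in> l + ub" "x \<in> ub \<Longrightarrow> x \<in> l + ub"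
proof -
  note 0 = cvs.subspace_0[OF nilrad(3)] cvs.subspace_0[OF sub_u] cvs.subspace_0[OF sub_ub]
  show "x \<in> l \<Longrightarrow> x \<in> l + u" "x \<in> l \<Longrightarrow> x \<in> l + ub" using set_plus_intro[of x l 0] 0 by simp_all
  show "x \<in> u \<Longrightarrow> x \<in> l + u" "x \<in> ub \<Longrightarrow> x \<in> l + ub" using set_plus_intro[of 0 l x] 0 by simp_all
qed

lemma cb_l_u: "X \<in> l \<Longrightarrow> y \<in> u \<Longrightarrow> cb X y \<in> u" and cb_l_ub: "X \<in> l \<Longrightarrow> y \<in> ub \<Longrightarrow> cb X y \<in> ub"
  and cb_u_u: "x \<in> u \<Longrightarrow> y \<in> u \<Longrightarrow> cb x y \<in> u" and cb_ub_ub: "x \<in> ub \<Longrightarrow> y \<in> ub \<Longrightarrow> cb x y \<in> ub"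
proof -
  have i: "\<And>x y. x \<in> l + u \<Longrightarrow> y \<in> u \<Longrightarrow> cb x y \<in> u" "\<And>x y. x \<in> l + ub \<Longrightarrow> y \<in> ub \<Longrightarrow> cb x y \<in> ub"
    using ideal unfolding lie_ideal_def by blast+
  show "X \<in> l \<Longrightarrow> y \<in> u \<Longrightarrow> cb X y \<in> u" by (rule i(1)[OF in_sum(1)])
  show "X \<in> l \<Longrightarrow> y \<in> ub \<Longrightarrow> cb X y \<in> ub" by (rule i(2)[OF in_sum(3)])
  show "x \<in> u \<Longrightarrow> y \<in> u \<Longrightarrow> cb x y \<in> u" by (rule i(1)[OF in_sum(2)])
  show "x \<in> ub \<Longrightarrow> y \<in> ub \<Longrightarrow> cb x y \<in> ub" by (rule i(2)[OF in_sum(4)])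
qed

lemma th_commutator: "lie_commutator cscale cb (th ` A) (th ` C) = th ` lie_commutator cscale cb A C"
proof -
  interpret t: Vector_Spaces.linear cscale cscale th by (rule th_linear)
  have "{cb x y | x y. x \<in> th ` A \<and> y \<in> th ` C} = th ` {cb x y | x y. x \<in> A \<and> y \<in> C}"
  proof (rule equalityI; rule subsetI)
    fix z assume "z \<in> {cb x y | x y. x \<in> th ` A \<and> y \<in> th ` C}"
    then obtain a c where "a \<in> A" "c \<in> C" "z = cb (th a) (th c)" by blast
    then have "a \<in> A" "c \<in> C" "z = th (cb a c)" by (simp_all only: cb_th)
    then show "z \<in> th ` {cb x y | x y. x \<in> A \<and> y \<in> C}" by blast
  next
    fix z assume "z \<in> th ` {cb x y | x y. x \<in> A \<and> y \<in> C}"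
    then obtain a c where "a \<in> A" "c \<in> C" "z = cb (th a) (th c)" unfolding cb_th by blast
    then show "z \<in> {cb x y | x y. x \<in> th ` A \<and> y \<in> th ` C}" by blast
  qed
  then show ?thesis by (simp add: lie_commutator_def t.span_image)
qed

text \<open>\<theta> preserves l + u, so it maps \<open>u\<close> to a nilpotent ideal of l + u, and
  \<open>u\<close> is the largest one.\<close>

lemma th_u: assumes "x \<in> u" shows "th x \<in> u"
proof -
  interpret t: Vector_Spaces.linear cscale cscale th by (rule th_linear)
  have "lie_ideal cscale cb (l + u) (th ` u)"
    unfolding lie_ideal_def
  proof (intro conjI ballI)
    show "cvs.subspace (th ` u)" by (rule t.subspace_image[OF sub_u])
    show "th ` u \<subseteq> l + u" using parab(2) in_sum(2) by blast
    fix x y assume "x \<in> l + u" "y \<in> th ` u"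
    then obtain x' y' where "x' \<in> l + u" "x = th x'" "y' \<in> u" "y = th y'" using parab(2) by blast
    then show "cb x y \<in> th ` u" using ideal(1) by (auto simp: cb_th lie_ideal_def)
  qed
  moreover have "lie_nilpotent cscale cb (th ` u)"
  proof -
    obtain k where k: "(lie_commutator cscale cb u ^^ k) u = {0}"
      using nilrad(1) by (auto simp: is_nilradical_def lie_nilpotent_def)
    have "(lie_commutator cscale cb (th ` u) ^^ k) (th ` u) = th ` ((lie_commutator cscale cb u ^^ k) u)" for k
      by (induction k) (simp_all add: th_commutator)
    then show ?thesis unfolding lie_nilpotent_def by (intro exI[of _ k]) (simp add: k)
  qed
  ultimately have "th ` u \<subseteq> u" using nilrad(1) by (simp add: is_nilradical_def)
  then show ?thesis using assms by auto
qed

lemma J_ub: "y \<in> ub \<Longrightarrow> J y \<in> u"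
  using th_u by (auto simp: th_cconj)

lemma e_in: "i < n \<Longrightarrow> e i \<in> u" and e'_in: "i < n \<Longrightarrow> e' i \<in> ub"
  and B_dual: "i < n \<Longrightarrow> j < n \<Longrightarrow> B (e i) (e' j) = (if i = j then 1 else 0)"
  using basis dual cvs.span_base[of _ "e ` {..<n}"] by (auto simp: basis_of_def dual_basis_of_def)

lemma e_basis: "inj_on e {..<n}" "cvs.independent (e ` {..<n})" "cvs.span (e ` {..<n}) = u"
  using basis by (auto simp: basis_of_def)

lemma B_add_right: "B z (x + y) = B z x + B z y" and B_sc_right: "B z (cscale c x) = c * B z x"
  using rl.ckl_add[of x y z] rl.ckl_scale[of c x z] by (simp_all add: rl.ckl_sym[of z])

lemma B_0 [simp]: "B 0 z = 0" "B z 0 = 0"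
  using rl.ckl_scale[of 0 0 z] rl.ckl_sym[of z 0] by simp_all

lemma B_sum: "B (\<Sum>i\<in>A. f i) z = (\<Sum>i\<in>A. B (f i) z)"
  by (induction A rule: infinite_finite_induct) (auto simp: rl.ckl_add)

lemma B_minus: "B (- x) z = - B x z" "B z (- x) = - B z x"
  using rl.ckl_add[of x "- x" z] B_add_right[of z x "- x"] by (simp_all add: add_eq_0_iff)

lemma u_expand: assumes "x \<in> u" shows "(\<Sum>i<n. cscale (B x (e' i)) (e i)) = x"
proof -
  have "x \<in> cvs.span (e ` {..<n})" using assms e_basis by simp
  then have "(\<Sum>v\<in>e ` {..<n}. cscale (cvs.representation (e ` {..<n}) x v) v) = x"
    by (intro cvs.sum_representation_eq e_basis(2)) auto
  then have x: "x = (\<Sum>i<n. cscale (cvs.representation (e ` {..<n}) x (e i)) (e i))"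
    by (simp add: sum.reindex[OF e_basis(1)])
  have "B x (e' i) = cvs.representation (e ` {..<n}) x (e i)" if "i < n" for i
  proof -
    have "B x (e' i) = (\<Sum>j<n. cvs.representation (e ` {..<n}) x (e j) * B (e j) (e' i))"
      by (subst x) (simp add: B_sum rl.ckl_scale)
    also have "\<dots> = (\<Sum>j<n. if j = i then cvs.representation (e ` {..<n}) x (e j) else 0)"
      by (intro sum.cong refl) (use that B_dual in auto)
    finally show ?thesis using that by simp
  qed
  then show ?thesis using x by simp
qed

lemma representation_e:
  assumes "x \<in> u" "i < n" shows "cvs.representation (e ` {..<n}) x (e i) = B x (e' i)"
proof -
  have "cvs.representation (e ` {..<n}) x (e i)
      = cvs.representation (e ` {..<n}) (\<Sum>j<n. cscale (B x (e' j)) (e j)) (e i)" by (simp add: u_expand assms)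
  also have "\<dots> = (\<Sum>j<n. B x (e' j) * (if e j = e i then 1 else 0))"
    by (subst cvs.representation_sum)
      (auto simp: e_basis cvs.representation_scale cvs.representation_basis e_in cvs.subspace_scale[OF sub_u] intro!: sum.cong)
  also have "\<dots> = (\<Sum>j<n. if j = i then B x (e' j) else 0)"
    using e_basis(1) assms(2) by (intro sum.cong refl) (auto simp: inj_on_def)
  finally show ?thesis using assms(2) by simp
qed

definition h :: "'e \<times> 'e \<Rightarrow> 'e \<times> 'e \<Rightarrow> complex" where "h = u_form br \<theta>"

lemma h_eq: "h x y = - 2 * B x (J y)" by (simp add: h_def u_form_def)

lemma h_herm: "h y x = cnj (h x y)"
proof -
  have "cnj (B x (J y)) = B (J x) (J (J y))" by (simp only: B_J)
  then show ?thesis by (simp add: h_eq rl.ckl_sym[of y])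
qed

text \<open>For x = a + i b the real part is -2 times the sum of the real Killing forms of a with
  \<theta> a and of b with \<theta> b. Neither is positive, and for x other than 0 one of them is
  negative.\<close>

lemma h_pos: assumes "x \<noteq> 0" shows "Re (h x x) > 0"
proof -
  obtain a b where x: "x = (a, b)" by (cases x)
  have m: "\<theta> (- b) = - \<theta> b" by (rule linear_neg[OF \<theta>(1)])
  have J: "J x = (\<theta> a, - \<theta> b)" by (simp add: x cmap_def cconj_def m)
  have "Re (h x x) = - 2 * (rl.kl a (\<theta> a) + rl.kl b (\<theta> b))"
    by (simp only: h_eq J) (simp add: x rl.ckl_eq rl.kl_minus)
  moreover have le: "rl.kl v (\<theta> v) \<le> 0" for v
    using \<theta>(4)[of v] rl.kl_scale[of 0 0 "\<theta> 0"] by (cases "v = 0") auto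
  moreover have "rl.kl a (\<theta> a) < 0 \<or> rl.kl b (\<theta> b) < 0"
    using assms x \<theta>(4)[of a] \<theta>(4)[of b] by (auto simp: zero_prod_def)
  ultimately have eq: "Re (h x x) = - 2 * (rl.kl a (\<theta> a) + rl.kl b (\<theta> b))"
    and neg: "rl.kl a (\<theta> a) < 0 \<or> rl.kl b (\<theta> b) < 0" by blast+
  from neg have "rl.kl a (\<theta> a) + rl.kl b (\<theta> b) < 0"
  proof
    assume "rl.kl a (\<theta> a) < 0"
    then show ?thesis using le[of b] by (rule add_neg_nonpos)
  next
    assume "rl.kl b (\<theta> b) < 0"
    with le[of a] show ?thesis by (rule add_nonpos_neg)
  qed
  then show ?thesis unfolding eq by simp
qed

text \<open>Duality alone does not say that the \<open>e'\<close> span \<open>ub\<close>. The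
  remainder pairs to 0 with all of \<open>u\<close>, in particular with its own image under
  \<open>J\<close>, and positivity of \<open>h\<close> makes it 0.\<close>

lemma ub_expand: assumes "y \<in> ub" shows "(\<Sum>i<n. cscale (B y (e i)) (e' i)) = y"
proof -
  define z where "z = y - (\<Sum>i<n. cscale (B y (e i)) (e' i))"
  have z: "z \<in> ub" unfolding z_def
    using assms e'_in by (intro cvs.subspace_diff[OF sub_ub] cvs.subspace_sum[OF sub_ub] cvs.subspace_scale[OF sub_ub]) auto
  have ze: "B z (e j) = 0" if "j < n" for j
  proof -
    have "B (\<Sum>i<n. cscale (B y (e i)) (e' i)) (e j) = (\<Sum>i<n. B y (e i) * B (e j) (e' i))"
      by (simp add: B_sum rl.ckl_scale rl.ckl_sym[of "e j"])
    also have "\<dots> = (\<Sum>i<n. if i = j then B y (e i) else 0)"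
      by (intro sum.cong refl) (use that B_dual in auto)
    finally have "B (\<Sum>i<n. cscale (B y (e i)) (e' i)) (e j) = B y (e j)" using that by simp
    then show ?thesis using rl.ckl_add[of z "\<Sum>i<n. cscale (B y (e i)) (e' i)" "e j"] by (simp add: z_def)
  qed
  have "B z x = 0" if "x \<in> u" for x
  proof -
    have "B z x = B (\<Sum>i<n. cscale (B x (e' i)) (e i)) z" by (simp add: u_expand[OF that] rl.ckl_sym[of z])
    also have "\<dots> = (\<Sum>i<n. B x (e' i) * B z (e i))" by (simp add: B_sum rl.ckl_scale rl.ckl_sym[of "e _" z])
    also have "\<dots> = 0" by (simp add: ze)
    finally show ?thesis .
  qed
  from this[OF J_ub[OF z]] have "h (J z) (J z) = 0"
    unfolding h_eq J_J rl.ckl_sym[of "J z" z] by simp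
  then have "J z = 0" using h_pos[of "J z"] by (cases "J z = 0") auto
  then have "z = 0" using J_J[of z] by simp
  then show ?thesis by (simp add: z_def)
qed

lemma e'_basis: "inj_on e' {..<n}" "cvs.independent (e' ` {..<n})" "cvs.span (e' ` {..<n}) = ub"
proof -
  show inj: "inj_on e' {..<n}"
  proof (rule inj_onI)
    fix i j assume "i \<in> {..<n}" "j \<in> {..<n}" "e' i = e' j"
    then show "i = j" using B_dual[of i i] B_dual[of i j] by (auto split: if_splits)
  qed
  show "cvs.independent (e' ` {..<n})"
  proof (rule cvs.independent_if_scalars_zero)
    fix g x assume 0: "(\<Sum>x\<in>e' ` {..<n}. cscale (g x) x) = 0" and "x \<in> e' ` {..<n}"
    then obtain j where j: "j < n" "x = e' j" by auto
    have "0 = B (\<Sum>i<n. cscale (g (e' i)) (e' i)) (e j)" using 0 by (simp add: sum.reindex[OF inj])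
    also have "\<dots> = (\<Sum>i<n. g (e' i) * B (e j) (e' i))" by (simp add: B_sum rl.ckl_scale rl.ckl_sym[of "e j"])
    also have "\<dots> = (\<Sum>i<n. if i = j then g (e' i) else 0)" by (intro sum.cong refl) (use j B_dual in auto)
    finally show "g x = 0" using j by simp
  qed simp
  show "cvs.span (e' ` {..<n}) = ub"
  proof
    show "cvs.span (e' ` {..<n}) \<subseteq> ub" by (rule cvs.span_minimal) (use e'_in sub_ub in auto)
    show "ub \<subseteq> cvs.span (e' ` {..<n})"
    proof
      fix y assume "y \<in> ub"
      from ub_expand[OF this, symmetric] show "y \<in> cvs.span (e' ` {..<n})"
        by (metis (no_types, lifting) cvs.span_sum cvs.span_scale cvs.span_base image_eqI)
    qed
  qed
qed

lemma trace_ub: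
  assumes "\<And>y. y \<in> ub \<Longrightarrow> cb X y \<in> ub"
  shows "trace_on cscale ub (cb X) = (\<Sum>j<n. B (cb X (e' j)) (e j))"
  by (rule cvs.trace_on_coord[OF e'_basis, of _ "\<lambda>i x. B x (e i)"])
    (simp_all add: rl.c.br_linear_right assms ub_expand)

lemma tr_ub: assumes "z \<in> ub" shows "(\<Sum>j<n. B (cb z (e' j)) (e j)) = 0"
proof -
  have "trace_on cscale ub (cb z) = 0"
    by (rule rl.c.nilpotent_trace[OF finite_creal_basis span_creal_basis _ _ assms])
      (use sub_ub cb_ub_ub nilrad(2) in \<open>auto simp: lie_subalgebra_def is_nilradical_def\<close>)
  then show ?thesis using trace_ub cb_ub_ub assms by simp
qed

definition pp :: "'e \<times> 'e \<Rightarrow> 'e \<times> 'e" where "pp x = cscale (1/2) (x - th x)"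

lemma hsd: "cvs.subspace p_plus" "cvs.subspace p_minus" "p_plus + p_minus = p_part \<theta>"
  "x \<in> p_plus \<Longrightarrow> y \<in> p_plus \<Longrightarrow> cb x y = 0" "x \<in> p_minus \<Longrightarrow> y \<in> p_minus \<Longrightarrow> cb x y = 0"
  "p_minus = cconj ` p_plus" "lie_ideal cscale cb (k_part \<theta> + p_plus) p_plus"
proof -
  show "cvs.subspace p_plus" "cvs.subspace p_minus"
    using hs unfolding hermitian_symmetric_def lie_subalgebra_def by iprover+
  show "p_plus + p_minus = p_part \<theta>" "p_minus = cconj ` p_plus"
    using hs unfolding hermitian_symmetric_def by iprover+
  have ab: "\<forall>x\<in>p_plus. \<forall>y\<in>p_plus. cbr (lg_br G) x y = 0" "\<forall>x\<in>p_minus. \<forall>y\<in>p_minus. cbr (lg_br G) x y = 0"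
    using hs unfolding hermitian_symmetric_def by iprover+
  show "x \<in> p_plus \<Longrightarrow> y \<in> p_plus \<Longrightarrow> cb x y = 0" "x \<in> p_minus \<Longrightarrow> y \<in> p_minus \<Longrightarrow> cb x y = 0"
    using ab unfolding br_def by blast+
  show "lie_ideal cscale cb (k_part \<theta> + p_plus) p_plus"
    using hs unfolding hermitian_symmetric_def parabolic_with_levi_def is_nilradical_def br_def
    by iprover
qed

lemma Ad_p: "k \<in> K \<Longrightarrow> x \<in> p_plus \<Longrightarrow> cmap (Ad G k) x \<in> p_plus"
  "k \<in> K \<Longrightarrow> x \<in> p_minus \<Longrightarrow> cmap (Ad G k) x \<in> p_minus"
proof -
  have "\<forall>k\<in>K. cmap (Ad G k) ` p_plus \<subseteq> p_plus \<and> cmap (Ad G k) ` p_minus \<subseteq> p_minus"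
    using hs unfolding hermitian_symmetric_def by iprover
  then show "k \<in> K \<Longrightarrow> x \<in> p_plus \<Longrightarrow> cmap (Ad G k) x \<in> p_plus"
    "k \<in> K \<Longrightarrow> x \<in> p_minus \<Longrightarrow> cmap (Ad G k) x \<in> p_minus" by blast+
qed

lemma half: "cscale (1/2) (x + x) = x"
  using cvs.scale_left_distrib[of "1/2" "1/2" x] by (simp add: cvs.scale_right_distrib)

lemma th_pp: "th (pp x) = - pp x" and pp_pp: "pp (pp x) = pp x"
  and th_eq: "th x = (x - pp x) - pp x"
proof -
  show 1: "th (pp x) = - pp x" for x
    by (simp add: pp_def th_sc th_diff flip: cvs.scale_minus_right)
  have "pp (pp x) = cscale (1/2) (pp x + pp x)" by (subst pp_def) (simp add: 1)
  then show "pp (pp x) = pp x" by (simp add: half)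
  have "pp x + pp x = x - th x" using half[of "x - th x"] by (simp add: pp_def cvs.scale_right_distrib)
  then show "th x = (x - pp x) - pp x" by (simp add: algebra_simps)
qed

lemma pp_add: "pp (x + y) = pp x + pp y" and pp_sc: "pp (cscale c x) = cscale c (pp x)"
  and pp_cconj: "pp (cconj x) = cconj (pp x)"
  by (simp_all add: pp_def th_add th_sc th_cconj cvs.scale_right_distrib cvs.scale_right_diff_distrib algebra_simps)

lemma B_pp: "B (pp x) y = B x (pp y)"
proof -
  have "B (th x) y = B x (th y)" using B_th[of x "th y"] by simp
  then show ?thesis
    using rl.ckl_add[of x "- th x" y] B_add_right[of x y "- th y"]
    by (simp add: pp_def rl.ckl_scale B_sc_right B_minus)
qed

text \<open>The decisive use of \<open>p_plus\<close> being contained in \<open>u\<close>: the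
  projection of an element of \<open>u\<close> lies in \<open>u\<close> because \<theta> preserves
  \<open>u\<close>, so its component in \<open>p_minus\<close> lies both in \<open>u\<close> and in
  the conjugate of \<open>u\<close>, which meet only in 0.\<close>

lemma pp_u_in: assumes "x \<in> u" shows "pp x \<in> p_plus"
proof -
  have "pp x \<in> u" unfolding pp_def using assms th_u by (intro cvs.subspace_scale[OF sub_u] cvs.subspace_diff[OF sub_u])
  moreover have "pp x \<in> p_plus + p_minus" by (simp add: hsd(3) p_part_def th_pp)
  then obtain a b where ab: "a \<in> p_plus" "b \<in> p_minus" "pp x = a + b" by (elim set_plus_elim)
  ultimately have "b \<in> u" using cvs.subspace_diff[OF sub_u, of "pp x" a] pu by auto
  moreover have "b \<in> ub" using ab(2) hsd(6) pu by auto
  ultimately have "b = 0" using parab(5) by auto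
  then show ?thesis using ab by simp
qed

lemma pp_ub_in: "y \<in> ub \<Longrightarrow> pp y \<in> p_minus"
  using pp_u_in hsd(6) by (auto simp: pp_cconj)

lemma pm_ub: "p_minus \<subseteq> ub" using hsd(6) pu by auto

lemma kp_k: "x - pp x \<in> k_part \<theta>"
proof -
  have "th (x - pp x) = th x + pp x" by (simp add: th_diff th_pp)
  also have "\<dots> = x - pp x" by (subst th_eq) simp
  finally show ?thesis by (simp add: k_part_def)
qed

lemma k_cconj: "x \<in> k_part \<theta> \<Longrightarrow> cconj x \<in> k_part \<theta>" by (simp add: k_part_def th_cconj)

lemma k_p_plus: assumes "x \<in> k_part \<theta>" "y \<in> p_plus" shows "cb x y \<in> p_plus"
proof -
  have "x + 0 \<in> k_part \<theta> + p_plus" using assms(1) cvs.subspace_0[OF hsd(1)] by (rule set_plus_intro)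
  then show ?thesis using hsd(7) assms(2) by (simp add: lie_ideal_def)
qed

text \<open>The Hermitian hypothesis states normalization by k for \<open>p_plus\<close>; complex
  conjugation carries it over to \<open>p_minus\<close>.\<close>

lemma k_p_minus: assumes "x \<in> k_part \<theta>" "y \<in> p_minus" shows "cb x y \<in> p_minus"
proof -
  obtain z where z: "z \<in> p_plus" "y = cconj z" using assms(2) hsd(6) by auto
  have "cb x y = cconj (cb (cconj x) z)" using rl.cbr_cconj[of "cconj x" z] z by simp
  then show ?thesis using k_p_plus[OF k_cconj[OF assms(1)] z(1)] hsd(6) by auto
qed

lemma pp_k: assumes "x \<in> k_part \<theta>" shows "pp (cb x y) = cb x (pp y)"
proof -
  have "th (cb x y) = cb x (th y)" using cb_th[of x y] assms by (simp add: k_part_def)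
  then show ?thesis by (simp add: pp_def rl.c.brr.scale rl.c.brr.diff)
qed

sublocale car: car_theta cscale cb B u ub n e e' "scal_op :: complex \<Rightarrow> 'v fock_op" create_op annih_op pp
proof
  show "(\<And>x y z. cb (x + y) z = cb x z + cb y z)" "\<And>x y z. cb x (y + z) = cb x y + cb x z"
    "\<And>c x y. cb (cscale c x) y = cscale c (cb x y)" "\<And>c x y. cb x (cscale c y) = cscale c (cb x y)"
    by (simp_all add: rl.c.brl.add rl.c.brr.add rl.c.brl.scale rl.c.brr.scale)
  show "\<And>x y. cb x y = - cb y x" by (rule rl.c.br_anti)
  show "\<And>x y z. cb x (cb y z) = cb (cb x y) z + cb y (cb x z)" by (rule rl.c.br_derivation)
  show "\<And>x y z. B (x + y) z = B x z + B y z" "\<And>c x y. B (cscale c x) y = c * B x y"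
    "\<And>x y. B x y = B y x" "\<And>x y z. B (cb x y) z = B x (cb y z)"
    by (rule rl.ckl_add rl.ckl_scale rl.ckl_sym rl.ckl_inv)+
  show "\<And>y. y \<in> ub \<Longrightarrow> - y \<in> ub" using cvs.subspace_neg[OF sub_ub] by blast
  show "\<And>x y. x \<in> u \<Longrightarrow> y \<in> u \<Longrightarrow> cb (pp x) (pp y) = 0" using hsd(4) pp_u_in by blast
  show "\<And>x y. x \<in> ub \<Longrightarrow> y \<in> ub \<Longrightarrow> cb (pp x) (pp y) = 0" using hsd(5) pp_ub_in by blast
  show "\<And>x. x \<in> u \<Longrightarrow> pp x \<in> u" "\<And>y. y \<in> ub \<Longrightarrow> pp y \<in> ub" using pp_u_in pp_ub_in pu pm_ub by blast+
  show "\<And>x y. pp (cb (x - pp x) y) = cb (x - pp x) (pp y)" by (rule pp_k[OF kp_k])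
  show "\<And>x y. x \<in> u \<Longrightarrow> y \<in> u \<Longrightarrow> cb (x - pp x) (pp y) \<in> u" using k_p_plus[OF kp_k pp_u_in] pu by blast
  show "\<And>x y. x \<in> u \<Longrightarrow> y \<in> ub \<Longrightarrow> cb (x - pp x) (pp y) \<in> ub" using k_p_minus[OF kp_k pp_ub_in] pm_ub by blast
  show "\<And>c x. scal_op c * x = x * (scal_op c :: 'v fock_op)" by (rule scal_central)
qed (rule cb_u_u cb_ub_ub e_in e'_in B_dual u_expand ub_expand tr_ub scal_add scal_mult scal_1
    create_anti annih_anti annih_create pp_add pp_sc pp_pp B_pp; assumption)+

end

section \<open>The representation on V, adjoints of C and C^-, and the abstract Hodge
  setting\<close>

context dirac_setting
begin

lemma vsV: "vector_space sV" and \<pi>_linear: "Vector_Spaces.linear sV sV (\<pi> X)"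
  and \<pi>_linear': "Vector_Spaces.linear cscale sV (\<lambda>X. \<pi> X v)"
  and \<pi>_br: "\<pi> (cb X Y) v = \<pi> X (\<pi> Y v) - \<pi> Y (\<pi> X v)"
  and \<sigma>_linear: "k \<in> K \<Longrightarrow> Vector_Spaces.linear sV sV (\<sigma> k)"
  and \<sigma>_one: "\<sigma> \<one>\<^bsub>G\<^esub> v = v"
  and \<sigma>_mult: "k \<in> K \<Longrightarrow> k' \<in> K \<Longrightarrow> \<sigma> (k \<otimes>\<^bsub>G\<^esub> k') v = \<sigma> k (\<sigma> k' v)"
  and \<sigma>_finite: "\<exists>W. v \<in> W \<and> stable_subspace sV K \<sigma> W \<and> fin_dim sV W"
  and \<sigma>_deriv: "\<theta> Z = Z \<Longrightarrow> Vector_Spaces.linear sV (*) \<phi> \<Longrightarrow>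
        ((\<lambda>t. \<phi> (\<sigma> (lg_exp G (t *\<^sub>R Z)) v)) has_vector_derivative \<phi> (\<pi> (Z, 0) v)) (at 0)"
  and \<sigma>_\<pi>: "k \<in> K \<Longrightarrow> \<sigma> k (\<pi> X v) = \<pi> (cmap (Ad G k) X) (\<sigma> k v)"
  using gK unfolding gK_module_def br_def by blast+

sublocale V: vector_space sV by (rule vsV)

lemma \<pi>_add: "\<pi> (X + Y) v = \<pi> X v + \<pi> Y v" and \<pi>_sc: "\<pi> (cscale c X) v = sV c (\<pi> X v)"
  using \<pi>_linear'[of v] unfolding Vector_Spaces.linear_iff by blast+

lemma ip_linear: "Vector_Spaces.linear sV (*) (\<lambda>v. ip v w)" and ip_herm: "ip w v = cnj (ip v w)"
  and ip_pos: "v \<noteq> 0 \<Longrightarrow> Re (ip v v) > 0" and ip_K: "k \<in> K \<Longrightarrow> ip (\<sigma> k v) (\<sigma> k w) = ip v w"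
  and ip_real: "ip (\<pi> (X, 0) v) w = - ip v (\<pi> (X, 0) w)"
proof -
  have 1: "\<forall>w. Vector_Spaces.linear sV (*) (\<lambda>v. ip v w)" "\<forall>v w. ip w v = cnj (ip v w)"
    "\<forall>v. v \<noteq> 0 \<longrightarrow> Re (ip v v) > 0" "\<forall>k\<in>K. \<forall>v w. ip (\<sigma> k v) (\<sigma> k w) = ip v w"
    "\<forall>X v w. ip (\<pi> (X, 0) v) w = - ip v (\<pi> (X, 0) w)"
    using uni unfolding unitary_form_def by iprover+
  show "Vector_Spaces.linear sV (*) (\<lambda>v. ip v w)" using 1(1) ..
  show "ip w v = cnj (ip v w)" using 1(2) by iprover
  show "v \<noteq> 0 \<Longrightarrow> Re (ip v v) > 0" using 1(3) by iprover
  show "k \<in> K \<Longrightarrow> ip (\<sigma> k v) (\<sigma> k w) = ip v w" using 1(4) by simp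
  show "ip (\<pi> (X, 0) v) w = - ip v (\<pi> (X, 0) w)" using 1(5) by iprover
qed

sublocale hV: herm_space sV ip
  by (intro herm_space.intro herm_space_axioms.intro vsV ip_linear ip_herm ip_pos)

text \<open>Linearity in \<open>X\<close> against conjugate-linearity of the form in its second
  argument produces the conjugation.\<close>

lemma ip_\<pi>: "ip (\<pi> X v) w = - ip v (\<pi> (cconj X) w)"
proof -
  obtain a b where X: "X = (a, b)" by (cases X)
  have 1: "X = (a, 0) + cscale \<i> (b, 0)" and 2: "cconj X = (a, 0) + cscale (- \<i>) (b, 0)"
    by (simp_all add: X cscale_def cconj_def)
  show ?thesis unfolding 2 unfolding 1
    by (simp only: \<pi>_add \<pi>_sc hV.ipl.add hV.ipl.scale hV.ip_add_right hV.ip_scale_right ip_real) simp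
qed

definition P :: "'e \<times> 'e \<Rightarrow> 'v fock_op" where "P X = coeff_op sV (\<pi> X)"
text \<open>The representation twisted by \<theta>, which reverses the sign of p; it is the one that
  occurs in the adjoint of C.\<close>

definition Pt :: "'e \<times> 'e \<Rightarrow> 'v fock_op" where "Pt X = P (th X)"

abbreviation app :: "'v fock_op \<Rightarrow> (nat set \<Rightarrow> 'v) \<Rightarrow> nat set \<Rightarrow> 'v" where "app \<equiv> op_family sV"

lemma app_P: "app (P X) f I = \<pi> X (f I)"
  by (simp add: P_def op_family_coeff \<pi>_linear)

lemma P_eqI: assumes "\<And>f I. app a f I = app b f I" "\<And>s f I. s \<noteq> sV \<Longrightarrow> vector_space s \<Longrightarrow> op_family s a f I = op_family s b f I"
  shows "a = b"
  by (rule fock_op_eqI) (use assms in metis)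

lemma op_family_P: "s \<noteq> sV \<Longrightarrow> op_family s (P X) f = 0"
  by (rule ext) (simp add: P_def op_family_coeff)

lemma op_family_0_right: "op_family s a 0 = (0 :: nat set \<Rightarrow> 'v)"
  using op_family_add[of s a 0 0] by simp

lemma rep_P: "car.rep P" and rep_Pt: "car.rep Pt"
proof -
  have a: "P (X + Y) = P X + P Y" for X Y
    by (rule P_eqI) (simp_all add: app_P op_family_simps op_family_P \<pi>_add)
  have s: "P (cscale c X) = scal_op c * P X" for c X
    by (rule P_eqI) (simp_all add: app_P op_family_simps op_family_P \<pi>_sc op_family_scal[OF vsV] op_family_0_right)
  have b: "P (cb X Y) = P X * P Y - P Y * P X" for X Y
    by (rule P_eqI) (simp_all add: app_P op_family_simps op_family_P \<pi>_br op_family_0_right)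
  have c: "P X * create_op i = create_op i * P X" "P X * annih_op i = annih_op i * P X" for X i
    by (simp_all add: P_def coeff_commute)
  show "car.rep P" unfolding car.rep_def car.lin_def using a s b c by blast
  show "car.rep Pt" unfolding car.rep_def car.lin_def Pt_def
    using a s b c by (simp add: th_add th_sc cb_th[symmetric])
qed

sublocale hE: herm_space cscale h
proof (intro herm_space.intro herm_space_axioms.intro vector_space_cscale)
  show "Vector_Spaces.linear cscale (*) (\<lambda>v. h v w)" for w
    by (simp add: h_eq Vector_Spaces.linear_iff vector_space_cscale rl.ckl_add rl.ckl_scale vector_space_def algebra_simps)
  show "h w v = cnj (h v w)" for v w by (rule h_herm)
  show "v \<noteq> 0 \<Longrightarrow> Re (h v v) > 0" for v by (rule h_pos)
qed

text \<open>The identity is the expansion of \<open>e j\<close> in an orthonormal basis of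
  \<open>u\<close>, read off at the coordinate \<open>i\<close>. Coordinates are recorded instead of
  vectors because \<open>fock_form_pos\<close> knows \<open>u\<close> only through its Gram
  coefficients.\<close>

lemma ex_onb: "\<exists>c. \<forall>i<n. \<forall>j<n. (\<Sum>k<n. c k i * (\<Sum>i'<n. cnj (c k i') * h (e j) (e i'))) = (if i = j then 1 else (0::complex))"
proof -
  obtain b where b: "\<forall>k<n. b k \<in> u" "\<forall>x\<in>u. x = (\<Sum>k<n. cscale (h x (b k)) (b k))"
    using hE.orthonormal_basis[OF e_basis(1,2)] e_basis(3) by auto
  define c where "c k i = B (b k) (e' i)" for k i
  have "(\<Sum>k<n. c k i * (\<Sum>i'<n. cnj (c k i') * h (e j) (e i'))) = (if i = j then 1 else 0)" if ij: "i < n" "j < n" for i j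
  proof -
    have "(\<Sum>i'<n. cnj (c k i') * h (e j) (e i')) = h (e j) (b k)" if "k < n" for k
    proof -
      have "h (e j) (b k) = h (e j) (\<Sum>i'<n. cscale (c k i') (e i'))" using u_expand[of "b k"] b(1) that by (simp add: c_def)
      then show ?thesis by (simp add: hE.ip_sum_right hE.ip_scale_right)
    qed
    then have "(\<Sum>k<n. c k i * (\<Sum>i'<n. cnj (c k i') * h (e j) (e i'))) = (\<Sum>k<n. h (e j) (b k) * B (b k) (e' i))"
      by (intro sum.cong refl) (simp add: c_def)
    also have "\<dots> = B (\<Sum>k<n. cscale (h (e j) (b k)) (b k)) (e' i)" by (simp add: B_sum rl.ckl_scale)
    also have "(\<Sum>k<n. cscale (h (e j) (b k)) (b k)) = e j" using b(2) e_in[OF ij(2)] by metis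
    finally show ?thesis using B_dual ij by simp
  qed
  then show ?thesis by blast
qed

definition onb :: "nat \<Rightarrow> nat \<Rightarrow> complex" where
  "onb = (SOME c. \<forall>i<n. \<forall>j<n. (\<Sum>k<n. c k i * (\<Sum>i'<n. cnj (c k i') * h (e j) (e i'))) = (if i = j then 1 else (0::complex)))"

lemma onb: "i < n \<Longrightarrow> j < n \<Longrightarrow> (\<Sum>k<n. onb k i * (\<Sum>i'<n. cnj (onb k i') * h (e j) (e i'))) = (if i = j then 1 else 0)"
  using someI_ex[OF ex_onb] unfolding onb_def by blast

sublocale F: fock_form_pos sV ip h n e onb
  by (intro fock_form_pos.intro fock_form.intro fock_form_axioms.intro fock_form_pos_axioms.intro
      vsV ip_linear ip_herm ip_pos h_herm onb)

abbreviation "eps \<equiv> car.eps"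
abbreviation "iota \<equiv> car.iota"

lemma lin_eps: "car.lin eps" and lin_iota: "car.lin iota" by (rule car.lin_eps car.lin_iota)+

lemma iota_sc: "iota (cscale c y) = scal_op c * iota y" and iota_add: "iota (x + y) = iota x + iota y"
  and eps_add: "eps (x + y) = eps x + eps y" and eps_sc: "eps (cscale c y) = scal_op c * eps y"
  using lin_iota lin_eps unfolding car.lin_def by blast+

text \<open>By the definition of \<open>h\<close> the coefficients in \<open>annih_dual\<close> are
  -2 times pairings with \<open>J (e i)\<close>.\<close>

lemma adj_E: assumes "i < n" shows "F.adj (create_op i) (iota (cscale (- 2) (J (e i))))"
proof -
  have "F.annih_dual i = iota (cscale (- 2) (J (e i)))"
    unfolding F.annih_dual_def car.iota_def 
    by (intro sum.cong refl) (simp only: h_eq rl.ckl_scale rl.ckl_sym[of "J (e i)"])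
  then show ?thesis using F.adj_create[OF assms] by simp
qed

lemma adj_eps: assumes "x \<in> u" shows "F.adj (eps x) (iota (cscale (- 2) (J x)))"
proof -
  have "F.adj (eps x) (\<Sum>i<n. iota (cscale (- 2) (J (e i))) * scal_op (cnj (B x (e' i))))"
    unfolding car.eps_def by (intro F.adj_sum F.adj_mult F.adj_scal adj_E) simp
  also have "(\<Sum>i<n. iota (cscale (- 2) (J (e i))) * scal_op (cnj (B x (e' i))))
      = iota (\<Sum>i<n. cscale (cnj (B x (e' i))) (cscale (- 2) (J (e i))))"
    by (simp only: car.lin_sum[OF lin_iota] iota_sc scal_central[symmetric])
  also have "(\<Sum>i<n. cscale (cnj (B x (e' i))) (cscale (- 2) (J (e i)))) = cscale (- 2) (J (\<Sum>i<n. cscale (B x (e' i)) (e i)))"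
    by (simp only: J_sum J_sc cvs.scale_sum_right cvs.scale_left_commute)
  finally show ?thesis by (simp only: u_expand[OF assms])
qed

lemma adj_iota: assumes "y \<in> ub" shows "F.adj (iota y) (eps (cscale (- 1/2) (J y)))"
proof -
  let ?x = "cscale (- 1/2) (J y)"
  have "?x \<in> u" using J_ub[OF assms] by (rule cvs.subspace_scale[OF sub_u])
  from F.adj_sym[OF adj_eps[OF this]]
  have "F.adj (iota (cscale (- 2) (J ?x))) (eps ?x)" .
  moreover have "cscale (- 2) (J ?x) = y" unfolding J_sc J_J by simp
  ultimately show ?thesis by simp
qed

lemma adj_P: "F.adj (P X) (- P (cconj X))"
proof -
  have l: "Vector_Spaces.linear sV sV (\<lambda>v. - \<pi> (cconj X) v)"
    using \<pi>_linear[of "cconj X"] by (simp add: Vector_Spaces.linear_iff)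
  have "coeff_op sV (\<lambda>v. - \<pi> (cconj X) v) = - P (cconj X)"
    by (rule P_eqI) (simp_all add: op_family_simps app_P op_family_P op_family_coeff l)
  moreover have "F.adj (P X) (coeff_op sV (\<lambda>v. - \<pi> (cconj X) v))"
    unfolding P_def by (rule F.adj_coeff[OF \<pi>_linear l]) (use hV.ip_diff_right[of _ 0] in \<open>simp add: ip_\<pi>\<close>)
  ultimately show ?thesis by simp
qed

text \<open>\<open>J\<close> is conjugate-linear and compatible with \<open>B\<close>, so the
  \<open>J (e' i)\<close> form a basis of \<open>u\<close> whose dual basis consists of the
  \<open>J (e i)\<close>.\<close>

lemma J_dual: assumes "j < n" shows "(\<Sum>i<n. cscale (B (J (e' i)) (e' j)) (J (e i))) = e' j"
proof -
  have B: "B (J (e' i)) (e' j) = cnj (B (J (e' j)) (e' i))" for i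
    using B_J[of "J (e' j)" "e' i"] by (simp add: rl.ckl_sym[of "e' j"])
  have "(\<Sum>i<n. cscale (B (J (e' i)) (e' j)) (J (e i))) = J (\<Sum>i<n. cscale (B (J (e' j)) (e' i)) (e i))"
    unfolding B J_sum J_sc ..
  also have "\<dots> = e' j" by (simp only: u_expand[OF J_ub[OF e'_in[OF assms]]] J_J)
  finally show ?thesis .
qed

lemma change_J: "car.bilin \<Phi> \<Longrightarrow> (\<Sum>i<n. \<Phi> (J (e i)) (J (e' i))) = (\<Sum>i<n. \<Phi> (e' i) (e i))"
  by (rule car.change_basis) (use J_dual J_ub e'_in in auto)

text \<open>The adjoint of Q X is - Q of the conjugate of X, and that conjugate is \<theta> (J X).
  Independence of the canonical tensor from the basis removes \<open>J\<close> from all sums; what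
  remains of it is the composition of \<open>Q\<close> with \<theta>.\<close>

lemma adj_opC_general:
  assumes Q: "car.rep Q" and Qa: "\<And>X. F.adj (Q X) (- Q (cconj X))" and Q': "\<And>X. Q' X = Q (th X)"
  shows "F.adj (car.opC Q) (car.opCm Q')"
proof -
  have Ql: "Q (x + y) = Q x + Q y" "Q (cscale c x) = scal_op c * Q x" for x y c
    using car.rep_lin[OF Q] unfolding car.lin_def by blast+
  have 1: "F.adj (car.lin_part Q) (scal_op 2 * car.lin_part_m Q')"
  proof -
    have "F.adj (car.lin_part Q) (\<Sum>i<n. iota (cscale (- 2) (J (e i))) * (- Q (cconj (e' i))))"
      unfolding car.lin_part_def by (intro F.adj_sum F.adj_mult Qa adj_E) simp
    also have "(\<Sum>i<n. iota (cscale (- 2) (J (e i))) * (- Q (cconj (e' i)))) = (\<Sum>i<n. scal_op 2 * (Q (th (J (e' i))) * iota (J (e i))))"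
    proof (intro sum.cong refl)
      fix i
      have "iota (cscale (- 2) (J (e i))) = - (scal_op 2 * iota (J (e i)))"
        by (simp only: iota_sc car.S_minus mult_minus_left)
      then show "iota (cscale (- 2) (J (e i))) * (- Q (cconj (e' i))) = scal_op 2 * (Q (th (J (e' i))) * iota (J (e i)))"
        by (simp add: mult.assoc car.rep_iota[OF Q])
    qed
    also have "\<dots> = scal_op 2 * (\<Sum>i<n. Q (th (e i)) * iota (e' i))"
    proof -
      have "car.bilin (\<lambda>y x. Q (th x) * iota y)"
        unfolding car.bilin_def by (simp only: iota_add iota_sc Ql th_add th_sc distrib_left distrib_right car.mult_S_left mult.assoc) simp
      from change_J[OF this] show ?thesis by (simp only: sum_distrib_left[symmetric])
    qed
    also have "(\<Sum>i<n. Q (th (e i)) * iota (e' i)) = car.lin_part_m Q'"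
      unfolding car.lin_part_m_def by (intro sum.cong refl) (simp add: Q')
    finally show ?thesis .
  qed
  have 2: "F.adj car.cubic (scal_op 2 * car.cubic_m)"
  proof -
    let ?f = "\<lambda>i. J (e' i)" and ?f' = "\<lambda>i. J (e i)"
    have "F.adj car.cubic (\<Sum>i<n. \<Sum>j<n. eps (cscale (- 1/2) (J (cb (e' i) (e' j)))) * (iota (cscale (- 2) (J (e j))) * iota (cscale (- 2) (J (e i)))))"
      unfolding car.cubic_def
      by (intro F.adj_sum F.adj_mult adj_E adj_iota cb_ub_ub e'_in) simp_all
    also have "(\<Sum>i<n. \<Sum>j<n. eps (cscale (- 1/2) (J (cb (e' i) (e' j)))) * (iota (cscale (- 2) (J (e j))) * iota (cscale (- 2) (J (e i)))))
       = (\<Sum>i<n. \<Sum>j<n. scal_op 2 * (eps (cb (?f i) (?f j)) * (iota (?f' i) * iota (?f' j))))"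
    proof (intro sum.cong refl)
      fix i j
      have "eps (cscale (- 1/2) (J (cb (e' i) (e' j)))) * (iota (cscale (- 2) (J (e j))) * iota (cscale (- 2) (J (e i))))
         = scal_op (- 1/2) * eps (cb (?f i) (?f j)) * (scal_op (- 2) * iota (?f' j) * (scal_op (- 2) * iota (?f' i)))"
        by (simp only: cb_J iota_sc eps_sc)
      \<comment> \<open>The adjoint of a contraction brings -1/2 and that of each wedge product -2,
        in total -2. Reversing the two contractions makes this 2, which the factor 1/2 of
        \<open>opC\<close> turns into the coefficient 1 of \<open>cubic_m\<close>.\<close>
      also have "\<dots> = scal_op (- 1/2 * (- 2 * - 2)) * (eps (cb (?f i) (?f j)) * (iota (?f' j) * iota (?f' i)))"
        by (simp only: car.scalar_prod)
      also have "iota (?f' j) * iota (?f' i) = - (iota (?f' i) * iota (?f' j))" by (rule car.iota_anti)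
      also have "scal_op (- 1/2 * (- 2 * - 2)) = (- scal_op 2 :: 'v fock_op)" by (simp add: car.S_minus[symmetric])
      finally show "eps (cscale (- 1/2) (J (cb (e' i) (e' j)))) * (iota (cscale (- 2) (J (e j))) * iota (cscale (- 2) (J (e i))))
         = scal_op 2 * (eps (cb (?f i) (?f j)) * (iota (?f' i) * iota (?f' j)))" by simp
    qed
    also have "\<dots> = scal_op 2 * (\<Sum>i<n. \<Sum>j<n. eps (cb (?f i) (?f j)) * (iota (?f' i) * iota (?f' j)))"
      by (simp only: sum_distrib_left)
    also have "(\<Sum>i<n. \<Sum>j<n. eps (cb (?f i) (?f j)) * (iota (?f' i) * iota (?f' j)))
       = (\<Sum>i<n. \<Sum>j<n. eps (cb (?f i) (e j)) * (iota (?f' i) * iota (e' j)))"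
    proof (rule sum.cong[OF refl])
      fix i
      have "car.bilin (\<lambda>y x. eps (cb (?f i) x) * (iota (?f' i) * iota y))"
        unfolding car.bilin_def
        by (simp only: iota_add iota_sc eps_add eps_sc distrib_left distrib_right car.mult_S_left mult.assoc rl.c.brr.add rl.c.brr.scale) simp
      from change_J[OF this] show "(\<Sum>j<n. eps (cb (?f i) (?f j)) * (iota (?f' i) * iota (?f' j)))
        = (\<Sum>j<n. eps (cb (?f i) (e j)) * (iota (?f' i) * iota (e' j)))" .
    qed
    also have "\<dots> = (\<Sum>i<n. \<Sum>j<n. eps (cb (e i) (e j)) * (iota (e' i) * iota (e' j)))"
    proof -
      have "car.bilin (\<lambda>y x. \<Sum>j<n. eps (cb x (e j)) * (iota y * iota (e' j)))"
        unfolding car.bilin_def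
        by (simp only: iota_add iota_sc eps_add eps_sc distrib_left distrib_right car.mult_S_left mult.assoc rl.c.brl.add rl.c.brl.scale sum.distrib sum_distrib_left) simp
      from change_J[OF this] show ?thesis .
    qed
    also have "\<dots> = car.cubic_m"
      unfolding car.cubic_m_def by (intro sum.cong refl) (simp add: mult.assoc)
    finally show ?thesis .
  qed
  have "F.adj (car.opC Q) (scal_op 2 * car.lin_part_m Q' - scal_op 2 * car.cubic_m * scal_op (cnj (1/2)))"
    unfolding car.opC_def by (intro F.adj_diff 1 F.adj_mult 2 F.adj_scal)
  also have "scal_op 2 * car.cubic_m * scal_op (cnj (1/2)) = car.cubic_m"
    by (subst scal_central[symmetric]) (simp flip: mult.assoc scal_mult add: scal_1)
  finally show ?thesis by (simp add: car.opCm_def)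
qed

lemma adj_opC: "F.adj (car.opC P) (car.opCm Pt)" and adj_opC_t: "F.adj (car.opC Pt) (car.opCm P)"
proof -
  show "F.adj (car.opC P) (car.opCm Pt)" by (rule adj_opC_general[OF rep_P adj_P]) (simp add: Pt_def)
  have "F.adj (Pt X) (- Pt (cconj X))" for X using adj_P[of "th X"] by (simp add: Pt_def th_cconj)
  then show "F.adj (car.opC Pt) (car.opCm P)" by (rule adj_opC_general[OF rep_Pt]) (simp add: Pt_def)
qed

abbreviation "Ck \<equiv> car.Ck P"
abbreviation "Cp \<equiv> car.Cp P"
abbreviation "Ckm \<equiv> car.Ckm P"
abbreviation "Cpm \<equiv> car.Cpm P"

lemma opC_split: "car.opC P = Ck + Cp" "car.opCm P = Ckm + Cpm"
  "car.opC Pt = Ck - Cp" "car.opCm Pt = Ckm - Cpm"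
proof -
  show "car.opC P = Ck + Cp" "car.opCm P = Ckm + Cpm" by (simp_all add: car.Ck_def car.Ckm_def)
  have q: "Pt x = P (car.kp x) - P (pp x)" for x
    using car.lin_diff[OF car.rep_lin[OF rep_P], of "car.kp x" "pp x"] th_eq[of x]
    by (simp add: Pt_def car.kp_def)
  show "car.opC Pt = Ck - Cp" "car.opCm Pt = Ckm - Cpm"
    using car.opC_theta[OF rep_P q] by auto
qed

definition pres :: "'v fock_op \<Rightarrow> bool" where "pres a \<longleftrightarrow> (\<forall>f\<in>VS n. app a f \<in> VS n)"

lemma pres_intros:
  "pres a \<Longrightarrow> pres b \<Longrightarrow> pres (a + b)" "pres a \<Longrightarrow> pres b \<Longrightarrow> pres (a - b)" "pres a \<Longrightarrow> pres b \<Longrightarrow> pres (a * b)"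
  "(\<And>i. i \<in> A \<Longrightarrow> pres (g i)) \<Longrightarrow> pres (\<Sum>i\<in>A. g i)"
  "pres (scal_op c)" "pres (P X)" "i < n \<Longrightarrow> pres (create_op i)" "i < n \<Longrightarrow> pres (annih_op i)"
proof -
  show "pres (a + b)" "pres (a - b)" "pres (a * b)" if "pres a" "pres b"
    using that by (auto simp: pres_def op_family_simps VS_def)
  show "pres (\<Sum>i\<in>A. g i)" if "\<And>i. i \<in> A \<Longrightarrow> pres (g i)"
    using that by (auto simp: pres_def F.app_sum intro: F.VS_sum)
  show "pres (scal_op c)" by (auto simp: pres_def VS_def F.app_scal)
  have "\<pi> X 0 = 0" for X using V.scale_zero_left[of "0 :: 'v"] \<pi>_linear[of X] by (metis Vector_Spaces.linear_iff V.scale_zero_left)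
  then show "pres (P X)" by (auto simp: pres_def VS_def app_P)
  show "pres (create_op i)" if "i < n"
  proof -
    have "\<not> I - {i} \<subseteq> {..<n}" if "\<not> I \<subseteq> {..<n}" for I using that \<open>i < n\<close> by auto
    then show ?thesis by (auto simp: pres_def VS_def F.app_create)
  qed
  show "pres (annih_op i)" if "i < n"
    using that by (auto simp: pres_def VS_def F.app_annih)
qed

lemma pres_eps: "pres (eps x)" and pres_iota: "pres (iota y)"
  unfolding car.eps_def car.iota_def by (intro pres_intros; simp)+

lemma pres_ops: "pres (car.opC P)" "pres (car.opCm P)" "pres Cp" "pres Cpm" "pres (car.opL P X)" "pres Ck" "pres Ckm"
  unfolding car.Ck_def car.Ckm_def car.opC_def car.opCm_def car.Cp_def car.Cpm_def car.opL_def car.lin_part_def car.lin_part_m_def car.cubic_def car.cubic_m_def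
  by (intro pres_intros pres_eps pres_iota; simp)+

lemma adj_half: "F.adj (a + a) (b + b) \<Longrightarrow> F.adj a b"
proof -
  assume "F.adj (a + a) (b + b)"
  from F.adj_mult[OF F.adj_scal[of "1/2"] this]
  have "F.adj (scal_op (1/2) * (a + a)) (scal_op (1/2) * (b + b))" by (simp only: scal_central[of "1/2" "b + b"]) simp
  then show ?thesis by (simp only: car.half_double)
qed

sublocale H: hodge sV ip h n e onb Ck Cp Ckm Cpm
proof
  show "f \<in> VS n \<Longrightarrow> app Ck f \<in> VS n" "f \<in> VS n \<Longrightarrow> app Cp f \<in> VS n"
      "f \<in> VS n \<Longrightarrow> app Ckm f \<in> VS n" "f \<in> VS n \<Longrightarrow> app Cpm f \<in> VS n" for f
    using pres_ops unfolding pres_def by blast+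
  \<comment> \<open>The twist reverses the sign of the p-parts only, so the sum of the two adjoint
    relations concerns twice the k-parts and their difference twice the p-parts.\<close>
  note 1 = adj_opC[unfolded opC_split] and 2 = adj_opC_t[unfolded opC_split]
  have "F.adj (Ck + Ck) (Ckm + Ckm)" using F.adj_add[OF 1 2] by (simp add: algebra_simps)
  then show "F.adj Ck Ckm" by (rule adj_half)
  have "F.adj (Cp + Cp) (- Cpm + - Cpm)" using F.adj_diff[OF 1 2] by (simp add: algebra_simps)
  then show "F.adj Cp (- Cpm)" by (rule adj_half)
  show "Cp * Cp = 0" by (rule car.Cp_sq[OF rep_P])
  show "(Ck + Cp) * (Ck + Cp) = 0" unfolding opC_split[symmetric] by (rule car.opC_sq[OF rep_P])
  show "(Ck - Cp) * (Ck - Cp) = 0" unfolding opC_split[symmetric] by (rule car.opC_sq[OF rep_Pt])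
  show "Cp * Ckm + Ckm * Cp = 0" by (rule car.Cp_Ckm[OF rep_P])
qed

end

section \<open>Local finiteness of the Laplacian\<close>

context vector_space
begin

lemma dependent_sequence:
  fixes x :: "nat \<Rightarrow> 'b"
  assumes B: "finite B" "\<And>k. x k \<in> span B"
  shows "\<exists>N c. (\<exists>k\<le>N. c k \<noteq> 0) \<and> (\<Sum>k\<le>N. scale (c k) (x k)) = 0"
proof (cases "inj_on x {..card B}")
  case True
  have "\<not> independent (x ` {..card B})"
  proof
    assume "independent (x ` {..card B})"
    then have "card (x ` {..card B}) \<le> card B" using independent_span_bound[OF B(1)] B(2) by auto
    then show False using True by (simp add: card_image)
  qed
  then obtain c where c: "\<exists>v\<in>x ` {..card B}. c v \<noteq> 0" "(\<Sum>v\<in>x ` {..card B}. scale (c v) v) = 0"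
    using dependent_finite[of "x ` {..card B}"] by auto
  then show ?thesis
    by (intro exI[of _ "card B"] exI[of _ "\<lambda>k. c (x k)"]) (auto simp: sum.reindex[OF True])
next
  case False
  \<comment> \<open>A repeated vector is a relation by itself, which the set of values would not
    show.\<close>
  then obtain i j where ij: "i \<le> card B" "j \<le> card B" "i \<noteq> j" "x i = x j" by (auto simp: inj_on_def)
  let ?c = "\<lambda>k. if k = i then 1 else if k = j then - 1 else 0"
  have "(\<Sum>k\<le>card B. scale (?c k) (x k)) = (\<Sum>k\<le>card B. (if k = i then x k else 0) - (if k = j then x k else 0))"
    by (intro sum.cong refl) (use ij in auto)
  also have "\<dots> = 0" using ij by (simp add: sum_subtractf)
  finally show ?thesis using ij by (intro exI[of _ "card B"] exI[of _ ?c]) auto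
qed

text \<open>Differentiability of the K-action is stated through linear functionals, so membership in
  a stable subspace has to be tested by them.\<close>

lemma functional_separating:
  assumes W: "subspace W" and w: "w \<notin> W"
  shows "\<exists>\<phi>. Vector_Spaces.linear scale (*) \<phi> \<and> (\<forall>x\<in>W. \<phi> x = 0) \<and> \<phi> w = 1"
proof -
  interpret f: vector_space "(*) :: 'a \<Rightarrow> 'a \<Rightarrow> 'a" by unfold_locales (auto simp: algebra_simps)
  interpret p: vector_space_pair scale "(*) :: 'a \<Rightarrow> 'a \<Rightarrow> 'a" ..
  obtain b where b: "b \<subseteq> W" "independent b" "W \<subseteq> span b" using maximal_independent_subset[of W] by blast
  have sp: "span b = W" using b W by (auto dest: span_minimal[of b W])
  have "w \<notin> b" using b(1) w by auto
  then have ind: "independent (insert w b)" using b(2) w sp by (simp add: independent_insert)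
  obtain \<phi> where \<phi>: "Vector_Spaces.linear scale (*) \<phi>" "\<forall>x\<in>insert w b. \<phi> x = (if x = w then 1 else 0)"
    using p.linear_independent_extend[OF ind, of "\<lambda>x. if x = w then 1 else 0"] by auto
  interpret \<phi>: Vector_Spaces.linear scale "(*)" \<phi> by (rule \<phi>(1))
  have "\<phi> x = 0" if "x \<in> W" for x
  proof -
    have "x \<in> span b" using that sp by simp
    then show ?thesis
      by (induction rule: span_induct_alt) (use \<phi>(2) \<open>w \<notin> b\<close> in \<open>auto simp: \<phi>.zero \<phi>.add \<phi>.scale\<close>)
  qed
  then show ?thesis using \<phi> by auto
qed

end

section \<open>From a relation between powers of the Laplacian to the splitting\<close>

context hodge
begin

lemma Lap_Lap: assumes f: "f \<in> VS n" and z: "app Lap (app Lap f) = 0" shows "app Lap f = 0"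
proof -
  have "F \<in> VS n \<Longrightarrow> form (app Lap F) F' = form F (app Lap F')" for F F'
    by (rule adjD[OF adj_add[OF adj_mult[OF adj_C adj_sym[OF adj_C]] adj_mult[OF adj_sym[OF adj_C] adj_C]]])
  from this[OF presC(5)[OF f], of f] have "form (app Lap f) (app Lap f) = form (app Lap (app Lap f)) f" by simp
  then have "form (app Lap f) (app Lap f) = 0" by (simp only: z form_0)
  then show ?thesis using form_pos(2)[OF presC(5)[OF f]] by blast
qed

lemma VS_scal: "f \<in> VS n \<Longrightarrow> app (scal_op d) f \<in> VS n"
  by (auto simp: VS_def app_scal)

lemma app_scal_commute: "app a (app (scal_op d) f) = app (scal_op d) (app a f)"
  using scal_central[of d a] by (metis app_simps(5))

lemma VS_Lap_power: "f \<in> VS n \<Longrightarrow> app (Lap ^ k) f \<in> VS n"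
proof (induction k)
  case 0
  then show ?case by (simp only: power_0 app_simps)
next
  case (Suc k)
  then show ?case by (simp only: power_Suc op_family_simps(5)[of _ Lap] presC(5))
qed

text \<open>
  A symmetric operator has the same kernel as its square, so that powers of \<open>Lap\<close> can be cancelled
  from a relation until its constant term is nonzero; dividing by that term solves for \<open>f\<close>.
\<close>

lemma split_of_relation:
  assumes f: "f \<in> VS n"
  shows "\<exists>k\<le>N. d k \<noteq> 0 \<Longrightarrow> app Lap (\<Sum>k\<le>N. app (scal_op (d k)) (app (Lap ^ k) f)) = 0 \<Longrightarrow>
    \<exists>h\<in>Harm. \<exists>y\<in>VS n. f = h + app Lap y"
proof (induction N arbitrary: d)
  case 0
  let ?g = "app (scal_op (d 0)) f"
  have "app Lap ?g = 0" using 0(2) by (simp only: atMost_0 sum.insert finite.emptyI empty_iff simp_thms sum.empty power_0 app_simps(6) add_0_right)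
  then have "app (scal_op (d 0)) (app Lap f) = 0" by (simp only: app_scal_commute)
  then have "sV (d 0) (app Lap f I) = 0" for I by (metis app_scal zero_fun_apply)
  then have "app Lap f I = 0" for I using 0(1) by (simp add: scale_eq_0_iff)
  then have "app Lap f = 0" by (intro ext) simp
  then have "f \<in> Harm" using f by (simp add: Harm_def kernel_on_def)
  moreover have "f = f + app Lap 0" by (simp only: app_zero add_0_right)
  ultimately show ?case using VS_closed(4) by blast
next
  case (Suc N)
  define w where "w = (\<Sum>k\<le>N. app (scal_op (d (Suc k))) (app (Lap ^ k) f))"
  have wV: "w \<in> VS n" unfolding w_def by (intro VS_sum VS_scal VS_Lap_power f)
  have Lw: "app Lap w = (\<Sum>k\<le>N. app (scal_op (d (Suc k))) (app (Lap ^ Suc k) f))"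
    unfolding w_def app_sum_right by (intro sum.cong refl) (simp only: app_scal_commute[of Lap] power_Suc op_family_simps(5)[of _ Lap])
  have g: "(\<Sum>k\<le>Suc N. app (scal_op (d k)) (app (Lap ^ k) f)) = app (scal_op (d 0)) f + app Lap w"
    unfolding Lw sum.atMost_Suc_shift by (simp only: power_0 app_simps(6))
  note z = Suc.prems(2)[unfolded g]
  show ?case
  proof (cases "d 0 = 0")
    case True
    have "app (scal_op (d 0)) f = 0" by (rule ext) (simp add: app_scal True)
    then have "app Lap (app Lap w) = 0" using z by (simp only: add_0_left)
    then have "app Lap w = 0" by (rule Lap_Lap[OF wV])
    moreover have "\<exists>k\<le>N. d (Suc k) \<noteq> 0" using Suc.prems(1) True by (metis Suc_le_mono not0_implies_Suc)
    ultimately show ?thesis using Suc.IH[of "\<lambda>k. d (Suc k)"] unfolding w_def by blast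
  next
    case False
    let ?s = "app (scal_op (1 / d 0)) :: (nat set \<Rightarrow> 'v) \<Rightarrow> _"
    let ?h = "?s (app (scal_op (d 0)) f + app Lap w)"
    have hV: "?h \<in> VS n" by (intro VS_scal VS_closed(1) f presC(5) wV)
    have "app Lap ?h = ?s (app Lap (app (scal_op (d 0)) f + app Lap w))" by (rule app_scal_commute)
    then have "app Lap ?h = 0" by (simp only: z app_zero)
    then have "?h \<in> Harm" using hV by (simp add: Harm_def kernel_on_def)
    moreover have "f = ?h + app Lap (- ?s w)"
    proof -
      have "?s (app (scal_op (d 0)) f) = f" by (rule ext) (simp add: app_scal False)
      then show ?thesis unfolding app_minus app_scal_commute[of Lap] op_family_add[of sV "scal_op (1 / d 0)"] by simp
    qed
    ultimately show ?thesis using VS_closed(3) VS_scal[OF wV] by blast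
  qed
qed

lemma complementsI:
  assumes "\<And>f. f \<in> VS n \<Longrightarrow> \<exists>N d. (\<exists>k\<le>N. d k \<noteq> 0) \<and> (\<Sum>k\<le>N. app (scal_op (d k)) (app (Lap ^ k) f)) = 0"
  shows complements
  unfolding complements_def
proof
  fix f :: "nat set \<Rightarrow> 'v" assume f: "f \<in> VS n"
  obtain N d where d: "\<exists>k\<le>N. d k \<noteq> 0" "(\<Sum>k\<le>N. app (scal_op (d k)) (app (Lap ^ k) f)) = 0"
    using assms[OF f] by blast
  have "app Lap (\<Sum>k\<le>N. app (scal_op (d k)) (app (Lap ^ k) f)) = 0" by (simp only: d(2) app_zero)
  from split_of_relation[OF f d(1) this] show "\<exists>h\<in>Harm. \<exists>y\<in>VS n. f = h + app Lap y" .
qed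

end

section \<open>Finite-dimensional subspaces stable under K, under k and under the invariant sum over
  p\<close>

context dirac_setting
begin

lemma K_carrier: "k \<in> K \<Longrightarrow> k \<in> carrier G"
  by (simp add: K_def fixed_subgroup_def)

lemma \<Theta>_hom: "\<Theta> \<in> hom G G" and \<Theta>_cont: "continuous_map (lg_top G) (lg_top G) \<Theta>"
  and \<Theta>_deriv: "(in_chart G \<Theta> has_derivative \<theta>) (at (snd (lg_chart G) \<one>\<^bsub>G\<^esub>))"
  using gci by (simp_all add: global_cartan_involution_def iso_def smooth_map_def)

lemma inv_K: "k \<in> K \<Longrightarrow> inv\<^bsub>G\<^esub> k \<in> K"
proof -
  assume k: "k \<in> K"
  interpret t: group_hom G G \<Theta>
    by (rule group_hom.intro[OF lg.grp lg.grp]) (simp add: group_hom_axioms_def \<Theta>_hom)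
  show ?thesis using k t.hom_inv[OF K_carrier[OF k]] lg.inv_closed by (simp add: K_def fixed_subgroup_def)
qed

lemma exp_K: "\<theta> Z = Z \<Longrightarrow> lg_exp G (t *\<^sub>R Z) \<in> K"
  using lg.hom_exp[OF \<Theta>_cont \<Theta>_deriv, of t Z] \<Theta>_hom lg.exp_carrier[of t Z]
  by (simp add: K_def fixed_subgroup_def hom_def)

sublocale UK: unitary_K sV ip K \<sigma>
proof (intro unitary_K.intro unitary_K_axioms.intro hV.herm_space_axioms \<sigma>_linear ip_K)
  fix k assume k: "k \<in> K"
  have "\<sigma> k (\<sigma> (inv\<^bsub>G\<^esub> k) v) = v" "\<sigma> (inv\<^bsub>G\<^esub> k) (\<sigma> k v) = v" for v
    using \<sigma>_mult[OF k inv_K[OF k], of v] \<sigma>_mult[OF inv_K[OF k] k, of v] K_carrier[OF k] \<sigma>_one[of v] by simp_all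
  then show "\<exists>k'\<in>K. \<forall>v. \<sigma> k (\<sigma> k' v) = v \<and> \<sigma> k' (\<sigma> k v) = v" using inv_K[OF k] by blast
qed

text \<open>
  A functional vanishing on \<open>W\<close> is constant along the curve through \<open>v\<close> whose derivative is \<open>\<pi> (Z, 0) v\<close>.
\<close>

lemma stable_real:
  assumes W: "UK.kstable W" and Z: "\<theta> Z = Z" and v: "v \<in> W" shows "\<pi> (Z, 0) v \<in> W"
proof (rule ccontr)
  assume "\<pi> (Z, 0) v \<notin> W"
  moreover have "V.subspace W" using W by (simp add: stable_subspace_def)
  ultimately obtain \<phi> where \<phi>: "Vector_Spaces.linear sV (*) \<phi>" "\<And>x. x \<in> W \<Longrightarrow> \<phi> x = 0" "\<phi> (\<pi> (Z, 0) v) = 1"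
    using V.functional_separating by blast
  have "(\<lambda>t. \<phi> (\<sigma> (lg_exp G (t *\<^sub>R Z)) v)) = (\<lambda>t. 0)"
    using \<phi>(2) W exp_K[OF Z] v by (auto simp: stable_subspace_def)
  then have "((\<lambda>t. 0) has_vector_derivative \<phi> (\<pi> (Z, 0) v)) (at 0)"
    using \<sigma>_deriv[OF Z \<phi>(1), of v] by simp
  then have "\<phi> (\<pi> (Z, 0) v) = 0" using has_vector_derivative_const vector_derivative_unique_at by blast
  then show False using \<phi>(3) by simp
qed

lemma stable_k:
  assumes W: "UK.kstable W" and X: "X \<in> k_part \<theta>" and v: "v \<in> W" shows "\<pi> X v \<in> W"
proof -
  obtain a b where ab: "X = (a, b)" by (cases X)
  then have f: "\<theta> a = a" "\<theta> b = b" using X by (auto simp: k_part_def cmap_def)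
  have "X = (a, 0) + cscale \<i> (b, 0)" by (simp add: ab cscale_def)
  then have "\<pi> X v = \<pi> (a, 0) v + sV \<i> (\<pi> (b, 0) v)" by (simp only: \<pi>_add \<pi>_sc)
  then show ?thesis
    using W stable_real[OF W f(1) v] stable_real[OF W f(2) v] V.subspace_add V.subspace_scale
    by (simp add: stable_subspace_def)
qed

abbreviation "cAd k \<equiv> cmap (Ad G k)"

lemma kl_Ad: assumes k: "k \<in> carrier G" shows "rl.kl (Ad G k x) (Ad G k y) = rl.kl x y"
  by (rule rl.kl_automorphism[of _ "Ad G (inv\<^bsub>G\<^esub> k)"])
    (use k lg.Ad_linear[of k] lg.Ad_linear[of "inv\<^bsub>G\<^esub> k"] lg.Ad_inv[OF k] lg.Ad_br[OF k] in
      \<open>simp_all add: linear_raw br_def\<close>)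

lemma B_cAd: "k \<in> K \<Longrightarrow> B (cAd k x) (cAd k y) = B x y"
  by (rule rl.ckl_cmap) (rule kl_Ad[OF K_carrier])

lemma cAd_inv: "k \<in> K \<Longrightarrow> cAd k (cAd (inv\<^bsub>G\<^esub> k) x) = x"
  using lg.Ad_inv[OF K_carrier] by (simp add: cmap_def prod_eq_iff)

lemma cAd_linear: "k \<in> K \<Longrightarrow> cAd k (x + y) = cAd k x + cAd k y" "k \<in> K \<Longrightarrow> cAd k (cscale c x) = cscale c (cAd k x)"
  using cmap_simps[OF lg.Ad_linear[OF K_carrier]] by blast+

lemma pp_p: "x \<in> p_plus \<or> x \<in> p_minus \<Longrightarrow> pp x = x"
proof -
  assume x: "x \<in> p_plus \<or> x \<in> p_minus"
  have "x \<in> p_part \<theta>"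
    using x hsd(3) set_plus_intro[of x p_plus 0 p_minus] set_plus_intro[of 0 p_plus x p_minus]
      cvs.subspace_0[OF hsd(1)] cvs.subspace_0[OF hsd(2)] by auto
  then have "th x = - x" by (simp add: p_part_def)
  then show ?thesis by (simp add: pp_def half)
qed

text \<open>
  The only part of the Laplacian in which \<open>\<pi>\<close> is not restricted to \<open>k\<close>; it preserves every
  isotypic component because it commutes with \<open>K\<close>.
\<close>

definition Tp :: "'v \<Rightarrow> 'v" where "Tp v = (\<Sum>i<n. \<pi> (pp (e i)) (\<pi> (pp (e' i)) v))"

text \<open>One of the two projections may be dropped, as the mixed part between k and p is 0; in
  \<open>sum_Ad\<close> the transferred sum takes this shape.\<close>

lemma sum_pp: "(\<Sum>i<n. P (pp (e i)) * P (pp (e' i))) = (\<Sum>i<n. P (e i) * P (pp (e' i)))"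
  using car.sum_P_kp_pp[OF rep_P]
  by (simp add: car.kp_def car.lin_diff[OF car.rep_lin[OF rep_P]] left_diff_distrib sum_subtractf)

text \<open>K-invariance of the canonical tensor of \<open>p_plus\<close> and
  \<open>p_minus\<close>. Ad k need not preserve \<open>u\<close>, so the pair of adjoint operators
  to be transferred is Ad k after \<open>pp\<close> on \<open>u\<close> and Ad of the inverse after
  \<open>pp\<close> on \<open>ub\<close>.\<close>

lemma sum_Ad:
  assumes k: "k \<in> K"
  shows "(\<Sum>i<n. P (cAd k (pp (e i))) * P (cAd k (pp (e' i)))) = (\<Sum>i<n. P (pp (e i)) * P (pp (e' i)))"
proof -
  let ?A = "\<lambda>x. cAd k (pp x)" and ?A' = "\<lambda>y. cAd (inv\<^bsub>G\<^esub> k) (pp y)"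
  note k' = inv_K[OF k]
  have b: "car.bilin (\<lambda>y x. P x * P (?A y))"
  proof -
    have l: "P (x + y) = P x + P y" "P (cscale c x) = scal_op c * P x" for x y c
      using car.rep_lin[OF rep_P] unfolding car.lin_def by blast+
    show ?thesis unfolding car.bilin_def
      by (simp only: l pp_add pp_sc cAd_linear[OF k] distrib_left distrib_right car.mult_S_left mult.assoc) simp
  qed
  have p1: "pp (?A (e i)) = ?A (e i)" if "i < n" for i
    using Ad_p(1)[OF k pp_u_in[OF e_in[OF that]]] by (intro pp_p) auto
  have p2: "pp (?A' (e' i)) = ?A' (e' i)" if "i < n" for i
    using Ad_p(2)[OF k' pp_ub_in[OF e'_in[OF that]]] by (intro pp_p) auto
  have "(\<Sum>i<n. P (?A (e i)) * P (?A (e' i))) = (\<Sum>i<n. P (e i) * P (?A (?A' (e' i))))"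
  proof (rule car.transfer[OF b, where A = ?A and A' = ?A'])
    show "?A (e i) \<in> u" if "i < n" for i using Ad_p(1)[OF k pp_u_in[OF e_in[OF that]]] pu by auto
    show "?A' (e' i) \<in> ub" if "i < n" for i using Ad_p(2)[OF k' pp_ub_in[OF e'_in[OF that]]] pm_ub by auto
    fix i j assume ij: "i < n" "j < n"
    have "B (?A (e i)) (e' j) = B (?A (e i)) (pp (e' j))" using B_pp[of "?A (e i)" "e' j"] p1[OF ij(1)] by simp
    also have "\<dots> = B (cAd k (pp (e i))) (cAd k (?A' (e' j)))" by (simp add: cAd_inv[OF k])
    also have "\<dots> = B (pp (e i)) (?A' (e' j))" by (rule B_cAd[OF k])
    also have "\<dots> = B (e i) (?A' (e' j))" by (simp add: B_pp p2[OF ij(2)])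
    finally show "B (?A (e i)) (e' j) = B (e i) (?A' (e' j))" .
  qed
  also have "\<dots> = (\<Sum>i<n. P (e i) * P (pp (e' i)))"
    by (intro sum.cong refl) (simp add: p2 cAd_inv[OF k])
  finally show ?thesis using sum_pp by simp
qed

text \<open>Evaluation at constant functions turns identities in the operator ring into identities
  of operators on V.\<close>

lemma app_sum_P: "app (\<Sum>i<n. P (f i) * P (g i)) (\<lambda>I. v) {} = (\<Sum>i<n. \<pi> (f i) (\<pi> (g i) v))"
proof -
  have 1: "app (P X) (\<lambda>I. v) = (\<lambda>I. \<pi> X v)" for X v by (rule ext) (simp add: app_P)
  show ?thesis by (simp add: F.app_sum F.sum_fun_eval op_family_simps 1)
qed

lemma Tp_K: assumes k: "k \<in> K" shows "Tp (\<sigma> k v) = \<sigma> k (Tp v)"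
proof -
  interpret s: Vector_Spaces.linear sV sV "\<sigma> k" by (rule \<sigma>_linear[OF k])
  have "\<sigma> k (Tp v) = (\<Sum>i<n. \<pi> (cAd k (pp (e i))) (\<pi> (cAd k (pp (e' i))) (\<sigma> k v)))"
    by (simp add: Tp_def s.sum \<sigma>_\<pi>[OF k])
  also have "\<dots> = Tp (\<sigma> k v)"
    unfolding Tp_def app_sum_P[symmetric] sum_Ad[OF k] ..
  finally show ?thesis ..
qed

lemma Tp_linear: "Vector_Spaces.linear sV sV Tp"
proof -
  have l: "\<pi> X (v + w) = \<pi> X v + \<pi> X w" "\<pi> X (sV c v) = sV c (\<pi> X v)" for X v w c
    using \<pi>_linear[of X] unfolding Vector_Spaces.linear_iff by blast+
  show ?thesis unfolding Vector_Spaces.linear_iff Tp_def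
    by (simp add: vsV l sum.distrib V.scale_sum_right)
qed

definition pres_sub :: "'v set \<Rightarrow> 'v fock_op \<Rightarrow> bool" where
  "pres_sub V' a \<longleftrightarrow> (\<forall>f. (\<forall>I. f I \<in> V') \<longrightarrow> (\<forall>I. app a f I \<in> V'))"

lemma pres_sub_intros:
  assumes V': "V.subspace V'"
  shows "pres_sub V' a \<Longrightarrow> pres_sub V' b \<Longrightarrow> pres_sub V' (a + b)" "pres_sub V' a \<Longrightarrow> pres_sub V' b \<Longrightarrow> pres_sub V' (a - b)"
    "pres_sub V' a \<Longrightarrow> pres_sub V' b \<Longrightarrow> pres_sub V' (a * b)"
    "(\<And>i. i \<in> A \<Longrightarrow> pres_sub V' (g i)) \<Longrightarrow> pres_sub V' (\<Sum>i\<in>A. g i)"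
    "pres_sub V' (scal_op c)" "(\<And>v. v \<in> V' \<Longrightarrow> \<pi> X v \<in> V') \<Longrightarrow> pres_sub V' (P X)"
    "pres_sub V' (create_op i)" "pres_sub V' (annih_op i)"
  using V.subspace_add[OF V'] V.subspace_diff[OF V'] V.subspace_scale[OF V'] V.subspace_0[OF V'] V.subspace_sum[OF V']
  by (auto simp: pres_sub_def op_family_simps F.app_scal app_P F.app_create F.app_annih F.app_sum F.sum_fun_eval
      intro!: V.subspace_sum[OF V'])

lemma pres_sub_eps: "V.subspace V' \<Longrightarrow> pres_sub V' (eps x)" and pres_sub_iota: "V.subspace V' \<Longrightarrow> pres_sub V' (iota y)"
  unfolding car.eps_def car.iota_def by (intro pres_sub_intros; assumption)+

lemma Ck_eq: "Ck = (\<Sum>i<n. P (e' i - pp (e' i)) * create_op i) - scal_op (1/2) * car.cubic"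
  "Ckm = scal_op 2 * (\<Sum>i<n. P (e i - pp (e i)) * annih_op i) - car.cubic_m"
  unfolding car.Ck_def car.Ckm_def car.opC_def car.opCm_def car.Cp_def car.Cpm_def car.lin_part_def car.lin_part_m_def
  by (simp_all add: car.lin_diff[OF car.rep_lin[OF rep_P]] left_diff_distrib sum_subtractf right_diff_distrib)

lemma k_bracket: "cb (pp x) (pp y) \<in> k_part \<theta>"
  using cb_th[of "pp x" "pp y"] by (simp add: k_part_def th_pp rl.c.brl.neg rl.c.brr.neg)

text \<open>A function in \<open>VS n\<close> has finitely many values, so one subspace
  \<open>V'\<close> contains them all. In the Laplacian the k-parts of C and C^- and the brackets of
  p with p act through k, which preserves every K-stable subspace; the rest is
  \<open>Tp\<close>.\<close>

lemma locally_finite: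
  assumes f: "f \<in> VS n"
  shows "\<exists>V'. (\<forall>I. f I \<in> V') \<and> V.subspace V' \<and> fin_dim sV V' \<and> (\<forall>g\<in>VS n. (\<forall>I. g I \<in> V') \<longrightarrow> (\<forall>I. app H.Lap g I \<in> V'))"
proof -
  have "finite (f ` Pow {..<n})" by simp
  from UK.good_finite[OF Tp_linear Tp_K adm this \<sigma>_finite]
  obtain V' where V': "f ` Pow {..<n} \<subseteq> V'" "UK.good Tp V'" by blast
  have st: "UK.kstable V'" "fin_dim sV V'" "Tp ` V' \<subseteq> V'" using V'(2) UK.good_def[OF Tp_linear Tp_K adm] by auto
  have sub: "V.subspace V'" using st(1) by (simp add: stable_subspace_def)
  have fV: "f I \<in> V'" for I
    using V'(1) f V.subspace_0[OF sub] by (cases "I \<subseteq> {..<n}") (auto simp: VS_def)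
  note [intro] = stable_k[OF st(1)]
  note pi = pres_sub_intros[OF sub] and pe = pres_sub_eps[OF sub] pres_sub_iota[OF sub]
  have k: "pres_sub V' Ck" "pres_sub V' Ckm"
    unfolding Ck_eq car.cubic_def car.cubic_m_def
    by (intro pi pe stable_k[OF st(1)] kp_k; assumption)+
  have t: "pres_sub V' (\<Sum>i<n. P (pp (e i)) * P (pp (e' i)))"
    unfolding pres_sub_def
  proof (intro allI impI)
    fix g :: "nat set \<Rightarrow> 'v" and I assume g: "\<forall>I. g I \<in> V'"
    have "app (\<Sum>i<n. P (pp (e i)) * P (pp (e' i))) g I = Tp (g I)"
      by (simp add: Tp_def F.app_sum F.sum_fun_eval op_family_simps app_P)
    then show "app (\<Sum>i<n. P (pp (e i)) * P (pp (e' i))) g I \<in> V'" using st(3) g by auto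
  qed
  have q: "pres_sub V' (Cp * Cpm + Cpm * Cp)"
    unfolding car.Cp_Cpm[OF rep_P] by (intro pi t stable_k[OF st(1)] k_bracket; assumption)
  have "app H.Lap g I \<in> V'" if g: "g \<in> VS n" "\<forall>I. g I \<in> V'" for g I
  proof -
    have "app H.Lap g = app (Ck * Ckm + Ckm * Ck - (Cp * Cpm + Cpm * Cp)) g"
      unfolding H.Lap_eq[OF g(1)] by (simp add: op_family_simps)
    moreover have "pres_sub V' (Ck * Ckm + Ckm * Ck - (Cp * Cpm + Cpm * Cp))"
      by (intro pi(1,2,3) k q)
    ultimately show ?thesis using g(2) by (simp add: pres_sub_def)
  qed
  then show ?thesis using fV sub st(2) by blast
qed

lemma fun_vector_space: "vector_space (\<lambda>c f. app (scal_op c) f)"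
  by unfold_locales (auto simp: F.app_scal fun_eq_iff V.scale_right_distrib V.scale_left_distrib)

text \<open>The functions in \<open>VS n\<close> with values in \<open>V'\<close> lie in a
  finite-dimensional space and are preserved by \<open>Lap\<close>, so the powers of
  \<open>Lap\<close> applied to \<open>f\<close> satisfy a linear relation.\<close>

lemma complements: "H.complements"
proof (rule H.complementsI)
  fix f :: "nat set \<Rightarrow> 'v" assume f: "f \<in> VS n"
  obtain V' where V': "\<forall>I. f I \<in> V'" "V.subspace V'" "fin_dim sV V'"
    "\<And>g. g \<in> VS n \<Longrightarrow> \<forall>I. g I \<in> V' \<Longrightarrow> \<forall>I. app H.Lap g I \<in> V'"
    using locally_finite[OF f] by blast
  obtain b where b: "finite b" "V' \<subseteq> V.span b" using V'(3) by (auto simp: fin_dim_def)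
  interpret fv: vector_space "\<lambda>c f. app (scal_op c) f" by (rule fun_vector_space)
  define single where "single I v = (\<lambda>J. if J = I then v else (0 :: 'v))" for I :: "nat set" and v
  define BB where "BB = (\<lambda>(I, v). single I v) ` (Pow {..<n} \<times> b)"
  have finBB: "finite BB" using b(1) by (simp add: BB_def)
  have single_in: "single I v \<in> fv.span BB" if I: "I \<in> Pow {..<n}" and v: "v \<in> V.span b" for I v
    using v
  proof (induction rule: V.span_induct_alt)
    case base
    have "single I 0 = 0" by (auto simp: single_def fun_eq_iff)
    then show ?case by (simp only: fv.span_zero)
  next
    case (step c x y)
    have "single I (sV c x + y) = app (scal_op c) (single I x) + single I y"
      by (auto simp: single_def fun_eq_iff F.app_scal)
    moreover have "single I x \<in> fv.span BB" by (rule fv.span_base) (use I step(1) in \<open>auto simp: BB_def\<close>)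
    ultimately show ?case using step(2) by (simp only: fv.span_add fv.span_scale)
  qed
  have inspan: "g \<in> fv.span BB" if g: "g \<in> VS n" "\<forall>I. g I \<in> V'" for g
  proof -
    have "g = (\<Sum>I\<in>Pow {..<n}. single I (g I))"
    proof
      fix J
      have "(\<Sum>I\<in>Pow {..<n}. single I (g I)) J = (\<Sum>I\<in>Pow {..<n}. if J = I then g I else 0)"
        by (simp add: F.sum_fun_eval single_def)
      also have "\<dots> = g J" using g(1) by (auto simp: VS_def)
      finally show "g J = (\<Sum>I\<in>Pow {..<n}. single I (g I)) J" ..
    qed
    moreover have "(\<Sum>I\<in>Pow {..<n}. single I (g I)) \<in> fv.span BB"
      by (rule fv.span_sum) (use single_in b(2) g(2) in blast)
    ultimately show ?thesis by simp
  qed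
  have pow: "app (H.Lap ^ k) f \<in> VS n \<and> (\<forall>I. app (H.Lap ^ k) f I \<in> V')" for k
  proof (induction k)
    case 0
    then show ?case using f V'(1) by (simp add: op_family_simps(6)[OF vsV])
  next
    case (Suc k)
    then show ?case using V'(4) H.presC(5) by (simp only: power_Suc op_family_simps(5)[of _ H.Lap]) blast
  qed
  show "\<exists>N c. (\<exists>k\<le>N. c k \<noteq> 0) \<and> (\<Sum>k\<le>N. app (scal_op (c k)) (app (H.Lap ^ k) f)) = 0"
    by (rule fv.dependent_sequence[OF finBB]) (use inspan pow in blast)
qed

end

section \<open>The Dirac operator\<close>

context dirac_setting
begin

text \<open>Restricted to \<open>VS n\<close> because \<open>wedge\<close> cuts off outside the
  subsets of \<open>{..<n}\<close>, while the ring operators act on all functions.\<close>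

lemma wedge_eq: assumes x: "x \<in> u" and f: "f \<in> VS n" shows "wedge sV n e x f = app (eps x) f"
proof
  fix I
  show "wedge sV n e x f I = app (eps x) f I"
  proof (cases "I \<subseteq> {..<n}")
    case True
    have "app (eps x) f I = (\<Sum>i<n. if i \<in> I then sV (sgn_pos I i * B x (e' i)) (f (I - {i})) else 0)"
      unfolding car.eps_def F.app_sum F.sum_fun_eval
      by (intro sum.cong refl) (simp add: op_family_simps F.app_scal F.app_create mult.commute)
    also have "\<dots> = (\<Sum>i\<in>{..<n} \<inter> I. sV (sgn_pos I i * B x (e' i)) (f (I - {i})))"
      by (simp add: sum.inter_restrict)
    also have "{..<n} \<inter> I = I" using True by auto
    also have "(\<Sum>i\<in>I. sV (sgn_pos I i * B x (e' i)) (f (I - {i}))) = wedge sV n e x f I"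
      using True by (auto simp: wedge_def sgn_pos_def representation_e[OF x] intro!: sum.cong)
    finally show ?thesis ..
  next
    case False
    then show ?thesis using pres_eps[of x] f by (auto simp: pres_def VS_def wedge_def)
  qed
qed

lemma contract_eq: assumes f: "f \<in> VS n" shows "contract sV br n e y f = app (scal_op 2 * iota y) f"
proof
  fix I
  show "contract sV br n e y f I = app (scal_op 2 * iota y) f I"
  proof (cases "I \<subseteq> {..<n}")
    case True
    have "app (scal_op 2 * iota y) f I = (\<Sum>i<n. if i \<in> - I then sV (2 * sgn_pos I i * B y (e i)) (f (insert i I)) else 0)"
      unfolding car.iota_def op_family_simps(5) F.app_scal F.app_sum F.sum_fun_eval V.scale_sum_right
    proof (rule sum.cong[OF refl])
      fix i
      show "sV 2 (sV (B y (e i)) (app (annih_op i) f I)) = (if i \<in> - I then sV (2 * sgn_pos I i * B y (e i)) (f (insert i I)) else 0)"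
        unfolding F.app_annih by (cases "i \<in> I") (simp_all only: V.scale_scale V.scale_zero_right Compl_iff if_True if_False simp_thms mult.assoc mult.commute[of "B y (e i)"])
    qed
    also have "\<dots> = (\<Sum>i\<in>{..<n} \<inter> - I. sV (2 * sgn_pos I i * B y (e i)) (f (insert i I)))"
      by (simp add: sum.inter_restrict)
    also have "{..<n} \<inter> - I = {..<n} - I" by auto
    finally show ?thesis using True by (simp add: contract_def sgn_pos_def)
  next
    case False
    have "app (scal_op 2 * iota y) f \<in> VS n"
      using pres_intros(3)[OF pres_intros(5)[of 2] pres_iota[of y]] f by (simp add: pres_def)
    then show ?thesis using False by (auto simp: VS_def contract_def)
  qed
qed

lemma eps_0: "eps 0 = 0" and iota_0: "iota 0 = 0"
  by (rule car.lin_0 lin_eps lin_iota)+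

lemma clifford_u: assumes x: "x \<in> u" and f: "f \<in> VS n" shows "clifford sV br u n e x f = app (eps x) f"
proof -
  have "(THE x'. x' \<in> u \<and> x - x' \<in> ub) = x"
  proof (rule the_equality)
    show "x \<in> u \<and> x - x \<in> ub" using x cvs.subspace_0[OF sub_ub] by simp
    fix x' assume "x' \<in> u \<and> x - x' \<in> ub"
    then have "x - x' \<in> u \<inter> ub" using cvs.subspace_diff[OF sub_u x] by blast
    then show "x' = x" using parab(5) by auto
  qed
  then show ?thesis
    by (simp only: clifford_def Let_def diff_self wedge_eq[OF x f] contract_eq[OF f] iota_0 mult_zero_right op_family_simps(1) add_0_right)
qed

lemma clifford_ub: assumes y: "y \<in> ub" and f: "f \<in> VS n" shows "clifford sV br u n e y f = app (scal_op 2 * iota y) f"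
proof -
  have "(THE x. x \<in> u \<and> y - x \<in> ub) = 0"
  proof (rule the_equality)
    show "0 \<in> u \<and> y - 0 \<in> ub" using y cvs.subspace_0[OF sub_u] by simp
    fix x assume x: "x \<in> u \<and> y - x \<in> ub"
    then have "y - (y - x) \<in> ub" using cvs.subspace_diff[OF sub_ub y] by blast
    then show "x = 0" using parab(5) x by auto
  qed
  then show ?thesis
    by (simp only: clifford_def Let_def diff_zero wedge_eq[OF cvs.subspace_0[OF sub_u] f] contract_eq[OF f] eps_0 op_family_simps(1) add_0_left)
qed

lemma on_coeffs_eq: "on_coeffs (\<pi> X) f = app (P X) f" "on_coeffs (sV c) f = app (scal_op c) f"
  by (simp_all add: fun_eq_iff on_coeffs_def app_P F.app_scal)

lemma pres_VS: "pres a \<Longrightarrow> f \<in> VS n \<Longrightarrow> app a f \<in> VS n"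
  by (simp add: pres_def)

lemma clifford_e: "i < n \<Longrightarrow> f \<in> VS n \<Longrightarrow> clifford sV br u n e (e i) f = app (create_op i) f"
  "i < n \<Longrightarrow> f \<in> VS n \<Longrightarrow> clifford sV br u n e (e' i) f = app (scal_op 2 * annih_op i) f"
  using clifford_u[OF e_in] clifford_ub[OF e'_in] by simp_all

text \<open>Of the three Clifford factors in the cubic term only the bracket acts as a contraction,
  with a factor 2, so 1/4 becomes 1/2. In C^- two of them are contractions and 1/4 becomes
  1.\<close>

lemma dirac_C_eq: assumes f: "f \<in> VS n" shows "dirac_C sV br \<pi> u n e e' f = app (car.opC P) f"
proof -
  have 1: "on_coeffs (\<pi> (e' i)) (clifford sV br u n e (e i) f) = app (P (e' i) * create_op i) f" if "i < n" for i
    by (simp only: clifford_e[OF that f] on_coeffs_eq op_family_simps(5))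
  have 2: "clifford sV br u n e (cb (e' i) (e' j)) (clifford sV br u n e (e i) (clifford sV br u n e (e j) f))
    = app (scal_op 2 * (iota (cb (e' i) (e' j)) * (create_op i * create_op j))) f" if ij: "i < n" "j < n" for i j
  proof -
    note v = pres_VS[OF pres_intros(7)[OF ij(2)] f]
    show ?thesis
      unfolding clifford_e(1)[OF ij(2) f] clifford_e(1)[OF ij(1) v]
        clifford_ub[OF cb_ub_ub[OF e'_in[OF ij(1)] e'_in[OF ij(2)]] pres_VS[OF pres_intros(7)[OF ij(1)] v]]
      by (simp only: op_family_simps(5))
  qed
  have "dirac_C sV br \<pi> u n e e' f = app (\<Sum>i<n. P (e' i) * create_op i) f
    - app (scal_op (1/4)) (app (\<Sum>i<n. \<Sum>j<n. scal_op 2 * (iota (cb (e' i) (e' j)) * (create_op i * create_op j))) f)"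
    unfolding dirac_C_def half_dirac_def Let_def on_coeffs_eq(2) F.app_sum
    by (intro arg_cong2[where f = "(-)"] arg_cong[where f = "app (scal_op (1/4))"] sum.cong refl 1 2) auto
  also have "\<dots> = app (car.lin_part P - scal_op (1/4) * (scal_op 2 * car.cubic)) f"
    unfolding sum_distrib_left[symmetric] car.cubic_reorder car.lin_part_def op_family_simps ..
  also have "scal_op (1/4) * (scal_op 2 * car.cubic) = scal_op (1/2) * car.cubic"
    by (simp flip: mult.assoc scal_mult)
  finally show ?thesis by (simp only: car.opC_def)
qed

lemma dirac_Cminus_eq: assumes f: "f \<in> VS n" shows "dirac_Cminus sV br \<pi> u n e e' f = app (car.opCm P) f"
proof -
  have 1: "on_coeffs (\<pi> (e i)) (clifford sV br u n e (e' i) f) = app (scal_op 2 * (P (e i) * annih_op i)) f" if "i < n" for i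
    unfolding clifford_e(2)[OF that f] on_coeffs_eq op_family_simps(5)[symmetric] car.mult_S_left ..
  have 2: "clifford sV br u n e (cb (e i) (e j)) (clifford sV br u n e (e' i) (clifford sV br u n e (e' j) f))
    = app (scal_op 4 * (eps (cb (e i) (e j)) * annih_op i * annih_op j)) f" if ij: "i < n" "j < n" for i j
  proof -
    have q: "pres (scal_op 2 * annih_op i)" if "i < n" for i using that by (intro pres_intros)
    note v = pres_VS[OF q[OF ij(2)] f]
    have "eps (cb (e i) (e j)) * ((scal_op 2 * annih_op i) * (scal_op 2 * annih_op j))
      = scal_op 4 * (eps (cb (e i) (e j)) * annih_op i * annih_op j)"
      unfolding car.scalar_prod by (subst car.mult_S_left) (simp add: mult.assoc)
    then show ?thesis
      unfolding clifford_e(2)[OF ij(2) f] clifford_e(2)[OF ij(1) v]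
        clifford_u[OF cb_u_u[OF e_in[OF ij(1)] e_in[OF ij(2)]] pres_VS[OF q[OF ij(1)] v]]
      by (metis op_family_simps(5))
  qed
  have "dirac_Cminus sV br \<pi> u n e e' f = app (\<Sum>i<n. scal_op 2 * (P (e i) * annih_op i)) f
    - app (scal_op (1/4)) (app (\<Sum>i<n. \<Sum>j<n. scal_op 4 * (eps (cb (e i) (e j)) * annih_op i * annih_op j)) f)"
    unfolding dirac_Cminus_def half_dirac_def Let_def on_coeffs_eq(2) F.app_sum
    by (intro arg_cong2[where f = "(-)"] arg_cong[where f = "app (scal_op (1/4))"] sum.cong refl 1 2) auto
  also have "\<dots> = app (scal_op 2 * car.lin_part_m P - scal_op (1/4) * (scal_op 4 * car.cubic_m)) f"
    unfolding sum_distrib_left[symmetric] car.cubic_m_def car.lin_part_m_def op_family_simps ..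
  also have "scal_op (1/4) * (scal_op 4 * car.cubic_m) = car.cubic_m"
    by (simp flip: mult.assoc scal_mult add: scal_1)
  finally show ?thesis by (simp only: car.opCm_def)
qed

lemma dirac_D_eq: "f \<in> VS n \<Longrightarrow> dirac_D sV br \<pi> u n e e' f = app (car.opC P + car.opCm P) f"
  by (simp only: dirac_D_def dirac_C_eq dirac_Cminus_eq op_family_simps)

lemma spin_action_eq:
  assumes X: "X \<in> l" and f: "f \<in> VS n"
  shows "spin_action sV br \<pi> u n e e' X f = app (car.opL P X + scal_op (rho_char br ub X)) f"
proof -
  have 1: "clifford sV br u n e (cb X (e i)) (clifford sV br u n e (e' i) f) + clifford sV br u n e (cb X (e' i)) (clifford sV br u n e (e i) f)
    = app (eps (cb X (e i)) * (scal_op 2 * annih_op i) + scal_op 2 * iota (cb X (e' i)) * create_op i) f" if i: "i < n" for i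
  proof -
    have q: "pres (scal_op 2 * annih_op i)" using i by (intro pres_intros)
    show ?thesis
      unfolding clifford_e[OF i f] clifford_u[OF cb_l_u[OF X e_in[OF i]] pres_VS[OF q f]]
        clifford_ub[OF cb_l_ub[OF X e'_in[OF i]] pres_VS[OF pres_intros(7)[OF i] f]]
      by (simp only: op_family_simps)
  qed
  have "spin_action sV br \<pi> u n e e' X f
    = app (P X + scal_op (1/4) * (\<Sum>i<n. eps (cb X (e i)) * (scal_op 2 * annih_op i) + scal_op 2 * iota (cb X (e' i)) * create_op i)) f"
    unfolding spin_action_def Let_def on_coeffs_eq op_family_simps(2)[of _ "P X"] op_family_simps(5)[of _ "scal_op (1/4)"] F.app_sum
    by (intro arg_cong2[where f = "(+)"] arg_cong[where f = "app (scal_op (1/4))"] sum.cong refl 1) auto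
  also have "\<dots> = app (car.opL P X + scal_op ((\<Sum>i<n. B (cb X (e' i)) (e i)) / 2)) f"
    using car.spin_opL[OF rep_P, of X] cb_l_u[OF X] cb_l_ub[OF X] by simp
  finally show ?thesis by (simp add: rho_char_def trace_ub cb_l_ub[OF X])
qed

text \<open>The definite description in \<open>adjoint_on\<close> requires uniqueness, which is
  nondegeneracy of the form on \<open>VS n\<close>.\<close>

lemma adjoint_C:
  assumes f: "f \<in> VS n" shows "adjoint_on (VS n) (VS_form ip (u_form br \<theta>) n e) (dirac_C sV br \<pi> u n e e') f = app H.Ca f"
proof -
  have C: "F.form (dirac_C sV br \<pi> u n e e' g) f = F.form g (app H.Ca f)" if "g \<in> VS n" for g
    unfolding dirac_C_eq[OF that] opC_split by (rule F.adjD[OF H.adj_C])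
  show ?thesis
    unfolding adjoint_on_def h_def[symmetric]
  proof (rule the_equality)
    show "app H.Ca f \<in> VS n \<and> (\<forall>g\<in>VS n. F.form (dirac_C sV br \<pi> u n e e' g) f = F.form g (app H.Ca f))"
      using C H.presC(3)[OF f] by blast
    fix z assume z: "z \<in> VS n \<and> (\<forall>g\<in>VS n. F.form (dirac_C sV br \<pi> u n e e' g) f = F.form g z)"
    have "z - app H.Ca f = 0"
    proof (rule H.form_nondeg)
      show "z - app H.Ca f \<in> VS n" using z H.presC(3)[OF f] H.VS_closed(2) by blast
      fix g :: "nat set \<Rightarrow> 'v" assume "g \<in> VS n"
      then show "F.form g (z - app H.Ca f) = 0"
        using z C F.form_add_right[of g z "- app H.Ca f"] by (simp add: F.form_minus_right)
    qed
    then show "z = app H.Ca f" by (rule eq_iff_diff_eq_0[THEN iffD2])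
  qed
qed

lemma laplacian_eq:
  defines "C \<equiv> dirac_C sV br \<pi> u n e e'" and "Cadj \<equiv> adjoint_on (VS n) (VS_form ip (u_form br \<theta>) n e) (dirac_C sV br \<pi> u n e e')"
  assumes f: "f \<in> VS n"
  shows "C (Cadj f) + Cadj (C f) = app H.Lap f"
  unfolding C_def Cadj_def adjoint_C[OF f] dirac_C_eq[OF f] opC_split dirac_C_eq[OF H.presC(3)[OF f]] adjoint_C[OF H.presC(1)[OF f]]
  by (simp only: op_family_simps)

end

section \<open>Cohomology\<close>

lemma nths_omit:
  "nths (x # xs) (- {0}) = xs" "nths (x # xs) (- {Suc i}) = x # nths xs (- {i})"
  "nths (x # xs) (- {0, Suc i}) = nths xs (- {i})" "nths (x # xs) (- {Suc i, Suc j}) = x # nths xs (- {i, j})"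
proof -
  have "{j. Suc j \<in> - {0}} = UNIV" "{j. Suc j \<in> - {Suc i}} = - {i}" "{j. Suc j \<in> - {0, Suc i}} = - {i}"
    "{k. Suc k \<in> - {Suc i, Suc j}} = - {i, j}" by auto
  then show "nths (x # xs) (- {0}) = xs" "nths (x # xs) (- {Suc i}) = x # nths xs (- {i})"
    "nths (x # xs) (- {0, Suc i}) = nths xs (- {i})" "nths (x # xs) (- {Suc i, Suc j}) = x # nths xs (- {i, j})"
    by (simp_all add: nths_Cons nths_all)
qed

text \<open>Splits off the pairs that involve the head of a list, for the recursions
  \<open>ev_opC\<close> and \<open>bdry_tw\<close>.\<close>

lemma sum_pairs_Suc:
  "(\<Sum>j<Suc m. \<Sum>i<j. g i j) = (\<Sum>j<m. g 0 (Suc j)) + (\<Sum>j<m. \<Sum>i<j. g (Suc i) (Suc j) :: 'm::comm_monoid_add)"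
proof -
  have "(\<Sum>j<Suc m. \<Sum>i<j. g i j) = (\<Sum>j<m. \<Sum>i<Suc j. g i (Suc j))"
    by (subst sum.lessThan_Suc_shift) simp
  also have "\<dots> = (\<Sum>j<m. g 0 (Suc j) + (\<Sum>i<j. g (Suc i) (Suc j)))"
    by (rule sum.cong[OF refl]) (rule sum.lessThan_Suc_shift)
  finally show ?thesis by (simp only: sum.distrib)
qed

lemma set_nths_omit: "set xs \<subseteq> W \<Longrightarrow> set (nths xs A) \<subseteq> W"
  by (rule subset_trans[OF set_nths_subset])

context vector_space
begin

text \<open>Bringing entry \<open>i\<close> of an alternating function to the front costs
  \<open>i\<close> transpositions. The differential and the boundary put a bracket in front, whereas
  the action of an element leaves it in place.\<close>

lemma update_to_front:
  fixes F :: "'c list \<Rightarrow> 'b"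
  assumes "\<And>ps a b zs. F (ps @ a # b # zs) = - F (ps @ b # a # zs)" and "i < length xs"
  shows "F (xs[i := z]) = scale ((- 1) ^ i) (F (z # nths xs (- {i})))"
  using assms
proof (induction xs arbitrary: F i)
  case (Cons x xs)
  show ?case
  proof (cases i)
    case (Suc j)
    have "(F \<circ> (#) x) (ps @ a # b # zs) = - (F \<circ> (#) x) (ps @ b # a # zs)" for ps a b zs
      using Cons.prems(1)[of "x # ps" a b zs] by simp
    from Cons.IH[of "F \<circ> (#) x" j, OF this] have "F (x # xs[j := z]) = scale ((- 1) ^ j) (F (x # z # nths xs (- {j})))"
      using Cons.prems(2) Suc by simp
    also have "F (x # z # nths xs (- {j})) = - F (z # x # nths xs (- {j}))"
      using Cons.prems(1)[of "[]" x z "nths xs (- {j})"] by simp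
    finally show ?thesis by (simp add: Suc nths_omit)
  qed (simp add: nths_omit)
qed simp

end

context dirac_setting
begin

text \<open>Iterated contraction identifies V \<otimes> \<Lambda>u with the alternating forms on
  \<open>ub\<close>. It uses \<open>iota\<close>, without the Clifford factor 2, so that the value
  on an increasing list of the \<open>e'\<close> is the coefficient itself.\<close>

primrec ev :: "('e \<times> 'e) list \<Rightarrow> (nat set \<Rightarrow> 'v) \<Rightarrow> 'v" where
  "ev [] f = f {}"
| "ev (x # xs) f = ev xs (app (iota x) f)"

lemma ev_add: "ev xs (f + g) = ev xs f + ev xs g"
  by (induction xs arbitrary: f g) (simp_all add: op_family_add)

lemma ev_scal: "ev xs (app (scal_op c) f) = sV c (ev xs f)"
proof (induction xs arbitrary: f)
  case (Cons x xs)
  have "app (iota x) (app (scal_op c) f) = app (scal_op c) (app (iota x) f)"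
    by (metis op_family_simps(5) scal_central)
  then show ?case by (simp only: ev.simps Cons.IH)
qed (simp add: F.app_scal)

lemma ev_zero: "ev xs 0 = 0"
proof (induction xs)
  case Nil
  show ?case by simp
next
  case (Cons x xs)
  then show ?case by (simp only: ev.simps F.app_zero)
qed

lemma \<pi>_0: "\<pi> X 0 = 0"
  using \<pi>_linear[of X] by (metis Vector_Spaces.linear_iff V.scale_zero_left)

lemma ev_uminus: "ev xs (- f) = - ev xs f"
  using ev_add[of xs f "- f"] by (simp add: ev_zero add_eq_0_iff)

lemma ev_diff: "ev xs (f - g) = ev xs f - ev xs g"
  using ev_add[of xs f "- g"] by (simp add: ev_uminus)

lemma ev_append: "ev (xs @ ys) f = ev ys (foldl (\<lambda>g x. app (iota x) g) f xs)"
  by (induction xs arbitrary: f) simp_all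

lemma ev_swap: "ev (ps @ a # b # zs) f = - ev (ps @ b # a # zs) f"
proof -
  have "app (iota b) (app (iota a) g) = - app (iota a) (app (iota b) g)" for g
    by (metis car.iota_anti op_family_simps(3,5))
  then show ?thesis by (simp only: ev_append ev.simps ev_uminus)
qed

lemma ev_linear_slot: "ev (ps @ (x + y) # zs) f = ev (ps @ x # zs) f + ev (ps @ y # zs) f"
  "ev (ps @ cscale c x # zs) f = sV c (ev (ps @ x # zs) f)"
  by (simp_all only: ev_append ev.simps iota_add iota_sc op_family_simps ev_add ev_scal)

lemma ev_repeat: "ev (ps @ a # ys @ a # zs) f = 0"
proof -
  have "iota a * iota a = (0 :: 'v fock_op)"
    by (rule car.double_eq_0) (metis car.iota_anti add.right_inverse)
  then have "app (iota a) (app (iota a) g) = 0" for g by (metis op_family_simps(1,5))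
  moreover have "ev (ys @ a # zs) g = 0" if "app (iota a) g = 0" for g
    using that
  proof (induction ys arbitrary: g)
    case Nil
    then show ?case by (simp only: append_Nil ev.simps ev_zero)
  next
    case (Cons b ys)
    have "app (iota a) (app (iota b) g) = - app (iota b) (app (iota a) g)"
      by (metis car.iota_anti op_family_simps(3,5))
    also have "\<dots> = 0" by (simp only: Cons.prems F.app_zero minus_zero)
    finally show ?case by (simp only: append_Cons ev.simps Cons.IH)
  qed
  ultimately show ?thesis by (simp only: ev_append[of ps] ev.simps)
qed

lemma ev_opL:
  assumes "set xs \<subseteq> ub"
  shows "ev xs (app (car.opL P X) f) = \<pi> X (ev xs f) - (\<Sum>i<length xs. ev (xs[i := cb X (xs ! i)]) f)"
  using assms
proof (induction xs arbitrary: f)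
  case Nil
  have "app (car.opL P X) f {} = \<pi> X (f {})"
    by (simp add: car.opL_def op_family_simps F.app_sum F.sum_fun_eval app_P F.app_create)
  then show ?case by simp
next
  case (Cons y ys)
  have "iota y * car.opL P X = car.opL P X * iota y - iota (cb X y)"
    using car.opL_iota[OF rep_P, of y X] Cons.prems by simp
  then have "app (iota y) (app (car.opL P X) f) = app (car.opL P X) (app (iota y) f) - app (iota (cb X y)) f"
    by (metis op_family_simps(4,5))
  then have "ev (y # ys) (app (car.opL P X) f)
      = \<pi> X (ev (y # ys) f) - (\<Sum>i<length ys. ev (y # ys[i := cb X (ys ! i)]) f) - ev (cb X y # ys) f"
    using Cons by (simp add: ev_diff)
  then show ?case by (simp add: sum.lessThan_Suc_shift del: sum.lessThan_Suc ev.simps)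
qed

text \<open>By Cartan's formula, contracting with the head \<open>x\<close> gives the action of
  \<open>x\<close> minus the differential of the contracted element. The first accounts for the
  terms in which \<open>x\<close> acts or is bracketed, the second, by induction, for all
  others.\<close>

lemma ev_opC:
  assumes "set xs \<subseteq> ub"
  shows "ev xs (app (car.opC P) f) = (\<Sum>i<length xs. sV ((-1) ^ i) (\<pi> (xs ! i) (ev (nths xs (- {i})) f))) +
     (\<Sum>j<length xs. \<Sum>i<j. sV ((-1) ^ (i + j)) (ev (cb (xs ! i) (xs ! j) # nths xs (- {i, j})) f))"
  using assms
proof (induction xs arbitrary: f)
  case Nil
  have "app (car.opC P) f {} = 0"
    by (simp add: car.opC_def car.lin_part_def car.cubic_def op_family_simps F.app_sum F.sum_fun_eval app_P F.app_create F.app_scal mult.assoc \<pi>_0)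
  then show ?case by simp
next
  case (Cons x xs)
  have xs: "set xs \<subseteq> ub" and x: "x \<in> ub" using Cons.prems by auto
  let ?f = "app (iota x) f"
  have "iota x * car.opC P = car.opL P x - car.opC P * iota x"
    using car.opC_iota[OF rep_P x] by (simp add: algebra_simps)
  then have "app (iota x) (app (car.opC P) f) = app (car.opL P x) f - app (car.opC P) ?f"
    by (metis op_family_simps(4,5))
  then have "ev (x # xs) (app (car.opC P) f) = ev xs (app (car.opL P x) f) - ev xs (app (car.opC P) ?f)"
    by (simp add: ev_diff)
  also have "ev xs (app (car.opL P x) f) = \<pi> x (ev xs f) - (\<Sum>i<length xs. sV ((- 1) ^ i) (ev (cb x (xs ! i) # nths xs (- {i})) f))"
    unfolding ev_opL[OF xs]
    by (intro arg_cong2[where f = "(-)"] sum.cong refl V.update_to_front[where F = "\<lambda>ys. ev ys f"] ev_swap) auto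
  also have "ev xs (app (car.opC P) ?f) = (\<Sum>i<length xs. sV ((-1) ^ i) (\<pi> (xs ! i) (ev (x # nths xs (- {i})) f))) -
     (\<Sum>j<length xs. \<Sum>i<j. sV ((-1) ^ (i + j)) (ev (cb (xs ! i) (xs ! j) # x # nths xs (- {i, j})) f))"
  proof -
    have "ev (y # ys) ?f = - ev (y # x # ys) f" for y ys
      using ev_swap[of "[]" x y ys f] by simp
    then show ?thesis using Cons.IH[OF xs, of ?f] by (simp add: sum_negf)
  qed
  finally show ?case
    unfolding length_Cons sum_pairs_Suc
    by (simp add: sum.lessThan_Suc_shift nths_omit sum_negf del: sum.lessThan_Suc ev.simps)
qed

definition cochain_of :: "(nat set \<Rightarrow> 'v) \<Rightarrow> ('e \<times> 'e) list \<Rightarrow> 'v" where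
  "cochain_of f xs = (if set xs \<subseteq> ub then ev xs f else 0)"

lemma sgn_pos_least: "(\<And>j. j \<in> I \<Longrightarrow> i \<le> j) \<Longrightarrow> sgn_pos I i = 1"
proof -
  assume "\<And>j. j \<in> I \<Longrightarrow> i \<le> j"
  then have "{j \<in> I. j < i} = {}" by force
  then show ?thesis by (simp add: sgn_pos_def del: Collect_empty_eq)
qed

lemma ev_e':
  assumes "sorted_wrt (<) is" "set is \<subseteq> {..<n}"
  shows "ev (map e' is) f = f (set is)"
  using assms
proof (induction "is" arbitrary: f)
  case (Cons i "is")
  have i: "i < n" "\<And>j. j \<in> set is \<Longrightarrow> i < j" using Cons.prems by auto
  have "ev (map e' (i # is)) f = app (annih_op i) f (set is)" using Cons i by (simp add: car.iota_e')
  also have "\<dots> = f (set (i # is))"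
    using i(2) sgn_pos_least[of "set is" i] by (auto simp: F.app_annih less_imp_le)
  finally show ?case .
qed simp

lemma cochain_of_sorted:
  assumes "I \<subseteq> {..<n}" shows "cochain_of f (map e' (sorted_list_of_set I)) = f I"
proof -
  have "finite I" using assms finite_subset by blast
  moreover have "e' ` I \<subseteq> ub" using assms e'_in by auto
  ultimately show ?thesis using assms ev_e'[of "sorted_list_of_set I"] by (simp add: cochain_of_def)
qed

lemma cochain_of_cochains: "cochain_of f \<in> cochains cscale sV ub"
proof -
  have d: "ev xs f = 0" if "\<not> distinct xs" for xs
    using not_distinct_decomp[OF that] ev_repeat by auto
  have c: "x + y \<in> ub" "cscale c x \<in> ub" if "x \<in> ub" "y \<in> ub" for x y c
    using that cvs.subspace_add[OF sub_ub] cvs.subspace_scale[OF sub_ub] by blast+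
  show ?thesis
    unfolding cochains_def mem_Collect_eq
  proof (intro conjI allI impI)
    fix xs ys x y c
    assume "set xs \<subseteq> ub \<and> set ys \<subseteq> ub \<and> x \<in> ub \<and> y \<in> ub"
    then show "cochain_of f (xs @ (x + y) # ys) = cochain_of f (xs @ x # ys) + cochain_of f (xs @ y # ys)"
      using c(1)[of x y] by (simp only: cochain_of_def set_append list.set Un_subset_iff insert_subset simp_thms if_True ev_linear_slot)
  next
    fix xs ys x c
    assume "set xs \<subseteq> ub \<and> set ys \<subseteq> ub \<and> x \<in> ub"
    then show "cochain_of f (xs @ cscale c x # ys) = sV c (cochain_of f (xs @ x # ys))"
      using c(2)[of x x c] by (simp only: cochain_of_def set_append list.set Un_subset_iff insert_subset simp_thms if_True ev_linear_slot)
  qed (auto simp: cochain_of_def d)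
qed

lemma cochain_of_linear: "cochain_of (f + g) = cochain_of f + cochain_of g" "cochain_of (f - g) = cochain_of f - cochain_of g"
  "cochain_of (on_coeffs (sV c) f) = on_coeffs (sV c) (cochain_of f)"
proof -
  show "cochain_of (f + g) = cochain_of f + cochain_of g" "cochain_of (f - g) = cochain_of f - cochain_of g"
    by (simp_all only: fun_eq_iff cochain_of_def ev_add ev_diff plus_fun_apply minus_apply) simp_all
  have "on_coeffs (sV c) f = app (scal_op c) f" by (simp add: fun_eq_iff on_coeffs_def F.app_scal)
  then show "cochain_of (on_coeffs (sV c) f) = on_coeffs (sV c) (cochain_of f)"
    by (simp only: fun_eq_iff cochain_of_def ev_scal on_coeffs_def) simp
qed

lemma cochain_of_inj: "inj_on cochain_of (VS n)"
proof (rule inj_onI)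
  fix f g :: "nat set \<Rightarrow> 'v" assume fg: "f \<in> VS n" "g \<in> VS n" "cochain_of f = cochain_of g"
  show "f = g"
  proof
    fix I show "f I = g I"
      using fg cochain_of_sorted[of I f] cochain_of_sorted[of I g] by (cases "I \<subseteq> {..<n}") (auto simp: VS_def)
  qed
qed

lemma cochain_add:
  assumes "c \<in> cochains cscale sV ub" "set xs \<subseteq> ub" "set ys \<subseteq> ub" "x \<in> ub" "y \<in> ub"
  shows "c (xs @ (x + y) # ys) = c (xs @ x # ys) + c (xs @ y # ys)"
  using assms unfolding cochains_def by blast

lemma cochain_scale:
  assumes "c \<in> cochains cscale sV ub" "set xs \<subseteq> ub" "set ys \<subseteq> ub" "x \<in> ub"
  shows "c (xs @ cscale a x # ys) = sV a (c (xs @ x # ys))"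
  using assms unfolding cochains_def by blast

lemma cochain_zero:
  assumes "c \<in> cochains cscale sV ub" shows "\<not> set xs \<subseteq> ub \<Longrightarrow> c xs = 0" "\<not> distinct xs \<Longrightarrow> c xs = 0"
  using assms unfolding cochains_def by blast+

lemma cochain_swap:
  assumes c: "c \<in> cochains cscale sV ub" and W: "set xs \<subseteq> ub" "set ys \<subseteq> ub" "x \<in> ub" "y \<in> ub"
  shows "c (xs @ x # y # ys) = - c (xs @ y # x # ys)"
proof -
  note add = cochain_add[OF c]
  have rep: "c (xs @ x # x # ys) = 0" for xs x ys using c unfolding cochains_def by force
  have xy: "x + y \<in> ub" using W cvs.subspace_add[OF sub_ub] by blast
  have a2: "c (xs @ z # (x + y) # ys) = c (xs @ z # x # ys) + c (xs @ z # y # ys)" if "z \<in> ub" for z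
    using add[of "xs @ [z]" ys x y] W that by simp
  have "0 = c (xs @ (x + y) # (x + y) # ys)" using rep by simp
  also have "\<dots> = c (xs @ x # (x + y) # ys) + c (xs @ y # (x + y) # ys)" by (rule add) (use W xy in auto)
  also have "\<dots> = c (xs @ x # y # ys) + c (xs @ y # x # ys)" by (simp only: a2 W rep add_0_left add_0_right)
  finally show ?thesis by (simp add: eq_neg_iff_add_eq_0)
qed

text \<open>Only vanishing is compared, so that the sign of the sorting permutation need not be
  tracked; \<open>cochain_eq_0\<close> asks for no more.\<close>

lemma cochain_insort:
  assumes c: "c \<in> cochains cscale sV ub"
  shows "set (ps @ i # js) \<subseteq> {..<n} \<Longrightarrow> c (map e' (ps @ insort i js)) = 0 \<longleftrightarrow> c (map e' (ps @ i # js)) = 0"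
proof (induction js arbitrary: ps)
  case (Cons j js)
  have "c (map e' ps @ e' j # e' i # map e' js) = - c (map e' ps @ e' i # e' j # map e' js)"
    by (rule cochain_swap[OF c]) (use Cons.prems e'_in in auto)
  moreover have "c (map e' ((ps @ [j]) @ insort i js)) = 0 \<longleftrightarrow> c (map e' ((ps @ [j]) @ i # js)) = 0"
    by (rule Cons.IH) (use Cons.prems in auto)
  ultimately show ?case by simp
qed simp

lemma cochain_sort:
  assumes c: "c \<in> cochains cscale sV ub"
  shows "set (ps @ is) \<subseteq> {..<n} \<Longrightarrow> c (map e' (ps @ sort is)) = 0 \<longleftrightarrow> c (map e' (ps @ is)) = 0"
proof (induction "is" arbitrary: ps)
  case (Cons i "is")
  have "c (map e' (ps @ sort (i # is))) = 0 \<longleftrightarrow> c (map e' (ps @ i # sort is)) = 0"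
    using cochain_insort[OF c, of ps i "sort is"] Cons.prems by simp
  also have "\<dots> \<longleftrightarrow> c (map e' (ps @ i # is)) = 0"
    using Cons.IH[of "ps @ [i]"] Cons.prems by simp
  finally show ?case .
qed simp

lemma cochain_eq_0:
  assumes c: "c \<in> cochains cscale sV ub" and 0: "\<And>I. I \<subseteq> {..<n} \<Longrightarrow> c (map e' (sorted_list_of_set I)) = 0"
  shows "c = 0"
proof
  have basis0: "c (map e' is) = 0" if "set is \<subseteq> {..<n}" for "is"
  proof (cases "distinct is")
    case True
    have "sorted_list_of_set (set is) = sort is"
      using True by (simp add: sorted_list_of_set_sort_remdups distinct_remdups_id)
    then show ?thesis using 0[OF that] cochain_sort[OF c, of "[]" "is"] that by simp
  next
    case False
    then have "\<not> distinct (map e' is)" by (simp add: distinct_map)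
    then show ?thesis using c unfolding cochains_def by blast
  qed
  \<comment> \<open>Entries are expanded in the basis one at a time; the basis vectors chosen so far
    stand in front as \<open>map e' is\<close>.\<close>
  have all0: "c (map e' is @ xs) = 0" if "set is \<subseteq> {..<n}" "set xs \<subseteq> ub" for "is" xs
    using that
  proof (induction xs arbitrary: "is")
    case (Cons x xs)
    have i: "set (map e' is) \<subseteq> ub" and xs: "set xs \<subseteq> ub" using Cons.prems e'_in by auto
    have "x \<in> cvs.span (e' ` {..<n})" using Cons.prems e'_basis(3) by simp
    then have "x \<in> ub \<and> c (map e' is @ x # xs) = 0"
    proof (induction rule: cvs.span_induct_alt)
      case base
      have "c (map e' is @ cscale 0 0 # xs) = sV 0 (c (map e' is @ 0 # xs))"
        by (rule cochain_scale[OF c i xs cvs.subspace_0[OF sub_ub]])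
      then show ?case using cvs.subspace_0[OF sub_ub] by (simp only: cvs.scale_zero_right V.scale_zero_left simp_thms)
    next
      case (step a x y)
      obtain j where j: "j < n" "x = e' j" using step(1) by auto
      note ax = cvs.subspace_scale[OF sub_ub e'_in[OF j(1)], of a]
      have "c (map e' (is @ [j]) @ xs) = 0" by (rule Cons.IH) (use Cons.prems j xs in auto)
      then have "c (map e' is @ cscale a (e' j) # xs) = 0"
        using cochain_scale[OF c i xs e'_in[OF j(1)], of a] by simp
      then show ?case
        using cochain_add[OF c i xs ax, of y] step(2) cvs.subspace_add[OF sub_ub ax, of y] unfolding j(2)
        by (simp only: simp_thms add_0_left)
    qed
    then show ?case ..
  qed (use basis0 in simp)
  fix xs
  show "c xs = 0 xs"
  proof (cases "set xs \<subseteq> ub")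
    case True
    then show ?thesis using all0[of "[]" xs] by simp
  next
    case False
    then show ?thesis using c unfolding cochains_def by simp
  qed
qed

lemma cochains_diff: assumes c: "c \<in> cochains cscale sV ub" and d: "d \<in> cochains cscale sV ub"
  shows "c - d \<in> cochains cscale sV ub"
  unfolding cochains_def mem_Collect_eq minus_apply
proof (intro conjI allI impI)
  fix xs ys x y assume "set xs \<subseteq> ub \<and> set ys \<subseteq> ub \<and> x \<in> ub \<and> y \<in> ub"
  then have W: "set xs \<subseteq> ub" "set ys \<subseteq> ub" "x \<in> ub" "y \<in> ub" by blast+
  show "c (xs @ (x + y) # ys) - d (xs @ (x + y) # ys) = c (xs @ x # ys) - d (xs @ x # ys) + (c (xs @ y # ys) - d (xs @ y # ys))"
    unfolding cochain_add[OF c W] cochain_add[OF d W] by (rule add_diff_add)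
next
  fix xs ys x a assume "set xs \<subseteq> ub \<and> set ys \<subseteq> ub \<and> x \<in> ub"
  then have W: "set xs \<subseteq> ub" "set ys \<subseteq> ub" "x \<in> ub" by blast+
  show "c (xs @ cscale a x # ys) - d (xs @ cscale a x # ys) = sV a (c (xs @ x # ys) - d (xs @ x # ys))"
    unfolding cochain_scale[OF c W] cochain_scale[OF d W] by (rule V.scale_right_diff_distrib[symmetric])
qed (simp_all add: cochain_zero[OF c] cochain_zero[OF d])

text \<open>A cochain and the one built from its values on increasing basis lists differ by a
  cochain that vanishes on all these lists, hence by 0.\<close>

lemma cochain_of_image: "cochain_of ` VS n = cochains cscale sV ub"
proof (rule equalityI; rule subsetI)
  fix c assume c: "c \<in> cochains cscale sV ub"
  define f where "f I = (if I \<subseteq> {..<n} then c (map e' (sorted_list_of_set I)) else 0)" for I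
  have "f \<in> VS n" by (simp add: f_def VS_def)
  moreover have "c - cochain_of f = 0"
    by (rule cochain_eq_0[OF cochains_diff[OF c cochain_of_cochains]]) (simp only: minus_apply cochain_of_sorted, simp add: f_def)
  then have "c = cochain_of f" by (rule eq_iff_diff_eq_0[THEN iffD2])
  ultimately show "c \<in> cochain_of ` VS n" by blast
qed (use cochain_of_cochains in blast)

lemma cohom_d_cochain_of: "cohom_d sV cb \<pi> ub (cochain_of f) = cochain_of (app (car.opC P) f)"
proof
  fix xs
  show "cohom_d sV cb \<pi> ub (cochain_of f) xs = cochain_of (app (car.opC P) f) xs"
  proof (cases "set xs \<subseteq> ub")
    case True
    have 1: "cochain_of f (nths xs A) = ev (nths xs A) f" for A
      using set_nths_omit[OF True] by (simp add: cochain_of_def)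
    have 2: "cochain_of f (cb (xs ! i) (xs ! j) # nths xs A) = ev (cb (xs ! i) (xs ! j) # nths xs A) f"
      if "j < length xs" "i < j" for i j A
    proof -
      have "xs ! i \<in> ub" "xs ! j \<in> ub" using True that by (meson nth_mem less_trans subsetD)+
      then have "set (cb (xs ! i) (xs ! j) # nths xs A) \<subseteq> ub" using set_nths_omit[OF True] cb_ub_ub by simp
      then show ?thesis by (simp only: cochain_of_def if_True)
    qed
    have 3: "(\<Sum>j<length xs. \<Sum>i<j. sV ((-1) ^ (i + j)) (cochain_of f (cb (xs ! i) (xs ! j) # nths xs (- {i, j}))))
      = (\<Sum>j<length xs. \<Sum>i<j. sV ((-1) ^ (i + j)) (ev (cb (xs ! i) (xs ! j) # nths xs (- {i, j})) f))"
      by (rule sum.cong[OF refl], rule sum.cong[OF refl], subst 2) simp_all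
    show ?thesis
      unfolding cohom_d_def 1 3 cochain_of_def[of "app (car.opC P) f"] ev_opC[OF True] using True by (simp only: if_True)
  qed (simp add: cohom_d_def cochain_of_def)
qed

lemma cohom_action_cochain_of:
  assumes X: "X \<in> l" shows "cohom_action cb \<pi> ub X (cochain_of f) = cochain_of (app (car.opL P X) f)"
proof
  fix xs
  show "cohom_action cb \<pi> ub X (cochain_of f) xs = cochain_of (app (car.opL P X) f) xs"
  proof (cases "set xs \<subseteq> ub")
    case True
    have 1: "cochain_of f (xs[i := cb X (xs ! i)]) = ev (xs[i := cb X (xs ! i)]) f" if "i < length xs" for i
    proof -
      have "xs ! i \<in> ub" using True that by (meson nth_mem subsetD)
      then have "set (xs[i := cb X (xs ! i)]) \<subseteq> ub" using set_update_subset_insert[of xs i] cb_l_ub[OF X] True by blast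
      then show ?thesis by (simp only: cochain_of_def if_True)
    qed
    then show ?thesis using True by (simp add: cohom_action_def cochain_of_def ev_opL)
  qed (simp add: cohom_action_def cochain_of_def)
qed

end

section \<open>Homology\<close>

lemma eq_uminus_diff: assumes "a + b = - (t :: 'm::ab_group_add)" shows "a = - b - t"
proof -
  have "- b - t = - b + (a + b)" by (simp only: assms diff_conv_add_uminus)
  then show ?thesis by simp
qed

lemma on_coeffs_uminus: "on_coeffs uminus g I = - g I"
  by (simp add: on_coeffs_def)

context dirac_setting
begin

sublocale fv: vector_space "\<lambda>c. on_coeffs (sV c) :: (nat set \<Rightarrow> 'v) \<Rightarrow> nat set \<Rightarrow> 'v"
  by unfold_locales (auto simp: on_coeffs_def fun_eq_iff V.scale_right_distrib V.scale_left_distrib)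

lemma app_on_coeffs: "app a (on_coeffs (sV c) f) = on_coeffs (sV c) (app a f)"
  unfolding on_coeffs_eq by (metis op_family_simps(5) scal_central)

text \<open>The action of \<open>y\<close> on V \<otimes> \<Lambda>u through the adjoint action on
  the wedge factors. For \<open>y\<close> in \<open>l\<close> it is \<open>opL\<close>; for
  \<open>y\<close> in \<open>u\<close> it is the operator that the dual of Cartan's formula
  produces.\<close>

definition opU :: "'e \<times> 'e \<Rightarrow> 'v fock_op" where
  "opU y = P y + (\<Sum>j<n. eps (cb y (e j)) * annih_op j)"

lemma opU_eps: assumes x: "x \<in> u" shows "opU y * eps x = eps x * opU y + eps (cb y x)"
proof -
  let ?T = "\<Sum>j<n. eps (cb y (e j)) * annih_op j :: 'v fock_op"
  have l: "car.lin (\<lambda>x. eps (cb y x))"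
    unfolding car.lin_def by (simp only: rl.c.brr.add rl.c.brr.scale eps_add eps_sc) simp
  have t: "eps (cb y (e j)) * annih_op j * eps x = scal_op (B x (e' j)) * eps (cb y (e j)) + eps x * (eps (cb y (e j)) * annih_op j)"
    if "j < n" for j
  proof -
    have "eps (cb y (e j)) * annih_op j * eps x = eps (cb y (e j)) * scal_op (B x (e' j)) - eps (cb y (e j)) * eps x * annih_op j"
      by (simp only: mult.assoc car.I_eps[OF that] right_diff_distrib)
    also have "eps (cb y (e j)) * eps x = - (eps x * eps (cb y (e j)))" by (rule car.eps_anti)
    finally show ?thesis by (simp add: scal_central mult.assoc)
  qed
  have "?T * eps x = (\<Sum>j<n. scal_op (B x (e' j)) * eps (cb y (e j))) + eps x * ?T"
    unfolding sum_distrib_right sum_distrib_left sum.distrib[symmetric] by (rule sum.cong[OF refl]) (use t in auto)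
  also have "(\<Sum>j<n. scal_op (B x (e' j)) * eps (cb y (e j))) = eps (cb y x)"
    by (rule car.lin_expand_u[OF l x])
  finally show ?thesis
    unfolding opU_def distrib_left distrib_right by (simp add: car.rep_eps[OF rep_P] add_ac)
qed

definition bdry :: "'v fock_op" where "bdry = scal_op (1/2) * car.cubic_m - car.lin_part_m P"

text \<open>The dual of Cartan's formula: it moves the boundary past a wedge product and so
  determines it recursively on decomposable elements.\<close>

lemma bdry_eps: assumes y: "y \<in> u" shows "bdry * eps y = - (eps y * bdry) - opU y"
proof -
  let ?T = "\<Sum>j<n. eps (cb y (e j)) * annih_op j :: 'v fock_op"
  have "scal_op (1/2) * (car.cubic_m * eps y + eps y * car.cubic_m) = - ?T"
    unfolding car.cubic_m_eps[OF y] mult_minus_right car.half_double ..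
  then have 1: "scal_op (1/2) * car.cubic_m * eps y = - (eps y * (scal_op (1/2) * car.cubic_m)) - ?T"
    unfolding distrib_left car.mult_S_left[of "eps y"] mult.assoc by (rule eq_uminus_diff)
  have 2: "car.lin_part_m P * eps y = - (eps y * car.lin_part_m P) + P y"
    using car.lin_part_m_eps[OF rep_P y] by (simp add: algebra_simps)
  show ?thesis unfolding bdry_def left_diff_distrib right_diff_distrib 1 2 opU_def by simp
qed

lemma opCm_bdry: "car.opCm P = scal_op (- 2) * bdry"
proof -
  have "scal_op 2 * (scal_op (1/2) * car.cubic_m) = car.cubic_m" by (simp flip: mult.assoc scal_mult add: scal_1)
  then show ?thesis by (simp add: car.opCm_def bdry_def right_diff_distrib car.S_minus)
qed

lemma opU_opL: "X \<in> l \<Longrightarrow> opU X = car.opL P X"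
  using car.opL_eq[OF rep_P, of X] cb_l_u cb_l_ub by (simp add: opU_def)

definition tw :: "'v \<Rightarrow> ('e \<times> 'e) list \<Rightarrow> nat set \<Rightarrow> 'v" where
  "tw v ys = foldr (\<lambda>y. app (eps y)) ys (\<lambda>I. if I = {} then v else 0)"

lemma tw_Cons: "tw v (y # ys) = app (eps y) (tw v ys)"
  by (simp add: tw_def)

lemma tw_VS: "tw v ys \<in> VS n"
proof (induction ys)
  case Nil
  show ?case by (simp add: tw_def VS_def)
next
  case (Cons y ys)
  then show ?case unfolding tw_Cons by (rule pres_VS[OF pres_eps])
qed

lemma tensor_wedge_eq: "set ys \<subseteq> u \<Longrightarrow> tensor_wedge sV n e v ys = tw v ys"
proof (induction ys)
  case (Cons y ys)
  have "tensor_wedge sV n e v (y # ys) = wedge sV n e y (tw v ys)"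
    using Cons by (simp add: tensor_wedge_def)
  also have "\<dots> = tw v (y # ys)" unfolding tw_Cons by (rule wedge_eq) (use Cons.prems tw_VS in auto)
  finally show ?case .
qed (simp add: tensor_wedge_def tw_def)

lemma tw_scale: "tw (sV c v) ys = on_coeffs (sV c) (tw v ys)"
proof (induction ys)
  case Nil
  show ?case by (auto simp: tw_def on_coeffs_def)
next
  case (Cons y ys)
  then show ?case by (simp only: tw_Cons app_on_coeffs)
qed

lemma tw_swap: "tw v (ps @ a # b # zs) = - tw v (ps @ b # a # zs)"
proof (induction ps)
  case Nil
  show ?case unfolding append_Nil tw_Cons by (metis car.eps_anti op_family_simps(3,5))
next
  case (Cons p ps)
  then show ?case by (simp only: append_Cons tw_Cons F.app_minus)
qed

lemma annih_tw_Nil: "app (annih_op j) (tw v []) = 0"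
  by (rule ext) (simp add: F.app_annih tw_def)

lemma opU_tw:
  assumes "set ys \<subseteq> u"
  shows "app (opU y) (tw v ys) = tw (\<pi> y v) ys + (\<Sum>i<length ys. tw v (ys[i := cb y (ys ! i)]))"
  using assms
proof (induction ys)
  case Nil
  have "app (P y) (tw v []) = tw (\<pi> y v) []" by (rule ext) (simp add: app_P tw_def \<pi>_0)
  then show ?case
    unfolding opU_def op_family_simps(2) F.app_sum by (simp only: op_family_simps(5) annih_tw_Nil F.app_zero sum.neutral_const) simp
next
  case (Cons x xs)
  have x: "x \<in> u" using Cons.prems by simp
  have "app (opU y) (tw v (x # xs)) = app (eps x) (app (opU y) (tw v xs)) + app (eps (cb y x)) (tw v xs)"
    unfolding tw_Cons by (metis opU_eps[OF x] op_family_simps(2,5))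
  also have "app (opU y) (tw v xs) = tw (\<pi> y v) xs + (\<Sum>i<length xs. tw v (xs[i := cb y (xs ! i)]))"
    by (rule Cons.IH) (use Cons.prems in simp)
  finally show ?case
    by (simp only: op_family_add F.app_sum_right tw_Cons[symmetric] length_Cons sum.lessThan_Suc_shift
        list_update_code nth_Cons_0 nth_Cons_Suc add_ac)
qed

text \<open>Induction through \<open>bdry_eps\<close>: the head contributes its action on
  \<open>v\<close> and its brackets with the later factors, the tail contributes the remaining terms
  wedged with the head.\<close>

lemma bdry_tw:
  assumes "set ys \<subseteq> u"
  shows "app bdry (tw v ys) = (\<Sum>i<length ys. on_coeffs (sV ((-1) ^ Suc i)) (tw (\<pi> (ys ! i) v) (nths ys (- {i})))) +
     (\<Sum>j<length ys. \<Sum>i<j. on_coeffs (sV ((-1) ^ (i + j))) (tw v (cb (ys ! i) (ys ! j) # nths ys (- {i, j}))))"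
  using assms
proof (induction ys)
  case Nil
  have "app bdry (tw v []) = 0"
    unfolding bdry_def car.cubic_m_def car.lin_part_m_def op_family_simps(4,5) F.app_sum
    by (simp only: annih_tw_Nil F.app_zero sum.neutral_const diff_self)
  then show ?case by (simp only: list.size lessThan_0 sum.empty add_0_left)
next
  case (Cons y ys)
  have y: "y \<in> u" and ys: "set ys \<subseteq> u" using Cons.prems by auto
  have "app bdry (tw v (y # ys)) = - app (eps y) (app bdry (tw v ys)) - app (opU y) (tw v ys)"
    unfolding tw_Cons by (metis bdry_eps[OF y] op_family_simps(3,4,5))
  also have "app (opU y) (tw v ys) = tw (\<pi> y v) ys + (\<Sum>i<length ys. on_coeffs (sV ((- 1) ^ i)) (tw v (cb y (ys ! i) # nths ys (- {i}))))"
    unfolding opU_tw[OF ys]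
    by (intro arg_cong2[where f = "(+)"] sum.cong refl fv.update_to_front[where F = "tw v"] tw_swap) auto
  also have "app (eps y) (app bdry (tw v ys)) = (\<Sum>i<length ys. on_coeffs (sV ((-1) ^ Suc i)) (tw (\<pi> (ys ! i) v) (y # nths ys (- {i})))) -
     (\<Sum>j<length ys. \<Sum>i<j. on_coeffs (sV ((-1) ^ (i + j))) (tw v (cb (ys ! i) (ys ! j) # y # nths ys (- {i, j}))))"
  proof -
    have sw: "tw v (y # a # zs) = - tw v (a # y # zs)" for a zs using tw_swap[of v "[]" y a zs] by simp
    show ?thesis
      unfolding Cons.IH[OF ys] op_family_add F.app_sum_right app_on_coeffs tw_Cons[where y = y, symmetric] sw fv.scale_minus_right sum_negf
      by (rule diff_conv_add_uminus[symmetric])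
  qed
  finally show ?case
    unfolding length_Cons sum_pairs_Suc
    by (simp add: sum.lessThan_Suc_shift nths_omit sum_negf on_coeffs_uminus algebra_simps del: sum.lessThan_Suc)
qed

lemma tw_sorted:
  assumes "sorted_wrt (<) is" "set is \<subseteq> {..<n}"
  shows "tw v (map e is) = (\<lambda>J. if J = set is then v else 0)"
  using assms
proof (induction "is")
  case Nil
  show ?case by (simp add: tw_def)
next
  case (Cons i "is")
  have i: "i < n" "\<And>j. j \<in> set is \<Longrightarrow> i < j" using Cons.prems by auto
  have IH: "tw v (map e is) = (\<lambda>J. if J = set is then v else 0)" using Cons by simp
  have eq: "i \<in> J \<and> J - {i} = set is \<longleftrightarrow> J = set (i # is)" for J using i(2) by auto
  have s: "sgn_pos (set (i # is)) i = 1" by (rule sgn_pos_least) (use i(2) in \<open>auto simp: less_imp_le\<close>)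
  show ?case
  proof
    fix J
    have "tw v (map e (i # is)) J = (if i \<in> J then sV (sgn_pos J i) (if J - {i} = set is then v else 0) else 0)"
      unfolding list.map tw_Cons car.eps_e[OF i(1)] F.app_create IH ..
    also have "\<dots> = (if J = set (i # is) then v else 0)"
    proof (cases "J = set (i # is)")
      case True
      then show ?thesis using eq[of J] s by simp
    next
      case False
      then show ?thesis using eq[of J] by (cases "i \<in> J") auto
    qed
    finally show "tw v (map e (i # is)) J = (if J = set (i # is) then v else 0)" .
  qed
qed

lemma tw_expand: assumes f: "f \<in> VS n" shows "(\<Sum>I\<in>Pow {..<n}. tw (f I) (map e (sorted_list_of_set I))) = f"
proof
  fix J
  have "(\<Sum>I\<in>Pow {..<n}. tw (f I) (map e (sorted_list_of_set I))) J = (\<Sum>I\<in>Pow {..<n}. if J = I then f I else 0)"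
    unfolding F.sum_fun_eval
  proof (rule sum.cong[OF refl])
    fix I assume "I \<in> Pow {..<n}"
    then have "finite I" "I \<subseteq> {..<n}" using finite_subset by auto
    then show "tw (f I) (map e (sorted_list_of_set I)) J = (if J = I then f I else 0)"
      using tw_sorted[of "sorted_list_of_set I" "f I"] by simp
  qed
  also have "\<dots> = f J" using f by (auto simp: VS_def)
  finally show "(\<Sum>I\<in>Pow {..<n}. tw (f I) (map e (sorted_list_of_set I))) J = f J" .
qed

text \<open>The operators of homology are prescribed on the basis elements of \<Lambda>u; a ring
  operator that agrees on decomposable elements is therefore equal to them on
  \<open>VS n\<close>.\<close>

lemma on_basis_eq:
  assumes f: "f \<in> VS n" and A: "\<And>v ys. set ys \<subseteq> u \<Longrightarrow> A v ys = app a (tw v ys)"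
  shows "on_basis n e A f = app a f"
proof -
  have "on_basis n e A f = (\<Sum>I\<in>Pow {..<n}. app a (tw (f I) (map e (sorted_list_of_set I))))"
    unfolding on_basis_def
  proof (rule sum.cong[OF refl])
    fix I assume "I \<in> Pow {..<n}"
    then have "finite I" "I \<subseteq> {..<n}" using finite_subset by auto
    then have "set (map e (sorted_list_of_set I)) \<subseteq> u" using e_in by auto
    then show "A (f I) (map e (sorted_list_of_set I)) = app a (tw (f I) (map e (sorted_list_of_set I)))" by (rule A)
  qed
  also have "\<dots> = app a f" unfolding F.app_sum_right[symmetric] tw_expand[OF f] ..
  finally show ?thesis .
qed

lemma hom_boundary_eq: assumes f: "f \<in> VS n" shows "hom_boundary sV br \<pi> n e f = app bdry f"
  unfolding hom_boundary_def
proof (rule on_basis_eq[OF f])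
  fix v and ys :: "('e \<times> 'e) list" assume ys: "set ys \<subseteq> u"
  have 1: "tensor_wedge sV n e w (nths ys A) = tw w (nths ys A)" for w A
    by (rule tensor_wedge_eq[OF set_nths_omit[OF ys]])
  have 2: "tensor_wedge sV n e w (cb (ys ! i) (ys ! j) # nths ys A) = tw w (cb (ys ! i) (ys ! j) # nths ys A)"
    if "j < length ys" "i < j" for i j A w
  proof -
    have "ys ! i \<in> u" "ys ! j \<in> u" using ys that by (meson nth_mem less_trans subsetD)+
    then have "set (cb (ys ! i) (ys ! j) # nths ys A) \<subseteq> u" using set_nths_omit[OF ys] cb_u_u by simp
    then show ?thesis by (rule tensor_wedge_eq)
  qed
  have 3: "(\<Sum>j<length ys. \<Sum>i<j. tensor_wedge sV n e (sV ((-1) ^ (i + j)) v) (cb (ys ! i) (ys ! j) # nths ys (- {i, j})))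
    = (\<Sum>j<length ys. \<Sum>i<j. on_coeffs (sV ((-1) ^ (i + j))) (tw v (cb (ys ! i) (ys ! j) # nths ys (- {i, j}))))"
    by (rule sum.cong[OF refl], rule sum.cong[OF refl], subst 2) (simp_all add: tw_scale)
  show "(\<Sum>i<length ys. tensor_wedge sV n e (sV ((-1) ^ Suc i) (\<pi> (ys ! i) v)) (nths ys (- {i}))) +
     (\<Sum>j<length ys. \<Sum>i<j. tensor_wedge sV n e (sV ((-1) ^ (i + j)) v)
        (cbr br (ys ! i) (ys ! j) # nths ys (- {i, j}))) = app bdry (tw v ys)"
    unfolding bdry_tw[OF ys] 3 1 tw_scale ..
qed

lemma hom_action_eq: assumes X: "X \<in> l" and f: "f \<in> VS n" shows "hom_action sV br \<pi> n e X f = app (car.opL P X) f"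
  unfolding hom_action_def opU_opL[OF X, symmetric]
proof (rule on_basis_eq[OF f])
  fix v and ys :: "('e \<times> 'e) list" assume ys: "set ys \<subseteq> u"
  have "tensor_wedge sV n e v (ys[i := cb X (ys ! i)]) = tw v (ys[i := cb X (ys ! i)])" if "i < length ys" for i
  proof (rule tensor_wedge_eq)
    have "ys ! i \<in> u" using ys that by (meson nth_mem subsetD)
    then show "set (ys[i := cb X (ys ! i)]) \<subseteq> u" using set_update_subset_insert[of ys i] cb_l_u[OF X] ys by blast
  qed
  then show "tensor_wedge sV n e (\<pi> X v) ys + (\<Sum>i<length ys. tensor_wedge sV n e v (ys[i := cbr br X (ys ! i)])) = app (opU X) (tw v ys)"
    unfolding opU_tw[OF ys] tensor_wedge_eq[OF ys] by simp
qed

end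

section \<open>The isomorphisms\<close>

lemma commute_anticommutator:
  fixes x :: "'r::ring"
  assumes "x * a = a * x" "x * b = b * x" shows "x * (a * b + b * a) = (a * b + b * a) * x"
proof -
  have "x * (a * b) = a * b * x" "x * (b * a) = b * a * x" by (metis assms mult.assoc)+
  then show ?thesis by (simp only: distrib_left distrib_right)
qed

context dirac_setting
begin

abbreviation "dC \<equiv> dirac_C sV br \<pi> u n e e'"
abbreviation "dCm \<equiv> dirac_Cminus sV br \<pi> u n e e'"
abbreviation "dD \<equiv> dirac_D sV br \<pi> u n e e'"
abbreviation "scV \<equiv> \<lambda>c. on_coeffs (sV c) :: (nat set \<Rightarrow> 'v) \<Rightarrow> nat set \<Rightarrow> 'v"
abbreviation "\<rho> \<equiv> rho_char br ub"

lemma kernel_cong: "(\<And>f. f \<in> VS n \<Longrightarrow> A f = app a f) \<Longrightarrow> kernel_on (VS n) A = kernel_on (VS n) (app a)"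
  by (auto simp: kernel_on_def)

lemma image_VS_cong: "(\<And>f. f \<in> VS n \<Longrightarrow> A f = app a f) \<Longrightarrow> A ` VS n = app a ` VS n"
  by (rule image_cong[OF refl])

lemmas dD_eq = dirac_D_eq[unfolded opC_split]
lemmas dC_eq = dirac_C_eq[unfolded opC_split]
lemmas dCm_eq = dirac_Cminus_eq[unfolded opC_split]

lemma VS_on_coeffs: "f \<in> VS n \<Longrightarrow> on_coeffs (sV c) f \<in> VS n"
  by (auto simp: VS_def on_coeffs_def)

lemma dirac_spaces:
  "kernel_on (VS n) dD = kernel_on (VS n) (app H.D)" "dD ` VS n = app H.D ` VS n"
  "kernel_on (VS n) dC = kernel_on (VS n) (app H.C)" "dC ` VS n = app H.C ` VS n"
  "kernel_on (VS n) dCm = kernel_on (VS n) (app H.Cm)" "dCm ` VS n = app H.Cm ` VS n"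
  by (rule kernel_cong image_VS_cong, erule dD_eq dC_eq dCm_eq)+

lemma represents_dirac:
  "represents H.Harm (kernel_on (VS n) dD) (dD ` VS n \<inter> kernel_on (VS n) dD)"
  "represents H.Harm (kernel_on (VS n) dC) (dC ` VS n)"
  "represents H.Harm (kernel_on (VS n) dCm) (dCm ` VS n)"
  unfolding dirac_spaces
  by (rule H.represents_D[OF complements] H.represents_C[OF complements] H.represents_Cm[OF complements])+

lemma kernel_subspace:
  "f \<in> kernel_on (VS n) (app a) \<Longrightarrow> g \<in> kernel_on (VS n) (app a) \<Longrightarrow> f - g \<in> kernel_on (VS n) (app a)"
  "f \<in> kernel_on (VS n) (app a) \<Longrightarrow> g \<in> kernel_on (VS n) (app a) \<Longrightarrow> f + g \<in> kernel_on (VS n) (app a)"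
  "0 \<in> kernel_on (VS n) (app a)"
proof -
  show "f - g \<in> kernel_on (VS n) (app a)" "f + g \<in> kernel_on (VS n) (app a)"
    if "f \<in> kernel_on (VS n) (app a)" "g \<in> kernel_on (VS n) (app a)"
  proof -
    have fg: "f \<in> VS n" "g \<in> VS n" and 0: "app a f = 0" "app a g = 0" using that by (simp_all only: kernel_on_def mem_Collect_eq)
    show "f - g \<in> kernel_on (VS n) (app a)"
      using H.VS_closed(2)[OF fg] by (simp only: kernel_on_def mem_Collect_eq F.app_diff 0 diff_self simp_thms)
    show "f + g \<in> kernel_on (VS n) (app a)"
      using H.VS_closed(1)[OF fg] by (simp only: kernel_on_def mem_Collect_eq op_family_add 0 add_0_left simp_thms)
  qed
  show "0 \<in> kernel_on (VS n) (app a)"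
    using H.VS_closed(4) by (simp only: kernel_on_def mem_Collect_eq F.app_zero simp_thms)
qed

text \<open>As \<open>l\<close> lies in k, X is fixed by \<theta> and the action is the same for the
  twisted representation. Hence it commutes with C and with the adjoint of C, and so with the
  Laplacian.\<close>

lemma opL_Harm:
  assumes X: "X \<in> l" and f: "f \<in> H.Harm" shows "app (car.opL P X) f \<in> H.Harm"
proof -
  have th: "th X = X" using X lk by (auto simp: k_part_def)
  have "car.opL Pt X = car.opL P X" by (simp add: car.opL_def Pt_def th)
  then have L: "car.opL P X * H.C = H.C * car.opL P X" "car.opL P X * H.Ca = H.Ca * car.opL P X"
    using car.opL_opC[OF rep_P, of X] car.opL_opCm[OF rep_Pt, of X] cb_l_u[OF X] cb_l_ub[OF X]
    by (simp_all only: opC_split)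
  have "car.opL P X * H.Lap = H.Lap * car.opL P X"
    by (rule commute_anticommutator[OF L])
  then have "app H.Lap (app (car.opL P X) f) = app (car.opL P X) (app H.Lap f)"
    by (simp only: op_family_simps(5)[symmetric])
  also have "app H.Lap f = 0" using f by (simp add: H.Harm_def kernel_on_def)
  finally have "app H.Lap (app (car.opL P X) f) = 0" by (simp only: F.app_zero)
  moreover have "app (car.opL P X) f \<in> VS n" by (rule pres_VS[OF pres_ops(5) H.Harm_VS[OF f]])
  ultimately show ?thesis by (simp add: H.Harm_def kernel_on_def)
qed

lemma Harm_add: "f \<in> H.Harm \<Longrightarrow> g \<in> H.Harm \<Longrightarrow> f + g \<in> H.Harm"
  unfolding H.Harm_def by (rule kernel_subspace(2))

lemma Harm_scale: assumes "f \<in> H.Harm" shows "on_coeffs (sV c) f \<in> H.Harm"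
proof -
  have "app H.Lap (on_coeffs (sV c) f) = on_coeffs (sV c) (app H.Lap f)" by (rule app_on_coeffs)
  also have "app H.Lap f = 0" using assms by (simp add: H.Harm_def kernel_on_def)
  also have "on_coeffs (sV c) (0 :: nat set \<Rightarrow> 'v) = 0" by (rule fv.scale_zero_right)
  finally show ?thesis using VS_on_coeffs[of f c] H.Harm_VS[OF assms] by (simp add: H.Harm_def kernel_on_def)
qed

text \<open>The harmonic space with the untwisted action of \<open>l\<close> is the common model
  with which all three modules are compared.\<close>

abbreviation "HL \<equiv> harm_module scV (\<lambda>X. app (car.opL P X)) H.Harm"

lemma HL_closed: "lmod_closed l HL" "lmod_closed l (twist \<rho> HL)"
  using Harm_add Harm_scale opL_Harm by (simp_all add: lmod_closed_def twist_def harm_module_def)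

lemma image_zero: "0 \<in> app a ` VS n"
  by (rule image_eqI[of _ _ 0]) (simp_all only: F.app_zero H.VS_closed)

lemma commute_kernel_image:
  assumes ab: "a * b = b * a" and b: "pres b"
  shows "f \<in> kernel_on (VS n) (app a) \<Longrightarrow> app b f \<in> kernel_on (VS n) (app a)"
    and "f \<in> app a ` VS n \<Longrightarrow> app b f \<in> app a ` VS n"
proof -
  have c: "app b (app a g) = app a (app b g)" for g by (metis ab op_family_simps(5))
  show "app b f \<in> app a ` VS n" if "f \<in> app a ` VS n"
  proof -
    from that obtain g where "g \<in> VS n" "f = app a g" by blast
    then show ?thesis using pres_VS[OF b, of g] c by blast
  qed
  show "app b f \<in> kernel_on (VS n) (app a)" if "f \<in> kernel_on (VS n) (app a)"
    using that c[of f] pres_VS[OF b] unfolding kernel_on_def mem_Collect_eq by (metis F.app_zero)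
qed

lemma opL_commute:
  assumes X: "X \<in> l"
  shows "H.C * car.opL P X = car.opL P X * H.C" "H.Cm * car.opL P X = car.opL P X * H.Cm"
  using car.opL_opC[OF rep_P, of X] car.opL_opCm[OF rep_P, of X] cb_l_u[OF X] cb_l_ub[OF X]
  by (simp_all only: opC_split)

text \<open>The spin action is \<open>opL\<close> plus the scalar \<rho> X, so it is the harmonic
  model that carries the twist.\<close>

lemma dirac_iso: "lmod_isomorphic l (twist \<rho> HL) (dirac_cohomology sV br \<pi> u n e e')"
proof -
  let ?a = "\<lambda>X. spin_action sV br \<pi> u n e e' X"
  let ?U = "kernel_on (VS n) (app H.D)" and ?b = "\<lambda>X. car.opL P X + scal_op (\<rho> X)"
  let ?W = "app H.D ` VS n \<inter> ?U"
  have eq: "dirac_cohomology sV br \<pi> u n e e' = subquotient scV ?a ?U ?W"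
    unfolding dirac_cohomology_def Let_def dirac_spaces ..
  have U: "f \<in> ?U \<Longrightarrow> f \<in> VS n" for f by (simp add: kernel_on_def)
  have sp: "?a X f = app (?b X) f" if "X \<in> l" "f \<in> VS n" for X f by (rule spin_action_eq[OF that])
  have com: "H.D * ?b X = ?b X * H.D" if "X \<in> l" for X
  proof -
    have c: "H.D * car.opL P X = car.opL P X * H.D"
      unfolding distrib_left[of _ H.C H.Cm] distrib_right[of H.C H.Cm] opL_commute[OF that] ..
    show ?thesis unfolding distrib_left[of H.D] distrib_right[of _ _ H.D] c scal_central[of "\<rho> X" H.D] ..
  qed
  have com': "H.D * scal_op c = scal_op c * H.D" for c by (rule scal_central[symmetric])
  have pb: "pres (?b X)" for X by (rule pres_intros(1)[OF pres_ops(5) pres_intros(5)])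
  have "lmod_isomorphic l (harm_module scV (\<lambda>X. app (?b X)) H.Harm) (subquotient scV ?a ?U ?W)"
  proof (rule represents_iso[where g = "\<lambda>x. x"])
    show "represents ((\<lambda>x. x) ` H.Harm) ?U ?W" using represents_dirac(1) unfolding dirac_spaces by simp
    show "0 \<in> ?W" using image_zero kernel_subspace(3) by blast
    show "x - y \<in> ?W" if "x \<in> ?W" "y \<in> ?W" for x y using that H.app_image_diff kernel_subspace(1) by blast
    show "app (?b X) x = ?a X x" if "X \<in> l" "x \<in> H.Harm" for X x using sp that H.Harm_VS by simp
    show "scV c w \<in> ?W" if "w \<in> ?W" for c w
      using commute_kernel_image[OF com' pres_intros(5), of w c] that unfolding on_coeffs_eq by blast
    show "?a X (x + w) = ?a X x + ?a X w" if "X \<in> l" "x \<in> ?U" "w \<in> ?W" for X x w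
      using that U sp[OF that(1)] H.VS_closed(1)[of x w] by (simp only: IntD2 op_family_add)
    show "?a X w \<in> ?W" if "X \<in> l" "w \<in> ?W" for X w
      using commute_kernel_image[OF com[OF that(1)] pb, of w] that sp[OF that(1) U, of w] by (metis IntD1 IntD2 IntI)
  qed (simp_all only: fv.scale_right_distrib inj_on_id2)
  moreover have "twist \<rho> HL = harm_module scV (\<lambda>X. app (?b X)) H.Harm"
  proof -
    have "(\<lambda>X x. app (car.opL P X) x + app (scal_op (\<rho> X)) x) = (\<lambda>X. app (?b X))"
      by (intro ext) (simp only: op_family_simps(2))
    then show ?thesis by (simp only: twist_def harm_module_def lmod.simps on_coeffs_eq)
  qed
  ultimately show ?thesis by (simp only: eq)
qed

text \<open>\<open>cochain_of\<close> is a bijection to the cochains that intertwines C with the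
  differential and \<open>opL\<close> with the action of \<open>l\<close>, so harmonic
  representatives are carried along.\<close>

lemma cohomology_iso: "lmod_isomorphic l HL (cohomology cscale sV cb \<pi> ub)"
proof -
  let ?d = "cohom_d sV cb \<pi> ub" and ?M = "cochains cscale sV ub" and ?a = "cohom_action cb \<pi> ub"
  let ?U = "kernel_on (VS n) (app H.C)" and ?W = "app H.C ` VS n"
  have UV: "?U \<subseteq> VS n" "?W \<subseteq> VS n" using H.presC(1) by (auto simp: kernel_on_def)
  have d: "?d (cochain_of f) = cochain_of (app H.C f)" for f by (simp only: cohom_d_cochain_of opC_split)
  have z: "cochain_of 0 = 0" using cochain_of_linear(2)[of 0 0] by (simp only: diff_self)
  have U: "kernel_on ?M ?d = cochain_of ` ?U"
  proof (rule equalityI; rule subsetI)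
    fix c assume c: "c \<in> kernel_on ?M ?d"
    then obtain f where f: "f \<in> VS n" "c = cochain_of f" using cochain_of_image unfolding kernel_on_def by blast
    have "cochain_of (app H.C f) = cochain_of 0" using c unfolding kernel_on_def f(2) mem_Collect_eq d z by blast
    then have "app H.C f = 0" using cochain_of_inj H.presC(1)[OF f(1)] H.VS_closed(4) unfolding inj_on_def by blast
    then show "c \<in> cochain_of ` ?U" using f unfolding kernel_on_def by blast
  next
    fix c assume "c \<in> cochain_of ` ?U"
    then obtain f where f: "f \<in> VS n" "app H.C f = 0" "c = cochain_of f" unfolding kernel_on_def by blast
    then show "c \<in> kernel_on ?M ?d" using cochain_of_image unfolding kernel_on_def mem_Collect_eq f(3) d f(2) z by blast
  qed
  have W: "?d ` ?M = cochain_of ` ?W"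
    unfolding cochain_of_image[symmetric] image_image d ..
  have eq: "cohomology cscale sV cb \<pi> ub = subquotient (\<lambda>c. on_coeffs (sV c)) ?a (cochain_of ` ?U) (cochain_of ` ?W)"
    unfolding cohomology_def Let_def U W ..
  show ?thesis
    unfolding eq
  proof (rule represents_iso[where g = cochain_of])
    have "represents H.Harm ?U ?W" using represents_dirac(2) unfolding dirac_spaces .
    then show "represents (cochain_of ` H.Harm) (cochain_of ` ?U) (cochain_of ` ?W)"
    proof (rule represents_image[where M = "VS n"])
      show "?U \<subseteq> VS n" "?W \<subseteq> VS n" by (rule UV)+
      show "inj_on cochain_of (VS n)" by (rule cochain_of_inj)
    qed (rule H.VS_closed(2) cochain_of_linear(2); assumption)+
    show "inj_on cochain_of H.Harm" by (rule inj_on_subset[OF cochain_of_inj]) (use H.Harm_VS in blast)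
    show "0 \<in> cochain_of ` ?W" using z image_zero by (metis image_eqI)
    show "x - y \<in> cochain_of ` ?W" if xy: "x \<in> cochain_of ` ?W" "y \<in> cochain_of ` ?W" for x y
    proof -
      obtain f g where "f \<in> ?W" "g \<in> ?W" "x = cochain_of f" "y = cochain_of g" using xy by blast
      then show ?thesis using H.app_image_diff cochain_of_linear(2)[of f g] by (metis image_eqI)
    qed
    show "cochain_of (x + y) = cochain_of x + cochain_of y" for x y by (rule cochain_of_linear(1))
    show "cochain_of (on_coeffs (sV c) x) = on_coeffs (sV c) (cochain_of x)" for c x by (rule cochain_of_linear(3))
    show "cochain_of (app (car.opL P X) x) = ?a X (cochain_of x)" if "X \<in> l" for X x
      by (rule cohom_action_cochain_of[OF that, symmetric])
    show "on_coeffs (sV c) (x + w) = on_coeffs (sV c) x + on_coeffs (sV c) w" for c and x w :: "('e \<times> 'e) list \<Rightarrow> 'v"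
      by (simp add: fun_eq_iff on_coeffs_def V.scale_right_distrib)
    show "on_coeffs (sV c) w \<in> cochain_of ` ?W" if w: "w \<in> cochain_of ` ?W" for c w
    proof -
      obtain f where f: "f \<in> ?W" "w = cochain_of f" using w by blast
      have "on_coeffs (sV c) f \<in> ?W" unfolding on_coeffs_eq
        by (rule commute_kernel_image(2)[OF scal_central[symmetric] pres_intros(5) f(1)])
      then show ?thesis unfolding f(2) cochain_of_linear(3)[symmetric] by (rule imageI)
    qed
    show "?a X (x + w) = ?a X x + ?a X w" if X: "X \<in> l" and xw: "x \<in> cochain_of ` ?U" "w \<in> cochain_of ` ?W" for X x w
    proof -
      obtain f g where "x = cochain_of f" "w = cochain_of g" using xw by blast
      then show ?thesis
        by (simp only: cochain_of_linear(1)[symmetric] cohom_action_cochain_of[OF X] op_family_add)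
    qed
    show "?a X w \<in> cochain_of ` ?W" if X: "X \<in> l" and w: "w \<in> cochain_of ` ?W" for X w
    proof -
      obtain f where f: "f \<in> ?W" "w = cochain_of f" using w by blast
      show ?thesis unfolding f(2) cohom_action_cochain_of[OF X]
        by (rule imageI, rule commute_kernel_image(2)[OF opL_commute(1)[OF X] pres_ops(5) f(1)])
    qed
  qed
qed

lemma bdry_Cm: "app H.Cm f = on_coeffs (sV (- 2)) (app bdry f)" "app bdry f = on_coeffs (sV (- 1/2)) (app H.Cm f)"
proof -
  show 1: "app H.Cm f = on_coeffs (sV (- 2)) (app bdry f)"
    unfolding opC_split[symmetric] opCm_bdry on_coeffs_eq op_family_simps(5) ..
  show "app bdry f = on_coeffs (sV (- 1/2)) (app H.Cm f)" unfolding 1 fv.scale_scale by simp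
qed

text \<open>C^- and the boundary differ by the nonzero factor -2, which changes neither kernel nor
  image.\<close>

lemma homology_iso: "lmod_isomorphic l HL (homology sV br \<pi> n e)"
proof -
  let ?a = "hom_action sV br \<pi> n e" and ?U = "kernel_on (VS n) (app H.Cm)" and ?W = "app H.Cm ` VS n"
  have U: "kernel_on (VS n) (app bdry) = ?U"
    unfolding kernel_on_def by (rule Collect_cong) (metis bdry_Cm fv.scale_zero_right)
  have W: "app bdry ` VS n = ?W"
  proof (rule equalityI; rule subsetI)
    fix x assume "x \<in> app bdry ` VS n"
    then obtain f where f: "f \<in> VS n" "x = app bdry f" by auto
    then have "x = app H.Cm (on_coeffs (sV (- 1/2)) f)" using bdry_Cm(2)[of f] by (simp only: app_on_coeffs)
    then show "x \<in> ?W" using VS_on_coeffs[OF f(1)] by blast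
  next
    fix x assume "x \<in> ?W"
    then obtain f where f: "f \<in> VS n" "x = app H.Cm f" by auto
    then have "x = app bdry (on_coeffs (sV (- 2)) f)" using bdry_Cm(1)[of f] by (simp only: app_on_coeffs)
    then show "x \<in> app bdry ` VS n" using VS_on_coeffs[OF f(1)] by blast
  qed
  have k: "kernel_on (VS n) (hom_boundary sV br \<pi> n e) = kernel_on (VS n) (app bdry)"
    and i: "hom_boundary sV br \<pi> n e ` VS n = app bdry ` VS n"
    by (rule kernel_cong image_VS_cong, erule hom_boundary_eq)+
  have eq: "homology sV br \<pi> n e = subquotient scV ?a ?U ?W"
    unfolding homology_def Let_def k U i W ..
  have UV: "f \<in> ?U \<Longrightarrow> f \<in> VS n" for f by (simp add: kernel_on_def)
  have WV: "f \<in> ?W \<Longrightarrow> f \<in> VS n" for f using H.presC(2) by auto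
  show ?thesis
    unfolding eq
  proof (rule represents_iso[where g = "\<lambda>x. x"])
    show "represents ((\<lambda>x. x) ` H.Harm) ?U ?W" using represents_dirac(3) unfolding dirac_spaces by simp
    show "0 \<in> ?W" by (rule image_zero)
    show "x - y \<in> ?W" if "x \<in> ?W" "y \<in> ?W" for x y using that by (rule H.app_image_diff)
    show "app (car.opL P X) x = ?a X x" if "X \<in> l" "x \<in> H.Harm" for X x using hom_action_eq that H.Harm_VS by simp
    show "scV c w \<in> ?W" if "w \<in> ?W" for c w
      unfolding on_coeffs_eq by (rule commute_kernel_image(2)[OF scal_central[symmetric] pres_intros(5) that])
    show "?a X (x + w) = ?a X x + ?a X w" if "X \<in> l" "x \<in> ?U" "w \<in> ?W" for X x w
      using hom_action_eq[OF that(1)] UV[OF that(2)] WV[OF that(3)] H.VS_closed(1)[of x w] by (simp only: op_family_add)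
    show "?a X w \<in> ?W" if "X \<in> l" "w \<in> ?W" for X w
      unfolding hom_action_eq[OF that(1) WV[OF that(2)]]
      by (rule commute_kernel_image(2)[OF opL_commute(2)[OF that(1)] pres_ops(5) that(2)])
  qed (simp_all only: fv.scale_right_distrib inj_on_id2)
qed

lemma harmonic_eq:
  "kernel_on (VS n) (\<lambda>f. dC (adjoint_on (VS n) (VS_form ip (u_form br \<theta>) n e) dC f)
     + adjoint_on (VS n) (VS_form ip (u_form br \<theta>) n e) dC (dC f)) = H.Harm"
  unfolding H.Harm_def by (rule kernel_cong) (rule laplacian_eq)

lemma isomorphic:
  "lmod_isomorphic l (dirac_cohomology sV br \<pi> u n e e') (twist \<rho> (cohomology cscale sV cb \<pi> ub))"
  "lmod_isomorphic l (twist \<rho> (cohomology cscale sV cb \<pi> ub)) (twist \<rho> (homology sV br \<pi> n e))"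
proof -
  note c = lmod_isomorphic_twist[OF cohomology_iso HL_closed(1), of \<rho>]
  show "lmod_isomorphic l (dirac_cohomology sV br \<pi> u n e e') (twist \<rho> (cohomology cscale sV cb \<pi> ub))"
    by (rule lmod_isomorphic_trans[OF lmod_isomorphic_sym[OF dirac_iso HL_closed(2)] c])
  show "lmod_isomorphic l (twist \<rho> (cohomology cscale sV cb \<pi> ub)) (twist \<rho> (homology sV br \<pi> n e))"
    by (rule lmod_isomorphic_trans[OF lmod_isomorphic_sym[OF c HL_closed(2)] lmod_isomorphic_twist[OF homology_iso HL_closed(1)]])
qed

end

theorem theorem7p8:
  fixes G :: "('g, 'e::euclidean_space) lie_group_data"
    and \<Theta> :: "'g \<Rightarrow> 'g" and \<theta> :: "'e \<Rightarrow> 'e" and K :: "'g set"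
    and p_plus p_minus l u :: "('e \<times> 'e) set"
    and br :: "'e \<Rightarrow> 'e \<Rightarrow> 'e"
    and sV :: "complex \<Rightarrow> 'v::ab_group_add \<Rightarrow> 'v"
    and \<pi> :: "'e \<times> 'e \<Rightarrow> 'v \<Rightarrow> 'v" and \<sigma> :: "'g \<Rightarrow> 'v \<Rightarrow> 'v" and ip :: "'v \<Rightarrow> 'v \<Rightarrow> complex"
    and n :: nat and e e' :: "nat \<Rightarrow> 'e \<times> 'e"
  assumes "connected_semisimple_finite_center G" and "br = lg_br G"
    and "global_cartan_involution G \<Theta> \<theta>" and "K = fixed_subgroup G \<Theta>"
    and "hermitian_symmetric G K \<theta> p_plus p_minus"
    and "theta_stable_parabolic br \<theta> l u" and "l \<subseteq> k_part \<theta>" and "p_plus \<subseteq> u"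
    and "gK_module G K \<theta> sV \<pi> \<sigma>" and "admissible sV K \<sigma>" and "unitary_form K sV \<pi> \<sigma> ip"
    and "basis_of cscale u n e" and "dual_basis_of (ckilling br) (cconj ` u) n e e'"
  shows
    "let HD = dirac_cohomology sV br \<pi> u n e e';
         Hcoh = cohomology cscale sV (cbr br) \<pi> (cconj ` u);
         Hhom = homology sV br \<pi> n e;
         \<rho> = rho_char br (cconj ` u);
         C = dirac_C sV br \<pi> u n e e';
         Cminus = dirac_Cminus sV br \<pi> u n e e';
         D = dirac_D sV br \<pi> u n e e';
         Cadj = adjoint_on (VS n) (VS_form ip (u_form br \<theta>) n e) C;
         \<Delta> = (\<lambda>f. C (Cadj f) + Cadj (C f));
         Harm = kernel_on (VS n) \<Delta>
     in lmod_isomorphic l HD (twist \<rho> Hcoh) \<and>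
        lmod_isomorphic l (twist \<rho> Hcoh) (twist \<rho> Hhom) \<and>
        represents Harm (kernel_on (VS n) D) (D ` VS n \<inter> kernel_on (VS n) D) \<and>
        represents Harm (kernel_on (VS n) C) (C ` VS n) \<and>
        represents Harm (kernel_on (VS n) Cminus) (Cminus ` VS n)"
proof -
  interpret dirac_setting G \<Theta> \<theta> K p_plus p_minus l u br sV \<pi> \<sigma> ip n e e'
    by (rule dirac_setting.intro) (rule assms)+
  show ?thesis
    unfolding Let_def harmonic_eq using isomorphic represents_dirac by (intro conjI)
qed

end
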